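(* For $n=6$ and $n=7$, let $\mathfrak g_n\subset\mathfrak{sl}(n+1,\mathbb C)$ be the $(n-1)$-dimensional Lie subalgebra spanned by the vector fields $X,Y_1,\dots,Y_{n-2}$ defined in the context. Then the foliations $\mathcal F(\mathfrak g_6)\in\mathscr F_1(6,5)$ and $\mathcal F(\mathfrak g_7)\in\mathscr F_1(7,6)$ are rigid.
   Context: $\mathfrak{sl}(n+1,\mathbb C)=\mathrm H^0(\mathbb P^n,T\mathbb P^n)$ is identified with the Lie algebra of linear vector fields of zero divergence on $\mathbb C^{n+1}$ with coordinates $z_0,\dots,z_n$. Definition of $\mathfrak g_n$, $n\in\{6,7\}$: put $$X=\sum_{i=0}^n(n-2i)z_i\frac{\partial}{\partial z_i},\quad Y_1=\sum_{i=0}^{n-1}z_{i+1}\frac{\partial}{\partial z_i},\quad Y_{n-2}=\sum_{i=0}^{2}z_{i+n-2}\frac{\partial}{\partial z_i},$$ and for $2\le k\le n-3$ $$Y_k=\sum_{i=0}^{n-k}b_i^{(k)}z_{i+k}\frac{\partial}{\partial z_i},\qquad b_i^{(k)}=\sum_{l=0}^{n-k-2}\binom{i}{l}b_0^{(k+l)},\qquad b_0^{(n-2)}=1,$$ where for $n=6$: $\bigl(b_0^{(2)},b_0^{(3)}\bigr)=\bigl(\tfrac98,-\tfrac32\bigr)$, and for $n=7$: $\bigl(b_0^{(2)},b_0^{(3)},b_0^{(4)}\bigr)=\bigl(\tfrac{\sqrt3}{2},\,1-\sqrt3,\,\tfrac{-3+\sqrt3}{2}\bigr)$. These satisfy $[X,Y_k]=-2kY_k$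 for $1\le k\le n-2$ and $[Y_1,Y_k]=-Y_{k+1}$ for $2\le k\le n-3$; the remaining brackets $[Y_i,Y_j]$ vanish, except $[Y_2,Y_3]=\tfrac52Y_5$ (and its antisymmetric counterpart) when $n=7$. The space of codimension one foliations of degree $d$ on $\mathbb P^n$ is the quasi-projective variety $\mathscr F_1(n,d)$ of classes $[\omega]$ (up to scalar) of $1$-forms $\omega$ on $\mathbb C^{n+1}$ with homogeneous polynomial coefficients of degree $d+1$ such that $i_R\omega=0$ (with $R=\sum_i z_i\frac{\partial}{\partial z_i}$), $\omega\wedge d\omega=0$ and the zero set of $\omega$ has codimension at least $2$. For an $(n-1)$-dimensional Lie subalgebra $\mathfrak g$ with basis $X_1,\dots,X_{n-1}$, $\mathcal F(\mathfrak g)=[\omega(\mathfrak g)]$ with $\omega(\mathfrak g)=i_{X_1}\cdots i_{X_{n-1}}i_R(dz_0\wedge\cdots\wedge dz_n)$, an element of $\mathscr F_1(n,n-1)$ when the zero set of $\omega(\mathfrak g)$ has codimension at least $2$. A foliation in $\mathscr F_1(n,n-1)$ is rigid if the closure (in $\mathscr F_1(n,n-1)$) of its orbit under $\mathrm{Aut}(\mathbb P^n)$ is an irreducible component of $\mathscr F_1(n,n-1)$. *)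

theory Defs
  imports
    "HOL-Analysis.Analysis"
    "HOL-Library.Poly_Mapping"
    "HOL-Library.Function_Algebras"
    "HOL-Library.Extended_Nat"
    "Jordan_Normal_Form.Matrix"
begin

section \<open>Multivariate polynomials over the complex numbers\<close>

text \<open>
  A polynomial is a finitely supported map from monomials to coefficients, a monomial being a
  finitely supported map from variables to exponents.
\<close>

type_synonym 'v cpoly = "('v \<Rightarrow>\<^sub>0 nat) \<Rightarrow>\<^sub>0 complex"

definition Const :: "complex \<Rightarrow> 'v cpoly" where
  "Const c = Poly_Mapping.single 0 c"

definition Var :: "'v \<Rightarrow> 'v cpoly" where
  "Var v = Poly_Mapping.single (Poly_Mapping.single v 1) 1"

text \<open>Evaluation at \<open>x\<close> in a ring \<open>'b\<close>, the coefficients being mapped there by \<open>h\<close>.\<close>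

definition poly_eval :: "(complex \<Rightarrow> 'b::comm_semiring_1) \<Rightarrow> ('v \<Rightarrow> 'b) \<Rightarrow> 'v cpoly \<Rightarrow> 'b" where
  "poly_eval h x p =
     (\<Sum>m\<in>Poly_Mapping.keys p.
        h (Poly_Mapping.lookup p m) * (\<Prod>v\<in>Poly_Mapping.keys m. x v ^ Poly_Mapping.lookup m v))"

definition eval_at :: "('v \<Rightarrow> complex) \<Rightarrow> 'v cpoly \<Rightarrow> complex" where
  "eval_at x p = poly_eval (\<lambda>c. c) x p"

definition substitute :: "('v \<Rightarrow> 'w cpoly) \<Rightarrow> 'v cpoly \<Rightarrow> 'w cpoly" where
  "substitute x p = poly_eval Const x p"

definition mon_degree :: "('v \<Rightarrow>\<^sub>0 nat) \<Rightarrow> nat" where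
  "mon_degree m = (\<Sum>v\<in>Poly_Mapping.keys m. Poly_Mapping.lookup m v)"

definition homogeneous :: "nat \<Rightarrow> 'v cpoly \<Rightarrow> bool" where
  "homogeneous e p \<longleftrightarrow> (\<forall>m\<in>Poly_Mapping.keys p. mon_degree m = e)"

text \<open>
  The truncated subtraction of monomials is harmless: a monomial that does not contain \<open>v\<close>
  contributes the coefficient \<open>0\<close>.
\<close>

definition pdiff :: "'v \<Rightarrow> 'v cpoly \<Rightarrow> 'v cpoly" where
  "pdiff v p =
     (\<Sum>m\<in>Poly_Mapping.keys p.
        Poly_Mapping.single (m - Poly_Mapping.single v 1)
          (of_nat (Poly_Mapping.lookup m v) * Poly_Mapping.lookup p m))"

definition hom_polys :: "nat \<Rightarrow> nat \<Rightarrow> nat cpoly set" where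
  "hom_polys n e = {p. homogeneous e p \<and> (\<forall>m\<in>Poly_Mapping.keys p. Poly_Mapping.keys m \<subseteq> {..n})}"


section \<open>Linear vector fields and Lie subalgebras\<close>

text \<open>The vector field \<open>\<Sum>\<^sub>i v\<^sub>i \<partial>/\<partial>z\<^sub>i\<close> is the family \<open>v\<close> of its components, with \<open>v\<^sub>i = 0\<close> for \<open>i > n\<close>.\<close>

type_synonym vfield = "nat \<Rightarrow> nat cpoly"

definition scale_vf :: "complex \<Rightarrow> vfield \<Rightarrow> vfield" where
  "scale_vf c v = (\<lambda>i. Const c * v i)"

lemma Const_add: "Const (a + b) = Const a + Const b"
  by (simp add: Const_def single_add)

lemma Const_mult: "Const (a * b) = Const a * Const b"
  by (simp add: Const_def mult_single)

lemma Const_1: "Const 1 = 1"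
  by (simp add: Const_def)

interpretation vf: vector_space scale_vf
  by unfold_locales
    (auto simp: scale_vf_def fun_eq_iff algebra_simps Const_add Const_mult Const_1)

definition lie_bracket :: "nat \<Rightarrow> vfield \<Rightarrow> vfield \<Rightarrow> vfield" where
  "lie_bracket n v w = (\<lambda>j. \<Sum>i\<le>n. v i * pdiff i (w j) - w i * pdiff i (v j))"

definition radial :: "nat \<Rightarrow> vfield" where
  "radial n = (\<lambda>i. if i \<le> n then Var i else 0)"

text \<open>\<open>\<ss>\<ll>(n+1, \<complex>)\<close> as the linear vector fields of zero divergence.\<close>

definition sl_fields :: "nat \<Rightarrow> vfield set" where
  "sl_fields n =
     {v. (\<forall>i\<le>n. v i \<in> hom_polys n 1) \<and> (\<forall>i>n. v i = 0) \<and> (\<Sum>i\<le>n. pdiff i (v i)) = 0}"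

definition lie_subalgebra :: "nat \<Rightarrow> vfield set \<Rightarrow> bool" where
  "lie_subalgebra n \<g> \<longleftrightarrow>
     vf.subspace \<g> \<and> \<g> \<subseteq> sl_fields n \<and> (\<forall>v\<in>\<g>. \<forall>w\<in>\<g>. lie_bracket n v w \<in> \<g>)"

definition ordered_basis :: "vfield list \<Rightarrow> vfield set \<Rightarrow> bool" where
  "ordered_basis Xs \<g> \<longleftrightarrow> distinct Xs \<and> vf.independent (set Xs) \<and> vf.span (set Xs) = \<g>"


section \<open>Polynomial differential forms\<close>

text \<open>
  The form \<open>\<Sum>\<^sub>I a\<^sub>I dz\<^sub>I\<close>, where \<open>dz\<^sub>I = dz\<^bsub>i\<^sub>1\<^esub> \<and> \<dots> \<and> dz\<^bsub>i\<^sub>k\<^esub>\<close> for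
  \<open>I = {i\<^sub>1 < \<dots> < i\<^sub>k}\<close>, is the family of its coefficients \<open>a\<^sub>I\<close>.
\<close>

type_synonym pform = "nat set \<Rightarrow> nat cpoly"

definition forms :: "nat \<Rightarrow> nat \<Rightarrow> nat \<Rightarrow> pform set" where
  "forms n k e =
     {\<alpha>. \<forall>I. if I \<subseteq> {..n} \<and> card I = k then \<alpha> I \<in> hom_polys n e else \<alpha> I = 0}"

definition scale_form :: "complex \<Rightarrow> pform \<Rightarrow> pform" where
  "scale_form c \<alpha> = (\<lambda>I. Const c * \<alpha> I)"

definition function_form :: "nat cpoly \<Rightarrow> pform" where
  "function_form p = (\<lambda>I. if I = {} then p else 0)"

definition volume_form :: "nat \<Rightarrow> pform" where
  "volume_form n = (\<lambda>I. if I = {..n} then 1 else 0)"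

text \<open>
  The signs come from \<open>dz\<^sub>I \<and> dz\<^sub>J = (-1)\<^bsup>|{(i,j) \<in> I \<times> J. i > j}|\<^esup> dz\<^bsub>I \<union> J\<^esub>\<close> for disjoint
  \<open>I\<close> and \<open>J\<close>.
\<close>

definition wedge :: "pform \<Rightarrow> pform \<Rightarrow> pform" where
  "wedge \<alpha> \<beta> =
     (\<lambda>K. \<Sum>I\<in>Pow K. (-1) ^ card {(i, j). i \<in> I \<and> j \<in> K - I \<and> j < i} * (\<alpha> I * \<beta> (K - I)))"

definition ext_d :: "pform \<Rightarrow> pform" where
  "ext_d \<alpha> = (\<lambda>K. \<Sum>k\<in>K. (-1) ^ card {j\<in>K. j < k} * pdiff k (\<alpha> (K - {k})))"

definition interior_prod :: "nat \<Rightarrow> vfield \<Rightarrow> pform \<Rightarrow> pform" where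
  "interior_prod n v \<alpha> =
     (\<lambda>I. \<Sum>k\<in>{..n} - I. (-1) ^ card {j\<in>I. j < k} * (v k * \<alpha> (insert k I)))"


section \<open>Zariski topologies, irreducibility and codimension\<close>

lemma poly_eval_superset:
  assumes "finite S" "Poly_Mapping.keys p \<subseteq> S" "h 0 = 0"
  shows "poly_eval h x p =
     (\<Sum>m\<in>S. h (Poly_Mapping.lookup p m) *
        (\<Prod>v\<in>Poly_Mapping.keys m. x v ^ Poly_Mapping.lookup m v))"
  unfolding poly_eval_def
  by (rule sum.mono_neutral_left) (use assms in \<open>auto simp: in_keys_iff\<close>)

lemma eval_at_0 [simp]: "eval_at x 0 = 0"
  by (simp add: eval_at_def poly_eval_def)

lemma eval_at_1 [simp]: "eval_at x 1 = 1"
  by (simp add: eval_at_def poly_eval_def)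

lemma eval_at_add: "eval_at x (p + q) = eval_at x p + eval_at x q"
proof -
  let ?S = "Poly_Mapping.keys p \<union> Poly_Mapping.keys q"
  have "Poly_Mapping.keys (p + q) \<subseteq> ?S"
    by (rule Poly_Mapping.keys_add)
  then show ?thesis
    unfolding eval_at_def
    by (simp add: poly_eval_superset[of ?S] lookup_add distrib_right sum.distrib)
qed

lemma eval_at_sum: "eval_at x (sum f A) = (\<Sum>a\<in>A. eval_at x (f a))"
  by (induction A rule: infinite_finite_induct) (auto simp: eval_at_add)

definition mon_eval :: "('v \<Rightarrow> complex) \<Rightarrow> ('v \<Rightarrow>\<^sub>0 nat) \<Rightarrow> complex" where
  "mon_eval x m = (\<Prod>v\<in>Poly_Mapping.keys m. x v ^ Poly_Mapping.lookup m v)"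

lemma mon_eval_superset:
  assumes "finite S" "Poly_Mapping.keys m \<subseteq> S"
  shows "mon_eval x m = (\<Prod>v\<in>S. x v ^ Poly_Mapping.lookup m v)"
  unfolding mon_eval_def
  by (rule prod.mono_neutral_left) (use assms in \<open>auto simp: in_keys_iff\<close>)

lemma mon_eval_add: "mon_eval x (m + m') = mon_eval x m * mon_eval x m'"
proof -
  let ?S = "Poly_Mapping.keys m \<union> Poly_Mapping.keys m'"
  have "Poly_Mapping.keys (m + m') \<subseteq> ?S"
    by (rule Poly_Mapping.keys_add)
  then show ?thesis
    by (simp add: mon_eval_superset[of ?S] lookup_add power_add prod.distrib)
qed

lemma eval_at_single: "eval_at x (Poly_Mapping.single m a) = a * mon_eval x m"
  by (simp add: eval_at_def poly_eval_def mon_eval_def)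

lemma cpoly_as_sum:
  "(p :: 'v cpoly) =
     (\<Sum>m\<in>Poly_Mapping.keys p. Poly_Mapping.single m (Poly_Mapping.lookup p m))"
proof (rule poly_mapping_eqI)
  fix k
  show "Poly_Mapping.lookup p k = Poly_Mapping.lookup
     (\<Sum>m\<in>Poly_Mapping.keys p. Poly_Mapping.single m (Poly_Mapping.lookup p m)) k"
    by (simp add: lookup_sum lookup_single when_def in_keys_iff)
qed

lemma eval_at_mult: "eval_at x (p * q) = eval_at x p * eval_at x q"
proof -
  have "p * q =
     (\<Sum>m\<in>Poly_Mapping.keys p. \<Sum>m'\<in>Poly_Mapping.keys q.
        Poly_Mapping.single (m + m') (Poly_Mapping.lookup p m * Poly_Mapping.lookup q m'))"
    by (subst (1) cpoly_as_sum[of p], subst (1) cpoly_as_sum[of q])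
      (simp add: sum_product mult_single)
  then have "eval_at x (p * q) =
     (\<Sum>m\<in>Poly_Mapping.keys p. \<Sum>m'\<in>Poly_Mapping.keys q.
        (Poly_Mapping.lookup p m * mon_eval x m) * (Poly_Mapping.lookup q m' * mon_eval x m'))"
    by (simp add: eval_at_sum eval_at_single mon_eval_add mult_ac)
  also have "\<dots> = eval_at x p * eval_at x q"
    unfolding eval_at_def poly_eval_def mon_eval_def by (simp add: sum_product)
  finally show ?thesis .
qed

lemma mon_degree_superset:
  assumes "finite S" "Poly_Mapping.keys m \<subseteq> S"
  shows "mon_degree m = (\<Sum>v\<in>S. Poly_Mapping.lookup m v)"
  unfolding mon_degree_def
  by (rule sum.mono_neutral_left) (use assms in \<open>auto simp: in_keys_iff\<close>)

lemma mon_degree_add: "mon_degree (m + m') = mon_degree m + mon_degree m'"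
proof -
  let ?S = "Poly_Mapping.keys m \<union> Poly_Mapping.keys m'"
  have "Poly_Mapping.keys (m + m') \<subseteq> ?S"
    by (rule Poly_Mapping.keys_add)
  then show ?thesis
    by (simp add: mon_degree_superset[of ?S] lookup_add sum.distrib)
qed

lemma homogeneous_mult:
  assumes "homogeneous d p" "homogeneous e q"
  shows "homogeneous (d + e) (p * q)"
  using assms keys_mult[of p q] by (force simp: homogeneous_def mon_degree_add)

lemma homogeneous_1: "homogeneous 0 1"
  by (simp add: homogeneous_def mon_degree_def)

lemma istopology_nonvanishing:
  fixes nz :: "'a \<Rightarrow> 'p \<Rightarrow> bool" and mul :: "'p \<Rightarrow> 'p \<Rightarrow> 'p"
  assumes H: "\<And>p q. p \<in> H \<Longrightarrow> q \<in> H \<Longrightarrow> mul p q \<in> H"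
    and nz: "\<And>x p q. nz x (mul p q) \<longleftrightarrow> nz x p \<and> nz x q"
  shows "istopology (\<lambda>U. \<exists>P. P \<subseteq> H \<and> U = {x \<in> S. \<exists>p\<in>P. nz x p})"
  unfolding istopology_def
proof (rule conjI; clarify)
  fix P Q assume P: "P \<subseteq> H" and Q: "Q \<subseteq> H"
  let ?R = "{r. \<exists>p\<in>P. \<exists>q\<in>Q. r = mul p q}"
  have "?R \<subseteq> H"
    using P Q H by blast
  moreover have "{x \<in> S. \<exists>p\<in>P. nz x p} \<inter> {x \<in> S. \<exists>p\<in>Q. nz x p} = {x \<in> S. \<exists>p\<in>?R. nz x p}"
    using nz by blast
  ultimately show "\<exists>R. R \<subseteq> H \<and>
      {x \<in> S. \<exists>p\<in>P. nz x p} \<inter> {x \<in> S. \<exists>p\<in>Q. nz x p} = {x \<in> S. \<exists>p\<in>R. nz x p}"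
    by blast
next
  fix K assume K: "\<forall>U\<in>K. \<exists>P. P \<subseteq> H \<and> U = {x \<in> S. \<exists>p\<in>P. nz x p}"
  let ?R = "\<Union>{P. P \<subseteq> H \<and> {x \<in> S. \<exists>p\<in>P. nz x p} \<in> K}"
  have "\<Union>K = {x \<in> S. \<exists>p\<in>?R. nz x p}"
  proof (intro equalityI subsetI)
    fix x assume "x \<in> \<Union>K"
    then obtain U where U: "U \<in> K" "x \<in> U" by blast
    with K obtain P where "P \<subseteq> H" "U = {x \<in> S. \<exists>p\<in>P. nz x p}" by blast
    with U show "x \<in> {x \<in> S. \<exists>p\<in>?R. nz x p}" by blast
  next
    fix x assume "x \<in> {x \<in> S. \<exists>p\<in>?R. nz x p}"
    then obtain p P where "x \<in> S" "nz x p" "p \<in> P" "{x \<in> S. \<exists>p\<in>P. nz x p} \<in> K" by blast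
    then show "x \<in> \<Union>K" by blast
  qed
  moreover have "?R \<subseteq> H" by blast
  ultimately show "\<exists>P. P \<subseteq> H \<and> \<Union>K = {x \<in> S. \<exists>p\<in>P. nz x p}" by blast
qed

text \<open>
  Points of \<open>\<complex>\<^bsup>n+1\<^esup>\<close> are families indexed by all naturals that vanish beyond \<open>n\<close>. The open sets are
  the complements of the common zero loci of arbitrary sets of polynomials; likewise, with
  homogeneous polynomials, for the projective space below.
\<close>

definition affine_space :: "nat \<Rightarrow> (nat \<Rightarrow> complex) set" where
  "affine_space n = {z. \<forall>i>n. z i = 0}"

definition affine_open :: "nat \<Rightarrow> (nat \<Rightarrow> complex) set \<Rightarrow> bool" where
  "affine_open n U \<longleftrightarrow> (\<exists>P. U = {z \<in> affine_space n. \<exists>p\<in>P. eval_at z p \<noteq> 0})"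

lemma istopology_affine_open: "istopology (affine_open n)"
  using istopology_nonvanishing[where H = UNIV and mul = "(*)" and S = "affine_space n"
      and nz = "\<lambda>z p. eval_at z p \<noteq> 0"]
  by (simp add: affine_open_def[abs_def] eval_at_mult)

definition affine_zariski :: "nat \<Rightarrow> (nat \<Rightarrow> complex) topology" where
  "affine_zariski n = topology (affine_open n)"

text \<open>
  The projective space of \<open>1\<close>-forms on \<open>\<complex>\<^bsup>n+1\<^esup>\<close> with homogeneous coefficients of degree \<open>e\<close>. Its
  points are the classes of nonzero forms up to a nonzero scalar; homogeneous coordinates of the
  class of \<open>\<omega>\<close> are the coefficients of \<open>\<omega>\<close>, indexed by a pair of \<open>{i}\<close> and a monomial.
\<close>

definition form_class :: "pform \<Rightarrow> pform set" where
  "form_class \<omega> = {scale_form c \<omega> |c. c \<noteq> 0}"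

definition proj_forms :: "nat \<Rightarrow> nat \<Rightarrow> pform set set" where
  "proj_forms n e = {form_class \<omega> |\<omega>. \<omega> \<in> forms n 1 e \<and> \<omega> \<noteq> 0}"

definition form_coords :: "pform \<Rightarrow> nat set \<times> (nat \<Rightarrow>\<^sub>0 nat) \<Rightarrow> complex" where
  "form_coords \<omega> = (\<lambda>(I, m). Poly_Mapping.lookup (\<omega> I) m)"

definition proj_open :: "nat \<Rightarrow> nat \<Rightarrow> pform set set \<Rightarrow> bool" where
  "proj_open n e U \<longleftrightarrow>
     (\<exists>P. P \<subseteq> {p. \<exists>r. homogeneous r p} \<and>
        U = {F \<in> proj_forms n e. \<exists>p\<in>P. \<forall>\<omega>\<in>F. eval_at (form_coords \<omega>) p \<noteq> 0})"

lemma istopology_proj_open: "istopology (proj_open n e)"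
proof -
  have "istopology (\<lambda>U. \<exists>P. P \<subseteq> {p. \<exists>r. homogeneous r p} \<and>
      U = {F \<in> proj_forms n e. \<exists>p\<in>P. \<forall>\<omega>\<in>F. eval_at (form_coords \<omega>) p \<noteq> 0})"
  proof (rule istopology_nonvanishing[where mul = "(*)"])
    fix p q :: "(nat set \<times> (nat \<Rightarrow>\<^sub>0 nat)) cpoly"
    assume "p \<in> {p. \<exists>r. homogeneous r p}" "q \<in> {p. \<exists>r. homogeneous r p}"
    then obtain r s where "homogeneous r p" "homogeneous s q" by blast
    then have "homogeneous (r + s) (p * q)" by (rule homogeneous_mult)
    then show "p * q \<in> {p. \<exists>r. homogeneous r p}" by blast
  next
    fix F :: "pform set" and p q :: "(nat set \<times> (nat \<Rightarrow>\<^sub>0 nat)) cpoly"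
    show "(\<forall>\<omega>\<in>F. eval_at (form_coords \<omega>) (p * q) \<noteq> 0) \<longleftrightarrow>
        (\<forall>\<omega>\<in>F. eval_at (form_coords \<omega>) p \<noteq> 0) \<and> (\<forall>\<omega>\<in>F. eval_at (form_coords \<omega>) q \<noteq> 0)"
      by (simp add: eval_at_mult ball_conj_distrib)
  qed
  then show ?thesis
    by (simp add: proj_open_def[abs_def])
qed

definition proj_zariski :: "nat \<Rightarrow> nat \<Rightarrow> pform set topology" where
  "proj_zariski n e = topology (proj_open n e)"

definition irreducible_in :: "'a topology \<Rightarrow> 'a set \<Rightarrow> bool" where
  "irreducible_in X S \<longleftrightarrow> S \<subseteq> topspace X \<and> S \<noteq> {} \<and>
     (\<forall>A B. closedin X A \<and> closedin X B \<and> S \<subseteq> A \<union> B \<longrightarrow> S \<subseteq> A \<or> S \<subseteq> B)"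

definition irreducible_component :: "'a topology \<Rightarrow> 'a set \<Rightarrow> bool" where
  "irreducible_component X S \<longleftrightarrow>
     irreducible_in X S \<and> (\<forall>T. irreducible_in X T \<and> S \<subseteq> T \<longrightarrow> T = S)"

text \<open>
  The codimension of an irreducible closed \<open>T\<close> is the supremum of the lengths of chains of
  irreducible closed sets starting at \<open>T\<close>; that of a closed \<open>Z\<close> is the infimum over the irreducible
  closed subsets of \<open>Z\<close>, so the empty set has codimension \<open>\<infinity>\<close>.
\<close>

definition codimension :: "'a topology \<Rightarrow> 'a set \<Rightarrow> enat" where
  "codimension X Z =
     (INF T \<in> {T. closedin X T \<and> irreducible_in X T \<and> T \<subseteq> Z}.
        SUP c \<in> {c. \<exists>C. C 0 = T \<and> (\<forall>i\<le>c. closedin X (C i) \<and> irreducible_in X (C i)) \<and>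
                        (\<forall>i<c. C i \<subset> C (Suc i))}.
          enat c)"


section \<open>Codimension one foliations\<close>

definition zero_set :: "nat \<Rightarrow> pform \<Rightarrow> (nat \<Rightarrow> complex) set" where
  "zero_set n \<omega> = {z \<in> affine_space n. \<forall>I. eval_at z (\<omega> I) = 0}"

definition foliations :: "nat \<Rightarrow> nat \<Rightarrow> pform set set" where
  "foliations n d =
     {form_class \<omega> |\<omega>. \<omega> \<in> forms n 1 (d + 1) \<and> interior_prod n (radial n) \<omega> = 0 \<and>
        wedge \<omega> (ext_d \<omega>) = 0 \<and> 2 \<le> codimension (affine_zariski n) (zero_set n \<omega>)}"

definition foliation_space :: "nat \<Rightarrow> nat \<Rightarrow> pform set topology" where
  "foliation_space n d = subtopology (proj_zariski n (d + 1)) (foliations n d)"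

text \<open>
  The pull-back of \<open>\<omega> = \<Sum>\<^sub>i a\<^sub>i dz\<^sub>i\<close> by the linear map with matrix \<open>A\<close>, that is
  \<open>\<Sum>\<^sub>i a\<^sub>i(A z) d((A z)\<^sub>i)\<close>.
\<close>

definition linear_coord :: "nat \<Rightarrow> complex mat \<Rightarrow> nat \<Rightarrow> nat cpoly" where
  "linear_coord n A i = (\<Sum>j\<le>n. Const (A $$ (i, j)) * Var j)"

definition pullback :: "nat \<Rightarrow> complex mat \<Rightarrow> pform \<Rightarrow> pform" where
  "pullback n A \<omega> =
     (\<lambda>I. \<Sum>i\<le>n. substitute (linear_coord n A) (\<omega> {i}) *
                    ext_d (function_form (linear_coord n A i)) I)"

text \<open>Every automorphism of the \<open>n\<close>-dimensional projective space is induced by an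
  element of \<open>GL(n+1, \<complex>)\<close>.\<close>

definition aut_orbit :: "nat \<Rightarrow> pform set \<Rightarrow> pform set set" where
  "aut_orbit n F =
     {form_class (pullback n A \<omega>) |A \<omega>.
        A \<in> carrier_mat (n + 1) (n + 1) \<and> invertible_mat A \<and> \<omega> \<in> F}"

definition rigid :: "nat \<Rightarrow> pform set \<Rightarrow> bool" where
  "rigid n F \<longleftrightarrow> F \<in> foliations n (n - 1) \<and>
     irreducible_component (foliation_space n (n - 1))
       (foliation_space n (n - 1) closure_of aut_orbit n F)"

definition lie_form :: "nat \<Rightarrow> vfield list \<Rightarrow> pform" where
  "lie_form n Xs = foldr (interior_prod n) Xs (interior_prod n (radial n) (volume_form n))"

text \<open>
  The class does not depend on the basis: a change of basis multiplies the form by its determinant.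
\<close>

definition lie_foliation :: "nat \<Rightarrow> vfield set \<Rightarrow> pform set" where
  "lie_foliation n \<g> = form_class (lie_form n (SOME Xs. ordered_basis Xs \<g>))"


section \<open>The Lie algebras \<open>\<g>\<^sub>6\<close> and \<open>\<g>\<^sub>7\<close>\<close>

definition X_field :: "nat \<Rightarrow> vfield" where
  "X_field n = (\<lambda>i. if i \<le> n then Const (of_nat n - 2 * of_nat i) * Var i else 0)"

text \<open>\<open>b_init n k\<close> is \<open>b\<^sub>0\<^sup>(\<^sup>k\<^sup>)\<close>; only \<open>n \<in> {6, 7}\<close> and \<open>2 \<le> k \<le> n - 2\<close> are meaningful.\<close>

definition b_init :: "nat \<Rightarrow> nat \<Rightarrow> complex" where
  "b_init n k =
     (if k = n - 2 then 1
      else if n = 6 \<and> k = 2 then 9 / 8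
      else if n = 6 \<and> k = 3 then - 3 / 2
      else if n = 7 \<and> k = 2 then complex_of_real (sqrt 3 / 2)
      else if n = 7 \<and> k = 3 then complex_of_real (1 - sqrt 3)
      else if n = 7 \<and> k = 4 then complex_of_real ((- 3 + sqrt 3) / 2)
      else 0)"

definition b_coeff :: "nat \<Rightarrow> nat \<Rightarrow> nat \<Rightarrow> complex" where
  "b_coeff n k i = (\<Sum>l\<le>n - k - 2. of_nat (i choose l) * b_init n (k + l))"

definition Y_field :: "nat \<Rightarrow> nat \<Rightarrow> vfield" where
  "Y_field n k =
     (\<lambda>i. if i + k \<le> n
          then Const (if k = 1 \<or> k = n - 2 then 1 else b_coeff n k i) * Var (i + k)
          else 0)"

definition lie_g :: "nat \<Rightarrow> vfield set" where
  "lie_g n = vf.span (insert (X_field n) (Y_field n ` {1..n - 2}))"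

end

theory Submission
  imports Defs "Jordan_Normal_Form.Determinant"
begin

text \<open>
  Adding a suitable multiple of the radial field \<open>R\<close> to \<open>X\<close> gives fields \<open>X\<^sub>0, Y\<^sub>1, \<dots>, Y\<^bsub>n-2\<^esub>\<close> that
  preserve the closed two-form \<open>\<Omega>\<close> obtained by contracting the volume form with them, and
  \<open>\<omega> = i\<^sub>R \<Omega>\<close> defines the foliation. Let \<open>\<eta>\<close> be a first-order deformation of \<open>\<omega>\<close>. The integrability
  condition makes \<open>d\<eta>\<close> vanish on all pairs of these fields. The coefficient of \<open>z\<^bsub>i+k\<^esub> \<partial>/\<partial>z\<^sub>i\<close> in \<open>Y\<^sub>k\<close>
  is nonzero when \<open>i + k \<ge> n - 2\<close>; this allows to divide forms with this property by \<open>\<Omega>\<close> explicitly, so that \<open>\<eta>\<close> comes from a deformation of the Lie algebra. By the weights of \<open>X\<^sub>0\<close> only deformations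
  that commute with \<open>X\<^sub>0\<close> matter, and these are trivial by a finite linear computation. Hence \<open>\<eta>\<close> is a
  Lie derivative of \<open>\<omega>\<close> along a linear field and is the velocity of a curve in the orbit of \<open>\<omega>\<close>.

  Let \<open>f\<close> vanish on the orbit. Since all solutions of the linearised equations are velocities of such
  curves, the leading form of \<open>f\<close> at \<open>\<omega>\<close> is a consequence of the linearised equations, and \<open>f\<close>
  can be corrected by equations of the space of foliations to arbitrarily high order. By Krull's intersection theorem
  a multiple \<open>g f\<close> with \<open>g(\<omega>) \<noteq> 0\<close> vanishes on the whole space. An irreducible set containing the orbit
  is therefore contained in its closure.
\<close>

section \<open>Polynomials\<close>

text \<open>The integrability equations might define a singular or non-reduced space at \<omega>, so
  no dimensions are compared: all solutions of the linearised equations are shown to be velocities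
  of curves in the orbit, and irreducibility enters only as "\<open>g * f\<close> vanishes and
  \<open>g\<close> does not, hence \<open>f\<close> vanishes". This runs on the cone of all
  integrable forms; the codimension of the singular set of \<omega> is a separate question, settled
  by how \<omega> depends on z_0. The multiple of R is harmless because all forms are contracted
  with R. The constant (n-1)(n-2)/(n+1) makes X_0 annihilate z_n^(n-1) dz_0 dz_1, the one
  coefficient of \<Omega> that decides its invariance. A deformation of weight \<mu> \<noteq> 0 is
  trivial because Cartan's formula recovers \<mu> \<eta> from contractions with X_0. In weight zero,
  after conjugating by diagonal matrices and scaling the fields, only the initial values b_0^(k) can
  still vary. They solve a small polynomial system given by the brackets, and the solution is
  nondegenerate: linear conditions for n = 6, a simple root of 2x^2 + 6x + 3 (the origin of the
  square root of 3) for n = 7.\<close>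

abbreviation "lookup \<equiv> Poly_Mapping.lookup"
abbreviation "keys \<equiv> Poly_Mapping.keys"
abbreviation "single \<equiv> Poly_Mapping.single"

lemma lookup_Const: "lookup (Const c) m = (if m = 0 then c else 0)"
  by (simp add: Const_def lookup_single when_def)

lemma Const_0 [simp]: "Const 0 = 0"
  by (simp add: Const_def)

lemma Const_eq_0_iff [simp]: "Const c = 0 \<longleftrightarrow> c = 0"
  by (metis Const_0 lookup_Const)

lemma Const_uminus: "Const (- a) = - Const a"
  by (simp add: Const_def single_uminus)

lemma Const_diff: "Const (a - b) = Const a - Const b"
  by (simp add: Const_def single_diff)

lemma Const_sum: "Const (sum f A) = (\<Sum>a\<in>A. Const (f a))"
  by (induction A rule: infinite_finite_induct) (auto simp: Const_add)

lemma Const_of_nat: "Const (of_nat k) = of_nat k"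
  by (induction k) (auto simp: Const_add Const_1)

lemma Const_power: "Const (a ^ k) = Const a ^ k"
  by (induction k) (auto simp: Const_mult Const_1)

lemma Const_mult_single: "Const c * single m a = single m (c * a)"
  by (simp add: Const_def mult_single)

lemma lookup_Const_mult [simp]: "lookup (Const c * p) m = c * lookup p m"
proof -
  have "Const c * p = (\<Sum>k\<in>keys p. single k (c * lookup p k))"
    by (subst cpoly_as_sum[of p]) (simp add: sum_distrib_left Const_mult_single)
  then show ?thesis
    by (simp add: lookup_sum lookup_single when_def in_keys_iff)
qed

lemma mult_eq_double_sum:
  "p * q = (\<Sum>m\<in>keys p. \<Sum>m'\<in>keys q. single (m + m') (lookup p m * lookup q m'))"
  for p q :: "'v cpoly"
  by (subst (1) cpoly_as_sum[of p], subst (1) cpoly_as_sum[of q])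
    (simp add: sum_product mult_single)

lemma keys_sum_singles: "m = (\<Sum>v\<in>keys m. single v (lookup m v))" for m :: "'v \<Rightarrow>\<^sub>0 nat"
proof (rule poly_mapping_eqI)
  fix k
  show "lookup m k = lookup (\<Sum>v\<in>keys m. single v (lookup m v)) k"
    by (simp add: lookup_sum lookup_single when_def in_keys_iff)
qed

lemma Var_power: "Var v ^ k = single (single v k) 1"
  by (induction k) (auto simp: Var_def mult_single single_add[symmetric])

lemma prod_Var_powers: "(\<Prod>v\<in>S. Var v ^ f v) = single (\<Sum>v\<in>S. single v (f v)) 1"
  by (induction S rule: infinite_finite_induct) (auto simp: Var_power mult_single)

lemma single_eq_prod: "single m a = Const a * (\<Prod>v\<in>keys m. Var v ^ lookup m v)"
  using keys_sum_singles[of m] by (simp add: prod_Var_powers Const_mult_single)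

text \<open>The variable types are infinite; the noetherian arguments take place in this subring, an
  ordinary polynomial ring when \<open>V\<close> is finite.\<close>

definition vars_in :: "'v set \<Rightarrow> 'v cpoly set" where
  "vars_in V = {p. \<forall>m\<in>keys p. keys m \<subseteq> V}"

lemma vars_in_UNIV [simp]: "p \<in> vars_in UNIV"
  by (simp add: vars_in_def)

lemma vars_in_mono: "V \<subseteq> W \<Longrightarrow> vars_in V \<subseteq> vars_in W"
  by (auto simp: vars_in_def)

text \<open>Constants and variables generate the subring, so homomorphisms and derivations can be
  compared on generators. Carrying membership in \<open>?Q\<close> is what gives the cases
  \<open>add\<close> and \<open>mult\<close> their extra hypotheses.\<close>

lemma cpoly_induct [consumes 1, case_names Const Var add mult]:
  assumes p: "p \<in> vars_in V"
    and C: "\<And>c. P (Const c)" and X: "\<And>v. v \<in> V \<Longrightarrow> P (Var v)"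
    and A: "\<And>p q. p \<in> vars_in V \<Longrightarrow> q \<in> vars_in V \<Longrightarrow> P p \<Longrightarrow> P q \<Longrightarrow> P (p + q)"
    and M: "\<And>p q. p \<in> vars_in V \<Longrightarrow> q \<in> vars_in V \<Longrightarrow> P p \<Longrightarrow> P q \<Longrightarrow> P (p * q)"
  shows "P p"
proof -
  let ?Q = "\<lambda>p. p \<in> vars_in V \<and> P p"
  have C': "?Q (Const c)" for c
    using C by (auto simp: vars_in_def Const_def)
  have X': "?Q (Var v)" if "v \<in> V" for v
    using X that by (auto simp: vars_in_def Var_def)
  have A': "?Q (p + q)" if "?Q p" "?Q q" for p q
    using that A Poly_Mapping.keys_add[of p q] by (fastforce simp: vars_in_def)
  have M': "?Q (p * q)" if "?Q p" "?Q q" for p q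
  proof -
    have "keys m \<subseteq> V" if "m \<in> keys (p * q)" for m
    proof -
      from that keys_mult[of p q] obtain a b where "m = a + b" "a \<in> keys p" "b \<in> keys q" by blast
      then show ?thesis
        using \<open>?Q p\<close> \<open>?Q q\<close> Poly_Mapping.keys_add[of a b] by (fastforce simp: vars_in_def)
    qed
    with that M show ?thesis by (auto simp: vars_in_def)
  qed
  have pw: "?Q (Var v ^ k)" if "v \<in> V" for v k
    using C'[of 1] X'[OF that] M' by (induction k) (auto simp: Const_1)
  have pr: "?Q (\<Prod>v\<in>S. Var v ^ f v)" if "S \<subseteq> V" for S f
    using that
  proof (induction S rule: infinite_finite_induct)
    case (insert x F)
    then show ?case using M' pw by auto
  qed (use C'[of 1] in \<open>auto simp: Const_1\<close>)
  have "?Q (\<Sum>m\<in>S. single m (f m))" if "\<forall>m\<in>S. keys m \<subseteq> V" for S f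
    using that
  proof (induction S rule: infinite_finite_induct)
    case (insert m F)
    have "?Q (single m (f m))"
      using pr[of "keys m" "lookup m"] insert.prems C' M' by (auto simp: single_eq_prod)
    with insert A' show ?case by auto
  qed (use C'[of 0] in auto)
  from this[of "keys p" "lookup p"] p show ?thesis
    using cpoly_as_sum[of p] by (auto simp: vars_in_def)
qed

lemma vars_in_add: "p \<in> vars_in V \<Longrightarrow> q \<in> vars_in V \<Longrightarrow> p + q \<in> vars_in V"
  using Poly_Mapping.keys_add[of p q] by (fastforce simp: vars_in_def)

lemma vars_in_Const [simp]: "Const c \<in> vars_in V"
  by (auto simp: vars_in_def Const_def)

lemma vars_in_0 [simp]: "0 \<in> vars_in V" and vars_in_1 [simp]: "1 \<in> vars_in V"
  using vars_in_Const[of 0 V] vars_in_Const[of 1 V] by (simp_all add: Const_1)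

lemma vars_in_Var: "v \<in> V \<Longrightarrow> Var v \<in> vars_in V"
  by (auto simp: vars_in_def Var_def)

lemma vars_in_mult: 
  assumes "p \<in> vars_in V" "q \<in> vars_in V"
  shows "p * q \<in> vars_in V"
  unfolding vars_in_def
proof safe
  fix m x assume "m \<in> keys (p * q)" "x \<in> keys m"
  moreover from this keys_mult[of p q] obtain a b where "m = a + b" "a \<in> keys p" "b \<in> keys q" by blast
  ultimately show "x \<in> V"
    using assms Poly_Mapping.keys_add[of a b] by (fastforce simp: vars_in_def)
qed

lemma vars_in_uminus: "p \<in> vars_in V \<Longrightarrow> - p \<in> vars_in V"
  by (simp add: vars_in_def)

lemma vars_in_diff: "p \<in> vars_in V \<Longrightarrow> q \<in> vars_in V \<Longrightarrow> p - q \<in> vars_in V"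
  using vars_in_add[of p V "- q"] vars_in_uminus[of q V] by simp

lemma vars_in_sum: "(\<And>a. a \<in> A \<Longrightarrow> f a \<in> vars_in V) \<Longrightarrow> sum f A \<in> vars_in V"
  by (induction A rule: infinite_finite_induct) (auto intro: vars_in_add)

lemma vars_in_single: "keys m \<subseteq> V \<Longrightarrow> single m a \<in> vars_in V"
  by (auto simp: vars_in_def)

subsection \<open>Evaluation and substitution\<close>

lemma poly_eval_add:
  assumes h: "h 0 = 0" "\<And>a b. h (a + b) = h a + h b"
  shows "poly_eval h x (p + q) = poly_eval h x p + poly_eval h x q"
proof -
  let ?S = "keys p \<union> keys q"
  have "keys (p + q) \<subseteq> ?S"
    by (rule Poly_Mapping.keys_add)
  then show ?thesis
    by (simp add: poly_eval_superset[of ?S] h lookup_add distrib_right sum.distrib)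
qed

lemma poly_eval_0 [simp]: "poly_eval h x 0 = 0"
  by (simp add: poly_eval_def)

lemma poly_eval_sum:
  assumes h: "h 0 = 0" "\<And>a b. h (a + b) = h a + h b"
  shows "poly_eval h x (sum f A) = (\<Sum>a\<in>A. poly_eval h x (f a))"
  by (induction A rule: infinite_finite_induct) (auto simp: poly_eval_add[OF h])

lemma poly_eval_single:
  "h 0 = 0 \<Longrightarrow> poly_eval h x (single m a) = h a * (\<Prod>v\<in>keys m. x v ^ lookup m v)"
  by (simp add: poly_eval_def)

lemma poly_eval_mult:
  fixes p q :: "'v cpoly"
  assumes h: "h 0 = 0" "\<And>a b. h (a + b) = h a + h b" "\<And>a b. h (a * b) = h a * h b"
  shows "poly_eval h x (p * q) = poly_eval h x p * poly_eval h x q"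
proof -
  have mon: "(\<Prod>v\<in>keys (m + m'). x v ^ lookup (m + m') v) =
      (\<Prod>v\<in>keys m. x v ^ lookup m v) * (\<Prod>v\<in>keys m'. x v ^ lookup m' v)" for m m' :: "'v \<Rightarrow>\<^sub>0 nat"
  proof -
    let ?S = "keys m \<union> keys m'"
    have *: "(\<Prod>v\<in>keys k. x v ^ lookup k v) = (\<Prod>v\<in>?S. x v ^ lookup k v)" if "keys k \<subseteq> ?S" for k
      by (rule prod.mono_neutral_left) (use that in \<open>auto simp: in_keys_iff\<close>)
    show ?thesis
      by (subst *[OF Poly_Mapping.keys_add], subst *[OF Un_upper1], subst *[OF Un_upper2])
        (simp add: lookup_add power_add prod.distrib)
  qed
  show ?thesis
    by (subst mult_eq_double_sum)
      (simp add: poly_eval_sum[where h = h, OF h(1,2)] poly_eval_single[where h = h, OF h(1)] mon h(3),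
       simp add: poly_eval_def sum_product mult_ac)
qed

lemma eval_at_Const [simp]: "eval_at x (Const c) = c"
  by (simp add: Const_def eval_at_single mon_eval_def)

lemma eval_at_Var [simp]: "eval_at x (Var v) = x v"
  by (simp add: Var_def eval_at_single mon_eval_def)

lemma eval_at_uminus: "eval_at x (- p) = - eval_at x p"
  using eval_at_add[of x p "- p"] by (simp add: eq_neg_iff_add_eq_0 add.commute)

lemma eval_at_diff: "eval_at x (p - q) = eval_at x p - eval_at x q"
  using eval_at_add[of x p "- q"] by (simp add: eval_at_uminus)

lemma eval_at_power: "eval_at x (p ^ k) = eval_at x p ^ k"
  by (induction k) (auto simp: eval_at_mult)

lemma eval_at_prod: "eval_at x (prod f A) = (\<Prod>a\<in>A. eval_at x (f a))"
  by (induction A rule: infinite_finite_induct) (auto simp: eval_at_mult)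

lemmas eval_at_simps = eval_at_add eval_at_diff eval_at_uminus eval_at_mult eval_at_power
  eval_at_sum eval_at_prod eval_at_Const eval_at_Var

lemma eval_at_cong:
  assumes "p \<in> vars_in V" "\<And>v. v \<in> V \<Longrightarrow> x v = y v"
  shows "eval_at x p = eval_at y p"
  using assms(1) by (induction rule: cpoly_induct) (auto simp: assms(2) eval_at_simps)

lemma substitute_0 [simp]: "substitute \<sigma> 0 = 0"
  by (simp add: substitute_def)

lemma substitute_Const [simp]: "substitute \<sigma> (Const c) = Const c"
  unfolding substitute_def by (subst (1) Const_def, subst poly_eval_single) auto

lemma substitute_1 [simp]: "substitute \<sigma> 1 = 1"
  using substitute_Const[of \<sigma> 1] by (simp add: Const_1)

lemma substitute_Var [simp]: "substitute \<sigma> (Var v) = \<sigma> v"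
  unfolding substitute_def Var_def by (subst poly_eval_single) (auto simp: Const_1)

lemma substitute_add: "substitute \<sigma> (p + q) = substitute \<sigma> p + substitute \<sigma> q"
  unfolding substitute_def by (rule poly_eval_add) (auto simp: Const_add)

lemma substitute_mult: "substitute \<sigma> (p * q) = substitute \<sigma> p * substitute \<sigma> q"
  unfolding substitute_def by (rule poly_eval_mult) (auto simp: Const_add Const_mult)

lemma eval_at_substitute: "eval_at x (substitute \<sigma> p) = eval_at (\<lambda>v. eval_at x (\<sigma> v)) p"
proof -
  have "p \<in> vars_in UNIV" by simp
  then show ?thesis
    by (induction rule: cpoly_induct) (auto simp: substitute_add substitute_mult eval_at_simps)
qed

lemma mon_eval_prod:
  "mon_eval (\<lambda>v. x v * y v) m = mon_eval x m * mon_eval y m"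
  by (simp add: mon_eval_def power_mult_distrib prod.distrib)

text \<open>Dedekind's argument: distinct monomials are distinct characters of the multiplicative monoid
  of points, hence linearly independent.\<close>

lemma mon_eval_independent:
  assumes "finite M" "\<And>x. (\<Sum>m\<in>M. a m * mon_eval x m) = 0"
  shows "\<forall>m\<in>M. a m = 0"
  using assms
proof (induction "card M" arbitrary: M a)
  case (Suc N)
  have *: "a m1 = 0" if m1: "m1 \<in> M" and m0: "m0 \<in> M" "m1 \<noteq> m0" for m0 m1
  proof -
    obtain v where v: "lookup m0 v \<noteq> lookup m1 v"
      using m0 by (metis poly_mapping_eqI)
    \<comment> \<open>\<open>y\<close> doubles the coordinate \<open>v\<close> only, so the two
      monomials take different powers of 2 at \<open>y\<close>. The relation at the product point
      minus \<open>mon_eval y m0\<close> times the relation at \<open>x\<close> no longer contains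
      \<open>m0\<close>.\<close>
    define y :: "'a \<Rightarrow> complex" where "y = (\<lambda>w. if w = v then 2 else 1)"
    have ey: "mon_eval y m = 2 ^ lookup m v" for m
      by (cases "v \<in> keys m") (auto simp: mon_eval_def y_def if_distrib prod.delta in_keys_iff
          if_distribR power_0_left cong: if_cong)
    let ?b = "\<lambda>m. a m * (mon_eval y m - mon_eval y m0)"
    have "(\<Sum>m\<in>M - {m0}. ?b m * mon_eval x m) = 0" for x
    proof -
      have "(\<Sum>m\<in>M - {m0}. ?b m * mon_eval x m) = (\<Sum>m\<in>M. ?b m * mon_eval x m)"
        using Suc.prems(1) by (intro sum.mono_neutral_left) auto
      also have "\<dots> = (\<Sum>m\<in>M. a m * mon_eval (\<lambda>v. x v * y v) m)
          - mon_eval y m0 * (\<Sum>m\<in>M. a m * mon_eval x m)"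
        by (simp add: mon_eval_prod sum_distrib_left algebra_simps flip: sum_subtractf)
      also have "\<dots> = 0"
        by (simp add: Suc.prems(2))
      finally show ?thesis .
    qed
    moreover have "N = card (M - {m0})"
      using Suc.hyps(2) m0(1) Suc.prems(1) by simp
    ultimately have "\<forall>m\<in>M - {m0}. ?b m = 0"
      using Suc.hyps(1)[of "M - {m0}" ?b] Suc.prems(1) by blast
    then have "a m1 * (mon_eval y m1 - mon_eval y m0) = 0"
      using m1 m0 by blast
    moreover have "norm (mon_eval y m1) \<noteq> norm (mon_eval y m0)"
      using v by (simp add: ey norm_power)
    ultimately show ?thesis by auto
  qed
  show ?case
  proof (rule ccontr)
    assume "\<not> ?thesis"
    then obtain m0 where m0: "m0 \<in> M" "a m0 \<noteq> 0" by blast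
    then have "M = {m0}" using * by (metis insertI1 singletonD subsetI subset_antisym
          Set.subset_singletonD empty_iff insert_absorb equalityI singleton_iff)
    with Suc.prems(2)[of "\<lambda>_. 1"] m0 show False
      by (simp add: mon_eval_def)
  qed
qed auto

lemma cpoly_eq_0I:
  assumes "\<And>x. eval_at x p = 0"
  shows "p = 0"
proof -
  have "\<forall>m\<in>keys p. lookup p m = 0"
    by (rule mon_eval_independent) (use assms in \<open>auto simp: eval_at_def poly_eval_def mon_eval_def\<close>)
  then show ?thesis
    by (metis in_keys_iff lookup_zero poly_mapping_eqI)
qed

text \<open>Coordinates outside \<open>V\<close> do not enter. Both the points of
  \<open>affine_space n\<close> and the coefficient vectors of forms are of the restricted
  kind.\<close>

lemma vars_in_eq_0I:
  assumes "p \<in> vars_in V" "\<And>x. \<forall>v. v \<notin> V \<longrightarrow> x v = 0 \<Longrightarrow> eval_at x p = 0"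
  shows "p = 0"
proof (rule cpoly_eq_0I)
  fix x
  have "eval_at x p = eval_at (\<lambda>v. if v \<in> V then x v else 0) p"
    by (rule eval_at_cong[OF assms(1)]) auto
  then show "eval_at x p = 0"
    using assms(2) by auto
qed

subsection \<open>Partial derivatives\<close>

lemma pdiff_superset:
  assumes "finite S" "keys p \<subseteq> S"
  shows "pdiff v p = (\<Sum>m\<in>S. single (m - single v 1) (of_nat (lookup m v) * lookup p m))"
  unfolding pdiff_def
  by (rule sum.mono_neutral_left) (use assms in \<open>auto simp: in_keys_iff\<close>)

lemma pdiff_0 [simp]: "pdiff v 0 = 0"
  by (simp add: pdiff_def)

lemma pdiff_add: "pdiff v (p + q) = pdiff v p + pdiff v q"
proof -
  let ?S = "keys p \<union> keys q"
  have "keys (p + q) \<subseteq> ?S"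
    by (rule Poly_Mapping.keys_add)
  then show ?thesis
    by (simp add: pdiff_superset[of ?S] lookup_add distrib_left single_add sum.distrib)
qed

lemma pdiff_uminus: "pdiff v (- p) = - pdiff v p"
  using pdiff_add[of v p "- p"] by (simp add: eq_neg_iff_add_eq_0 add.commute)

lemma pdiff_diff: "pdiff v (p - q) = pdiff v p - pdiff v q"
  using pdiff_add[of v p "- q"] by (simp add: pdiff_uminus)

lemma pdiff_sum: "pdiff v (sum f A) = (\<Sum>a\<in>A. pdiff v (f a))"
  by (induction A rule: infinite_finite_induct) (auto simp: pdiff_add)

lemma pdiff_single: "pdiff v (single m a) = single (m - single v 1) (of_nat (lookup m v) * a)"
  by (cases "a = 0") (auto simp: pdiff_def)

lemma pdiff_mult: "pdiff v (p * q) = pdiff v p * q + p * pdiff v q"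
proof -
  have mon: "pdiff v (single m a * single m' b) =
      pdiff v (single m a) * single m' b + single m a * pdiff v (single m' b)"
    for m m' :: "'a \<Rightarrow>\<^sub>0 nat" and a b
  proof -
    \<comment> \<open>If \<open>v\<close> is missing from \<open>m\<close>, the truncated difference
      is the wrong monomial, but then both coefficients are 0.\<close>
    have 1: "single (m + m' - single v 1) (of_nat (lookup m v) * a * b) =
        single (m - single v 1 + m') (of_nat (lookup m v) * a * b)"
    proof (cases "lookup m v = 0")
      case False
      then have "m + m' - single v 1 = m - single v 1 + m'"
        by (intro poly_mapping_eqI) (auto simp: lookup_add lookup_minus lookup_single when_def)
      then show ?thesis by simp
    qed auto
    have 2: "single (m + m' - single v 1) (of_nat (lookup m' v) * a * b) =
        single (m + (m' - single v 1)) (of_nat (lookup m' v) * a * b)"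
    proof (cases "lookup m' v = 0")
      case False
      then have "m + m' - single v 1 = m + (m' - single v 1)"
        by (intro poly_mapping_eqI) (auto simp: lookup_add lookup_minus lookup_single when_def)
      then show ?thesis by simp
    qed auto
    show ?thesis
      using 1 2 by (simp add: mult_single pdiff_single lookup_add algebra_simps single_add)
  qed
  have "pdiff v ((\<Sum>m\<in>keys p. single m (lookup p m)) * (\<Sum>m\<in>keys q. single m (lookup q m))) =
      pdiff v (\<Sum>m\<in>keys p. single m (lookup p m)) * (\<Sum>m\<in>keys q. single m (lookup q m)) +
      (\<Sum>m\<in>keys p. single m (lookup p m)) * pdiff v (\<Sum>m\<in>keys q. single m (lookup q m))"
    by (simp add: sum_product pdiff_sum mon sum.distrib)
  then show ?thesis
    by (simp flip: cpoly_as_sum)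
qed

lemma pdiff_Const [simp]: "pdiff v (Const c) = 0"
  by (simp add: Const_def pdiff_single)

lemma pdiff_1 [simp]: "pdiff v 1 = 0"
  using pdiff_Const[of v 1] by (simp add: Const_1)

lemma pdiff_Var: "pdiff v (Var w) = (if v = w then 1 else 0)"
  by (auto simp: Var_def pdiff_single lookup_single)

lemma pdiff_of_nat [simp]: "pdiff v (of_nat k) = 0"
  by (simp flip: Const_of_nat)

lemma pdiff_power: "pdiff v (p ^ Suc k) = of_nat (Suc k) * p ^ k * pdiff v p"
  by (induction k) (auto simp: pdiff_mult algebra_simps)

lemma pdiff_prod_Const: "pdiff v (Const c * p) = Const c * pdiff v p"
  by (simp add: pdiff_mult)

lemma pdiff_commute: "pdiff v (pdiff w p) = pdiff w (pdiff v p)"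
proof -
  have "p \<in> vars_in UNIV" by simp
  then show ?thesis
    by (induction rule: cpoly_induct) (auto simp: pdiff_add pdiff_mult pdiff_Var algebra_simps)
qed

lemma pdiff_vars_in:
  assumes "p \<in> vars_in V"
  shows "pdiff v p \<in> vars_in V"
  using assms
  by (induction rule: cpoly_induct)
    (auto simp: pdiff_add pdiff_mult pdiff_Var intro: vars_in_add vars_in_mult)

lemma pdiff_eq_0:
  assumes "p \<in> vars_in V" "v \<notin> V"
  shows "pdiff v p = 0"
  using assms(1)
  by (induction rule: cpoly_induct) (use assms(2) in \<open>auto simp: pdiff_add pdiff_mult pdiff_Var\<close>)

subsection \<open>Homogeneous polynomials\<close>

lemma mon_degree_single: "mon_degree (single v k) = k"
  by (simp add: mon_degree_def)

lemma hom_polys_iff: "p \<in> hom_polys n e \<longleftrightarrow> homogeneous e p \<and> p \<in> vars_in {..n}"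
  by (auto simp: hom_polys_def vars_in_def)

lemma homogeneous_0 [simp]: "homogeneous e 0"
  by (simp add: homogeneous_def)

lemma homogeneous_Const [simp]: "homogeneous 0 (Const c)"
  by (simp add: homogeneous_def Const_def mon_degree_def)

lemma homogeneous_Var: "homogeneous 1 (Var v)"
  by (simp add: homogeneous_def Var_def mon_degree_single)

lemma homogeneous_add: "homogeneous e p \<Longrightarrow> homogeneous e q \<Longrightarrow> homogeneous e (p + q)"
  using Poly_Mapping.keys_add[of p q] by (fastforce simp: homogeneous_def)

lemma homogeneous_uminus: "homogeneous e p \<Longrightarrow> homogeneous e (- p)"
  by (simp add: homogeneous_def)

lemma homogeneous_diff: "homogeneous e p \<Longrightarrow> homogeneous e q \<Longrightarrow> homogeneous e (p - q)"
  using homogeneous_add[of e p "- q"] by (simp add: homogeneous_uminus)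

lemma homogeneous_sum: "(\<And>a. a \<in> A \<Longrightarrow> homogeneous e (f a)) \<Longrightarrow> homogeneous e (sum f A)"
  by (induction A rule: infinite_finite_induct) (auto intro: homogeneous_add)

lemma homogeneous_pdiff:
  assumes "homogeneous (Suc e) p"
  shows "homogeneous e (pdiff v p)"
  unfolding pdiff_def
proof (rule homogeneous_sum)
  fix m assume m: "m \<in> keys p"
  show "homogeneous e (single (m - single v 1) (of_nat (lookup m v) * lookup p m))"
  proof (cases "lookup m v = 0")
    case False
    then have "m = (m - single v 1) + single v 1"
      by (intro poly_mapping_eqI) (auto simp: lookup_add lookup_minus lookup_single when_def)
    then have "mon_degree m = mon_degree (m - single v 1) + 1"
      by (metis mon_degree_add mon_degree_single)
    then show ?thesis
      using m assms by (auto simp: homogeneous_def)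
  qed auto
qed

lemma
  shows hom_polys_0 [simp]: "0 \<in> hom_polys n e"
    and hom_polys_add: "p \<in> hom_polys n e \<Longrightarrow> q \<in> hom_polys n e \<Longrightarrow> p + q \<in> hom_polys n e"
    and hom_polys_uminus: "p \<in> hom_polys n e \<Longrightarrow> - p \<in> hom_polys n e"
    and hom_polys_diff: "p \<in> hom_polys n e \<Longrightarrow> q \<in> hom_polys n e \<Longrightarrow> p - q \<in> hom_polys n e"
    and hom_polys_mult: "p \<in> hom_polys n d \<Longrightarrow> q \<in> hom_polys n e \<Longrightarrow> p * q \<in> hom_polys n (d + e)"
    and hom_polys_Const [simp]: "Const c \<in> hom_polys n 0"
    and hom_polys_Var: "i \<le> n \<Longrightarrow> Var i \<in> hom_polys n 1"
    and hom_polys_pdiff: "p \<in> hom_polys n (Suc e) \<Longrightarrow> pdiff i p \<in> hom_polys n e"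
    and hom_polys_Const_mult: "p \<in> hom_polys n e \<Longrightarrow> Const c * p \<in> hom_polys n e"
  using homogeneous_mult[of 0 "Const c" e p]
  by (auto simp: hom_polys_iff homogeneous_add homogeneous_uminus homogeneous_diff homogeneous_mult
      homogeneous_Var homogeneous_pdiff vars_in_add vars_in_uminus vars_in_diff vars_in_mult vars_in_Var
      pdiff_vars_in simp del: One_nat_def)

lemma hom_polys_sum: "(\<And>a. a \<in> A \<Longrightarrow> f a \<in> hom_polys n e) \<Longrightarrow> sum f A \<in> hom_polys n e"
  by (induction A rule: infinite_finite_induct) (auto intro: hom_polys_add)

lemma hom_polys_sgn_mult: "p \<in> hom_polys n e \<Longrightarrow> (- 1) ^ k * p \<in> hom_polys n e"
  by (cases "even k") (auto intro: hom_polys_uminus)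

lemma Var_pdiff_single: "Var i * pdiff i (single m a) = single m (of_nat (lookup m i) * a)"
proof (cases "lookup m i = 0")
  case False
  then have "single i 1 + (m - single i 1) = m"
    by (intro poly_mapping_eqI) (auto simp: lookup_add lookup_minus lookup_single when_def)
  then show ?thesis
    by (simp add: pdiff_single Var_def mult_single)
qed (simp add: pdiff_single)

lemma single_sum: "single m (sum f A) = (\<Sum>a\<in>A. single m (f a))"
  by (induction A rule: infinite_finite_induct) (auto simp: single_add)

lemma euler_formula:
  assumes "p \<in> hom_polys n e"
  shows "(\<Sum>i\<le>n. Var i * pdiff i p) = of_nat e * p"
proof -
  have "(\<Sum>i\<le>n. Var i * pdiff i (single m (lookup p m))) = of_nat e * single m (lookup p m)"
    if m: "m \<in> keys p" for m
  proof -
    have "keys m \<subseteq> {..n}" "mon_degree m = e"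
      using assms m by (auto simp: hom_polys_def homogeneous_def)
    then have "e = (\<Sum>i\<le>n. lookup m i)"
      by (simp add: mon_degree_superset[of "{..n}"])
    then have "single m (of_nat e * lookup p m) = (\<Sum>i\<le>n. single m (of_nat (lookup m i) * lookup p m))"
      by (simp add: sum_distrib_right single_sum)
    then show ?thesis
      by (simp add: Var_pdiff_single flip: Const_of_nat Const_mult_single)
  qed
  then have "(\<Sum>m\<in>keys p. \<Sum>i\<le>n. Var i * pdiff i (single m (lookup p m))) =
      (\<Sum>m\<in>keys p. of_nat e * single m (lookup p m))"
    by (rule sum.cong[OF refl])
  then have "(\<Sum>i\<le>n. Var i * pdiff i (\<Sum>m\<in>keys p. single m (lookup p m))) =
      of_nat e * (\<Sum>m\<in>keys p. single m (lookup p m))"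
    by (subst (asm) sum.swap) (simp add: pdiff_sum sum_distrib_left)
  then show ?thesis
    by (simp flip: cpoly_as_sum)
qed

subsection \<open>Selecting the monomials with a given property\<close>

text \<open>One projection serves three purposes: homogeneous components, weight spaces of the
  diagonal field, and reduction modulo some variables.\<close>

definition pfilter :: "(('v \<Rightarrow>\<^sub>0 nat) \<Rightarrow> bool) \<Rightarrow> 'v cpoly \<Rightarrow> 'v cpoly" where
  "pfilter Q p = (\<Sum>m\<in>keys p. single m (if Q m then lookup p m else 0))"

lemma lookup_pfilter: "lookup (pfilter Q p) m = (if Q m then lookup p m else 0)"
  by (simp add: pfilter_def lookup_sum lookup_single when_def in_keys_iff)

lemma keys_pfilter: "keys (pfilter Q p) = {m \<in> keys p. Q m}"
  by (auto simp: in_keys_iff lookup_pfilter split: if_splits)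

lemma pfilter_0 [simp]: "pfilter Q 0 = 0"
  by (simp add: pfilter_def)

lemma pfilter_add: "pfilter Q (p + q) = pfilter Q p + pfilter Q q"
  by (rule poly_mapping_eqI) (simp add: lookup_pfilter lookup_add)

lemma pfilter_diff: "pfilter Q (p - q) = pfilter Q p - pfilter Q q"
  by (rule poly_mapping_eqI) (simp add: lookup_pfilter lookup_minus)

lemma pfilter_uminus: "pfilter Q (- p) = - pfilter Q p"
  by (rule poly_mapping_eqI) (simp add: lookup_pfilter)

lemma pfilter_sum: "pfilter Q (sum f A) = (\<Sum>a\<in>A. pfilter Q (f a))"
  by (induction A rule: infinite_finite_induct) (auto simp: pfilter_add)

lemma pfilter_single: "pfilter Q (single m a) = (if Q m then single m a else 0)"
  by (rule poly_mapping_eqI) (auto simp: lookup_pfilter lookup_single when_def)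

lemma pfilter_id: "(\<And>m. m \<in> keys p \<Longrightarrow> Q m) \<Longrightarrow> pfilter Q p = p"
  by (rule poly_mapping_eqI) (auto simp: lookup_pfilter in_keys_iff)

lemma pfilter_eq_0: "(\<And>m. m \<in> keys p \<Longrightarrow> \<not> Q m) \<Longrightarrow> pfilter Q p = 0"
  by (rule poly_mapping_eqI) (auto simp: lookup_pfilter in_keys_iff)

text \<open>The hypothesis holds when all monomials of \<open>q\<close> have the same grade,
  \<open>R\<close> being the grade condition shifted by it. This is how a factor in an identity is
  replaced by its component of the right degree or weight.\<close>

lemma pfilter_mult:
  assumes "\<And>m m'. m' \<in> keys q \<Longrightarrow> Q (m + m') \<longleftrightarrow> R m"
  shows "pfilter Q (p * q) = pfilter R p * q"
proof -
  have "pfilter Q (p * q) = (\<Sum>m\<in>keys p. \<Sum>m'\<in>keys q.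
      if R m then single (m + m') (lookup p m * lookup q m') else 0)"
    by (subst mult_eq_double_sum) (auto simp: pfilter_sum pfilter_single assms intro!: sum.cong)
  also have "\<dots> = (\<Sum>m\<in>keys p. \<Sum>m'\<in>keys q.
      single m (if R m then lookup p m else 0) * single m' (lookup q m'))"
    by (intro sum.cong) (auto simp: mult_single)
  also have "\<dots> = pfilter R p * q"
    by (subst (2) cpoly_as_sum[of q]) (simp add: pfilter_def sum_product)
  finally show ?thesis .
qed

lemma pfilter_pdiff:
  assumes "\<And>m. Q m \<longleftrightarrow> R (m + single v 1)"
  shows "pfilter Q (pdiff v p) = pdiff v (pfilter R p)"
proof -
  have "pfilter Q (pdiff v (single m a)) = pdiff v (pfilter R (single m a))" for m a
  proof (cases "lookup m v = 0")
    case False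
    then have "m - single v 1 + single v 1 = m"
      by (intro poly_mapping_eqI) (auto simp: lookup_add lookup_minus lookup_single when_def)
    then show ?thesis
      using assms[of "m - single v 1"] by (simp add: pdiff_single pfilter_single)
  qed (simp add: pdiff_single pfilter_single)
  then have "pfilter Q (pdiff v (\<Sum>m\<in>keys p. single m (lookup p m))) =
      pdiff v (pfilter R (\<Sum>m\<in>keys p. single m (lookup p m)))"
    by (simp add: pdiff_sum pfilter_sum)
  then show ?thesis
    by (simp flip: cpoly_as_sum)
qed

section \<open>Ascending chains in subrings, the Rees algebra of the origin, and Krull's
  theorem\<close>

section \<open>Noetherian subrings and Krull's intersection theorem\<close>

definition is_subring :: "'a::comm_ring_1 set \<Rightarrow> bool" where
  "is_subring B \<longleftrightarrow> 1 \<in> B \<and> (\<forall>x\<in>B. \<forall>y\<in>B. x + y \<in> B \<and> x * y \<in> B \<and> - x \<in> B)"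

text \<open>Rings are subsets of an ambient ring so that the Rees algebra needs no type of its own.
  The chain condition is stated for sequences because the relation it produces is exactly what
  Krull's theorem consumes.\<close>

definition noetherian :: "'a::comm_ring_1 set \<Rightarrow> bool" where
  "noetherian B \<longleftrightarrow> is_subring B \<and>
     (\<forall>f :: nat \<Rightarrow> 'a. range f \<subseteq> B \<longrightarrow> (\<exists>k c. range c \<subseteq> B \<and> f k = (\<Sum>i<k. c i * f i)))"

lemma
  assumes "is_subring B"
  shows is_subring_1: "1 \<in> B" and is_subring_0: "0 \<in> B"
    and is_subring_add: "x \<in> B \<Longrightarrow> y \<in> B \<Longrightarrow> x + y \<in> B"
    and is_subring_mult: "x \<in> B \<Longrightarrow> y \<in> B \<Longrightarrow> x * y \<in> B"
    and is_subring_uminus: "x \<in> B \<Longrightarrow> - x \<in> B"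
    and is_subring_diff: "x \<in> B \<Longrightarrow> y \<in> B \<Longrightarrow> x - y \<in> B"
proof -
  note B = assms[unfolded is_subring_def]
  show 1: "1 \<in> B" using B by blast
  have "1 + - 1 \<in> B" using B by blast
  then show "0 \<in> B" by simp
  show "x \<in> B \<Longrightarrow> y \<in> B \<Longrightarrow> x + y \<in> B" "x \<in> B \<Longrightarrow> y \<in> B \<Longrightarrow> x * y \<in> B" "x \<in> B \<Longrightarrow> - x \<in> B"
    using B by blast+
  have "x \<in> B \<Longrightarrow> y \<in> B \<Longrightarrow> x + - y \<in> B" using B by blast
  then show "x \<in> B \<Longrightarrow> y \<in> B \<Longrightarrow> x - y \<in> B" by simp
qed

lemma is_subring_sum:
  "is_subring B \<Longrightarrow> (\<And>a. a \<in> A \<Longrightarrow> f a \<in> B) \<Longrightarrow> sum f A \<in> B"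
  by (induction A rule: infinite_finite_induct) (auto intro: is_subring_0 is_subring_add)

text \<open>Hilbert's basis theorem for \<open>B[x]\<close> inside an arbitrary ring: the usual argument with
  generators of minimal degree is run on representing polynomials.\<close>

lemma noetherian_adjoin:
  fixes B :: "'a::comm_ring_1 set"
  assumes B: "noetherian B"
  shows "noetherian {poly q x |q. range (coeff q) \<subseteq> B}" (is "noetherian ?D")
proof -
  define B' where "B' = ?D"
  have sB: "is_subring B"
    using B by (simp add: noetherian_def)
  note sub = is_subring_1[OF sB] is_subring_0[OF sB] is_subring_add[OF sB] is_subring_mult[OF sB]
    is_subring_uminus[OF sB] is_subring_diff[OF sB]
  let ?C = "{q. range (coeff q) \<subseteq> B}"
  have C_add: "q + r \<in> ?C" and C_diff: "q - r \<in> ?C" and C_uminus: "- q \<in> ?C"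
    if "q \<in> ?C" "r \<in> ?C" for q r
    using that sub by (simp_all add: image_subset_iff)
  have C_mult: "q * r \<in> ?C" if "q \<in> ?C" "r \<in> ?C" for q r
    using that by (auto simp: image_subset_iff coeff_mult intro!: is_subring_sum[OF sB] sub(4))
  have C_monom: "monom c k \<in> ?C" if "c \<in> B" for c k
    using that sub by (simp add: image_subset_iff)
  have C_sum: "sum h A \<in> ?C" if "\<And>a. a \<in> A \<Longrightarrow> h a \<in> ?C" for h :: "nat \<Rightarrow> 'a poly" and A
    using that
  proof (induction A rule: infinite_finite_induct)
    case (insert a F)
    then show ?case using C_add[of "h a" "sum h F"] by simp
  qed (use sub in \<open>simp_all add: image_subset_iff\<close>)
  have sB': "is_subring B'"
    unfolding is_subring_def B'_def
  proof (intro conjI ballI)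
    show "1 \<in> ?D"
      using C_monom[OF sub(1), of 0] by (auto intro!: exI[of _ "monom 1 0"] simp: poly_monom)
  next
    fix y z assume "y \<in> ?D" "z \<in> ?D"
    then obtain q r where *: "y = poly q x" "z = poly r x" "q \<in> ?C" "r \<in> ?C" by blast
    show "y + z \<in> ?D" using C_add[OF *(3,4)] * by (auto intro!: exI[of _ "q + r"])
    show "y * z \<in> ?D" using C_mult[OF *(3,4)] * by (auto intro!: exI[of _ "q * r"])
    show "- y \<in> ?D" using C_uminus[OF *(3,4)] * by (auto intro!: exI[of _ "- q"])
  qed
  note sub' = is_subring_1[OF sB'] is_subring_0[OF sB'] is_subring_add[OF sB'] is_subring_mult[OF sB']
    is_subring_uminus[OF sB'] is_subring_diff[OF sB']
  define J where "J h k = {(\<Sum>i<k. c i * h i) |c. range c \<subseteq> B'}" for h :: "nat \<Rightarrow> 'a" and k :: nat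
  have JI: "y \<in> J h k" if "y = (\<Sum>i<k. c i * h i)" "range c \<subseteq> B'" for y h c k
    unfolding J_def by (rule CollectI, rule exI[of _ c], rule conjI) (fact that)+
  have JD: "\<exists>c. y = (\<Sum>i<k. c i * h i) \<and> range c \<subseteq> B'" if "y \<in> J h k" for y h k
    using that unfolding J_def by (rule CollectD)
  have J_mono: "J h k \<subseteq> J h l" if "k \<le> l" for h k l
  proof
    fix y assume "y \<in> J h k"
    then obtain c where c: "range c \<subseteq> B'" "y = (\<Sum>i<k. c i * h i)" by (auto dest: JD)
    have "y = (\<Sum>i<l. (if i < k then c i else 0) * h i)"
      unfolding c(2) using that by (intro sum.mono_neutral_cong_left) auto
    moreover have "range (\<lambda>i. if i < k then c i else 0) \<subseteq> B'"
      using c(1) sub'(2) by (simp add: image_subset_iff)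
    ultimately show "y \<in> J h l" by (rule JI)
  qed
  have J_add: "y + z \<in> J h k" if yz: "y \<in> J h k" "z \<in> J h k" for y z h k
  proof -
    obtain c d where cd: "range c \<subseteq> B'" "y = (\<Sum>i<k. c i * h i)" "range d \<subseteq> B'" "z = (\<Sum>i<k. d i * h i)"
      using yz[THEN JD] by auto
    have "y + z = (\<Sum>i<k. (c i + d i) * h i)"
      by (simp add: cd distrib_right sum.distrib)
    moreover have "range (\<lambda>i. c i + d i) \<subseteq> B'"
      using cd(1,3) sub'(3) by (simp add: image_subset_iff)
    ultimately show ?thesis
      by (rule JI)
  qed
  have J_mult: "y * z \<in> J h k" if yz: "y \<in> B'" "z \<in> J h k" for y z h k
  proof -
    obtain d where d: "range d \<subseteq> B'" "z = (\<Sum>i<k. d i * h i)"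
      using yz(2)[THEN JD] by auto
    have "y * z = (\<Sum>i<k. (y * d i) * h i)"
      by (simp add: d sum_distrib_left mult.assoc)
    moreover have "range (\<lambda>i. y * d i) \<subseteq> B'"
      using sub'(4)[OF yz(1)] d(1) by (simp add: image_subset_iff)
    ultimately show ?thesis
      by (rule JI)
  qed
  have J_0: "0 \<in> J h k" for h k
  proof -
    have "0 = (\<Sum>i<k. 0 * h i)" "range (\<lambda>_::nat. 0) \<subseteq> B'"
      using sub'(2) by (simp_all add: image_subset_iff)
    then show ?thesis by (rule JI)
  qed
  have J_gen: "h i \<in> J h k" if "i < k" for h i k
  proof -
    have "h i = (\<Sum>j<k. (if j = i then 1 else 0) * h j)"
      using that by (simp add: if_distrib[of "\<lambda>c. c * _"] sum.delta cong: if_cong)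
    moreover have "range (\<lambda>j. if j = i then 1 else 0) \<subseteq> B'"
      using sub'(1,2) by (simp add: image_subset_iff)
    ultimately show ?thesis by (rule JI)
  qed
  have J_sum: "(\<Sum>i<l. c i * h' i) \<in> J h k" if "range c \<subseteq> B'" "\<And>i. i < l \<Longrightarrow> h' i \<in> J h k" for c h' h k and l :: nat
    using that(2)
  proof (induction l)
    case 0
    then show ?case using J_0 by simp
  next
    case (Suc l)
    then show ?case using J_add J_mult that(1) by (simp add: image_subset_iff)
  qed
  have "noetherian B'"
    unfolding noetherian_def
  proof (intro conjI sB' allI impI)
    fix f :: "nat \<Rightarrow> 'a" assume f: "range f \<subseteq> B'"
    show "\<exists>k c. range c \<subseteq> B' \<and> f k = (\<Sum>i<k. c i * f i)"
    proof (rule ccontr)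
      assume "\<not> ?thesis"
      then have nf: "f k \<notin> J f k" for k
        by (auto dest!: JD)
      \<comment> \<open>\<open>x\<close> may satisfy relations over \<open>B\<close>, so degrees
        exist only for representing polynomials. \<open>P\<close> collects the representatives of
        elements of the ideal generated by all \<open>f i\<close>.\<close>
      define P where "P = {q \<in> ?C. \<exists>K. poly q x \<in> J f K}"
      define good where "good g k q \<longleftrightarrow> q \<in> P \<and> poly q x \<notin> J (\<lambda>i. poly (g i) x) k" for g k q
      have ex: "\<exists>q. good g k q" if g: "\<And>i. i < k \<Longrightarrow> g i \<in> P" for g k
      proof -
        have "\<forall>i<k. \<exists>K. poly (g i) x \<in> J f K"
          using g unfolding P_def by blast
        then obtain K where K: "\<And>i. i < k \<Longrightarrow> poly (g i) x \<in> J f (K i)" by metis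
        define M where "M = Max (insert 0 (K ` {..<k}))"
        have "poly (g i) x \<in> J f M" if "i < k" for i
        proof -
          have "K i \<le> M" unfolding M_def using that by (intro Max_ge) auto
          then show ?thesis using K[OF that] J_mono by blast
        qed
        then have sub: "J (\<lambda>i. poly (g i) x) k \<subseteq> J f M"
          using J_sum[of _ k "\<lambda>i. poly (g i) x" f M] by (auto dest!: JD)
        obtain q where q: "q \<in> ?C" "f M = poly q x"
          using f unfolding B'_def by blast
        have "q \<in> P"
          unfolding P_def using q J_gen[of M "Suc M" f] by auto
        moreover have "poly q x \<notin> J (\<lambda>i. poly (g i) x) k"
          using sub nf[of M] q by auto
        ultimately show ?thesis unfolding good_def by blast
      qed
      \<comment> \<open>Each \<open>g k\<close> has least degree among the representatives in
        \<open>P\<close> whose value is not generated by the values of its predecessors.\<close>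
      have "\<exists>g. \<forall>k. good g k (g k) \<and> (\<forall>q. good g k q \<longrightarrow> degree (g k) \<le> degree q)"
      proof (rule dependent_wellorder_choice)
        fix r :: "'a poly" and g h :: "nat \<Rightarrow> 'a poly" and k :: nat
        assume "\<And>y. y < k \<Longrightarrow> g y = h y"
        then have "J (\<lambda>i. poly (g i) x) k = J (\<lambda>i. poly (h i) x) k"
          unfolding J_def by auto
        then show "(good g k r \<and> (\<forall>q. good g k q \<longrightarrow> degree r \<le> degree q)) =
            (good h k r \<and> (\<forall>q. good h k q \<longrightarrow> degree r \<le> degree q))"
          unfolding good_def by simp
      next
        fix k :: nat and g :: "nat \<Rightarrow> 'a poly"
        assume "\<And>y. y < k \<Longrightarrow> good g y (g y) \<and> (\<forall>q. good g y q \<longrightarrow> degree (g y) \<le> degree q)"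
        then have "\<exists>q. good g k q"
          by (intro ex) (auto simp: good_def)
        then show "\<exists>r. good g k r \<and> (\<forall>q. good g k q \<longrightarrow> degree r \<le> degree q)"
          using ex_has_least_nat[of "good g k" _ degree] by blast
      qed
      then obtain g where g: "\<And>k. good g k (g k)" "\<And>k q. good g k q \<Longrightarrow> degree (g k) \<le> degree q"
        by blast
      have gP: "g k \<in> P" and gC: "g k \<in> ?C" for k
        using g(1)[of k] unfolding good_def P_def by auto
      let ?Jg = "J (\<lambda>i. poly (g i) x)"
      define a where "a k = lead_coeff (g k)" for k
      have "range a \<subseteq> B"
        using gC unfolding a_def by blast
      then obtain k c where c: "range c \<subseteq> B" "a k = (\<Sum>i<k. c i * a i)"
        using B unfolding noetherian_def by meson
      have deg: "degree (g i) \<le> degree (g k)" if "i < k" for i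
      proof -
        have "good g i (g k)"
          using g(1)[of k] J_mono[of i k] that unfolding good_def by auto
        then show ?thesis by (rule g(2))
      qed
      \<comment> \<open>The exponents lift every \<open>g i\<close> to the degree of
        \<open>g k\<close>, which is possible since minimality makes the degrees nondecreasing. Then
        \<open>s\<close> and \<open>g k\<close> have the same leading term, and \<open>r\<close>
        contradicts the minimal choice of \<open>g k\<close>.\<close>
      define s where "s = (\<Sum>i<k. monom (c i) (degree (g k) - degree (g i)) * g i)"
      define r where "r = g k - s"
      have mC: "monom (c i) j \<in> ?C" for i j
        using c(1) C_monom by blast
      have sC: "s \<in> ?C"
        unfolding s_def by (intro C_sum C_mult mC gC)
      have rC: "r \<in> ?C"
        unfolding r_def by (intro C_diff gC sC)
      have mB: "poly (monom (c i) j) x \<in> B'" for i j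
        using mC[of i j] unfolding B'_def by blast
      then have sJg: "poly s x \<in> ?Jg k"
        unfolding s_def poly_sum poly_mult by (intro JI[OF refl]) (simp add: image_subset_iff)
      have "\<exists>K. poly s x \<in> J f K"
      proof -
        have "\<exists>K. poly (\<Sum>i<l. monom (c i) (degree (g k) - degree (g i)) * g i) x \<in> J f K" for l
        proof (induction l)
          case 0
          then show ?case using J_0 by auto
        next
          case (Suc l)
          obtain K1 where K1: "poly (\<Sum>i<l. monom (c i) (degree (g k) - degree (g i)) * g i) x \<in> J f K1"
            using Suc by blast
          obtain K2 where "poly (g l) x \<in> J f K2"
            using gP[of l] unfolding P_def by blast
          then have K2: "poly (monom (c l) (degree (g k) - degree (g l)) * g l) x \<in> J f K2"
            unfolding poly_mult using J_mult mB by blast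
          have "poly (\<Sum>i<l. monom (c i) (degree (g k) - degree (g i)) * g i) x \<in> J f (max K1 K2)"
            "poly (monom (c l) (degree (g k) - degree (g l)) * g l) x \<in> J f (max K1 K2)"
            using K1 K2 J_mono[of K1 "max K1 K2" f] J_mono[of K2 "max K1 K2" f] by auto
          then have "poly (\<Sum>i<l. monom (c i) (degree (g k) - degree (g i)) * g i) x +
              poly (monom (c l) (degree (g k) - degree (g l)) * g l) x \<in> J f (max K1 K2)"
            by (rule J_add)
          then show ?case
            by (auto simp del: poly_mult)
        qed
        then show ?thesis unfolding s_def by blast
      qed
      moreover obtain K1 where "poly (g k) x \<in> J f K1"
        using gP[of k] unfolding P_def by blast
      moreover have "poly r x = poly (g k) x + (- 1) * poly s x"
        by (simp add: r_def)
      moreover have "- 1 \<in> B'"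
        using sub'(1,5) by blast
      ultimately have "\<exists>K. poly r x \<in> J f K"
        using J_add J_mult J_mono[OF max.cobounded1] J_mono[OF max.cobounded2]
        by (metis (no_types, lifting) subsetD)
      then have rP: "r \<in> P"
        unfolding P_def by (intro CollectI conjI) (use rC in simp)
      have rJ: "poly r x \<notin> ?Jg k"
      proof
        assume "poly r x \<in> ?Jg k"
        then have "poly r x + poly s x \<in> ?Jg k"
          using J_add sJg by blast
        then have "poly (g k) x \<in> ?Jg k"
          by (simp add: r_def)
        then show False using g(1)[of k] unfolding good_def by blast
      qed
      have coeff_r: "coeff r j = 0" if j: "j \<ge> degree (g k)" for j
      proof -
        have "coeff (monom (c i) (degree (g k) - degree (g i)) * g i) j =
            (if j = degree (g k) then c i * a i else 0)" if "i < k" for i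
        proof -
          have *: "j - (degree (g k) - degree (g i)) = j - degree (g k) + degree (g i)"
            using deg[OF that] j by linarith
          show ?thesis
            using j deg[OF that] by (auto simp: coeff_monom_mult a_def * coeff_eq_0)
        qed
        then have "coeff s j = (if j = degree (g k) then a k else 0)"
          unfolding s_def coeff_sum c(2) by simp
        then show ?thesis
          using j by (auto simp: r_def a_def coeff_eq_0)
      qed
      have "r \<noteq> 0"
        using rJ J_0 by auto
      then have "degree r < degree (g k)"
        using coeff_r by (meson leading_coeff_0_iff not_le)
      moreover have "good g k r"
        unfolding good_def using rP rJ by blast
      ultimately show False
        using g(2)[of k r] by simp
    qed
  qed
  then show ?thesis
    by (simp only: B'_def)
qed

text \<open>The last clause, minimality of \<open>B'\<close>, acts as an induction principle:
  properties of its elements are proved by exhibiting a subring with the generators.\<close>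

lemma noetherian_adjoin_finite:
  assumes "finite S" "noetherian B"
  shows "\<exists>B'. noetherian B' \<and> B \<subseteq> B' \<and> S \<subseteq> B' \<and>
    (\<forall>R. is_subring R \<and> B \<subseteq> R \<and> S \<subseteq> R \<longrightarrow> B' \<subseteq> R)"
  using assms
proof (induction S rule: finite_induct)
  case (insert x S)
  from insert.IH[OF insert.prems] obtain B' where *: "noetherian B' \<and> B \<subseteq> B' \<and> S \<subseteq> B' \<and>
    (\<forall>R. is_subring R \<and> B \<subseteq> R \<and> S \<subseteq> R \<longrightarrow> B' \<subseteq> R)"
    by (rule exE)
  note B' = *[THEN conjunct1] *[THEN conjunct2, THEN conjunct1]
    *[THEN conjunct2, THEN conjunct2, THEN conjunct1]
  have min: "B' \<subseteq> R" if "is_subring R" "B \<subseteq> R" "S \<subseteq> R" for R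
    using * that by (elim conjE allE impE) simp_all
  have s: "is_subring B'"
    using B'(1) by (simp add: noetherian_def)
  let ?B = "{poly q x |q. range (coeff q) \<subseteq> B'}"
  have "B' \<subseteq> ?B"
  proof
    fix b assume "b \<in> B'"
    then have "b = poly [:b:] x" "range (coeff [:b:]) \<subseteq> B'"
      using is_subring_0[OF s] by (auto simp: coeff_pCons split: nat.splits)
    then show "b \<in> ?B" by blast
  qed
  moreover have "x \<in> ?B"
  proof -
    have "x = poly [:0, 1:] x" "range (coeff [:0, 1:]) \<subseteq> B'"
      using is_subring_0[OF s] is_subring_1[OF s] by (auto simp: coeff_pCons split: nat.splits)
    then show ?thesis by blast
  qed
  moreover have "?B \<subseteq> R" if R: "is_subring R" "B \<subseteq> R" "insert x S \<subseteq> R" for R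
  proof safe
    fix q assume q: "range (coeff q) \<subseteq> B'"
    have "B' \<subseteq> R" using min R by simp
    moreover have "x ^ k \<in> R" for k
      using R by (induction k) (auto intro: is_subring_1 is_subring_mult)
    moreover have "coeff q k \<in> R" for k
      using q \<open>B' \<subseteq> R\<close> by (auto simp: image_subset_iff)
    ultimately show "poly q x \<in> R"
      unfolding poly_altdef using R(1) by (intro is_subring_sum is_subring_mult) simp_all
  qed
  ultimately have "noetherian ?B \<and> B \<subseteq> ?B \<and> insert x S \<subseteq> ?B \<and>
      (\<forall>R. is_subring R \<and> B \<subseteq> R \<and> insert x S \<subseteq> R \<longrightarrow> ?B \<subseteq> R)"
    using noetherian_adjoin[OF B'(1), of x] B'(2,3) by (intro conjI) simp_all
  then show ?case
    by (rule exI)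
qed (auto intro!: exI[of _ B])

text \<open>The \<open>k\<close>-th power of the maximal ideal of the origin.\<close>

definition min_degree :: "nat \<Rightarrow> 'v cpoly set" where
  "min_degree k = {p. \<forall>m\<in>keys p. k \<le> mon_degree m}"

lemma min_degree_0 [simp]: "p \<in> min_degree 0" "0 \<in> min_degree k"
  by (auto simp: min_degree_def)

lemma min_degree_add: "p \<in> min_degree k \<Longrightarrow> q \<in> min_degree k \<Longrightarrow> p + q \<in> min_degree k"
  using Poly_Mapping.keys_add[of p q] by (fastforce simp: min_degree_def)

lemma min_degree_uminus: "p \<in> min_degree k \<Longrightarrow> - p \<in> min_degree k"
  by (auto simp: min_degree_def)

lemma min_degree_diff: "p \<in> min_degree k \<Longrightarrow> q \<in> min_degree k \<Longrightarrow> p - q \<in> min_degree k"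
  using min_degree_add[of p k "- q"] min_degree_uminus[of q k] by simp

lemma min_degree_sum: "(\<And>a. a \<in> A \<Longrightarrow> f a \<in> min_degree k) \<Longrightarrow> sum f A \<in> min_degree k"
  by (induction A rule: infinite_finite_induct) (auto intro: min_degree_add)

lemma min_degree_mult: "p \<in> min_degree k \<Longrightarrow> q \<in> min_degree l \<Longrightarrow> p * q \<in> min_degree (k + l)"
  using keys_mult[of p q] by (force simp: min_degree_def mon_degree_add intro: add_mono)

lemma min_degree_mono: "k \<le> l \<Longrightarrow> min_degree l \<subseteq> min_degree k"
  by (auto simp: min_degree_def)

text \<open>The Rees algebra \<open>\<Oplus>\<^sub>k \<mm>\<^sup>k t\<^sup>k\<close> is finitely generated, so
  the ascending chain condition applies to the elements \<open>P\<^sub>k t\<^sup>k\<close>.\<close>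

lemma rees_chain:
  fixes P :: "nat \<Rightarrow> 'v cpoly"
  assumes V: "finite V" and P: "\<And>k. P k \<in> min_degree k" "\<And>k. P k \<in> vars_in V"
  obtains k c where "P k = (\<Sum>i<k. c i * P i)" "\<And>i. i < k \<Longrightarrow> c i \<in> min_degree 1 \<inter> vars_in V"
proof -
  let ?B = "range (\<lambda>c. [:Const c:] :: 'v cpoly poly)"
  have nB: "noetherian ?B"
    unfolding noetherian_def
  proof (intro conjI allI impI)
    show "is_subring ?B"
      unfolding is_subring_def
    proof (intro conjI ballI)
      show "1 \<in> ?B" by (auto simp: one_pCons Const_1 intro!: image_eqI[of _ _ 1])
    next
      fix x y assume "x \<in> ?B" "y \<in> ?B"
      then obtain a b where "x = [:Const a:]" "y = [:Const b:]" by blast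
      then have "x + y = [:Const (a + b):]" "x * y = [:Const (a * b):]" "- x = [:Const (- a):]"
        by (simp_all add: Const_uminus Const_add Const_mult)
      then show "x + y \<in> ?B" "x * y \<in> ?B" "- x \<in> ?B" by blast+
    qed
  next
    fix f :: "nat \<Rightarrow> 'v cpoly poly" assume "range f \<subseteq> ?B"
    then have "\<forall>i. \<exists>a. f i = [:Const a:]" by blast
    then obtain a where a: "\<And>i. f i = [:Const (a i):]" by metis
    show "\<exists>k c. range c \<subseteq> ?B \<and> f k = (\<Sum>i<k. c i * f i)"
    \<comment> \<open>The constants form a field: either the first term is 0, which is the empty sum
      at \<open>k = 0\<close>, or it is a unit and generates the term at
      \<open>k = 1\<close>.\<close>
    proof (cases "a 0 = 0")
      case True
      then show ?thesis by (intro exI[of _ 0] exI[of _ "\<lambda>_. [:Const 0:]"]) (auto simp: a)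
    next
      case False
      then show ?thesis
        by (intro exI[of _ 1] exI[of _ "\<lambda>_. [:Const (a 1 / a 0):]"]) (auto simp: a simp flip: Const_mult)
    qed
  qed
  have fS: "finite ((\<lambda>v. [:Var v:]) ` V \<union> (\<lambda>v. monom (Var v) 1) ` V)" (is "finite ?S")
    using V by simp
  from noetherian_adjoin_finite[OF fS nB] obtain B' where *: "noetherian B' \<and> ?B \<subseteq> B' \<and> ?S \<subseteq> B' \<and>
      (\<forall>R. is_subring R \<and> ?B \<subseteq> R \<and> ?S \<subseteq> R \<longrightarrow> B' \<subseteq> R)"
    by (rule exE)
  note B' = *[THEN conjunct1] *[THEN conjunct2, THEN conjunct1]
    *[THEN conjunct2, THEN conjunct2, THEN conjunct1]
  have min: "B' \<subseteq> R" if "is_subring R" "?B \<subseteq> R" "?S \<subseteq> R" for R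
    using * that by (elim conjE allE impE) simp_all
  have s: "is_subring B'"
    using B'(1) by (simp add: noetherian_def)
  \<comment> \<open>The Rees algebra, with the variable of \<open>poly\<close> as t. Minimality of
    \<open>B'\<close> puts the multipliers from the chain condition into it.\<close>
  let ?R = "{Q. \<forall>j. coeff Q j \<in> min_degree j \<inter> vars_in V} :: 'v cpoly poly set"
  have "B' \<subseteq> ?R"
  proof (rule min)
    show "is_subring ?R"
      unfolding is_subring_def
    proof (intro conjI ballI)
      fix x y assume xy: "x \<in> ?R" "y \<in> ?R"
      show "x * y \<in> ?R"
      proof safe
        fix j
        show "coeff (x * y) j \<in> vars_in V"
          unfolding coeff_mult using xy by (intro vars_in_sum vars_in_mult) auto
        have "coeff x i * coeff y (j - i) \<in> min_degree j" if "i \<le> j" for i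
          using min_degree_mult[of "coeff x i" i "coeff y (j - i)" "j - i"] xy that by auto
        then show "coeff (x * y) j \<in> min_degree j"
          unfolding coeff_mult by (intro min_degree_sum) auto
      qed
    qed (auto simp: min_degree_add min_degree_uminus vars_in_add vars_in_uminus coeff_pCons one_pCons split: nat.splits)
    show "?B \<subseteq> ?R"
      by (auto simp: coeff_pCons split: nat.splits)
    show "?S \<subseteq> ?R"
    proof -
      have "Var v \<in> min_degree 1" for v :: 'v
        by (simp add: min_degree_def Var_def mon_degree_single)
      then show ?thesis
        by (auto simp: coeff_pCons vars_in_Var split: nat.splits simp del: One_nat_def)
    qed
  qed
  have gen0: "[:q:] \<in> B'" if "q \<in> vars_in V" for q
    using that
  proof (induction rule: cpoly_induct)
    case (add p q)
    then show ?case using is_subring_add[OF s] by fastforce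
  next
    case (mult p q)
    then show ?case using is_subring_mult[OF s, of "[:p:]" "[:q:]"] by (simp add: mult.commute)
  qed (use B' in auto)
  \<comment> \<open>A monomial of degree at least \<open>k\<close>, times t^k, splits into
    \<open>k\<close> factors z_v t and a remainder without t.\<close>
  have gen1: "monom (single m a) k \<in> B'" if "keys m \<subseteq> V" "k \<le> mon_degree m" for m a k
    using that
  proof (induction k arbitrary: m)
    case 0
    then show ?case
      using gen0[of "single m a"] by (simp add: monom_0 vars_in_single)
  next
    case (Suc k)
    then obtain v where v: "v \<in> keys m"
      unfolding mon_degree_def by fastforce
    define m' where "m' = m - single v 1"
    have m: "m = single v 1 + m'"
      unfolding m'_def using v
      by (intro poly_mapping_eqI) (auto simp: lookup_add lookup_minus lookup_single when_def in_keys_iff)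
    then have "mon_degree m = 1 + mon_degree m'"
      by (metis mon_degree_add mon_degree_single)
    moreover have "keys m' \<subseteq> V"
      using Suc.prems(1) unfolding m'_def by (auto simp: in_keys_iff lookup_minus)
    ultimately have "monom (single m' a) k \<in> B'"
      using Suc by simp
    moreover have "monom (Var v) 1 \<in> B'"
      using B'(3) v Suc.prems(1) by auto
    moreover have "monom (single m a) (Suc k) = monom (Var v) 1 * monom (single m' a) k"
      by (simp add: mult_monom Var_def mult_single m)
    ultimately show ?case
      using is_subring_mult[OF s] by metis
  qed
  have "monom (P k) k \<in> B'" for k
  proof -
    have "monom (P k) k = (\<Sum>m\<in>keys (P k). monom (single m (lookup (P k) m)) k)"
      by (subst (1) cpoly_as_sum[of "P k"]) (simp add: poly_eq_iff coeff_sum)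
    also have "\<dots> \<in> B'"
      using P[of k] by (intro is_subring_sum[OF s] gen1) (auto simp: min_degree_def vars_in_def)
    finally show ?thesis .
  qed
  then have "range (\<lambda>k. monom (P k) k) \<subseteq> B'" by blast
  then obtain k c where c: "range c \<subseteq> B'" "monom (P k) k = (\<Sum>i<k. c i * monom (P i) i)"
    using B'(1) unfolding noetherian_def by meson
  \<comment> \<open>Only the coefficient of t^k of the chain relation matters. The multiplier of
    \<open>P i\<close> in it is a coefficient of t^(k-i), hence lies in the maximal ideal because
    \<open>i < k\<close>.\<close>
  have "P k = coeff (monom (P k) k) k" by simp
  also have "\<dots> = (\<Sum>i<k. coeff (c i) (k - i) * P i)"
    unfolding c(2) coeff_sum
  proof (rule sum.cong[OF refl])
    fix i assume "i \<in> {..<k}"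
    then show "coeff (c i * monom (P i) i) k = coeff (c i) (k - i) * P i"
      using coeff_monom_mult[of "P i" i "c i" k] by (simp add: mult.commute)
  qed
  finally have "P k = (\<Sum>i<k. coeff (c i) (k - i) * P i)" .
  moreover have "coeff (c i) (k - i) \<in> min_degree 1 \<inter> vars_in V" if "i < k" for i
  proof -
    have "c i \<in> ?R" using c(1) \<open>B' \<subseteq> ?R\<close> by blast
    then have "coeff (c i) (k - i) \<in> min_degree (k - i) \<inter> vars_in V" by blast
    moreover have "1 \<le> k - i" using that by simp
    ultimately show ?thesis using min_degree_mono[of 1 "k - i"] by blast
  qed
  ultimately show ?thesis by (rule that)
qed

lemma eval_at_zero: "eval_at (\<lambda>_. 0) p = lookup p 0"
proof -
  have "mon_eval (\<lambda>_. 0) m = (if m = 0 then 1 else 0)" for m :: "'a \<Rightarrow>\<^sub>0 nat"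
  proof (cases "m = 0")
    case False
    then obtain v where "v \<in> keys m"
      by (metis keys_eq_empty all_not_in_conv)
    then have "mon_eval (\<lambda>_. 0) m = 0"
      unfolding mon_eval_def by (intro prod_zero) (auto simp: in_keys_iff power_0_left)
    then show ?thesis using False by simp
  qed (simp add: mon_eval_def)
  then have "eval_at (\<lambda>_. 0) p = (\<Sum>m\<in>keys p. if m = 0 then lookup p m else 0)"
    unfolding eval_at_def poly_eval_def mon_eval_def[symmetric] by (intro sum.cong) auto
  then show ?thesis
    by (simp add: in_keys_iff)
qed

text \<open>With remainders P_k = f - e_k, the chain relation P_k = sum of c_i P_i has all c_i in
  the maximal ideal. Moving the sum to the left, (1 - sum of c_i) f is a combination of the e_i, so
  the multiplier is explicit.\<close>

lemma krull_intersection: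
  assumes V: "finite V" and I: "0 \<in> I" "\<And>p q. p \<in> I \<Longrightarrow> q \<in> I \<Longrightarrow> p + q \<in> I"
    "\<And>p q. p \<in> vars_in V \<Longrightarrow> q \<in> I \<Longrightarrow> p * q \<in> I" "I \<subseteq> vars_in V"
    and f: "f \<in> vars_in V" "\<And>k. \<exists>e\<in>I. f - e \<in> min_degree k"
  shows "\<exists>g\<in>vars_in V. eval_at (\<lambda>_. 0) g = 1 \<and> g * f \<in> I"
proof -
  obtain e where e: "\<And>k. e k \<in> I" "\<And>k. f - e k \<in> min_degree k"
    using f(2) by metis
  have "f - e k \<in> vars_in V" for k
    using f(1) e(1) I(4) vars_in_diff by blast
  from rees_chain[of V "\<lambda>k. f - e k", OF V e(2) this]
  obtain k c where c: "f - e k = (\<Sum>i<k. c i * (f - e i))" "\<And>i. i < k \<Longrightarrow> c i \<in> min_degree 1 \<inter> vars_in V"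
    by blast
  have Isum: "sum h A \<in> I" if "\<And>a. a \<in> A \<Longrightarrow> h a \<in> I" for h :: "nat \<Rightarrow> _" and A
    using that by (induction A rule: infinite_finite_induct) (auto intro: I)
  let ?g = "1 - (\<Sum>i<k. c i)"
  have "?g * f = e k + (\<Sum>i<k. (- c i) * e i)"
    using c(1) by (simp add: algebra_simps sum_subtractf sum_distrib_left sum_negf)
  also have "\<dots> \<in> I"
    using e(1) c(2) by (intro I(2) Isum I(3) vars_in_uminus) auto
  finally have "?g * f \<in> I" .
  moreover have "eval_at (\<lambda>_. 0) (c i) = 0" if "i < k" for i
  proof -
    have "lookup (c i) 0 = 0"
      using c(2)[OF that] by (force simp: min_degree_def in_keys_iff mon_degree_def)
    then show ?thesis by (simp add: eval_at_zero)
  qed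
  then have "eval_at (\<lambda>_. 0) ?g = 1"
    by (simp add: eval_at_diff eval_at_sum)
  moreover have "?g \<in> vars_in V"
    using c(2) by (intro vars_in_diff vars_in_sum) auto
  ultimately show ?thesis by blast
qed

section \<open>From tangent vectors at one point to vanishing on the whole set after a
  multiplier\<close>

section \<open>Local vanishing from a tangent space computation\<close>

definition lin_form :: "'v set \<Rightarrow> ('v \<Rightarrow> complex) \<Rightarrow> 'v cpoly" where
  "lin_form V \<alpha> = (\<Sum>v\<in>V. Const (\<alpha> v) * Var v)"

lemma eval_at_lin_form [simp]: "eval_at x (lin_form V \<alpha>) = (\<Sum>v\<in>V. \<alpha> v * x v)"
  by (simp add: lin_form_def eval_at_simps)

lemma lin_form_vars_in: "lin_form V \<alpha> \<in> vars_in V"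
  unfolding lin_form_def by (intro vars_in_sum vars_in_mult vars_in_Const vars_in_Var)

lemma pdiff_lin_form:
  assumes "finite V" "v \<in> V"
  shows "pdiff v (lin_form V \<alpha>) = Const (\<alpha> v)"
  using assms by (simp add: lin_form_def pdiff_sum pdiff_mult pdiff_Var if_distrib[of "\<lambda>c. _ * c"] cong: if_cong)

lemma pfilter_idem: "pfilter Q (pfilter Q p) = pfilter Q p"
  by (rule poly_mapping_eqI) (simp add: lookup_pfilter)

text \<open>Congruences modulo an ideal that hold for the variables propagate through sums and
  products.\<close>

lemma substitute_diff_mem:
  assumes h: "h \<in> vars_in V"
    and I: "0 \<in> I" "\<And>p q. p \<in> I \<Longrightarrow> q \<in> I \<Longrightarrow> p + q \<in> I"
      "\<And>p q. p \<in> vars_in V \<Longrightarrow> q \<in> I \<Longrightarrow> p * q \<in> I"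
    and \<sigma>: "\<And>v. v \<in> V \<Longrightarrow> \<sigma> v \<in> vars_in V" "\<And>v. v \<in> V \<Longrightarrow> Var v - \<sigma> v \<in> I"
  shows "h - substitute \<sigma> h \<in> I \<and> substitute \<sigma> h \<in> vars_in V"
  using h
proof (induction rule: cpoly_induct)
  case (add p q)
  have *: "p + q - substitute \<sigma> (p + q) = (p - substitute \<sigma> p) + (q - substitute \<sigma> q)"
    by (simp add: substitute_add)
  have "p + q - substitute \<sigma> (p + q) \<in> I"
    unfolding * using add I(2) by simp
  then show ?case
    using add by (simp add: substitute_add vars_in_add)
next
  case (mult p q)
  have *: "p * q - substitute \<sigma> (p * q) = p * (q - substitute \<sigma> q) + substitute \<sigma> q * (p - substitute \<sigma> p)"
    by (simp add: substitute_mult algebra_simps)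
  have "p * q - substitute \<sigma> (p * q) \<in> I"
    unfolding * using mult I(2,3) by simp
  then show ?case
    using mult by (simp add: substitute_mult vars_in_mult)
qed (use I \<sigma> in auto)

text \<open>A linear form \<open>\<alpha>\<close> with \<open>\<alpha>(v) \<noteq> 0\<close> allows to eliminate the variable \<open>v\<close>.\<close>

lemma linear_nullstellensatz:
  assumes "finite V"
    and "0 \<in> I" "\<And>p q. p \<in> I \<Longrightarrow> q \<in> I \<Longrightarrow> p + q \<in> I"
      "\<And>p q. p \<in> vars_in V \<Longrightarrow> q \<in> I \<Longrightarrow> p * q \<in> I"
    and "\<And>\<alpha>. \<alpha> \<in> L \<Longrightarrow> lin_form V \<alpha> \<in> I" and "h \<in> vars_in V"
    and "\<And>w. \<forall>v. v \<notin> V \<longrightarrow> w v = 0 \<Longrightarrow> \<forall>\<alpha>\<in>L. (\<Sum>v\<in>V. \<alpha> v * w v) = 0 \<Longrightarrow> eval_at w h = 0"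
  shows "h \<in> I"
  using assms
proof (induction "card V" arbitrary: V L h rule: less_induct)
  case less
  note I = less.prems(2-4)
  show ?case
  proof (cases "\<forall>\<alpha>\<in>L. \<forall>v\<in>V. \<alpha> v = 0")
    case True
    then have "\<forall>\<alpha>\<in>L. (\<Sum>v\<in>V. \<alpha> v * w v) = 0" for w
      by (auto intro!: sum.neutral)
    then have "h = 0"
      using less.prems(6,7) by (intro vars_in_eq_0I[of h V]) auto
    then show ?thesis using I by simp
  next
    case False
    then obtain \<mu> v0 where \<mu>: "\<mu> \<in> L" "v0 \<in> V" "\<mu> v0 \<noteq> 0" by blast
    define W where "W = V - {v0}"
    have "card W < card V"
      unfolding W_def by (rule card_Diff1_less) (use less.prems(1) \<mu>(2) in auto)
    then have W: "finite W" "card W < card V" "W \<subseteq> V" "V = insert v0 W" "v0 \<notin> W"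
      using less.prems(1) \<mu>(2) by (auto simp: W_def)
    define \<sigma> where "\<sigma> v = (if v = v0 then lin_form W (\<lambda>u. - \<mu> u / \<mu> v0) else Var v)" for v
    have \<sigma>W: "\<sigma> v \<in> vars_in W" if "v \<in> V" for v
      using that W by (auto simp: \<sigma>_def lin_form_vars_in vars_in_Var)
    have split: "lin_form V \<alpha> = Const (\<alpha> v0) * Var v0 + lin_form W \<alpha>" for \<alpha>
      using W by (simp add: lin_form_def)
    have scale: "Const c * lin_form W \<alpha> = lin_form W (\<lambda>u. c * \<alpha> u)" for c \<alpha>
      by (simp add: lin_form_def sum_distrib_left Const_mult mult.assoc)
    have sub: "h - substitute \<sigma> h \<in> I \<and> substitute \<sigma> h \<in> vars_in V"
    proof (rule substitute_diff_mem[OF less.prems(6) I])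
      fix v assume "v \<in> V"
      then show "\<sigma> v \<in> vars_in V" using \<sigma>W vars_in_mono[OF W(3)] by blast
      show "Var v - \<sigma> v \<in> I"
      proof (cases "v = v0")
        case True
        have "Var v - \<sigma> v = Const (1 / \<mu> v0) * lin_form V \<mu>"
          using \<mu>(3) True by (simp add: \<sigma>_def split distrib_left scale Const_1 flip: mult.assoc Const_mult)
            (simp add: lin_form_def sum_negf Const_uminus)
        then show ?thesis using I(3) less.prems(5)[OF \<mu>(1)] by simp
      qed (simp add: \<sigma>_def I)
    qed
    have subW: "substitute \<sigma> h \<in> vars_in W"
      using less.prems(6)
      by (induction rule: cpoly_induct) (auto simp: substitute_add substitute_mult vars_in_add vars_in_mult \<sigma>W)
    \<comment> \<open>One step of Gaussian elimination: multiples of \<open>\<mu>\<close> remove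
      \<open>v0\<close> from the forms in \<open>L\<close>. The point \<open>w'\<close> below
      extends a solution in \<open>W\<close> to a solution in \<open>V\<close>.\<close>
    let ?L = "(\<lambda>\<alpha> u. \<alpha> u - \<alpha> v0 / \<mu> v0 * \<mu> u) ` L"
    have "substitute \<sigma> h \<in> I"
    proof (rule less.hyps[OF W(2,1) I(1,2)])
      show "p * q \<in> I" if "p \<in> vars_in W" "q \<in> I" for p q
        using that I(3) vars_in_mono[OF W(3)] by blast
    next
      fix \<alpha>' assume "\<alpha>' \<in> ?L"
      then obtain \<alpha> where \<alpha>: "\<alpha> \<in> L" "\<alpha>' = (\<lambda>u. \<alpha> u - \<alpha> v0 / \<mu> v0 * \<mu> u)" by blast
      have "lin_form W \<alpha>' = lin_form V \<alpha> + Const (- (\<alpha> v0 / \<mu> v0)) * lin_form V \<mu>"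
        using \<mu>(3) by (simp add: split distrib_left flip: mult.assoc Const_mult)
          (simp add: \<alpha>(2) lin_form_def sum_distrib_left sum_subtractf Const_diff Const_uminus algebra_simps sum_negf flip: Const_mult)
      then show "lin_form W \<alpha>' \<in> I"
        using I less.prems(5) \<alpha>(1) \<mu>(1) by simp
    next
      show "substitute \<sigma> h \<in> vars_in W" by (rule subW)
    next
      fix w :: "'a \<Rightarrow> complex"
      assume w: "\<forall>v. v \<notin> W \<longrightarrow> w v = 0" "\<forall>\<alpha>\<in>?L. (\<Sum>v\<in>W. \<alpha> v * w v) = 0"
      define w' where "w' v = (if v = v0 then - (\<Sum>u\<in>W. \<mu> u * w u) / \<mu> v0 else w v)" for v
      have w'W: "(\<Sum>u\<in>W. \<alpha> u * w' u) = (\<Sum>u\<in>W. \<alpha> u * w u)" for \<alpha>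
        using W(5) by (intro sum.cong) (auto simp: w'_def)
      have "eval_at w' h = 0"
      proof (rule less.prems(7))
        show "\<forall>v. v \<notin> V \<longrightarrow> w' v = 0"
          using w(1) W by (auto simp: w'_def)
        show "\<forall>\<alpha>\<in>L. (\<Sum>v\<in>V. \<alpha> v * w' v) = 0"
        proof
          fix \<alpha> assume "\<alpha> \<in> L"
          then have "(\<Sum>v\<in>W. (\<alpha> v - \<alpha> v0 / \<mu> v0 * \<mu> v) * w v) = 0"
            using w(2) by auto
          then have *: "(\<Sum>v\<in>W. \<alpha> v * w v) = \<alpha> v0 / \<mu> v0 * (\<Sum>v\<in>W. \<mu> v * w v)"
            by (simp add: algebra_simps sum_subtractf sum_distrib_left)
          have "(\<Sum>v\<in>V. \<alpha> v * w' v) = \<alpha> v0 * w' v0 + (\<Sum>v\<in>W. \<alpha> v * w v)"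
            using W w'W by simp
          then show "(\<Sum>v\<in>V. \<alpha> v * w' v) = 0"
            by (simp add: w'_def *)
        qed
      qed
      moreover have "eval_at w (substitute \<sigma> h) = eval_at w' h"
        unfolding eval_at_substitute
      proof (rule eval_at_cong[OF less.prems(6)])
        fix v assume "v \<in> V"
        show "eval_at w (\<sigma> v) = w' v"
          by (auto simp: \<sigma>_def w'_def sum_negf sum_divide_distrib)
      qed
      ultimately show "eval_at w (substitute \<sigma> h) = 0" by simp
    qed
    moreover have "h = (h - substitute \<sigma> h) + substitute \<sigma> h" by simp
    ultimately show ?thesis using sub I(2) by metis
  qed
qed

lemma mon_eval_scale: "mon_eval (\<lambda>v. s * y v) m = s ^ mon_degree m * mon_eval y m"
  by (simp add: mon_eval_def mon_degree_def power_mult_distrib prod.distrib power_sum)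

lemma eval_at_eq_sum: "eval_at x p = (\<Sum>m\<in>keys p. lookup p m * mon_eval x m)"
  by (simp add: eval_at_def poly_eval_def mon_eval_def)

lemma eval_at_eq_sum_superset:
  "finite S \<Longrightarrow> keys p \<subseteq> S \<Longrightarrow> eval_at x p = (\<Sum>m\<in>S. lookup p m * mon_eval x m)"
  unfolding eval_at_eq_sum by (rule sum.mono_neutral_left) (auto simp: in_keys_iff)

text \<open>Divide h(s u(s)) by s^k and let s tend to 0: only the terms of degree \<open>k\<close>
  survive, evaluated at the limit direction.\<close>

lemma leading_form_vanishes:
  assumes h: "h \<in> min_degree k" and u: "\<And>v. ((\<lambda>s. u s v) \<longlongrightarrow> w v) (at (0::complex))"
    and z: "eventually (\<lambda>s. eval_at (\<lambda>v. s * u s v) h = 0) (at 0)"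
  shows "eval_at w (pfilter (\<lambda>m. mon_degree m = k) h) = 0"
proof -
  define F where "F s = (\<Sum>m\<in>keys h. lookup h m * (s ^ (mon_degree m - k) * mon_eval (u s) m))" for s
  have "(F \<longlongrightarrow> (\<Sum>m\<in>keys h. lookup h m * (0 ^ (mon_degree m - k) * mon_eval w m))) (at 0)"
    unfolding F_def mon_eval_def by (intro tendsto_intros u)
  also have "(\<Sum>m\<in>keys h. lookup h m * (0 ^ (mon_degree m - k) * mon_eval w m)) =
      (\<Sum>m\<in>keys h. lookup (pfilter (\<lambda>m. mon_degree m = k) h) m * mon_eval w m)"
    using h by (intro sum.cong refl) (auto simp: lookup_pfilter min_degree_def power_0_left)
  also have "\<dots> = eval_at w (pfilter (\<lambda>m. mon_degree m = k) h)"
    by (rule eval_at_eq_sum_superset[symmetric]) (auto simp: keys_pfilter)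
  finally have lim: "(F \<longlongrightarrow> eval_at w (pfilter (\<lambda>m. mon_degree m = k) h)) (at 0)" .
  have sF: "s ^ k * F s = eval_at (\<lambda>v. s * u s v) h" for s
    unfolding F_def eval_at_eq_sum mon_eval_scale sum_distrib_left
  proof (intro sum.cong refl)
    fix m assume "m \<in> keys h"
    then have "mon_degree m = k + (mon_degree m - k)"
      using h by (auto simp: min_degree_def)
    then have "s ^ mon_degree m = s ^ k * s ^ (mon_degree m - k)"
      by (metis power_add)
    then show "s ^ k * (lookup h m * (s ^ (mon_degree m - k) * mon_eval (u s) m)) =
        lookup h m * (s ^ mon_degree m * mon_eval (u s) m)"
      by simp
  qed
  have "eventually (\<lambda>s. s \<noteq> (0::complex)) (at 0)"
    by (rule eventually_neq_at_within)
  with z have "eventually (\<lambda>s. F s = 0) (at 0)"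
  proof eventually_elim
    case (elim s)
    then show ?case using sF[of s] by simp
  qed
  then have "(F \<longlongrightarrow> 0) (at 0)"
    by (rule tendsto_eventually)
  with lim show ?thesis
    using tendsto_unique[of "at (0::complex)"] by simp
qed

lemma lookup_pdiff: "lookup (pdiff v p) m = of_nat (Suc (lookup m v)) * lookup p (m + single v 1)"
proof -
  have mon: "lookup (pdiff v (single k a)) m = of_nat (Suc (lookup m v)) * lookup (single k a) (m + single v 1)" for k a
  proof (cases "lookup k v = 0")
    case True
    then have "k \<noteq> m + single v 1"
      by (metis add_is_0 lookup_add lookup_single_eq one_neq_zero)
    then show ?thesis
      using True by (simp add: pdiff_single lookup_single when_def)
  next
    case False
    then have "k - single v 1 = m \<longleftrightarrow> k = m + single v 1"
    proof -
      have "k = k - single v 1 + single v 1"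
        using False by (intro poly_mapping_eqI) (auto simp: lookup_add lookup_minus lookup_single when_def)
      then show ?thesis by (metis add_right_cancel)
    qed
    then show ?thesis
      by (auto simp: pdiff_single lookup_single when_def lookup_add)
  qed
  have "lookup (pdiff v (\<Sum>k\<in>keys p. single k (lookup p k))) m =
      of_nat (Suc (lookup m v)) * lookup (\<Sum>k\<in>keys p. single k (lookup p k)) (m + single v 1)"
    unfolding pdiff_sum lookup_sum mon sum_distrib_left ..
  then show ?thesis
    by (simp only: cpoly_as_sum[symmetric])
qed

lemma mon_degree_1_iff: "mon_degree m = 1 \<longleftrightarrow> (\<exists>v. m = single v 1)"
proof
  assume m: "mon_degree m = 1"
  then obtain v where v: "v \<in> keys m" "lookup m v = 1" "\<forall>w\<in>keys m. v \<noteq> w \<longrightarrow> lookup m w = 0"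
    unfolding mon_degree_def by (auto simp: sum_eq_Suc0_iff)
  then have "m = single v 1"
    by (intro poly_mapping_eqI) (auto simp: lookup_single when_def in_keys_iff)
  then show "\<exists>v. m = single v 1" ..
qed (auto simp: mon_degree_single)

lemma linear_part:
  assumes V: "finite V" and q: "q \<in> vars_in V"
  shows "pfilter (\<lambda>m. mon_degree m = 1) q = lin_form V (\<lambda>v. eval_at (\<lambda>_. 0) (pdiff v q))"
proof (rule poly_mapping_eqI)
  fix m
  have *: "lookup (lin_form V \<alpha>) m = (\<Sum>v\<in>V. if m = single v 1 then \<alpha> v else 0)" for \<alpha>
    unfolding lin_form_def lookup_sum
    by (intro sum.cong refl) (auto simp: Var_def lookup_single when_def)
  show "lookup (pfilter (\<lambda>m. mon_degree m = 1) q) m = lookup (lin_form V (\<lambda>v. eval_at (\<lambda>_. 0) (pdiff v q))) m"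
  proof (cases "mon_degree m = 1")
    case False
    then show ?thesis
      by (auto simp: * lookup_pfilter mon_degree_single intro!: sum.neutral)
  next
    case True
    then obtain v where v: "m = single v 1" unfolding mon_degree_1_iff by (rule exE)
    have "single v (1::nat) = single u 1 \<longleftrightarrow> v = u" for u
    proof
      assume "single v (1::nat) = single u 1"
      then have "lookup (single v (1::nat)) v = lookup (single u 1) v" by simp
      then show "v = u" by (auto simp: lookup_single when_def split: if_splits)
    qed simp
    then have "lookup (lin_form V \<alpha>) m = (if v \<in> V then \<alpha> v else 0)" for \<alpha>
      unfolding * unfolding v using V by simp
    moreover have "lookup q m = 0" if "v \<notin> V"
    proof (rule ccontr)
      assume "lookup q m \<noteq> 0"
      then have "keys m \<subseteq> V" using q by (auto simp: vars_in_def in_keys_iff)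
      then show False using v that by simp
    qed
    ultimately show ?thesis
      by (auto simp: lookup_pfilter True eval_at_zero lookup_pdiff v mon_degree_single simp del: One_nat_def)
  qed
qed

text \<open>\<open>Ob\<close> is the orbit and \<open>S\<close> the ambient set on which the
  equations \<open>E\<close> hold. The hypothesis \<open>tangent\<close> turns every solution of the
  linearised equations into the velocity of a curve in \<open>Ob\<close>, where \<open>u s\<close>
  is the difference quotient. The multiplier \<open>g\<close> expresses that \<open>f\<close>
  vanishes on \<open>S\<close> near \<open>p\<close> in the Zariski sense.\<close>

lemma local_vanishing:
  fixes S Ob :: "('v \<Rightarrow> complex) set" and E :: "'v cpoly set" and p :: "'v \<Rightarrow> complex"
  assumes V: "finite V"
    and supp: "\<And>x v. x \<in> S \<Longrightarrow> v \<notin> V \<Longrightarrow> x v = 0" and p: "p \<in> S" and Ob: "Ob \<subseteq> S"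
    and E: "\<And>e x. e \<in> E \<Longrightarrow> x \<in> S \<Longrightarrow> eval_at x e = 0"
    and tangent: "\<And>w. \<forall>v. v \<notin> V \<longrightarrow> w v = 0 \<Longrightarrow>
        \<forall>e\<in>E. (\<Sum>v\<in>V. eval_at p (pdiff v e) * w v) = 0 \<Longrightarrow>
        \<exists>u. (\<forall>v. ((\<lambda>s. u s v) \<longlongrightarrow> w v) (at (0::complex))) \<and>
            eventually (\<lambda>s. (\<lambda>v. p v + s * u s v) \<in> Ob) (at 0)"
    and f: "\<And>x. x \<in> Ob \<Longrightarrow> eval_at x f = 0"
  shows "\<exists>g. eval_at p g \<noteq> 0 \<and> (\<forall>x\<in>S. eval_at x (g * f) = 0)"
proof -
  \<comment> \<open>Translation of \<open>p\<close> to the origin; the variables outside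
    \<open>V\<close>, which vanish on \<open>S\<close>, are set to 0.\<close>
  define \<tau> where "\<tau> v = (if v \<in> V then Var v + Const (p v) else 0)" for v
  have \<tau>V: "substitute \<tau> q \<in> vars_in V" for q
  proof -
    have "q \<in> vars_in UNIV" by simp
    then show ?thesis
      by (induction rule: cpoly_induct)
        (auto simp: substitute_add substitute_mult vars_in_add vars_in_mult \<tau>_def vars_in_Var)
  qed
  have \<tau>_eval: "eval_at (\<lambda>v. x v - p v) (substitute \<tau> q) = eval_at x q" if "x \<in> S" for x q
  proof -
    have "(\<lambda>v. eval_at (\<lambda>v. x v - p v) (\<tau> v)) = x"
      using supp[OF that] by (auto simp: \<tau>_def eval_at_simps)
    then show ?thesis by (simp add: eval_at_substitute)
  qed
  have \<tau>_diff: "eval_at (\<lambda>_. 0) (pdiff v (substitute \<tau> q)) = eval_at p (pdiff v q)" if "v \<in> V" for v q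
  proof -
    have p0: "eval_at (\<lambda>_. 0) (substitute \<tau> q) = eval_at p q" for q
      using \<tau>_eval[OF p, of q] by simp
    have "q \<in> vars_in UNIV" by simp
    then show ?thesis
    proof (induction rule: cpoly_induct)
      case (Var w)
      show ?case using that by (auto simp: \<tau>_def pdiff_Var pdiff_add)
    qed (auto simp: substitute_add substitute_mult pdiff_add pdiff_mult eval_at_simps p0)
  qed
  define I0 where "I0 = {h \<in> vars_in V. \<forall>x\<in>S. eval_at (\<lambda>v. x v - p v) h = 0}"
  define J where "J = {h \<in> vars_in V. \<forall>x\<in>Ob. eval_at (\<lambda>v. x v - p v) h = 0}"
  have I0: "0 \<in> I0" "\<And>p q. p \<in> I0 \<Longrightarrow> q \<in> I0 \<Longrightarrow> p + q \<in> I0"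
    "\<And>p q. p \<in> vars_in V \<Longrightarrow> q \<in> I0 \<Longrightarrow> p * q \<in> I0" "I0 \<subseteq> vars_in V"
    by (auto simp: I0_def vars_in_add vars_in_mult eval_at_simps)
  have J_diff: "h - e \<in> J" if "h \<in> J" "e \<in> I0" for h e
    using that Ob by (auto simp: J_def I0_def vars_in_diff eval_at_simps)
  have E_I0: "substitute \<tau> e \<in> I0" if "e \<in> E" for e
    using that by (auto simp: I0_def \<tau>V \<tau>_eval E)
  \<comment> \<open>The ideal generated by the initial forms at \<open>p\<close> of the functions vanishing on \<open>S\<close>.\<close>
  define I where "I = {q \<in> vars_in V. \<forall>j. \<exists>e\<in>I0 \<inter> min_degree j.
      pfilter (\<lambda>m. mon_degree m = j) q = pfilter (\<lambda>m. mon_degree m = j) e}"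
  have I_0: "0 \<in> I"
    unfolding I_def using I0(1) by (auto intro!: bexI[of _ 0])
  have I_add: "q + r \<in> I" if "q \<in> I" "r \<in> I" for q r
  proof -
    have "\<exists>e\<in>I0 \<inter> min_degree j. pfilter (\<lambda>m. mon_degree m = j) (q + r) = pfilter (\<lambda>m. mon_degree m = j) e" for j
    proof -
      obtain e1 e2 where "e1 \<in> I0 \<inter> min_degree j" "e2 \<in> I0 \<inter> min_degree j"
        "pfilter (\<lambda>m. mon_degree m = j) q = pfilter (\<lambda>m. mon_degree m = j) e1"
        "pfilter (\<lambda>m. mon_degree m = j) r = pfilter (\<lambda>m. mon_degree m = j) e2"
        using \<open>q \<in> I\<close> \<open>r \<in> I\<close> unfolding I_def by blast
      then show ?thesis
        using I0(2) by (intro bexI[of _ "e1 + e2"]) (auto simp: pfilter_add min_degree_add)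
    qed
    then show ?thesis
      using that unfolding I_def by (simp add: vars_in_add)
  qed
  have I_mult: "r * q \<in> I" if "r \<in> vars_in V" "q \<in> I" for r q
    using that
  proof (induction arbitrary: q rule: cpoly_induct)
    case (Const c)
    have "\<exists>e\<in>I0 \<inter> min_degree j. pfilter (\<lambda>m. mon_degree m = j) (Const c * q) = pfilter (\<lambda>m. mon_degree m = j) e" for j
    proof -
      obtain e where e: "e \<in> I0 \<inter> min_degree j"
        "pfilter (\<lambda>m. mon_degree m = j) q = pfilter (\<lambda>m. mon_degree m = j) e"
        using Const unfolding I_def by blast
      have "pfilter Q (Const c * r) = Const c * pfilter Q r" for Q and r :: "'v cpoly"
        by (rule poly_mapping_eqI) (simp add: lookup_pfilter)
      moreover have "Const c * e \<in> min_degree j"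
        using e(1) min_degree_mult[of "Const c" 0 e j] by simp
      ultimately show ?thesis
        using e I0(3)[of "Const c" e] by (intro bexI[of _ "Const c * e"]) auto
    qed
    then show ?case
      using Const unfolding I_def by (simp add: vars_in_mult)
  next
    case (Var v)
    have "\<exists>e\<in>I0 \<inter> min_degree j. pfilter (\<lambda>m. mon_degree m = j) (Var v * q) = pfilter (\<lambda>m. mon_degree m = j) e" for j
    proof (cases j)
      case 0
      have "pfilter (\<lambda>m. mon_degree m = 0) (q * Var v) = pfilter (\<lambda>_. False) q * Var v"
        by (rule pfilter_mult) (auto simp: Var_def mon_degree_add mon_degree_single)
      also have "\<dots> = 0" by (simp add: pfilter_eq_0)
      finally show ?thesis
        using I0(1) 0 by (intro bexI[of _ 0]) (auto simp: mult.commute)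
    next
      case (Suc i)
      obtain e where e: "e \<in> I0 \<inter> min_degree i"
        "pfilter (\<lambda>m. mon_degree m = i) q = pfilter (\<lambda>m. mon_degree m = i) e"
        using Var unfolding I_def by blast
      have *: "pfilter (\<lambda>m. mon_degree m = j) (Var v * r) = Var v * pfilter (\<lambda>m. mon_degree m = i) r" for r
        by (subst (1 2) mult.commute, rule pfilter_mult) (auto simp: Var_def mon_degree_add mon_degree_single Suc)
      have "Var v \<in> min_degree 1"
        by (simp add: min_degree_def Var_def mon_degree_single)
      then have "Var v * e \<in> min_degree j"
        using e(1) min_degree_mult[of "Var v" 1 e i] Suc by simp
      then show ?thesis
        using e I0(3)[of "Var v" e] Var by (intro bexI[of _ "Var v * e"]) (auto simp: * vars_in_Var)
    qed
    then show ?case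
      using Var unfolding I_def by (simp add: vars_in_mult vars_in_Var)
  next
    case (add r s)
    then show ?case using I_add by (simp add: distrib_right)
  next
    case (mult r s)
    then show ?case by (simp add: mult.assoc)
  qed
  let ?L = "(\<lambda>e v. eval_at p (pdiff v e)) ` E"
  have L_I: "lin_form V \<alpha> \<in> I" if \<alpha>: "\<alpha> \<in> ?L" for \<alpha>
  proof -
    obtain e where e: "e \<in> E" "\<alpha> = (\<lambda>v. eval_at p (pdiff v e))" using \<alpha> by blast
    let ?e = "substitute \<tau> e"
    have lin: "lin_form V \<alpha> = pfilter (\<lambda>m. mon_degree m = 1) ?e"
      unfolding linear_part[OF V \<tau>V] lin_form_def by (intro sum.cong refl) (simp add: e \<tau>_diff)
    have "lookup ?e 0 = 0"
      using \<tau>_eval[OF p, of e] E[OF e(1) p] by (simp add: eval_at_zero)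
    moreover have "m = 0" if "mon_degree m = 0" for m :: "'v \<Rightarrow>\<^sub>0 nat"
      using that by (auto simp: mon_degree_def in_keys_iff intro!: poly_mapping_eqI)
    ultimately have m1: "?e \<in> min_degree 1"
      by (auto simp: min_degree_def Suc_le_eq in_keys_iff intro: gr0I)
    have "\<exists>e'\<in>I0 \<inter> min_degree j. pfilter (\<lambda>m. mon_degree m = j) (lin_form V \<alpha>) = pfilter (\<lambda>m. mon_degree m = j) e'" for j
    proof (cases "j = 1")
      case True
      then show ?thesis
        using m1 E_I0[OF e(1)] by (intro bexI[of _ ?e]) (auto simp: lin pfilter_idem)
    next
      case False
      then have "pfilter (\<lambda>m. mon_degree m = j) (lin_form V \<alpha>) = 0"
        unfolding lin by (intro pfilter_eq_0) (auto simp: keys_pfilter)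
      then show ?thesis using I0(1) by (intro bexI[of _ 0]) auto
    qed
    then show ?thesis
      by (simp add: I_def lin_form_vars_in)
  qed
  have step: "\<exists>e\<in>I0. h - e \<in> min_degree (Suc k)" if h: "h \<in> J" "h \<in> min_degree k" for h k
  proof -
    let ?h = "pfilter (\<lambda>m. mon_degree m = k) h"
    \<comment> \<open>The leading form vanishes on the linear space cut out by \<open>?L\<close>,
      hence lies in the ideal of these linear forms, which is part of \<open>I\<close>. It is
      therefore the leading form of some \<open>e\<close> in \<open>I0\<close>, and subtracting
      \<open>e\<close> raises the order of \<open>h\<close>.\<close>
    have "?h \<in> I"
    proof (rule linear_nullstellensatz[OF V I_0 I_add I_mult L_I])
      show "?h \<in> vars_in V"
        using h(1) by (auto simp: J_def vars_in_def keys_pfilter)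
      fix w assume w: "\<forall>v. v \<notin> V \<longrightarrow> w v = 0" "\<forall>\<alpha>\<in>?L. (\<Sum>v\<in>V. \<alpha> v * w v) = 0"
      then obtain u where u: "\<And>v. ((\<lambda>s. u s v) \<longlongrightarrow> w v) (at (0::complex))"
        "eventually (\<lambda>s. (\<lambda>v. p v + s * u s v) \<in> Ob) (at 0)"
        using tangent[OF w(1)] by auto
      have "eventually (\<lambda>s. eval_at (\<lambda>v. s * u s v) h = 0) (at 0)"
        using u(2)
      proof eventually_elim
        case (elim s)
        have "\<forall>x\<in>Ob. eval_at (\<lambda>v. x v - p v) h = 0"
          using h(1) by (simp add: J_def)
        from bspec[OF this elim] show ?case by simp
      qed
      then show "eval_at w ?h = 0"
        by (rule leading_form_vanishes[OF h(2) u(1)])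
    qed
    then obtain e where e: "e \<in> I0" "e \<in> min_degree k"
      "pfilter (\<lambda>m. mon_degree m = k) ?h = pfilter (\<lambda>m. mon_degree m = k) e"
      unfolding I_def by blast
    have "pfilter (\<lambda>m. mon_degree m = k) (h - e) = 0"
      using e(3) by (simp add: pfilter_diff pfilter_idem)
    then have "mon_degree m \<noteq> k" if "m \<in> keys (h - e)" for m
    proof -
      have "lookup (pfilter (\<lambda>m. mon_degree m = k) (h - e)) m = 0"
        using \<open>pfilter (\<lambda>m. mon_degree m = k) (h - e) = 0\<close> by simp
      then show ?thesis
        using that by (auto simp: lookup_pfilter in_keys_iff)
    qed
    moreover have "k \<le> mon_degree m" if "m \<in> keys (h - e)" for m
      using min_degree_diff[OF h(2) e(2)] that by (auto simp: min_degree_def)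
    ultimately have "h - e \<in> min_degree (Suc k)"
      by (auto simp: min_degree_def Suc_le_eq) (metis le_neq_implies_less)
    then show ?thesis using e(1) by blast
  qed
  have approx: "\<exists>e\<in>I0. h - e \<in> min_degree k" if hJ: "h \<in> J" for h k
  proof (induction k)
    case 0
    then show ?case using I0(1) by auto
  next
    case (Suc k)
    then obtain e where e: "e \<in> I0" "h - e \<in> min_degree k" by blast
    then obtain e' where "e' \<in> I0" "h - e - e' \<in> min_degree (Suc k)"
      using step[OF J_diff[OF hJ e(1)] e(2)] by blast
    then show ?case
      using I0(2)[OF e(1)] by (intro bexI[of _ "e + e'"]) (auto simp: algebra_simps)
  qed
  have fJ: "substitute \<tau> f \<in> J"
    using \<tau>_eval Ob f by (auto simp: J_def \<tau>V)
  obtain g where g: "g \<in> vars_in V" "eval_at (\<lambda>_. 0) g = 1" "g * substitute \<tau> f \<in> I0"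
    using krull_intersection[OF V I0 \<tau>V approx[OF fJ]] by blast
  let ?g = "substitute (\<lambda>v. Var v - Const (p v)) g"
  have g_eval: "eval_at x ?g = eval_at (\<lambda>v. x v - p v) g" for x
    by (simp add: eval_at_substitute eval_at_simps)
  have "eval_at x (?g * f) = 0" if "x \<in> S" for x
    using g(3) that by (auto simp: I0_def eval_at_mult g_eval \<tau>_eval)
  moreover have "eval_at p ?g \<noteq> 0"
    using g(2) by (simp add: g_eval)
  ultimately show ?thesis by blast
qed

section \<open>Homogeneous linear fields, contractions, and reduction modulo variables\<close>

section \<open>Vector fields shifting the index of the coordinates\<close>

lemma sum_eq_single:
  assumes "finite A" "i \<in> A" "\<And>j. j \<in> A \<Longrightarrow> j \<noteq> i \<Longrightarrow> f j = (0::'a::comm_monoid_add)"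
  shows "sum f A = f i"
proof -
  have "sum f A = f i + sum f (A - {i})"
    using assms(1,2) by (simp add: sum.remove)
  also have "sum f (A - {i}) = 0"
    using assms(3) by (intro sum.neutral) auto
  finally show ?thesis by simp
qed

lemma sum_eq_two:
  assumes "finite A" "i \<in> A" "j \<in> A" "i \<noteq> j" "\<And>k. k \<in> A \<Longrightarrow> k \<noteq> i \<Longrightarrow> k \<noteq> j \<Longrightarrow> f k = (0::'a::comm_monoid_add)"
  shows "sum f A = f i + f j"
proof -
  have "sum f A = f i + sum f (A - {i})"
    using assms(1,2) by (simp add: sum.remove)
  also have "sum f (A - {i}) = f j"
    using assms by (intro sum_eq_single) auto
  finally show ?thesis .
qed

lemma cpoly_eq_uminus_iff: "p = - p \<longleftrightarrow> p = 0" for p :: "'v cpoly"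
proof
  assume p: "p = - p"
  show "p = 0"
  proof (rule poly_mapping_eqI)
    fix m
    have "lookup p m = - lookup p m"
      using p by (metis lookup_uminus)
    then show "lookup p m = lookup 0 m" by simp
  qed
qed simp

text \<open>These are the weight spaces of linear fields under a diagonal field with equidistant
  eigenvalues; \<open>k = 0\<close> gives the diagonal fields, and brackets add the shifts.\<close>

definition shift_field :: "nat \<Rightarrow> nat \<Rightarrow> (nat \<Rightarrow> complex) \<Rightarrow> vfield" where
  "shift_field n k c = (\<lambda>i. if i + k \<le> n then Const (c i) * Var (i + k) else 0)"

text \<open>One-forms are families of components and two-forms antisymmetric matrices; the
  contraction of a two-form \<open>B\<close> is \<open>pairing n v (\<lambda>i. B i l)\<close> as a
  family in \<open>l\<close>.\<close>

definition pairing :: "nat \<Rightarrow> vfield \<Rightarrow> (nat \<Rightarrow> nat cpoly) \<Rightarrow> nat cpoly" where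
  "pairing n v \<gamma> = (\<Sum>i\<le>n. v i * \<gamma> i)"

lemma pairing_cong: "(\<And>i. i \<le> n \<Longrightarrow> v i = w i) \<Longrightarrow> (\<And>i. i \<le> n \<Longrightarrow> \<gamma> i = \<delta> i) \<Longrightarrow> pairing n v \<gamma> = pairing n w \<delta>"
  unfolding pairing_def by (intro sum.cong) auto

lemma pairing_add: "pairing n (\<lambda>i. v i + w i) \<gamma> = pairing n v \<gamma> + pairing n w \<gamma>"
  by (simp add: pairing_def distrib_right sum.distrib)

lemma pairing_diff: "pairing n (\<lambda>i. v i - w i) \<gamma> = pairing n v \<gamma> - pairing n w \<gamma>"
  by (simp add: pairing_def left_diff_distrib sum_subtractf)

lemma pairing_mult: "pairing n (\<lambda>i. p * v i) \<gamma> = p * pairing n v \<gamma>"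
  by (simp add: pairing_def sum_distrib_left mult.assoc)

lemma pairing_sum: "pairing n (\<lambda>i. \<Sum>k\<in>K. v k i) \<gamma> = (\<Sum>k\<in>K. pairing n (v k) \<gamma>)"
  unfolding pairing_def by (subst sum.swap) (simp add: sum_distrib_right)

lemma pairing_diff_right: "pairing n v (\<lambda>i. \<gamma> i - \<delta> i) = pairing n v \<gamma> - pairing n v \<delta>"
  by (simp add: pairing_def right_diff_distrib sum_subtractf)

lemma pairing_mult_right: "pairing n v (\<lambda>i. p * \<gamma> i) = p * pairing n v \<gamma>"
  by (simp add: pairing_def sum_distrib_left mult.left_commute)

lemma pairing_0 [simp]: "pairing n v (\<lambda>_. 0) = 0" "pairing n (\<lambda>_. 0) \<gamma> = 0"
  by (simp_all add: pairing_def)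

lemma pairing_swap:
  assumes "\<And>i j. B i j = - B j i"
  shows "pairing n v (\<lambda>l. pairing n w (\<lambda>i. B i l)) = - pairing n w (\<lambda>i. pairing n v (\<lambda>l. B l i))"
proof -
  have "pairing n v (\<lambda>l. pairing n w (\<lambda>i. B i l)) = (\<Sum>l\<le>n. \<Sum>i\<le>n. v l * (w i * B i l))"
    by (simp add: pairing_def sum_distrib_left)
  also have "\<dots> = (\<Sum>i\<le>n. \<Sum>l\<le>n. v l * (w i * B i l))"
    by (rule sum.swap)
  also have "\<dots> = (\<Sum>i\<le>n. \<Sum>l\<le>n. - (w i * (v l * B l i)))"
  proof (intro sum.cong refl)
    fix i l
    show "v l * (w i * B i l) = - (w i * (v l * B l i))"
      by (subst assms) (simp add: mult.left_commute)
  qed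
  finally show ?thesis
    by (simp add: pairing_def sum_distrib_left sum_negf)
qed

subsection \<open>Reduction modulo some of the variables\<close>

definition kill :: "'v set \<Rightarrow> 'v cpoly \<Rightarrow> 'v cpoly" where
  "kill S = pfilter (\<lambda>m. keys m \<inter> S = {})"

lemma kill_0 [simp]: "kill S 0 = 0"
  and kill_add: "kill S (p + q) = kill S p + kill S q"
  and kill_uminus: "kill S (- p) = - kill S p"
  and kill_diff: "kill S (p - q) = kill S p - kill S q"
  and kill_sum: "kill S (sum f A) = (\<Sum>a\<in>A. kill S (f a))"
  by (simp_all add: kill_def pfilter_add pfilter_diff pfilter_uminus pfilter_sum)

lemma kill_Const [simp]: "kill S (Const c) = Const c"
  unfolding kill_def by (rule pfilter_id) (auto simp: Const_def split: if_splits)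

lemma kill_Var: "kill S (Var v) = (if v \<in> S then 0 else Var v)"
  by (simp add: kill_def Var_def pfilter_single)

lemma keys_add_nat: "keys (m + m') = keys m \<union> keys m'" for m m' :: "'v \<Rightarrow>\<^sub>0 nat"
  by (auto simp: in_keys_iff lookup_add)

lemma kill_mult: "kill S (p * q) = kill S p * kill S q"
proof -
  have s: "kill S (single m a * single m' b) = kill S (single m a) * kill S (single m' b)"
    for m m' :: "'a \<Rightarrow>\<^sub>0 nat" and a b
    by (auto simp: kill_def mult_single pfilter_single keys_add_nat)
  have "kill S ((\<Sum>m\<in>keys p. single m (lookup p m)) * (\<Sum>m\<in>keys q. single m (lookup q m))) =
      kill S (\<Sum>m\<in>keys p. single m (lookup p m)) * kill S (\<Sum>m\<in>keys q. single m (lookup q m))"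
    by (simp add: sum_product kill_sum s)
  then show ?thesis
    by (simp only: cpoly_as_sum[symmetric])
qed

lemma kill_power: "kill S (p ^ k) = kill S p ^ k"
  using kill_Const[of S 1] by (induction k) (auto simp: kill_mult Const_1)

lemma kill_eq_0_dvd:
  assumes "kill {a} p = 0"
  shows "\<exists>q. p = Var a * q"
proof
  let ?q = "\<Sum>m\<in>keys p. single (m - single a 1) (lookup p m)"
  have "Var a * single (m - single a 1) (lookup p m) = single m (lookup p m)" if m: "m \<in> keys p" for m
  proof -
    have "lookup (kill {a} p) m = 0" using assms by simp
    then have "a \<in> keys m"
      using m by (auto simp: kill_def lookup_pfilter in_keys_iff split: if_splits)
    then have "single a 1 + (m - single a 1) = m"
      by (intro poly_mapping_eqI) (auto simp: lookup_add lookup_minus lookup_single when_def in_keys_iff)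
    then show ?thesis by (simp add: Var_def mult_single)
  qed
  then have "Var a * ?q = (\<Sum>m\<in>keys p. single m (lookup p m))"
    by (simp add: sum_distrib_left)
  then show "p = Var a * ?q"
    by (simp only: cpoly_as_sum[symmetric])
qed

lemma kill_mono:
  assumes "kill S p = 0" "S \<subseteq> T"
  shows "kill T p = 0"
proof (rule poly_mapping_eqI)
  fix m
  have "lookup (kill S p) m = 0" using assms(1) by simp
  with assms(2) show "lookup (kill T p) m = lookup 0 m"
    by (auto simp: kill_def lookup_pfilter split: if_splits)
qed

lemma kill_two_eq_0:
  assumes "kill {a, b} p = 0"
  shows "\<exists>q r. p = Var a * q + Var b * r"
proof -
  have "kill {a} (p - kill {a} p) = 0"
    by (simp add: kill_def pfilter_diff pfilter_idem)
  from kill_eq_0_dvd[OF this] obtain q where q: "p - kill {a} p = Var a * q" ..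
  have "kill {b} (kill {a} p) = kill {a, b} p"
    by (rule poly_mapping_eqI) (auto simp: kill_def lookup_pfilter)
  with assms have "kill {b} (kill {a} p) = 0" by simp
  from kill_eq_0_dvd[OF this] obtain r where "kill {a} p = Var b * r" ..
  with q have "p = Var a * q + Var b * r"
    by (metis add.commute diff_add_cancel)
  then show ?thesis by blast
qed

lemma Var_neq_0 [simp]: "Var v \<noteq> 0"
proof
  assume "Var v = 0"
  then have "eval_at (\<lambda>_. 1) (Var v) = eval_at (\<lambda>_. 1) 0" by simp
  then show False by simp
qed

section \<open>Elimination with triangular families of fields, in place of a depth argument\<close>

section \<open>Division by a form with prescribed kernel\<close>

text \<open>The three antidiagonals supply pivots for three eliminations: \<open>i + k = n\<close>
  where z_n is inverted, \<open>i + k = n - 1\<close> modulo z_n, and \<open>i + k = n - 2\<close>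
  modulo z_(n-1) and z_n.\<close>

locale shift_family =
  fixes n :: nat and \<beta> :: "nat \<Rightarrow> nat \<Rightarrow> complex"
  assumes n_ge: "3 \<le> n"
    and \<beta>_nz: "k < n - 1 \<Longrightarrow> n - 2 \<le> i + k \<Longrightarrow> i + k \<le> n \<Longrightarrow> \<beta> k i \<noteq> 0"
begin

abbreviation X :: "nat \<Rightarrow> vfield" where "X k \<equiv> shift_field n k (\<beta> k)"

text \<open>The field with shift \<open>n - i\<close> has the entry \<beta> z_n in row
  \<open>i\<close> and nothing in later rows, so it expresses component \<open>i\<close> by earlier
  ones. Only the components 0 and 1 are free.\<close>

lemma covector_eq_0:
  assumes "\<And>k. k < n - 1 \<Longrightarrow> pairing n (X k) \<gamma> = 0" and "\<gamma> 0 = 0" "\<gamma> 1 = 0"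
  shows "i \<le> n \<Longrightarrow> \<gamma> i = 0"
proof (induction i rule: less_induct)
  case (less i)
  show ?case
  proof (cases "i < 2")
    case True
    then have "i = 0 \<or> i = 1" by linarith
    then show ?thesis using assms(2,3) by auto
  next
    case False
    let ?k = "n - i"
    have k: "?k < n - 1" "i + ?k = n" using False less.prems n_ge by auto
    have "pairing n (X ?k) \<gamma> = X ?k i * \<gamma> i"
      unfolding pairing_def
    proof (rule sum_eq_single)
      fix j assume j: "j \<in> {..n}" "j \<noteq> i"
      show "X ?k j * \<gamma> j = 0"
        using j less k(2) by (cases "j < i") (auto simp: shift_field_def)
    qed (use less.prems in auto)
    then have "Const (\<beta> ?k i) * Var n * \<gamma> i = 0"
      using assms(1)[OF k(1)] by (simp add: shift_field_def k(2))
    then show ?thesis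
      using \<beta>_nz[of ?k i] k by simp
  qed
qed

text \<open>Reduces an identity of two-forms with the prescribed kernel to the single coefficient of
  dz_0 dz_1.\<close>

lemma tensor_eq_0:
  assumes anti: "\<And>i j. B i j = - B j i"
    and ker: "\<And>k l. k < n - 1 \<Longrightarrow> l \<le> n \<Longrightarrow> pairing n (X k) (\<lambda>i. B i l) = 0"
    and B01: "B 0 1 = 0" and ij: "i \<le> n" "j \<le> n"
  shows "B i j = 0"
proof -
  have d: "B i i = 0" for i
    using anti[of i i] cpoly_eq_uminus_iff by blast
  have B10: "B 1 0 = 0" using anti[of 1 0] B01 by simp
  have 0: "B i 0 = 0" if "i \<le> n" for i
    by (rule covector_eq_0[of "\<lambda>i. B i 0"]) (use ker[of _ 0] d B10 that in auto)
  have 1: "B i 1 = 0" if "i \<le> n" for i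
    by (rule covector_eq_0[of "\<lambda>i. B i 1"]) (use ker[of _ 1] n_ge d B01 that in auto)
  show ?thesis
    by (rule covector_eq_0[of "\<lambda>i. B i j"]) (use ker[of _ j] 0[OF ij(2)] 1[OF ij(2)] anti[of _ j] ij in auto)
qed

end

text \<open>The two coefficients give the nonvanishing that division needs:
  \<open>\<Omega> 0 1\<close> away from z_n = 0, and \<open>\<Omega> 0 n\<close> on that
  hyperplane.\<close>

locale kernel_form = shift_family +
  fixes \<Omega> :: "nat \<Rightarrow> nat \<Rightarrow> nat cpoly" and c c' :: complex
  assumes \<Omega>_anti: "\<Omega> i j = - \<Omega> j i"
    and \<Omega>_hom: "i \<le> n \<Longrightarrow> j \<le> n \<Longrightarrow> \<Omega> i j \<in> hom_polys n (n - 1)"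
    and \<Omega>_ker: "k < n - 1 \<Longrightarrow> l \<le> n \<Longrightarrow> pairing n (X k) (\<lambda>i. \<Omega> i l) = 0"
    and \<Omega>_01: "\<Omega> 0 1 = Const c * Var n ^ (n - 1)" and c_nz: "c \<noteq> 0"
    and \<Omega>_0n: "kill {n} (\<Omega> 0 n) = Const c' * Var (n - 1) ^ (n - 1)" and c'_nz: "c' \<noteq> 0"
begin

lemma \<Omega>_diag [simp]: "\<Omega> i i = 0"
  using \<Omega>_anti[of i i] cpoly_eq_uminus_iff by blast

abbreviation contract :: "vfield \<Rightarrow> nat \<Rightarrow> nat cpoly" where
  "contract v l \<equiv> pairing n v (\<lambda>i. \<Omega> i l)"

lemma contract_X_sum:
  assumes "l \<le> n"
  shows "contract (\<lambda>i. \<Sum>k<n - 1. a k * X k i) l = 0"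
  using \<Omega>_ker[OF _ assms] by (simp add: pairing_sum pairing_mult)

text \<open>Gaussian elimination modulo z_n with z_(n-1) as denominator. Modulo z_n the field
  \<open>X j\<close> has the pivot \<beta> z_(n-1) in row \<open>n - 1 - j\<close> and nothing in
  later rows, so rows already cleared stay cleared.\<close>

lemma eliminate_columns:
  assumes "j \<le> n - 1"
  shows "\<exists>a w. (\<forall>i\<le>n. Var (n - 1) ^ j * v i = (\<Sum>k<j. a k * X k i) + w i) \<and>
    (\<forall>i. n - j \<le> i \<and> i \<le> n - 1 \<longrightarrow> kill {n} (w i) = 0)"
  using assms
proof (induction j)
  case 0
  show ?case using n_ge by (intro exI[of _ "\<lambda>_. 0"] exI[of _ v]) auto
next
  case (Suc j)
  then obtain a w where aw: "\<And>i. i \<le> n \<Longrightarrow> Var (n - 1) ^ j * v i = (\<Sum>k<j. a k * X k i) + w i"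
    "\<And>i. n - j \<le> i \<Longrightarrow> i \<le> n - 1 \<Longrightarrow> kill {n} (w i) = 0" by auto
  define col where "col = n - 1 - j"
  have col: "col + j = n - 1" "col \<le> n" using Suc.prems by (auto simp: col_def)
  have nz: "\<beta> j col \<noteq> 0" using \<beta>_nz[of j col] Suc.prems col n_ge by auto
  define b where "b = Const (1 / \<beta> j col) * w col"
  define a' where "a' k = (if k = j then b else Var (n - 1) * a k)" for k
  define w' where "w' i = Var (n - 1) * w i - b * X j i" for i
  have "Var (n - 1) ^ Suc j * v i = (\<Sum>k<Suc j. a' k * X k i) + w' i" if "i \<le> n" for i
  proof -
    have "Var (n - 1) ^ Suc j * v i = Var (n - 1) * ((\<Sum>k<j. a k * X k i) + w i)"
      by (simp add: mult.assoc flip: aw(1)[OF that])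
    moreover have "(\<Sum>k<j. a' k * X k i) = Var (n - 1) * (\<Sum>k<j. a k * X k i)"
      by (simp add: a'_def sum_distrib_left mult.assoc)
    ultimately show ?thesis
      by (simp add: w'_def a'_def distrib_left)
  qed
  moreover have "kill {n} (w' i) = 0" if i: "n - Suc j \<le> i" "i \<le> n - 1" for i
  proof (cases "i = col")
    case True
    have "Const (1 / \<beta> j col) * Const (\<beta> j col) = (1 :: nat cpoly)"
      using nz by (simp add: Const_1 flip: Const_mult)
    then have "b * X j col = Var (n - 1) * w col"
      using col by (simp add: b_def shift_field_def mult_ac)
    then show ?thesis by (simp add: w'_def True)
  next
    case False
    then have "n - j \<le> i" using i by (auto simp: col_def)
    then show ?thesis
      using aw(2)[of i] i by (auto simp: w'_def kill_diff kill_mult kill_Var shift_field_def)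
  qed
  ultimately show ?case by blast
qed

text \<open>Removes the denominator z_(n-1)^m one factor at a time: modulo z_(n-1) and z_n the
  fields still have the triangular pivots \<beta> z_(n-2) in row \<open>n - 2 - k\<close>, so every
  coefficient \<open>a k\<close> lies in the ideal of these two variables.\<close>

lemma kill_combination:
  assumes "\<And>i. i \<le> n \<Longrightarrow> kill {n} (Var (n - 1) ^ m * v i - (\<Sum>k<n - 1. a k * X k i)) = 0"
  shows "\<exists>a. \<forall>i\<le>n. kill {n} (v i - (\<Sum>k<n - 1. a k * X k i)) = 0"
  using assms
proof (induction m arbitrary: a)
  case 0
  then show ?case by auto
next
  case (Suc m)
  let ?K = "kill {n - 1, n}"
  have K: "?K (\<Sum>k<n - 1. a k * X k i) = 0" if "i \<le> n" for i
    using kill_mono[OF Suc.prems[OF that], of "{n - 1, n}"]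
    by (simp add: kill_diff kill_mult kill_Var)
  have "?K (a k) = 0" if "k < n - 1" for k
    using that
  proof (induction k rule: less_induct)
    case (less k)
    let ?i = "n - 2 - k"
    have i: "?i + k = n - 2" "?i \<le> n" using less.prems by auto
    have "0 = (\<Sum>k'<n - 1. ?K (a k') * ?K (X k' ?i))"
      using K[OF i(2)] by (simp add: kill_sum kill_mult)
    also have "\<dots> = ?K (a k) * ?K (X k ?i)"
    proof (rule sum_eq_single)
      fix k' assume k': "k' \<in> {..<n - 1}" "k' \<noteq> k"
      show "?K (a k') * ?K (X k' ?i) = 0"
      proof (cases "k' < k")
        case True
        then show ?thesis using less k' by simp
      next
        case False
        then have "?i + k' = n - 1 \<or> ?i + k' = n \<or> ?i + k' > n" using k' i by linarith
        then have "?K (X k' ?i) = 0" by (auto simp: shift_field_def kill_mult kill_Var)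
        then show ?thesis by simp
      qed
    qed (use less.prems in auto)
    also have "?K (X k ?i) = Const (\<beta> k ?i) * Var (n - 2)"
      using i n_ge by (auto simp: shift_field_def kill_mult kill_Var)
    finally show ?case
      using \<beta>_nz[of k ?i] i less.prems by simp
  qed
  then have "\<forall>k. \<exists>q r. k < n - 1 \<longrightarrow> a k = Var (n - 1) * q + Var n * r"
    by (metis kill_two_eq_0)
  then obtain q r where qr: "\<And>k. k < n - 1 \<Longrightarrow> a k = Var (n - 1) * q k + Var n * r k" by metis
  have "kill {n} (Var (n - 1) ^ m * v i - (\<Sum>k<n - 1. q k * X k i)) = 0" if "i \<le> n" for i
  proof -
    have ne: "n - 1 \<noteq> n" using n_ge by linarith
    have *: "kill {n} (a k) = Var (n - 1) * kill {n} (q k)" if "k < n - 1" for k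
      using that by (simp add: qr kill_add kill_mult kill_Var)
    have "0 = kill {n} (Var (n - 1) ^ Suc m * v i - (\<Sum>k<n - 1. a k * X k i))"
      using Suc.prems that by simp
    also have "\<dots> = Var (n - 1) * kill {n} (Var (n - 1) ^ m * v i - (\<Sum>k<n - 1. q k * X k i))"
      using ne by (simp add: kill_diff kill_mult kill_sum kill_power kill_Var * right_diff_distrib sum_distrib_left mult_ac)
    finally show ?thesis by simp
  qed
  then show ?case by (rule Suc.IH)
qed

text \<open>Modulo z_n the kernel of contraction with \<Omega> is still spanned by the fields: no
  new elements appear on the hyperplane, which is what makes division by z_n possible.\<close>

lemma contract_mod_last:
  assumes "\<And>l. l \<le> n \<Longrightarrow> kill {n} (contract v l) = 0"
  shows "\<exists>a u. \<forall>i\<le>n. v i = (\<Sum>k<n - 1. a k * X k i) + Var n * u i"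
proof -
  obtain a w where aw: "\<And>i. i \<le> n \<Longrightarrow> Var (n - 1) ^ (n - 1) * v i = (\<Sum>k<n - 1. a k * X k i) + w i"
    "\<And>i. n - (n - 1) \<le> i \<Longrightarrow> i \<le> n - 1 \<Longrightarrow> kill {n} (w i) = 0"
    using eliminate_columns[of "n - 1" v] by auto
  have w: "kill {n} (contract w l) = 0" if "l \<le> n" for l
  proof -
    have "Var (n - 1) ^ (n - 1) * contract v l = contract (\<lambda>i. Var (n - 1) ^ (n - 1) * v i) l"
      by (simp add: pairing_mult)
    also have "\<dots> = contract (\<lambda>i. (\<Sum>k<n - 1. a k * X k i) + w i) l"
      by (intro pairing_cong aw(1)) auto
    also have "\<dots> = contract w l"
      using that by (simp add: pairing_add contract_X_sum del: One_nat_def)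
    finally have "kill {n} (contract w l) = kill {n} (Var (n - 1) ^ (n - 1) * contract v l)" by simp
    then show ?thesis using assms[OF that] by (simp add: kill_mult)
  qed
  \<comment> \<open>After elimination only rows 0 and n of \<open>w\<close> survive modulo z_n.
    Testing with \<open>l = n\<close> and \<open>l = 0\<close> isolates each of them against the
    nonzero coefficient \<open>\<Omega> 0 n\<close>.\<close>
  have w2: "kill {n} (contract w l) = kill {n} (w 0) * kill {n} (\<Omega> 0 l) + kill {n} (w n) * kill {n} (\<Omega> n l)" for l
    unfolding pairing_def kill_sum kill_mult
  proof (rule sum_eq_two)
    fix i assume i: "i \<in> {..n}" "i \<noteq> 0" "i \<noteq> n"
    then have "n - (n - 1) \<le> i" "i \<le> n - 1" using n_ge by auto
    then show "kill {n} (w i) * kill {n} (\<Omega> i l) = 0" using aw(2) by simp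
  qed (use n_ge in auto)
  have pw: "Var (n - 1) ^ (n - 1) \<noteq> (0 :: nat cpoly)" by simp
  have "kill {n} (w 0) * (Const c' * Var (n - 1) ^ (n - 1)) = 0"
    using w2[of n] w[of n] by (simp add: \<Omega>_0n)
  then have w0: "kill {n} (w 0) = 0" using c'_nz pw by simp
  have "kill {n} (\<Omega> n 0) = - (Const c' * Var (n - 1) ^ (n - 1))"
    using \<Omega>_anti[of n 0] \<Omega>_0n by (simp add: kill_uminus del: One_nat_def)
  then have "kill {n} (w n) * (Const c' * Var (n - 1) ^ (n - 1)) = 0"
    using w2[of 0] w[of 0] by simp
  then have wn: "kill {n} (w n) = 0" using c'_nz pw by simp
  have "kill {n} (w i) = 0" if "i \<le> n" for i
  proof (cases "i = 0 \<or> i = n")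
    case False
    then show ?thesis using that aw(2)[of i] n_ge by auto
  qed (use w0 wn in auto)
  then have "kill {n} (Var (n - 1) ^ (n - 1) * v i - (\<Sum>k<n - 1. a k * X k i)) = 0" if "i \<le> n" for i
    using that aw(1)[OF that] by simp
  then obtain a' where a': "\<forall>i\<le>n. kill {n} (v i - (\<Sum>k<n - 1. a' k * X k i)) = 0"
    using kill_combination[of "n - 1" v a] by auto
  have "\<exists>u. v i = (\<Sum>k<n - 1. a' k * X k i) + Var n * u" if "i \<le> n" for i
  proof -
    have "kill {n} (v i - (\<Sum>k<n - 1. a' k * X k i)) = 0" using a' that by blast
    from kill_eq_0_dvd[OF this] obtain u where "v i - (\<Sum>k<n - 1. a' k * X k i) = Var n * u" ..
    then have "v i = (\<Sum>k<n - 1. a' k * X k i) + Var n * u"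
      by (simp only: diff_eq_eq add.commute)
    then show ?thesis ..
  qed
  then obtain u where "\<And>i. i \<le> n \<Longrightarrow> v i = (\<Sum>k<n - 1. a' k * X k i) + Var n * u i"
    by metis
  then show ?thesis by (intro exI allI impI)
qed

lemma contract_combination:
  assumes "\<And>i. i \<le> n \<Longrightarrow> v i = (\<Sum>k<n - 1. a k * X k i) + Var n * u i" and "l \<le> n"
  shows "contract v l = Var n * contract u l"
proof -
  have "contract v l = contract (\<lambda>i. (\<Sum>k<n - 1. a k * X k i) + Var n * u i) l"
    by (intro pairing_cong assms(1)) auto
  then show ?thesis
    using assms(2) by (simp add: pairing_add contract_X_sum pairing_mult del: One_nat_def)
qed

text \<open>If the contraction of \<open>v\<close> is divisible by z_n, then \<open>v\<close> is z_n
  times another field modulo the kernel; one factor z_n cancels per step.\<close>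

lemma divide_by_last:
  assumes "\<And>l. l \<le> n \<Longrightarrow> Var n ^ m * \<gamma> l = contract v l"
  shows "\<exists>v. \<forall>l\<le>n. \<gamma> l = contract v l"
  using assms
proof (induction m arbitrary: v)
  case 0
  then show ?case by auto
next
  case (Suc m)
  have kz: "kill {n} (contract v l) = 0" if "l \<le> n" for l
    using Suc.prems[OF that] by (simp add: kill_mult kill_Var flip: Suc.prems[OF that])
  obtain a u where au: "\<And>i. i \<le> n \<Longrightarrow> v i = (\<Sum>k<n - 1. a k * X k i) + Var n * u i"
    using contract_mod_last[of v] kz by auto
  have "Var n ^ m * \<gamma> l = contract u l" if "l \<le> n" for l
  proof -
    have "Var n * (Var n ^ m * \<gamma> l) = Var n * contract u l"
      using contract_combination[OF au that] Suc.prems[OF that] by (simp add: mult.assoc)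
    then show ?thesis by simp
  qed
  then show ?case by (rule Suc.IH)
qed

text \<open>Cramer's rule with the rows 0 and 1 solves the problem after multiplication by
  \<open>\<Omega> 0 1\<close>: the difference \<delta> has components 0 and 1 equal to 0 and is
  annihilated by all fields. As \<open>\<Omega> 0 1\<close> is a constant times a power of z_n,
  \<open>divide_by_last\<close> applies.\<close>

lemma division:
  assumes "\<And>k. k < n - 1 \<Longrightarrow> pairing n (X k) \<gamma> = 0"
  shows "\<exists>v. \<forall>l\<le>n. \<gamma> l = contract v l"
proof -
  define v where "v i = (if i = 0 then \<gamma> 1 else if i = 1 then - \<gamma> 0 else 0)" for i :: nat
  have v: "contract v l = \<gamma> 1 * \<Omega> 0 l - \<gamma> 0 * \<Omega> 1 l" for l
  proof -
    have "contract v l = v 0 * \<Omega> 0 l + v 1 * \<Omega> 1 l"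
      unfolding pairing_def by (rule sum_eq_two) (use n_ge in \<open>auto simp: v_def\<close>)
    then show ?thesis by (simp add: v_def)
  qed
  define \<delta> where "\<delta> l = \<Omega> 0 1 * \<gamma> l - contract v l" for l
  have \<delta>0: "\<delta> l = 0" if "l \<le> n" for l
  proof (rule covector_eq_0[of \<delta>])
    show "pairing n (X k) \<delta> = 0" if "k < n - 1" for k
    proof -
      have "pairing n (X k) (contract v) = - pairing n v (\<lambda>i. contract (X k) i)"
        by (rule pairing_swap) (rule \<Omega>_anti)
      also have "pairing n v (\<lambda>i. contract (X k) i) = pairing n v (\<lambda>_. 0)"
        by (intro pairing_cong \<Omega>_ker that) auto
      finally show ?thesis
        unfolding \<delta>_def using assms[OF that] by (simp add: pairing_diff_right pairing_mult_right)
    qed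
    show "\<delta> 0 = 0"
      using \<Omega>_anti[of 1 0] by (simp add: \<delta>_def v mult.commute)
    show "\<delta> 1 = 0"
      by (simp add: \<delta>_def v mult.commute)
  qed (rule that)
  have "Var n ^ (n - 1) * \<gamma> l = contract (\<lambda>i. Const (1 / c) * v i) l" if "l \<le> n" for l
  proof -
    have "Const (1 / c) * contract v l = (Const (1 / c) * Const c) * (Var n ^ (n - 1) * \<gamma> l)"
      using \<delta>0[OF that] by (simp add: \<delta>_def \<Omega>_01 mult.assoc del: One_nat_def)
    also have "Const (1 / c) * Const c = (1 :: nat cpoly)"
      using c_nz by (simp add: Const_1 flip: Const_mult)
    finally show ?thesis by (simp add: pairing_mult)
  qed
  then show ?thesis by (rule divide_by_last)
qed

text \<open>The entries of \<Omega> are homogeneous in degree and weight, so the quotient may be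
  replaced by its component of the matching degree and weight.\<close>

lemma division_filtered:
  assumes ker: "\<And>k. k < n - 1 \<Longrightarrow> pairing n (X k) \<gamma> = 0"
    and Q: "\<And>l m. l \<le> n \<Longrightarrow> m \<in> keys (\<gamma> l) \<Longrightarrow> Q l m"
    and QR: "\<And>i l m m'. i \<le> n \<Longrightarrow> l \<le> n \<Longrightarrow> m' \<in> keys (\<Omega> i l) \<Longrightarrow> Q l (m + m') \<longleftrightarrow> R i m"
  shows "\<exists>v. (\<forall>l\<le>n. \<gamma> l = contract v l) \<and> (\<forall>i. \<forall>m\<in>keys (v i). R i m)"
proof -
  obtain v where v: "\<And>l. l \<le> n \<Longrightarrow> \<gamma> l = contract v l"
    using division[of \<gamma>] ker by auto
  show ?thesis
  proof (intro exI conjI allI impI ballI)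
    fix l assume l: "l \<le> n"
    have "\<gamma> l = pfilter (Q l) (\<gamma> l)"
      using Q[OF l] by (simp add: pfilter_id)
    also have "\<dots> = contract (\<lambda>i. pfilter (R i) (v i)) l"
      unfolding v[OF l] pairing_def pfilter_sum
      by (intro sum.cong refl pfilter_mult) (use QR l in auto)
    finally show "\<gamma> l = contract (\<lambda>i. pfilter (R i) (v i)) l" .
  next
    fix i m assume "m \<in> keys (pfilter (R i) (v i))"
    then show "R i m" by (simp add: keys_pfilter)
  qed
qed

lemma kernel:
  assumes "\<And>l. l \<le> n \<Longrightarrow> contract v l = 0"
  shows "\<exists>a u. (\<forall>i\<le>n. v i = (\<Sum>k<n - 1. a k * X k i) + Var n * u i) \<and>
    (\<forall>l\<le>n. contract u l = 0)"
proof -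
  have kz: "kill {n} (contract v l) = 0" if "l \<le> n" for l
    using assms[OF that] by simp
  obtain a u where au: "\<And>i. i \<le> n \<Longrightarrow> v i = (\<Sum>k<n - 1. a k * X k i) + Var n * u i"
    using contract_mod_last[of v] kz by auto
  moreover have "contract u l = 0" if "l \<le> n" for l
    using contract_combination[OF au that] assms[OF that] by simp
  ultimately show ?thesis by blast
qed

lemma kernel_at_origin:
  assumes "\<And>l. l \<le> n \<Longrightarrow> contract v l = 0" and "i \<le> n"
  shows "eval_at (\<lambda>_. 0) (v i) = 0"
proof -
  obtain a u where "\<And>i. i \<le> n \<Longrightarrow> v i = (\<Sum>k<n - 1. a k * X k i) + Var n * u i"
    using kernel[of v] assms(1) by auto
  then show ?thesis
    using assms(2) by (simp add: eval_at_simps shift_field_def if_distrib[of "eval_at _"] cong: if_cong)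
qed

text \<open>Compare linear parts at the origin. The remainder z_n u contributes nothing, since
  \<open>u\<close> again lies in the kernel and so vanishes at the origin; what is left is a
  constant multiple of the field with the same shift.\<close>

lemma kernel_shift:
  assumes "\<And>l. l \<le> n \<Longrightarrow> contract (shift_field n s d) l = 0"
  shows "\<exists>\<alpha>. \<forall>i. i + s \<le> n \<longrightarrow> d i = (if s < n - 1 then \<alpha> * \<beta> s i else 0)"
proof -
  obtain a u where au: "\<And>i. i \<le> n \<Longrightarrow> shift_field n s d i = (\<Sum>k<n - 1. a k * X k i) + Var n * u i"
    and u: "\<And>l. l \<le> n \<Longrightarrow> contract u l = 0"
    using kernel[of "shift_field n s d"] assms by auto
  let ?e = "eval_at (\<lambda>_. 0)"
  have "d i = (if s < n - 1 then ?e (a s) * \<beta> s i else 0)" if i: "i + s \<le> n" for i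
  proof -
    have X0: "?e (X k i) = 0" for k
      by (cases "i + k \<le> n") (simp_all add: shift_field_def eval_at_mult)
    have pX: "?e (pdiff (i + s) (X k i)) = (if k = s then \<beta> s i else 0)" for k
    proof (cases "i + k \<le> n")
      case True
      then have "pdiff (i + s) (X k i) = Const (\<beta> k i) * (if s = k then 1 else 0)"
        by (simp add: shift_field_def pdiff_mult pdiff_Var)
      then show ?thesis by (cases "k = s") (simp_all add: eval_at_mult)
    next
      case False
      then show ?thesis using i by (cases "k = s") (simp_all add: shift_field_def)
    qed
    have "d i = ?e (pdiff (i + s) (shift_field n s d i))"
      using i by (simp add: shift_field_def pdiff_mult pdiff_Var)
    also have "\<dots> = (\<Sum>k<n - 1. ?e (a k) * ?e (pdiff (i + s) (X k i)))"
      using au[of i] i kernel_at_origin[OF u, of i]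
      by (simp add: pdiff_add pdiff_sum pdiff_mult eval_at_simps X0 pdiff_Var)
    also have "\<dots> = (if s < n - 1 then ?e (a s) * \<beta> s i else 0)"
      by (simp add: pX if_distrib[of "\<lambda>c. _ * c"] sum.delta cong: if_cong)
    finally show ?thesis .
  qed
  then show ?thesis by blast
qed

end

section \<open>Exterior and Lie derivatives of one- and two-forms by components\<close>

section \<open>Cartan calculus in low degree\<close>

definition d1 :: "(nat \<Rightarrow> nat cpoly) \<Rightarrow> nat \<Rightarrow> nat \<Rightarrow> nat cpoly" where
  "d1 \<gamma> a b = pdiff a (\<gamma> b) - pdiff b (\<gamma> a)"

definition d2 :: "(nat \<Rightarrow> nat \<Rightarrow> nat cpoly) \<Rightarrow> nat \<Rightarrow> nat \<Rightarrow> nat \<Rightarrow> nat cpoly" where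
  "d2 B a b c = pdiff a (B b c) + pdiff b (B c a) + pdiff c (B a b)"

definition Lie1 :: "nat \<Rightarrow> vfield \<Rightarrow> (nat \<Rightarrow> nat cpoly) \<Rightarrow> nat \<Rightarrow> nat cpoly" where
  "Lie1 n v \<gamma> l = (\<Sum>i\<le>n. v i * pdiff i (\<gamma> l) + \<gamma> i * pdiff l (v i))"

definition Lie2 :: "nat \<Rightarrow> vfield \<Rightarrow> (nat \<Rightarrow> nat \<Rightarrow> nat cpoly) \<Rightarrow> nat \<Rightarrow> nat \<Rightarrow> nat cpoly" where
  "Lie2 n v B a b = (\<Sum>k\<le>n. v k * pdiff k (B a b) + pdiff a (v k) * B k b + pdiff b (v k) * B a k)"

lemma d1_anti: "d1 \<gamma> a b = - d1 \<gamma> b a"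
  by (simp add: d1_def)

lemma d2_d1: "d2 (d1 \<gamma>) a b c = 0"
  using pdiff_commute[of a b "\<gamma> c"] pdiff_commute[of b c "\<gamma> a"] pdiff_commute[of c a "\<gamma> b"]
  by (simp add: d1_def d2_def pdiff_diff)

lemma d2_cyclic: "d2 B a b c = d2 B b c a"
  by (simp add: d2_def algebra_simps)

lemma d2_swap:
  assumes "\<And>i j. B i j = - B j i"
  shows "d2 B a b c = - d2 B b a c"
  using assms[of b c] assms[of c a] assms[of a b] by (simp add: d2_def pdiff_uminus)

lemma cartan1: "Lie1 n v \<gamma> l = pairing n v (\<lambda>i. d1 \<gamma> i l) + pdiff l (pairing n v \<gamma>)"
  by (simp add: Lie1_def pairing_def d1_def pdiff_sum pdiff_mult algebra_simps sum.distrib sum_subtractf)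

lemma cartan2:
  assumes "\<And>i j. B i j = - B j i"
  shows "Lie2 n v B a b = d1 (\<lambda>l. pairing n v (\<lambda>i. B i l)) a b + pairing n v (\<lambda>k. d2 B k a b)"
proof -
  have *: "v k * pdiff k (B a b) + pdiff a (v k) * B k b + pdiff b (v k) * B a k =
      (pdiff a (v k) * B k b + v k * pdiff a (B k b)) - (pdiff b (v k) * B k a + v k * pdiff b (B k a)) +
      v k * d2 B k a b" for k
    using assms[of a k] assms[of b k] by (simp add: d2_def pdiff_uminus algebra_simps)
  show ?thesis
    unfolding Lie2_def *
    by (simp add: d1_def pairing_def pdiff_sum pdiff_mult sum.distrib sum_subtractf)
qed

text \<open>The rule i_w L_v = L_v i_w - i_[v,w], obtained by comparing the four kinds of terms in
  the Leibniz expansions.\<close>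

lemma cartan_commutator:
  "pairing n w (\<lambda>a. Lie2 n v B a b) =
     Lie1 n v (\<lambda>l. pairing n w (\<lambda>i. B i l)) b - pairing n (lie_bracket n v w) (\<lambda>a. B a b)"
proof -
  define A1 where "A1 = (\<Sum>a\<le>n. \<Sum>k\<le>n. w a * v k * pdiff k (B a b))"
  define A2 where "A2 = (\<Sum>a\<le>n. \<Sum>k\<le>n. w a * pdiff a (v k) * B k b)"
  define A3 where "A3 = (\<Sum>a\<le>n. \<Sum>k\<le>n. w a * pdiff b (v k) * B a k)"
  define A4 where "A4 = (\<Sum>a\<le>n. \<Sum>k\<le>n. v k * pdiff k (w a) * B a b)"
  have 1: "pairing n w (\<lambda>a. Lie2 n v B a b) = A1 + A2 + A3"
    by (simp add: pairing_def Lie2_def A1_def A2_def A3_def sum_distrib_left sum.distrib distrib_left mult.assoc)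
  have "Lie1 n v (\<lambda>l. pairing n w (\<lambda>i. B i l)) b =
      (\<Sum>k\<le>n. \<Sum>a\<le>n. v k * pdiff k (w a) * B a b + w a * v k * pdiff k (B a b) + w a * pdiff b (v k) * B a k)"
    by (simp add: Lie1_def pairing_def pdiff_sum pdiff_mult sum_distrib_left sum_distrib_right sum.distrib algebra_simps)
  also have "\<dots> = A4 + A1 + A3"
    unfolding A1_def A3_def A4_def by (subst sum.swap) (simp add: sum.distrib)
  finally have 2: "Lie1 n v (\<lambda>l. pairing n w (\<lambda>i. B i l)) b = A4 + A1 + A3" .
  have "pairing n (lie_bracket n v w) (\<lambda>a. B a b) =
      A4 - (\<Sum>a\<le>n. \<Sum>k\<le>n. w k * pdiff k (v a) * B a b)"
    by (simp add: pairing_def lie_bracket_def A4_def sum_distrib_right left_diff_distrib sum_subtractf)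
  also have "(\<Sum>a\<le>n. \<Sum>k\<le>n. w k * pdiff k (v a) * B a b) = A2"
    unfolding A2_def by (rule sum.swap)
  finally have "pairing n (lie_bracket n v w) (\<lambda>a. B a b) = A4 - A2" .
  with 1 2 show ?thesis by simp
qed

section \<open>The linearised integrability equation at \<omega>, solved weight by weight\<close>

section \<open>First-order deformations\<close>

lemma pairing_add_right: "pairing n v (\<lambda>i. \<gamma> i + \<delta> i) = pairing n v \<gamma> + pairing n v \<delta>"
  by (simp add: pairing_def distrib_left sum.distrib)

lemma pairing_mult_right2: "pairing n v (\<lambda>i. \<gamma> i * p) = pairing n v \<gamma> * p"
  by (simp add: pairing_def sum_distrib_right mult.assoc)

lemma pairing_uminus_right: "pairing n v (\<lambda>i. - \<gamma> i) = - pairing n v \<gamma>"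
  by (simp add: pairing_def sum_negf)

lemma pairing_sum_right: "pairing n v (\<lambda>i. \<Sum>k\<in>K. \<gamma> k i) = (\<Sum>k\<in>K. pairing n v (\<gamma> k))"
  unfolding pairing_def by (subst sum.swap) (simp add: sum_distrib_left)

lemma Lie1_cong:
  assumes "\<And>i. i \<le> n \<Longrightarrow> v i = w i" "\<And>i. i \<le> n \<Longrightarrow> \<gamma> i = \<delta> i" "l \<le> n"
  shows "Lie1 n v \<gamma> l = Lie1 n w \<delta> l"
  unfolding Lie1_def using assms by (intro sum.cong) auto

lemma Lie1_add: "Lie1 n (\<lambda>i. v i + w i) \<gamma> l = Lie1 n v \<gamma> l + Lie1 n w \<gamma> l"
  by (simp add: Lie1_def pdiff_add distrib_left distrib_right sum.distrib)

lemma Lie1_sum: "Lie1 n (\<lambda>i. \<Sum>a\<in>A. v a i) \<gamma> l = (\<Sum>a\<in>A. Lie1 n (v a) \<gamma> l)"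
proof (induction A rule: infinite_finite_induct)
  case (insert a A)
  then show ?case using Lie1_add[of n "v a" "\<lambda>i. \<Sum>a\<in>A. v a i"] by simp
qed (simp_all add: Lie1_def)

lemma Lie1_Const: "Lie1 n (\<lambda>i. Const c * v i) \<gamma> l = Const c * Lie1 n v \<gamma> l"
  by (simp add: Lie1_def pdiff_mult sum_distrib_left distrib_left mult.left_commute mult.assoc)

lemma pairing_radial_pdiff:
  assumes "p \<in> hom_polys n e"
  shows "pairing n (radial n) (\<lambda>i. pdiff i p) = of_nat e * p"
  using euler_formula[OF assms] by (simp add: pairing_def radial_def)

lemma pdiff_radial: "i \<le> n \<Longrightarrow> pdiff l (radial n i) = (if l = i then 1 else 0)"
  by (simp add: radial_def pdiff_Var)

lemma pairing_pdiff_radial: "l \<le> n \<Longrightarrow> (\<Sum>i\<le>n. \<gamma> i * pdiff l (radial n i)) = \<gamma> l"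
  by (subst sum_eq_single[where i = l]) (auto simp: pdiff_radial)

lemma Lie1_radial:
  assumes "\<And>i. i \<le> n \<Longrightarrow> \<gamma> i \<in> hom_polys n e" "l \<le> n"
  shows "Lie1 n (radial n) \<gamma> l = of_nat (e + 1) * \<gamma> l"
proof -
  have "Lie1 n (radial n) \<gamma> l = pairing n (radial n) (\<lambda>i. pdiff i (\<gamma> l)) + (\<Sum>i\<le>n. \<gamma> i * pdiff l (radial n i))"
    by (simp add: Lie1_def pairing_def sum.distrib)
  then show ?thesis
    using assms by (simp add: pairing_radial_pdiff pairing_pdiff_radial distrib_right)
qed

lemma Lie2_radial:
  assumes "B a b \<in> hom_polys n e" "a \<le> n" "b \<le> n"
  shows "Lie2 n (radial n) B a b = of_nat (e + 2) * B a b"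
proof -
  have "Lie2 n (radial n) B a b = pairing n (radial n) (\<lambda>k. pdiff k (B a b)) +
      (\<Sum>k\<le>n. B k b * pdiff a (radial n k)) + (\<Sum>k\<le>n. B a k * pdiff b (radial n k))"
    by (simp add: Lie2_def pairing_def sum.distrib mult.commute)
  then show ?thesis
    using assms by (simp add: pairing_radial_pdiff pairing_pdiff_radial distrib_right algebra_simps)
qed

lemma shift_field_hom: "i \<le> n \<Longrightarrow> shift_field n k d i \<in> hom_polys n 1"
  using hom_polys_Const_mult[OF hom_polys_Var] by (simp add: shift_field_def)

lemma radial_hom: "i \<le> n \<Longrightarrow> radial n i \<in> hom_polys n 1"
  using hom_polys_Var by (simp add: radial_def)

lemma lie_bracket_radial:
  assumes "\<And>i. i \<le> n \<Longrightarrow> v i \<in> hom_polys n 1" "j \<le> n"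
  shows "lie_bracket n v (radial n) j = 0" "lie_bracket n (radial n) v j = 0"
proof -
  have "(\<Sum>i\<le>n. v i * pdiff i (radial n j)) = v j"
    using assms(2) by (subst sum_eq_single[where i = j]) (auto simp: pdiff_radial)
  moreover have "(\<Sum>i\<le>n. radial n i * pdiff i (v j)) = v j"
    using pairing_radial_pdiff[OF assms(1)[OF assms(2)]] by (simp add: pairing_def)
  ultimately show "lie_bracket n v (radial n) j = 0" "lie_bracket n (radial n) v j = 0"
    by (simp_all add: lie_bracket_def sum_subtractf)
qed

lemma lie_bracket_shift:
  assumes "j \<le> n"
  shows "lie_bracket n (shift_field n k c) (shift_field n l d) j =
    shift_field n (k + l) (\<lambda>j. c (j + l) * d j - c j * d (j + k)) j"
proof -
  have *: "(\<Sum>i\<le>n. shift_field n k c i * pdiff i (shift_field n l d j)) =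
      (if j + k + l \<le> n then Const (c (j + l) * d j) * Var (j + (k + l)) else 0)" for k c l d
  proof (cases "j + l \<le> n")
    case True
    have "(\<Sum>i\<le>n. shift_field n k c i * pdiff i (shift_field n l d j)) =
        shift_field n k c (j + l) * pdiff (j + l) (shift_field n l d j)"
      using True by (intro sum_eq_single) (auto simp: shift_field_def pdiff_mult pdiff_Var)
    then show ?thesis
      using True by (auto simp: shift_field_def pdiff_mult pdiff_Var Const_mult mult_ac add_ac)
  qed (simp add: shift_field_def)
  show ?thesis
    unfolding lie_bracket_def sum_subtractf *
    by (auto simp: shift_field_def Const_diff algebra_simps)
qed

lemma shift_field_diff: "shift_field n k c i - shift_field n k d i = shift_field n k (\<lambda>i. c i - d i) i"
  and shift_field_add: "shift_field n k c i + shift_field n k d i = shift_field n k (\<lambda>i. c i + d i) i"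
  and shift_field_Const: "Const a * shift_field n k c i = shift_field n k (\<lambda>i. a * c i) i"
  by (simp_all add: shift_field_def Const_diff Const_add Const_mult left_diff_distrib distrib_right mult.assoc)

lemma shift_field_cong:
  "(\<And>i. i + k \<le> n \<Longrightarrow> c i = d i) \<Longrightarrow> shift_field n k c i = shift_field n k d i"
  by (simp add: shift_field_def)

text \<open>\<open>bracket\<close> encodes [X_i, X_j] = g_ij X_(i+j), with 0 when the shift exceeds
  n - 2. \<open>trace\<close> says that X_0 annihilates z_n^(n-1) dz_0 dz_1. \<open>rigidity\<close>
  is the vanishing of weight-zero deformations up to rescaling each field and conjugating by
  diagonal matrices \<open>d\<close>; it is the only condition that depends on the particular
  algebra beyond its brackets.\<close>

locale deformation_setup = kernel_form +
  fixes g :: "nat \<Rightarrow> nat \<Rightarrow> complex"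
  assumes bracket: "i < n - 1 \<Longrightarrow> j < n - 1 \<Longrightarrow> m + i + j \<le> n \<Longrightarrow>
      \<beta> i (m + j) * \<beta> j m - \<beta> i m * \<beta> j (m + i) = (if i + j < n - 1 then g i j * \<beta> (i + j) m else 0)"
    and \<beta>_0: "\<beta> 0 i = \<beta> 0 0 - 2 * of_nat i"
    and \<beta>_1: "\<beta> 1 i = 1"
    and trace: "of_nat (n - 1) * \<beta> 0 n + \<beta> 0 0 + \<beta> 0 1 = 0"
    and rigidity: "(\<And>i j. 1 \<le> i \<Longrightarrow> i < n - 1 \<Longrightarrow> 1 \<le> j \<Longrightarrow> j < n - 1 \<Longrightarrow>
        \<exists>\<alpha>. \<forall>m. m + i + j \<le> n \<longrightarrow>
          \<beta> i (m + j) * C j m - \<beta> i m * C j (m + i) + (C i (m + j) * \<beta> j m - C i m * \<beta> j (m + i))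
            - (if i + j < n - 1 then g i j * C (i + j) m else 0)
          = (if i + j < n - 1 then \<alpha> * \<beta> (i + j) m else 0)) \<Longrightarrow>
      \<exists>d. \<forall>k. 1 \<le> k \<and> k < n - 1 \<longrightarrow>
        (\<exists>\<epsilon>. \<forall>m. m + k \<le> n \<longrightarrow> C k m = \<epsilon> * \<beta> k m - (d (m + k) - d m) * \<beta> k m)"
begin

lemma bracket_X:
  assumes "i < n - 1" "j < n - 1" "m \<le> n"
  shows "lie_bracket n (X i) (X j) m = (if i + j < n - 1 then Const (g i j) * X (i + j) m else 0)"
  using assms bracket[of i j m]
  by (subst lie_bracket_shift[OF assms(3)]) (auto simp: shift_field_def add.assoc Const_mult mult.assoc)

lemma contract_X: "k < n - 1 \<Longrightarrow> l \<le> n \<Longrightarrow> contract (X k) l = 0"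
  by (rule \<Omega>_ker)

lemma contract_bracket:
  assumes "i < n - 1" "j < n - 1" "l \<le> n"
  shows "contract (lie_bracket n (X i) (X j)) l = 0"
proof -
  have "contract (lie_bracket n (X i) (X j)) l =
      contract (\<lambda>m. Const (if i + j < n - 1 then g i j else 0) * X (if i + j < n - 1 then i + j else 0) m) l"
    using bracket_X[OF assms(1,2)] by (intro pairing_cong) auto
  then show ?thesis
    using contract_X[of "if i + j < n - 1 then i + j else 0" l] assms n_ge by (simp add: pairing_mult)
qed

lemma Lie2_anti: "Lie2 n v \<Omega> a b = - Lie2 n v \<Omega> b a"
  unfolding Lie2_def sum_negf[symmetric]
proof (intro sum.cong refl)
  fix k
  show "v k * pdiff k (\<Omega> a b) + pdiff a (v k) * \<Omega> k b + pdiff b (v k) * \<Omega> a k =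
      - (v k * pdiff k (\<Omega> b a) + pdiff b (v k) * \<Omega> k a + pdiff a (v k) * \<Omega> b k)"
    by (subst \<Omega>_anti[of a b], subst \<Omega>_anti[of k b], subst \<Omega>_anti[of a k]) (simp add: pdiff_uminus)
qed

text \<open>The brackets stay in the span of the fields, so the Lie derivative has the same kernel
  as \<Omega> and only its coefficient at (0, 1) has to be computed. There the fields with positive
  shift contribute nothing, and X_0 contributes the factor in \<open>trace\<close>.\<close>

lemma Lie2_X:
  assumes j: "j < n - 1" and ab: "a \<le> n" "b \<le> n"
  shows "Lie2 n (X j) \<Omega> a b = 0"
proof (rule tensor_eq_0[OF _ _ _ ab])
  fix k l assume kl: "k < n - 1" "l \<le> n"
  have "Lie1 n (X j) (contract (X k)) l = Lie1 n (X j) (\<lambda>_. 0) l"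
    using kl contract_X by (intro Lie1_cong) auto
  then show "pairing n (X k) (\<lambda>i. Lie2 n (X j) \<Omega> i l) = 0"
    using contract_bracket[OF j kl] by (simp add: cartan_commutator Lie1_def)
next
  have Xn: "X j n = (if j = 0 then Const (\<beta> 0 n) * Var n else 0)"
    by (simp add: shift_field_def)
  have p: "pdiff k (\<Omega> 0 1) = (if k = n then Const c * (of_nat (n - 1) * Var n ^ (n - 2)) else 0)" for k
  proof -
    have "n - 1 = Suc (n - 2)" using n_ge by simp
    then show ?thesis
      unfolding \<Omega>_01 by (simp only: pdiff_prod_Const pdiff_power pdiff_Var) simp
  qed
  have 1: "(\<Sum>k\<le>n. X j k * pdiff k (\<Omega> 0 1)) = X j n * pdiff n (\<Omega> 0 1)"
    by (rule sum_eq_single) (auto simp: p simp del: One_nat_def)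
  have 2: "(\<Sum>k\<le>n. pdiff 0 (X j k) * \<Omega> k 1) = (if j = 0 then Const (\<beta> 0 0) * \<Omega> 0 1 else 0)"
  proof -
    have "(\<Sum>k\<le>n. pdiff 0 (X j k) * \<Omega> k 1) = pdiff 0 (X j 0) * \<Omega> 0 1"
      by (rule sum_eq_single) (auto simp: shift_field_def pdiff_mult pdiff_Var)
    then show ?thesis by (auto simp: shift_field_def pdiff_mult pdiff_Var)
  qed
  have 3: "(\<Sum>k\<le>n. pdiff 1 (X j k) * \<Omega> 0 k) = (if j = 0 then Const (\<beta> 0 1) * \<Omega> 0 1 else 0)"
  proof -
    have "(\<Sum>k\<le>n. pdiff 1 (X j k) * \<Omega> 0 k) = pdiff 1 (X j 1) * \<Omega> 0 1"
    proof (rule sum_eq_single)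
      fix k assume "k \<in> {..n}" "k \<noteq> 1"
      then show "pdiff 1 (X j k) * \<Omega> 0 k = 0"
        by (cases "k = 0") (auto simp: shift_field_def pdiff_mult pdiff_Var)
    qed (use n_ge in auto)
    then show ?thesis using n_ge by (auto simp: shift_field_def pdiff_mult pdiff_Var)
  qed
  show "Lie2 n (X j) \<Omega> 0 1 = 0"
  proof (cases "j = 0")
    case True
    have "Var n * Var n ^ (n - 2) = (Var n ^ (n - 1) :: nat cpoly)"
      using n_ge by (simp flip: power_Suc add: Suc_diff_Suc numeral_2_eq_2)
    moreover have "X j n * pdiff n (\<Omega> 0 1) = Const (\<beta> 0 n) * of_nat (n - 1) * (Const c * (Var n * Var n ^ (n - 2)))"
      unfolding Xn p using True by (simp add: mult_ac)
    ultimately have X1: "X j n * pdiff n (\<Omega> 0 1) = Const (\<beta> 0 n) * of_nat (n - 1) * \<Omega> 0 1"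
      by (simp only: \<Omega>_01)
    have "Const (of_nat (n - 1) * \<beta> 0 n + \<beta> 0 0 + \<beta> 0 1) =
        Const (\<beta> 0 n) * of_nat (n - 1) + Const (\<beta> 0 0) + (Const (\<beta> 0 1) :: nat cpoly)"
      by (simp only: Const_add Const_mult Const_of_nat mult.commute)
    then have "Lie2 n (X j) \<Omega> 0 1 = Const (of_nat (n - 1) * \<beta> 0 n + \<beta> 0 0 + \<beta> 0 1) * \<Omega> 0 1"
      unfolding Lie2_def sum.distrib 1 2 3 X1 using True
      by (simp only: if_True simp_thms distrib_right)
    then show ?thesis unfolding trace by simp
  next
    case False
    then show ?thesis unfolding Lie2_def sum.distrib 1 2 3 by (simp add: Xn)
  qed
qed (rule Lie2_anti)

text \<open>By Cartan's formula every field contracts the derivative of \<Omega> to 0, and a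
  three-form annihilated by all fields vanishes: only two directions, 0 and 1, remain free.\<close>

lemma \<Omega>_closed:
  assumes "a \<le> n" "b \<le> n" "e \<le> n"
  shows "d2 \<Omega> a b e = 0"
proof -
  have swap: "d2 \<Omega> a b e = - d2 \<Omega> b a e" for a b e
    by (rule d2_swap) (rule \<Omega>_anti)
  have ker: "pairing n (X k) (\<lambda>a. d2 \<Omega> a b e) = 0" if "k < n - 1" "b \<le> n" "e \<le> n" for k b e
  proof -
    have "d1 (contract (X k)) b e = 0"
      using that contract_X by (simp add: d1_def)
    then show ?thesis
      using cartan2[where B = \<Omega> and n = n and v = "X k" and a = b and b = e, OF \<Omega>_anti] Lie2_X[OF that] by simp
  qed
  have rep: "d2 \<Omega> a a e = 0" for a e
    using swap[of a a e] cpoly_eq_uminus_iff by blast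
  have rep2: "d2 \<Omega> a b a = 0" for a b
    using rep[of a b] d2_cyclic[of \<Omega> a b a] d2_cyclic[of \<Omega> b a a] by simp
  have 1: "d2 \<Omega> 0 1 e = 0" if "e \<le> n" for e
  proof -
    have "d2 \<Omega> e 0 1 = 0"
      by (rule covector_eq_0[of "\<lambda>e. d2 \<Omega> e 0 1"]) (use ker[of _ 0 1] rep rep2 that n_ge in auto)
    then show ?thesis
      using d2_cyclic[of \<Omega> e 0 1] by simp
  qed
  have 2: "d2 \<Omega> b 0 e = 0" if "b \<le> n" "e \<le> n" for b e
  proof (rule covector_eq_0[of "\<lambda>b. d2 \<Omega> b 0 e"])
    show "d2 \<Omega> 1 0 e = 0" using swap[of 1 0 e] 1[OF that(2)] by simp
  qed (use ker[of _ 0 e] rep that in auto)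
  have 3: "d2 \<Omega> b 1 e = 0" if "b \<le> n" "e \<le> n" for b e
    by (rule covector_eq_0[of "\<lambda>b. d2 \<Omega> b 1 e"]) (use ker[of _ 1 e] rep 1 that n_ge in auto)
  show ?thesis
  proof (rule covector_eq_0[of "\<lambda>a. d2 \<Omega> a b e"])
    show "d2 \<Omega> 0 b e = 0" using swap[of 0 b e] 2[OF assms(2,3)] by simp
    show "d2 \<Omega> 1 b e = 0" using swap[of 1 b e] 3[OF assms(2,3)] by simp
  qed (use ker[of _ b e] assms in auto)
qed

lemma cartan2_\<Omega>:
  assumes "a \<le> n" "b \<le> n"
  shows "Lie2 n v \<Omega> a b = d1 (contract v) a b"
proof -
  have "pairing n v (\<lambda>k. d2 \<Omega> k a b) = pairing n v (\<lambda>k. 0)"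
    using assms \<Omega>_closed by (intro pairing_cong) auto
  then show ?thesis using cartan2[where B = \<Omega> and n = n and v = v and a = a and b = b, OF \<Omega>_anti] by simp
qed

definition \<omega> :: "nat \<Rightarrow> nat cpoly" where "\<omega> = contract (radial n)"

lemma \<omega>_hom: "l \<le> n \<Longrightarrow> \<omega> l \<in> hom_polys n n"
  using hom_polys_mult[OF radial_hom \<Omega>_hom] n_ge
  by (auto simp: \<omega>_def pairing_def intro!: hom_polys_sum)

text \<open>As \<Omega> is closed, the derivative of its contraction with R is its Lie derivative
  along R, which counts the degree n - 1 of the coefficients and the two differentials.\<close>

lemma d1_\<omega>:
  assumes "a \<le> n" "b \<le> n"
  shows "d1 \<omega> a b = of_nat (n + 1) * \<Omega> a b"
  using cartan2_\<Omega>[OF assms, of "radial n"] Lie2_radial[of \<Omega> a b n "n - 1"] \<Omega>_hom assms n_ge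
  by (simp add: \<omega>_def)

lemma pairing_radial_\<omega>: "pairing n (radial n) \<omega> = 0"
proof -
  have "pairing n (radial n) \<omega> = - pairing n (radial n) \<omega>"
    unfolding \<omega>_def by (rule pairing_swap) (rule \<Omega>_anti)
  then show ?thesis by (simp only: cpoly_eq_uminus_iff)
qed

lemma pairing_X_\<omega>: assumes "k < n - 1" shows "pairing n (X k) \<omega> = 0"
proof -
  have "pairing n (X k) \<omega> = - pairing n (radial n) (\<lambda>i. contract (X k) i)"
    unfolding \<omega>_def by (rule pairing_swap) (rule \<Omega>_anti)
  also have "pairing n (radial n) (\<lambda>i. contract (X k) i) = pairing n (radial n) (\<lambda>_. 0)"
    using contract_X[OF assms] by (intro pairing_cong) auto
  finally show ?thesis by simp
qed

lemma d1_\<omega>_01: "d1 \<omega> 0 1 \<noteq> 0"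
proof -
  have "of_nat (n + 1) * (Const c * Var n ^ (n - 1)) \<noteq> (0 :: nat cpoly)"
    using c_nz by (simp add: of_nat_neq_0 del: of_nat_Suc)
  then show ?thesis using d1_\<omega>[of 0 1] n_ge by (simp add: \<Omega>_01 del: One_nat_def)
qed

text \<open>The part of the linearised equations that the division argument uses: the derivative of
  \<eta> vanishes on pairs of the fields.\<close>

definition tangent :: "(nat \<Rightarrow> nat cpoly) \<Rightarrow> bool" where
  "tangent \<eta> \<longleftrightarrow> (\<forall>l\<le>n. \<eta> l \<in> hom_polys n n) \<and> pairing n (radial n) \<eta> = 0 \<and>
     (\<forall>j<n - 1. \<forall>k<n - 1. pairing n (X j) (\<lambda>a. pairing n (X k) (\<lambda>b. d1 \<eta> a b)) = 0)"

text \<open>Contract the linearised equation with two of the fields. Since they annihilate \<omega>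
  and its derivative, only \<omega> times the value of the derivative of \<eta> on the pair
  survives.\<close>

lemma tangentI:
  assumes hom: "\<And>l. l \<le> n \<Longrightarrow> \<eta> l \<in> hom_polys n n" and R: "pairing n (radial n) \<eta> = 0"
    and eq: "\<And>a b e. a \<le> n \<Longrightarrow> b \<le> n \<Longrightarrow> e \<le> n \<Longrightarrow>
      \<omega> a * d1 \<eta> b e + \<omega> b * d1 \<eta> e a + \<omega> e * d1 \<eta> a b +
      \<eta> a * d1 \<omega> b e + \<eta> b * d1 \<omega> e a + \<eta> e * d1 \<omega> a b = 0"
  shows "tangent \<eta>"
proof -
  have ker: "pairing n (X k) (\<lambda>b. d1 \<omega> b e) = 0" if "k < n - 1" "e \<le> n" for k e
  proof -
    have "pairing n (X k) (\<lambda>b. d1 \<omega> b e) = pairing n (X k) (\<lambda>b. of_nat (n + 1) * \<Omega> b e)"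
      using that d1_\<omega> by (intro pairing_cong) auto
    then show ?thesis using contract_X[OF that] by (simp add: pairing_mult_right)
  qed
  have ker': "pairing n (X k) (d1 \<omega> e) = 0" if "k < n - 1" "e \<le> n" for k e
  proof -
    have "pairing n (X k) (d1 \<omega> e) = pairing n (X k) (\<lambda>b. - d1 \<omega> b e)"
      by (intro pairing_cong refl d1_anti)
    then show ?thesis using ker[OF that] by (simp add: pairing_uminus_right)
  qed
  have "pairing n (X j) (\<lambda>a. pairing n (X k) (\<lambda>b. d1 \<eta> a b)) = 0" if jk: "j < n - 1" "k < n - 1" for j k
  proof -
    let ?T = "pairing n (X j) (\<lambda>a. pairing n (X k) (\<lambda>b. d1 \<eta> a b))"
    have "\<omega> e * ?T = 0" if e: "e \<le> n" for e
    proof -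
      have 1: "\<omega> a * pairing n (X k) (\<lambda>b. d1 \<eta> b e) + \<omega> e * pairing n (X k) (\<lambda>b. d1 \<eta> a b) +
          pairing n (X k) \<eta> * d1 \<omega> e a = 0" if a: "a \<le> n" for a
      proof -
        have "pairing n (X k) (\<lambda>b. \<omega> a * d1 \<eta> b e + \<omega> b * d1 \<eta> e a + \<omega> e * d1 \<eta> a b +
            \<eta> a * d1 \<omega> b e + \<eta> b * d1 \<omega> e a + \<eta> e * d1 \<omega> a b) = pairing n (X k) (\<lambda>b. 0)"
          using eq a e by (intro pairing_cong) auto
        then show ?thesis
          using ker[OF jk(2) e] ker'[OF jk(2) a] pairing_X_\<omega>[OF jk(2)]
          by (simp add: pairing_add_right pairing_mult_right pairing_mult_right2)
      qed
      have "pairing n (X j) (\<lambda>a. \<omega> a * pairing n (X k) (\<lambda>b. d1 \<eta> b e) + \<omega> e * pairing n (X k) (\<lambda>b. d1 \<eta> a b) +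
          pairing n (X k) \<eta> * d1 \<omega> e a) = pairing n (X j) (\<lambda>a. 0)"
        using 1 by (intro pairing_cong) auto
      then show ?thesis
        using ker'[OF jk(1) e] pairing_X_\<omega>[OF jk(1)]
        by (simp add: pairing_add_right pairing_mult_right pairing_mult_right2)
    qed
    \<comment> \<open>If both components vanished, so would the coefficient at (0, 1) of the
      derivative of \<omega>.\<close>
    moreover have "\<omega> 0 \<noteq> 0 \<or> \<omega> 1 \<noteq> 0"
      using d1_\<omega>_01 by (auto simp: d1_def)
    ultimately show ?thesis
      using n_ge by (metis le_trans mult_eq_0_iff one_le_numeral zero_le)
  qed
  with hom R show ?thesis unfolding tangent_def by blast
qed

text \<open>The eigenvalue of X_0 on the monomial \<open>m\<close>; the form m dz_l has eigenvalue
  \<open>wt m + \<beta> 0 l\<close>.\<close>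

definition wt :: "(nat \<Rightarrow>\<^sub>0 nat) \<Rightarrow> complex" where
  "wt m = (\<Sum>j\<in>keys m. of_nat (lookup m j) * \<beta> 0 j)"

lemma wt_superset: "finite S \<Longrightarrow> keys m \<subseteq> S \<Longrightarrow> wt m = (\<Sum>j\<in>S. of_nat (lookup m j) * \<beta> 0 j)"
  unfolding wt_def by (rule sum.mono_neutral_left) (auto simp: in_keys_iff)

lemma wt_add: "wt (m + m') = wt m + wt m'"
proof -
  let ?S = "keys m \<union> keys m'"
  have "wt (m + m') = (\<Sum>j\<in>?S. of_nat (lookup (m + m') j) * \<beta> 0 j)"
    by (rule wt_superset) (auto simp: keys_add_nat)
  also have "\<dots> = wt m + wt m'"
    by (simp add: wt_superset[of ?S] lookup_add distrib_right sum.distrib)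
  finally show ?thesis .
qed

lemma wt_single: "wt (single j k) = of_nat k * \<beta> 0 j"
  by (simp add: wt_def)

lemma lookup_X0_derivative:
  assumes "p \<in> vars_in {..n}"
  shows "lookup (pairing n (X 0) (\<lambda>i. pdiff i p)) m = wt m * lookup p m"
proof -
  have "pairing n (X 0) (\<lambda>i. pdiff i (single k a)) = single k (wt k * a)" if "keys k \<subseteq> {..n}" for k a
  proof -
    have "pairing n (X 0) (\<lambda>i. pdiff i (single k a)) = (\<Sum>i\<le>n. Const (\<beta> 0 i) * (Var i * pdiff i (single k a)))"
      by (simp add: pairing_def shift_field_def mult.assoc)
    also have "\<dots> = single k (\<Sum>i\<le>n. \<beta> 0 i * (of_nat (lookup k i) * a))"
      by (simp add: Var_pdiff_single Const_mult_single single_sum)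
    also have "(\<Sum>i\<le>n. \<beta> 0 i * (of_nat (lookup k i) * a)) = wt k * a"
      using wt_superset[of "{..n}" k] that by (simp add: sum_distrib_right sum_distrib_left mult_ac)
    finally show ?thesis .
  qed
  then have "(\<Sum>k\<in>keys p. pairing n (X 0) (\<lambda>i. pdiff i (single k (lookup p k)))) =
      (\<Sum>k\<in>keys p. single k (wt k * lookup p k))"
    using assms by (intro sum.cong) (auto simp: vars_in_def)
  moreover have "pairing n (X 0) (\<lambda>i. pdiff i p) =
      (\<Sum>k\<in>keys p. pairing n (X 0) (\<lambda>i. pdiff i (single k (lookup p k))))"
    by (subst (1) cpoly_as_sum[of p]) (simp only: pdiff_sum pairing_sum_right)
  ultimately show ?thesis
    by (simp add: lookup_sum lookup_single when_def in_keys_iff)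
qed

lemma lookup_Lie1_X0:
  assumes "\<gamma> l \<in> vars_in {..n}" "l \<le> n"
  shows "lookup (Lie1 n (X 0) \<gamma> l) m = (wt m + \<beta> 0 l) * lookup (\<gamma> l) m"
proof -
  have "(\<Sum>i\<le>n. \<gamma> i * pdiff l (X 0 i)) = \<gamma> l * pdiff l (X 0 l)"
    using assms(2) by (intro sum_eq_single) (auto simp: shift_field_def pdiff_mult pdiff_Var)
  then have "Lie1 n (X 0) \<gamma> l = pairing n (X 0) (\<lambda>i. pdiff i (\<gamma> l)) + Const (\<beta> 0 l) * \<gamma> l"
    using assms(2) by (simp add: Lie1_def pairing_def sum.distrib shift_field_def pdiff_mult pdiff_Var mult.commute)
  then show ?thesis
    using lookup_X0_derivative[OF assms(1)] by (simp add: lookup_add distrib_right)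
qed

lemma wt_\<Omega>:
  assumes "a \<le> n" "b \<le> n" "m \<in> keys (\<Omega> a b)"
  shows "wt m + \<beta> 0 a + \<beta> 0 b = 0"
proof -
  have 1: "(\<Sum>k\<le>n. pdiff a (X 0 k) * \<Omega> k b) = Const (\<beta> 0 a) * \<Omega> a b"
  proof -
    have "(\<Sum>k\<le>n. pdiff a (X 0 k) * \<Omega> k b) = pdiff a (X 0 a) * \<Omega> a b"
      using assms by (intro sum_eq_single) (auto simp: shift_field_def pdiff_mult pdiff_Var)
    then show ?thesis using assms by (simp add: shift_field_def pdiff_mult pdiff_Var)
  qed
  have 2: "(\<Sum>k\<le>n. pdiff b (X 0 k) * \<Omega> a k) = Const (\<beta> 0 b) * \<Omega> a b"
  proof -
    have "(\<Sum>k\<le>n. pdiff b (X 0 k) * \<Omega> a k) = pdiff b (X 0 b) * \<Omega> a b"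
      using assms by (intro sum_eq_single) (auto simp: shift_field_def pdiff_mult pdiff_Var)
    then show ?thesis using assms by (simp add: shift_field_def pdiff_mult pdiff_Var)
  qed
  have "\<Omega> a b \<in> vars_in {..n}" using \<Omega>_hom assms by (auto simp: hom_polys_iff)
  then have "lookup (Lie2 n (X 0) \<Omega> a b) m = (wt m + \<beta> 0 a + \<beta> 0 b) * lookup (\<Omega> a b) m"
    using lookup_X0_derivative[of "\<Omega> a b" m]
    unfolding Lie2_def sum.distrib 1 2 pairing_def by (simp add: lookup_add distrib_right)
  moreover have "Lie2 n (X 0) \<Omega> a b = 0" using Lie2_X[of 0 a b] n_ge assms by simp
  ultimately show ?thesis using assms(3) by (auto simp: in_keys_iff)
qed

definition part :: "complex \<Rightarrow> (nat \<Rightarrow> nat cpoly) \<Rightarrow> nat \<Rightarrow> nat cpoly" where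
  "part \<mu> \<eta> l = pfilter (\<lambda>m. wt m + \<beta> 0 l = \<mu>) (\<eta> l)"

lemma pfilter_Var_mult: "pfilter Q (Var v * p) = Var v * pfilter (\<lambda>m. Q (m + single v 1)) p"
proof -
  have "pfilter Q (p * Var v) = pfilter (\<lambda>m. Q (m + single v 1)) p * Var v"
    by (rule pfilter_mult) (simp add: Var_def)
  then show ?thesis by (simp add: mult.commute)
qed

lemma pfilter_Const_mult: "pfilter Q (Const a * p) = Const a * pfilter Q p"
  by (rule poly_mapping_eqI) (simp add: lookup_pfilter)

lemma part_pdiff: "pdiff a (part \<mu> \<eta> b) = pfilter (\<lambda>m. wt m + \<beta> 0 a + \<beta> 0 b = \<mu>) (pdiff a (\<eta> b))"
  unfolding part_def by (rule pfilter_pdiff[symmetric]) (auto simp: wt_add wt_single algebra_simps)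

lemma d1_part: "d1 (part \<mu> \<eta>) a b = pfilter (\<lambda>m. wt m + \<beta> 0 a + \<beta> 0 b = \<mu>) (d1 \<eta> a b)"
proof -
  have "(\<lambda>m. wt m + \<beta> 0 b + \<beta> 0 a = \<mu>) = (\<lambda>m. wt m + \<beta> 0 a + \<beta> 0 b = \<mu>)"
    by (simp add: add_ac)
  then show ?thesis by (simp add: d1_def part_pdiff pfilter_diff)
qed

lemma pfilter_pairing_X:
  assumes "\<And>i m. i + k \<le> n \<Longrightarrow> Q (m + single (i + k) 1) \<longleftrightarrow> R i m"
  shows "pfilter Q (pairing n (X k) \<gamma>) = pairing n (X k) (\<lambda>i. pfilter (R i) (\<gamma> i))"
  unfolding pairing_def pfilter_sum
proof (rule sum.cong[OF refl])
  fix i assume "i \<in> {..n}"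
  show "pfilter Q (X k i * \<gamma> i) = X k i * pfilter (R i) (\<gamma> i)"
    using assms[of i] by (simp add: shift_field_def mult.assoc pfilter_Const_mult pfilter_Var_mult)
qed

lemma \<beta>_0_add: "\<beta> 0 (i + k) = \<beta> 0 i - 2 * of_nat k"
  by (subst \<beta>_0[of "i + k"], subst \<beta>_0[of i]) (simp add: algebra_simps)

text \<open>R has weight 0 and the field with shift \<open>k\<close> has weight -2k, so each
  defining equation splits into its weight components.\<close>

lemma tangent_part:
  assumes "tangent \<eta>"
  shows "tangent (part \<mu> \<eta>)"
  unfolding tangent_def
proof (intro conjI allI impI)
  fix l assume "l \<le> n"
  then have "\<eta> l \<in> hom_polys n n" using assms by (auto simp: tangent_def)
  then show "part \<mu> \<eta> l \<in> hom_polys n n"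
    by (auto simp: part_def hom_polys_def homogeneous_def keys_pfilter)
next
  have "pairing n (radial n) (part \<mu> \<eta>) = pfilter (\<lambda>m. wt m = \<mu>) (pairing n (radial n) \<eta>)"
    unfolding pairing_def pfilter_sum
  proof (rule sum.cong[OF refl])
    fix i assume "i \<in> {..n}"
    then show "radial n i * part \<mu> \<eta> i = pfilter (\<lambda>m. wt m = \<mu>) (radial n i * \<eta> i)"
      by (simp add: radial_def part_def pfilter_Var_mult wt_add wt_single)
  qed
  then show "pairing n (radial n) (part \<mu> \<eta>) = 0"
    using assms by (simp add: tangent_def)
next
  fix j k assume jk: "j < n - 1" "k < n - 1"
  define Q where "Q = (\<lambda>m. wt m + 2 * of_nat j + 2 * of_nat k = \<mu>)"
  have "pairing n (X j) (\<lambda>a. pairing n (X k) (\<lambda>b. d1 (part \<mu> \<eta>) a b)) =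
      pairing n (X j) (\<lambda>a. pfilter (\<lambda>m. wt m + \<beta> 0 a + 2 * of_nat k = \<mu>) (pairing n (X k) (\<lambda>b. d1 \<eta> a b)))"
    unfolding d1_part
    by (intro pairing_cong refl pfilter_pairing_X[symmetric]) (auto simp: wt_add wt_single \<beta>_0_add algebra_simps)
  also have "\<dots> = pfilter Q (pairing n (X j) (\<lambda>a. pairing n (X k) (\<lambda>b. d1 \<eta> a b)))"
    by (intro pfilter_pairing_X[symmetric]) (auto simp: Q_def wt_add wt_single \<beta>_0_add algebra_simps)
  also have "\<dots> = 0"
    using assms jk by (simp add: tangent_def)
  finally show "pairing n (X j) (\<lambda>a. pairing n (X k) (\<lambda>b. d1 (part \<mu> \<eta>) a b)) = 0" .
qed

text \<open>These are the velocities of the action of GL(n+1) at \<omega>. The linear fields may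
  have a trace, so multiples of \<omega>, being Lie derivatives along multiples of R, are
  included.\<close>

definition trivial :: "(nat \<Rightarrow> nat cpoly) \<Rightarrow> bool" where
  "trivial \<eta> \<longleftrightarrow> (\<exists>v. (\<forall>i\<le>n. v i \<in> hom_polys n 1) \<and> (\<forall>l\<le>n. \<eta> l = Lie1 n v \<omega> l))"

lemma trivial_Const: assumes "trivial \<eta>" shows "trivial (\<lambda>l. Const a * \<eta> l)"
proof -
  obtain v where "\<forall>i\<le>n. v i \<in> hom_polys n 1" "\<forall>l\<le>n. \<eta> l = Lie1 n v \<omega> l"
    using assms unfolding trivial_def by blast
  then show ?thesis
    unfolding trivial_def using hom_polys_Const_mult
    by (intro exI[of _ "\<lambda>i. Const a * v i"]) (auto simp: Lie1_Const)
qed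

lemma trivial_sum:
  assumes "finite A" "\<And>a. a \<in> A \<Longrightarrow> trivial (\<eta> a)"
  shows "trivial (\<lambda>l. \<Sum>a\<in>A. \<eta> a l)"
proof -
  have "\<forall>a\<in>A. \<exists>v. (\<forall>i\<le>n. v i \<in> hom_polys n 1) \<and> (\<forall>l\<le>n. \<eta> a l = Lie1 n v \<omega> l)"
    using assms(2) unfolding trivial_def by blast
  then obtain v where v: "\<And>a i. a \<in> A \<Longrightarrow> i \<le> n \<Longrightarrow> v a i \<in> hom_polys n 1"
    "\<And>a l. a \<in> A \<Longrightarrow> l \<le> n \<Longrightarrow> \<eta> a l = Lie1 n (v a) \<omega> l" by metis
  then show ?thesis
    unfolding trivial_def
    by (intro exI[of _ "\<lambda>i. \<Sum>a\<in>A. v a i"]) (auto simp: Lie1_sum intro!: hom_polys_sum)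
qed

lemma contraction_ker:
  assumes "tangent \<eta>" "j < n - 1" "k < n - 1"
  shows "pairing n (X j) (\<lambda>l. pairing n (X k) (\<lambda>i. d1 \<eta> i l)) = 0"
proof -
  have "pairing n (X j) (\<lambda>l. pairing n (X k) (\<lambda>i. d1 \<eta> i l)) =
      pairing n (X j) (\<lambda>l. pairing n (X k) (\<lambda>i. - d1 \<eta> l i))"
    by (intro pairing_cong refl d1_anti)
  then show ?thesis using assms by (simp add: pairing_uminus_right tangent_def)
qed

lemma d1_hom: "a \<le> n \<Longrightarrow> b \<le> n \<Longrightarrow> \<gamma> a \<in> hom_polys n n \<Longrightarrow> \<gamma> b \<in> hom_polys n n \<Longrightarrow> d1 \<gamma> a b \<in> hom_polys n (n - 1)"
  using n_ge unfolding d1_def by (intro hom_polys_diff hom_polys_pdiff) auto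

lemma contraction_hom:
  assumes "tangent \<eta>" "l \<le> n"
  shows "pairing n (X k) (\<lambda>i. d1 \<eta> i l) \<in> hom_polys n n"
  unfolding pairing_def
proof (rule hom_polys_sum)
  fix i assume "i \<in> {..n}"
  then have "X k i * d1 \<eta> i l \<in> hom_polys n (1 + (n - 1))"
    using assms by (intro hom_polys_mult shift_field_hom d1_hom) (auto simp: tangent_def)
  then show "X k i * d1 \<eta> i l \<in> hom_polys n n" using n_ge by simp
qed

text \<open>Cartan's formula gives \<mu> \<eta> = \<gamma> + dF with \<gamma> = i_(X_0) d\<eta> and
  F = i_(X_0) \<eta>. Division writes \<gamma> as a contraction i_v \<Omega>, and contracting with R
  identifies (n+1) F with i_v \<omega>. Together (n+1) \<mu> \<eta> is the Lie derivative of
  \<omega> along v.\<close>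

lemma trivial_nonzero_weight:
  assumes T: "tangent \<eta>" and \<mu>: "\<mu> \<noteq> 0" and w: "\<And>l m. l \<le> n \<Longrightarrow> m \<in> keys (\<eta> l) \<Longrightarrow> wt m + \<beta> 0 l = \<mu>"
  shows "trivial \<eta>"
proof -
  have hom: "\<eta> l \<in> hom_polys n n" if "l \<le> n" for l
    using T that by (auto simp: tangent_def)
  define \<gamma> where "\<gamma> l = pairing n (X 0) (\<lambda>i. d1 \<eta> i l)" for l
  define F where "F = pairing n (X 0) \<eta>"
  have lie: "Const \<mu> * \<eta> l = \<gamma> l + pdiff l F" if "l \<le> n" for l
  proof -
    have "Lie1 n (X 0) \<eta> l = Const \<mu> * \<eta> l"
    proof (rule poly_mapping_eqI)
      fix m
      show "lookup (Lie1 n (X 0) \<eta> l) m = lookup (Const \<mu> * \<eta> l) m"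
        using lookup_Lie1_X0[of \<eta> l m] hom[OF that] that w[OF that, of m]
        by (cases "m \<in> keys (\<eta> l)") (auto simp: hom_polys_iff in_keys_iff)
    qed
    then show ?thesis by (simp add: cartan1 \<gamma>_def F_def)
  qed
  have \<gamma>_hom: "\<gamma> l \<in> hom_polys n n" if "l \<le> n" for l
    unfolding \<gamma>_def by (rule contraction_hom[OF T that])
  have "\<exists>v. (\<forall>l\<le>n. \<gamma> l = contract v l) \<and> (\<forall>i. \<forall>m\<in>keys (v i). mon_degree m = 1 \<and> keys m \<subseteq> {..n})"
  proof (rule division_filtered)
    show "pairing n (X k) \<gamma> = 0" if "k < n - 1" for k
      unfolding \<gamma>_def using that n_ge by (intro contraction_ker[OF T]) auto
    show "mon_degree m = n \<and> keys m \<subseteq> {..n}" if "l \<le> n" "m \<in> keys (\<gamma> l)" for l m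
      using \<gamma>_hom[OF that(1)] that(2) by (auto simp: hom_polys_def homogeneous_def)
    show "(mon_degree (m + m') = n \<and> keys (m + m') \<subseteq> {..n}) \<longleftrightarrow> (mon_degree m = 1 \<and> keys m \<subseteq> {..n})"
      if "i \<le> n" "l \<le> n" "m' \<in> keys (\<Omega> i l)" for i l m m'
    proof -
      have "mon_degree m' = n - 1" "keys m' \<subseteq> {..n}"
        using \<Omega>_hom[OF that(1,2)] that(3) by (auto simp: hom_polys_def homogeneous_def)
      then show ?thesis using n_ge by (auto simp: mon_degree_add keys_add_nat)
    qed
  qed
  then obtain v where v: "\<And>l. l \<le> n \<Longrightarrow> \<gamma> l = contract v l" and vhom: "\<And>i. v i \<in> hom_polys n 1"
    unfolding hom_polys_def homogeneous_def by blast
  have "F \<in> hom_polys n (1 + n)"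
    unfolding F_def pairing_def by (intro hom_polys_sum hom_polys_mult shift_field_hom hom) auto
  then have RF: "pairing n (radial n) (\<lambda>l. pdiff l F) = of_nat (1 + n) * F"
    by (rule pairing_radial_pdiff)
  have "pairing n (radial n) \<gamma> = pairing n (radial n) (contract v)"
    using v by (intro pairing_cong) auto
  also have "\<dots> = - pairing n v \<omega>"
    unfolding \<omega>_def by (rule pairing_swap) (rule \<Omega>_anti)
  finally have R\<gamma>: "pairing n (radial n) \<gamma> = - pairing n v \<omega>" .
  have "pairing n (radial n) (\<lambda>l. Const \<mu> * \<eta> l) = pairing n (radial n) (\<lambda>l. \<gamma> l + pdiff l F)"
    using lie by (intro pairing_cong) auto
  then have F: "of_nat (1 + n) * F = pairing n v \<omega>"
    using T by (simp add: pairing_mult_right pairing_add_right RF R\<gamma> tangent_def)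
  have "Lie1 n v \<omega> l = Const (of_nat (1 + n) * \<mu>) * \<eta> l" if l: "l \<le> n" for l
  proof -
    have "pairing n v (\<lambda>i. d1 \<omega> i l) = pairing n v (\<lambda>i. of_nat (n + 1) * \<Omega> i l)"
      using l d1_\<omega> by (intro pairing_cong) auto
    also have "\<dots> = of_nat (1 + n) * \<gamma> l"
      using v[OF l] by (simp add: pairing_mult_right)
    finally have A: "pairing n v (\<lambda>i. d1 \<omega> i l) = of_nat (1 + n) * \<gamma> l" .
    have "Lie1 n v \<omega> l = of_nat (1 + n) * \<gamma> l + pdiff l (of_nat (1 + n) * F)"
      by (simp only: cartan1 A F)
    also have "\<dots> = of_nat (1 + n) * (\<gamma> l + pdiff l F)"
      by (simp only: pdiff_mult pdiff_of_nat mult_zero_left add_0_left distrib_left)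
    finally show ?thesis
      unfolding lie[OF l, symmetric] by (simp add: Const_mult Const_of_nat mult.assoc del: of_nat_Suc of_nat_add)
  qed
  then have "trivial (\<lambda>l. Const (of_nat (1 + n) * \<mu>) * \<eta> l)"
    unfolding trivial_def using vhom by metis
  then have "trivial (\<lambda>l. Const (1 / (of_nat (1 + n) * \<mu>)) * (Const (of_nat (1 + n) * \<mu>) * \<eta> l))"
    by (rule trivial_Const)
  moreover have "1 / (of_nat (1 + n) * \<mu>) * (of_nat (1 + n) * \<mu>) = 1"
    using \<mu> of_nat_neq_0[of n, where 'a = complex] by (simp del: of_nat_Suc of_nat_add)
  then have "Const (1 / (of_nat (1 + n) * \<mu>)) * (Const (of_nat (1 + n) * \<mu>) * \<eta> l) = \<eta> l" for l
    by (simp only: mult.assoc[symmetric] Const_mult[symmetric] Const_1 mult_1)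
  ultimately show ?thesis by (simp only:)
qed

end

context deformation_setup
begin

text \<open>Contraction with X_k lowers the weight by 2k, so the quotient field may be taken linear
  with the weight of a shift by \<open>k\<close>. The eigenvalues \<open>\<beta> 0 i\<close> are
  distinct and equidistant, which leaves the single monomial z_(i+k) in component i.\<close>

lemma weight_zero_contractions:
  assumes T: "tangent \<eta>" and w: "\<And>l m. l \<le> n \<Longrightarrow> m \<in> keys (\<eta> l) \<Longrightarrow> wt m + \<beta> 0 l = 0" and k: "k < n - 1"
  shows "\<exists>d. \<forall>l\<le>n. pairing n (X k) (\<lambda>i. d1 \<eta> i l) = contract (shift_field n k d) l"
proof -
  have "part 0 \<eta> l = \<eta> l" if "l \<le> n" for l
    unfolding part_def using w[OF that] by (rule pfilter_id)
  then have d1w: "d1 \<eta> a b = pfilter (\<lambda>m. wt m + \<beta> 0 a + \<beta> 0 b = 0) (d1 \<eta> a b)" if "a \<le> n" "b \<le> n" for a b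
    using d1_part[of 0 \<eta> a b] that by (simp add: d1_def)
  define \<gamma> where "\<gamma> l = pairing n (X k) (\<lambda>i. d1 \<eta> i l)" for l
  have \<gamma>w: "\<gamma> l = pfilter (\<lambda>m. wt m + \<beta> 0 l + 2 * of_nat k = 0) (\<gamma> l)" if l: "l \<le> n" for l
  proof -
    have "\<gamma> l = pairing n (X k) (\<lambda>i. pfilter (\<lambda>m. wt m + \<beta> 0 i + \<beta> 0 l = 0) (d1 \<eta> i l))"
      unfolding \<gamma>_def using l by (intro pairing_cong refl d1w)
    also have "\<dots> = pfilter (\<lambda>m. wt m + \<beta> 0 l + 2 * of_nat k = 0) (\<gamma> l)"
      unfolding \<gamma>_def
      by (intro pfilter_pairing_X[symmetric]) (auto simp: wt_add wt_single \<beta>_0_add algebra_simps)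
    finally show ?thesis .
  qed
  have "\<exists>v. (\<forall>l\<le>n. \<gamma> l = contract v l) \<and> (\<forall>i. \<forall>m\<in>keys (v i). mon_degree m = 1 \<and> keys m \<subseteq> {..n} \<and> wt m + 2 * of_nat k = \<beta> 0 i)"
  proof (rule division_filtered)
    show "pairing n (X j) \<gamma> = 0" if "j < n - 1" for j
      unfolding \<gamma>_def using that k by (intro contraction_ker[OF T]) auto
    show "mon_degree m = n \<and> keys m \<subseteq> {..n} \<and> wt m + \<beta> 0 l + 2 * of_nat k = 0"
      if l: "l \<le> n" and m: "m \<in> keys (\<gamma> l)" for l m
    proof -
      have "\<gamma> l \<in> hom_polys n n" unfolding \<gamma>_def by (rule contraction_hom[OF T l])
      moreover have "m \<in> keys (pfilter (\<lambda>m. wt m + \<beta> 0 l + 2 * of_nat k = 0) (\<gamma> l))"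
        using \<gamma>w[OF l] m by simp
      ultimately show ?thesis
        using m by (auto simp: hom_polys_def homogeneous_def keys_pfilter)
    qed
    show "(mon_degree (m + m') = n \<and> keys (m + m') \<subseteq> {..n} \<and> wt (m + m') + \<beta> 0 l + 2 * of_nat k = 0) \<longleftrightarrow>
        (mon_degree m = 1 \<and> keys m \<subseteq> {..n} \<and> wt m + 2 * of_nat k = \<beta> 0 i)"
      if "i \<le> n" "l \<le> n" "m' \<in> keys (\<Omega> i l)" for i l m m'
    proof -
      have m': "mon_degree m' = n - 1" "keys m' \<subseteq> {..n}"
        using \<Omega>_hom[OF that(1,2)] that(3) by (auto simp: hom_polys_def homogeneous_def)
      have "wt (m + m') + \<beta> 0 l + 2 * of_nat k = (wt m + 2 * of_nat k - \<beta> 0 i) + (wt m' + \<beta> 0 i + \<beta> 0 l)"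
        by (simp add: wt_add)
      then have "wt (m + m') + \<beta> 0 l + 2 * of_nat k = 0 \<longleftrightarrow> wt m + 2 * of_nat k = \<beta> 0 i"
        using wt_\<Omega>[OF that] by (auto simp: diff_add_eq)
      moreover have "mon_degree (m + m') = n \<longleftrightarrow> mon_degree m = 1"
        using m'(1) n_ge by (auto simp: mon_degree_add)
      ultimately show ?thesis using m'(2) by (auto simp: keys_add_nat)
    qed
  qed
  then obtain v where v: "\<And>l. l \<le> n \<Longrightarrow> \<gamma> l = contract v l"
    and vk: "\<And>i m. m \<in> keys (v i) \<Longrightarrow> mon_degree m = 1 \<and> keys m \<subseteq> {..n} \<and> wt m + 2 * of_nat k = \<beta> 0 i"
    by blast
  have "v i = shift_field n k (\<lambda>i. lookup (v i) (single (i + k) 1)) i" for i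
  proof -
    have m: "m = single (i + k) 1 \<and> i + k \<le> n" if m: "m \<in> keys (v i)" for m
    proof -
      note * = vk[OF m]
      then obtain j where j: "m = single j 1" using mon_degree_1_iff[of m] by (elim conjE iffD1[THEN exE]) auto
      then have "\<beta> 0 j + 2 * of_nat k = \<beta> 0 i" "j \<le> n"
        using * by (auto simp: wt_single)
      then have "(of_nat j :: complex) = of_nat (i + k)"
      proof -
        have "2 * (of_nat j :: complex) = 2 * of_nat (i + k)"
          using \<open>\<beta> 0 j + 2 * of_nat k = \<beta> 0 i\<close> unfolding \<beta>_0[of i] \<beta>_0[of j] by (simp add: algebra_simps)
        then show ?thesis by (metis mult_left_cancel zero_neq_numeral)
      qed
      then have "j = i + k" using of_nat_eq_iff by blast
      then show ?thesis using j \<open>j \<le> n\<close> by simp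
    qed
    show ?thesis
    proof (cases "i + k \<le> n")
      case False
      then have "keys (v i) = {}" using m by blast
      then show ?thesis using False by (simp add: shift_field_def)
    next
      case True
      have "v i = Const (lookup (v i) (single (i + k) 1)) * Var (i + k)"
      proof (rule poly_mapping_eqI)
        fix m'
        show "lookup (v i) m' = lookup (Const (lookup (v i) (single (i + k) 1)) * Var (i + k)) m'"
          using m[of m'] by (cases "m' \<in> keys (v i)") (auto simp: Var_def lookup_single when_def in_keys_iff)
      qed
      then show ?thesis using True by (simp add: shift_field_def)
    qed
  qed
  then have "v = shift_field n k (\<lambda>i. lookup (v i) (single (i + k) 1))" by blast
  then show ?thesis using v unfolding \<gamma>_def by metis
qed

text \<open>The family \<open>X\<^sub>k \<mapsto> Z\<^sub>k\<close> is a cocycle modulo the kernel of \<open>\<Omega>\<close>.\<close>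

lemma cocycle:
  assumes anti: "\<And>a b. \<theta> a b = - \<theta> b a" and closed: "\<And>a b e. d2 \<theta> a b e = 0"
    and contr: "\<forall>k<n - 1. \<forall>l\<le>n. pairing n (X k) (\<lambda>i. \<theta> i l) = contract (shift_field n k (C k)) l"
    and ij: "i < n - 1" "j < n - 1"
  shows "\<exists>\<alpha>. \<forall>m. m + i + j \<le> n \<longrightarrow>
      \<beta> i (m + j) * C j m - \<beta> i m * C j (m + i) + (C i (m + j) * \<beta> j m - C i m * \<beta> j (m + i))
        - (if i + j < n - 1 then g i j * C (i + j) m else 0)
      = (if i + j < n - 1 then \<alpha> * \<beta> (i + j) m else 0)"
proof -
  let ?Z = "\<lambda>k. shift_field n k (C k)"
  have Z: "pairing n (X k) (\<lambda>i. \<theta> i l) = contract (?Z k) l" if "k < n - 1" "l \<le> n" for k l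
    using contr that by blast
  define e where "e m = \<beta> i (m + j) * C j m - \<beta> i m * C j (m + i) + (C i (m + j) * \<beta> j m - C i m * \<beta> j (m + i))
        - (if i + j < n - 1 then g i j * C (i + j) m else 0)" for m
  have "contract (shift_field n (i + j) e) l = 0" if l: "l \<le> n" for l
  proof -
    \<comment> \<open>The contraction with X_j of the Lie derivative of \<theta> along X_i is
      computed twice. First, both \<theta> and \<Omega> are closed, so this Lie derivative equals
      that of \<Omega> along Z_i.\<close>
    have "Lie2 n (X i) \<theta> a b = Lie2 n (?Z i) \<Omega> a b" if "a \<le> n" "b \<le> n" for a b
    proof -
      have "Lie2 n (X i) \<theta> a b = d1 (\<lambda>l. pairing n (X i) (\<lambda>i. \<theta> i l)) a b"
        using cartan2[where B = \<theta>, OF anti] by (simp add: closed)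
      also have "\<dots> = d1 (contract (?Z i)) a b"
        using Z[OF ij(1)] that by (simp add: d1_def)
      finally show ?thesis using cartan2_\<Omega>[OF that] by simp
    qed
    then have "pairing n (X j) (\<lambda>a. Lie2 n (X i) \<theta> a l) = pairing n (X j) (\<lambda>a. Lie2 n (?Z i) \<Omega> a l)"
      using l by (intro pairing_cong) auto
    also have "\<dots> = Lie1 n (?Z i) (contract (X j)) l - contract (lie_bracket n (?Z i) (X j)) l"
      by (rule cartan_commutator)
    also have "Lie1 n (?Z i) (contract (X j)) l = Lie1 n (?Z i) (\<lambda>_. 0) l"
      using contract_X[OF ij(2)] l by (intro Lie1_cong) auto
    finally have 1: "pairing n (X j) (\<lambda>a. Lie2 n (X i) \<theta> a l) = - contract (lie_bracket n (?Z i) (X j)) l"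
      by (simp add: Lie1_def)
    \<comment> \<open>Second, the commutator rule is applied to \<theta> itself. Equating both
      results puts [X_i, Z_j] + [Z_i, X_j] - g_ij Z_(i+j) into the kernel of \<Omega>.\<close>
    have "pairing n (X j) (\<lambda>a. Lie2 n (X i) \<theta> a l) =
        Lie1 n (X i) (\<lambda>l. pairing n (X j) (\<lambda>i. \<theta> i l)) l - pairing n (lie_bracket n (X i) (X j)) (\<lambda>a. \<theta> a l)"
      by (rule cartan_commutator)
    also have "Lie1 n (X i) (\<lambda>l. pairing n (X j) (\<lambda>i. \<theta> i l)) l = Lie1 n (X i) (contract (?Z j)) l"
      using Z[OF ij(2)] l by (intro Lie1_cong) auto
    also have "\<dots> = contract (lie_bracket n (X i) (?Z j)) l"
    proof -
      have "pairing n (?Z j) (\<lambda>a. Lie2 n (X i) \<Omega> a l) = pairing n (?Z j) (\<lambda>a. 0)"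
        using Lie2_X[OF ij(1)] l by (intro pairing_cong) auto
      then show ?thesis using cartan_commutator[of n "?Z j" "X i" \<Omega> l] by simp
    qed
    also have "pairing n (lie_bracket n (X i) (X j)) (\<lambda>a. \<theta> a l) =
        contract (\<lambda>m. if i + j < n - 1 then Const (g i j) * ?Z (i + j) m else 0) l"
    proof (cases "i + j < n - 1")
      case True
      have "pairing n (lie_bracket n (X i) (X j)) (\<lambda>a. \<theta> a l) = pairing n (\<lambda>m. Const (g i j) * X (i + j) m) (\<lambda>a. \<theta> a l)"
        using bracket_X[OF ij] True by (intro pairing_cong) auto
      then show ?thesis using True Z[OF True l] by (simp add: pairing_mult)
    next
      case False
      have "pairing n (lie_bracket n (X i) (X j)) (\<lambda>a. \<theta> a l) = pairing n (\<lambda>m. 0) (\<lambda>a. \<theta> a l)"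
        using bracket_X[OF ij] False by (intro pairing_cong) auto
      then show ?thesis using False by simp
    qed
    finally have 2: "pairing n (X j) (\<lambda>a. Lie2 n (X i) \<theta> a l) = contract (lie_bracket n (X i) (?Z j)) l -
        contract (\<lambda>m. if i + j < n - 1 then Const (g i j) * ?Z (i + j) m else 0) l" .
    have 3: "contract (\<lambda>m. lie_bracket n (X i) (?Z j) m + lie_bracket n (?Z i) (X j) m -
        (if i + j < n - 1 then Const (g i j) * ?Z (i + j) m else 0)) l = 0"
    proof -
      have "A + B - D = 0" if "- B = A - D" for A B D :: "nat cpoly"
      proof -
        have "A + B - D = (A - D) + B" by simp
        then show ?thesis unfolding that[symmetric] by simp
      qed
      from this[OF trans[OF 1[symmetric] 2]] show ?thesis
        by (simp only: pairing_diff pairing_add)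
    qed
    have "contract (shift_field n (i + j) e) l =
        contract (\<lambda>m. lie_bracket n (X i) (?Z j) m + lie_bracket n (?Z i) (X j) m -
        (if i + j < n - 1 then Const (g i j) * ?Z (i + j) m else 0)) l"
    proof (rule pairing_cong[OF _ refl])
      fix m assume m: "m \<le> n"
      have z: "(if i + j < n - 1 then Const (g i j) * ?Z (i + j) m else 0) =
          shift_field n (i + j) (\<lambda>m. if i + j < n - 1 then g i j * C (i + j) m else 0) m"
        by (simp add: shift_field_def Const_mult mult.assoc)
      show "shift_field n (i + j) e m = lie_bracket n (X i) (?Z j) m + lie_bracket n (?Z i) (X j) m -
        (if i + j < n - 1 then Const (g i j) * ?Z (i + j) m else 0)"
        unfolding z lie_bracket_shift[OF m] shift_field_add shift_field_diff e_def ..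
    qed
    then show ?thesis using 3 by simp
  qed
  from kernel_shift[OF this] show ?thesis
    unfolding e_def by (simp add: add.assoc)
qed

text \<open>Equal kernels make the forms proportional over the rational functions. The numerator
  \<open>\<theta> 0 1\<close> must absorb the whole power z_n^(n-1) of \<open>\<Omega> 0 1\<close>,
  and for degree reasons the quotient is constant.\<close>

lemma proportional:
  assumes anti: "\<And>a b. \<theta> a b = - \<theta> b a"
    and hom: "\<theta> 0 1 \<in> hom_polys n (n - 1)"
    and ker: "\<And>k l. k < n - 1 \<Longrightarrow> l \<le> n \<Longrightarrow> pairing n (X k) (\<lambda>i. \<theta> i l) = 0"
  shows "\<exists>e. \<forall>a\<le>n. \<forall>b\<le>n. \<theta> a b = Const e * \<Omega> a b"
proof -
  have quot: "\<Omega> 0 1 * \<theta> a b = \<theta> 0 1 * \<Omega> a b" if "a \<le> n" "b \<le> n" for a b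
  proof -
    have "\<Omega> 0 1 * \<theta> a b - \<theta> 0 1 * \<Omega> a b = 0"
    proof (rule tensor_eq_0[of "\<lambda>a b. \<Omega> 0 1 * \<theta> a b - \<theta> 0 1 * \<Omega> a b", OF _ _ _ that])
      fix i j
      show "\<Omega> 0 1 * \<theta> i j - \<theta> 0 1 * \<Omega> i j = - (\<Omega> 0 1 * \<theta> j i - \<theta> 0 1 * \<Omega> j i)"
        by (subst anti[of i j], subst \<Omega>_anti[of i j]) simp
    next
      fix k l assume "k < n - 1" "l \<le> n"
      then show "pairing n (X k) (\<lambda>i. \<Omega> 0 1 * \<theta> i l - \<theta> 0 1 * \<Omega> i l) = 0"
        using ker contract_X by (simp add: pairing_diff_right pairing_mult_right)
    qed (simp add: mult.commute)
    then show ?thesis by simp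
  qed
  have "\<exists>q. \<theta> 0 1 = Var n ^ m * q" if "m \<le> n - 1" for m
    using that
  proof (induction m)
    case (Suc m)
    then obtain q where q: "\<theta> 0 1 = Var n ^ m * q" by auto
    define r where "r = n - 1 - Suc m"
    have r: "n - 1 = m + Suc r" using Suc.prems by (simp add: r_def)
    \<comment> \<open>The entry (0, n) of the proportionality: \<open>\<Omega> 0 n\<close> is
      nonzero modulo z_n, so as long as a factor z_n is left on the other side, it divides
      \<open>q\<close>.\<close>
    have "Var n ^ m * (Const c * Var n ^ Suc r * \<theta> 0 n) = Var n ^ m * (q * \<Omega> 0 n)"
      using quot[of 0 n] unfolding \<Omega>_01 q r by (simp add: power_add mult_ac)
    then have "Const c * Var n ^ Suc r * \<theta> 0 n = q * \<Omega> 0 n" by simp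
    then have "kill {n} (Const c * Var n ^ Suc r * \<theta> 0 n) = kill {n} (q * \<Omega> 0 n)" by simp
    then have "kill {n} q * (Const c' * Var (n - 1) ^ (n - 1)) = 0"
      by (simp add: kill_mult kill_Var \<Omega>_0n)
    then have "kill {n} q = 0" using c'_nz by simp
    from kill_eq_0_dvd[OF this] obtain q' where "q = Var n * q'" ..
    then have "\<theta> 0 1 = Var n ^ Suc m * q'" using q by (simp add: mult_ac)
    then show ?case ..
  qed auto
  then obtain q where q: "\<theta> 0 1 = Var n ^ (n - 1) * q" by auto
  define Q where "Q = (\<lambda>m::nat \<Rightarrow>\<^sub>0 nat. mon_degree m = n - 1)"
  have "\<theta> 0 1 = pfilter Q (q * Var n ^ (n - 1))"
    using hom q by (subst pfilter_id) (auto simp: Q_def hom_polys_def homogeneous_def mult.commute)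
  also have "\<dots> = pfilter (\<lambda>m. m = 0) q * Var n ^ (n - 1)"
  proof (rule pfilter_mult)
    fix m m' :: "nat \<Rightarrow>\<^sub>0 nat" assume "m' \<in> keys (Var n ^ (n - 1))"
    then have "mon_degree m' = n - 1"
      by (auto simp: Var_power mon_degree_single split: if_splits)
    moreover have "mon_degree m = 0 \<longleftrightarrow> m = 0"
      by (auto simp: mon_degree_def in_keys_iff intro!: poly_mapping_eqI)
    ultimately show "Q (m + m') \<longleftrightarrow> m = 0" by (auto simp: Q_def mon_degree_add)
  qed
  also have "pfilter (\<lambda>m. m = 0) q = Const (lookup q 0)"
    by (rule poly_mapping_eqI) (simp add: lookup_pfilter lookup_Const)
  finally have 01: "\<theta> 0 1 = Const (lookup q 0) * Var n ^ (n - 1)" .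
  have "\<theta> a b = Const (lookup q 0 / c) * \<Omega> a b" if "a \<le> n" "b \<le> n" for a b
  proof -
    have "Var n ^ (n - 1) * (Const c * \<theta> a b) = Var n ^ (n - 1) * (Const (lookup q 0) * \<Omega> a b)"
      using quot[OF that] unfolding \<Omega>_01 01 by (simp add: mult_ac)
    then have "Const c * \<theta> a b = Const (lookup q 0) * \<Omega> a b" by simp
    then have "Const (1 / c) * (Const c * \<theta> a b) = Const (1 / c) * (Const (lookup q 0) * \<Omega> a b)" by simp
    then show ?thesis
      using c_nz by (simp add: Const_1 flip: mult.assoc Const_mult)
  qed
  then show ?thesis by blast
qed

lemma Lie2_hom:
  assumes "\<And>i. i \<le> n \<Longrightarrow> v i \<in> hom_polys n 1" "a \<le> n" "b \<le> n"
  shows "Lie2 n v \<Omega> a b \<in> hom_polys n (n - 1)"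
  unfolding Lie2_def
proof (rule hom_polys_sum)
  fix k assume k: "k \<in> {..n}"
  have "\<Omega> a b \<in> hom_polys n (Suc (n - 2))" using \<Omega>_hom assms n_ge by (metis One_nat_def Suc_diff_Suc numeral_2_eq_2 Suc_le_lessD Suc_leD numeral_3_eq_3)
  then have "v k * pdiff k (\<Omega> a b) \<in> hom_polys n (1 + (n - 2))"
    using assms k by (intro hom_polys_mult hom_polys_pdiff) auto
  then have 1: "v k * pdiff k (\<Omega> a b) \<in> hom_polys n (n - 1)"
  proof -
    have "1 + (n - 2) = n - 1" using n_ge by linarith
    then show ?thesis using \<open>v k * pdiff k (\<Omega> a b) \<in> hom_polys n (1 + (n - 2))\<close> by (simp only:)
  qed
  have "pdiff x (v k) * \<Omega> y z \<in> hom_polys n (0 + (n - 1))" if "y \<le> n" "z \<le> n" for x y z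
    using assms k that \<Omega>_hom by (intro hom_polys_mult hom_polys_pdiff) auto
  then show "v k * pdiff k (\<Omega> a b) + pdiff a (v k) * \<Omega> k b + pdiff b (v k) * \<Omega> a k \<in> hom_polys n (n - 1)"
    using 1 assms k by (intro hom_polys_add) auto
qed

text \<open>The contraction with X_0 is first shown to vanish, then \<open>rigidity\<close> supplies
  a diagonal field whose Lie derivative of \<Omega> has the same contractions with all fields as
  d\<eta>. The difference is a constant multiple of \<Omega>, and contracting with R returns to
  \<eta>.\<close>

lemma trivial_zero_weight:
  assumes T: "tangent \<eta>" and w: "\<And>l m. l \<le> n \<Longrightarrow> m \<in> keys (\<eta> l) \<Longrightarrow> wt m + \<beta> 0 l = 0"
  shows "trivial \<eta>"
proof -
  have hom: "\<eta> l \<in> hom_polys n n" if "l \<le> n" for l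
    using T that by (auto simp: tangent_def)
  let ?\<theta> = "d1 \<eta>"
  have "\<forall>k. \<exists>d. k < n - 1 \<longrightarrow> (\<forall>l\<le>n. pairing n (X k) (\<lambda>i. ?\<theta> i l) = contract (shift_field n k d) l)"
    using weight_zero_contractions[OF T w] by blast
  then obtain C where C: "\<And>k l. k < n - 1 \<Longrightarrow> l \<le> n \<Longrightarrow>
      pairing n (X k) (\<lambda>i. ?\<theta> i l) = contract (shift_field n k (C k)) l"
    by metis
  have "\<forall>k<n - 1. \<forall>l\<le>n. pairing n (X k) (\<lambda>i. ?\<theta> i l) = contract (shift_field n k (C k)) l"
    using C by blast
  note coc = cocycle[of ?\<theta> C, OF d1_anti d2_d1 this]
  have n01: "0 < n - 1" "1 < n - 1" using n_ge by auto
  \<comment> \<open>In the cocycle relation for the shifts 0 and 1 the terms with \<open>C 1\<close>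
    cancel because \<open>g 0 1 = - 2\<close>. So \<open>C 0\<close> is affine in the index, and Z_0
    is a combination of R and X_0.\<close>
  have "\<exists>\<alpha>. \<forall>m. m + 1 \<le> n \<longrightarrow> C 0 (m + 1) - C 0 m = \<alpha>"
  proof -
    have b1: "\<beta> 0 (m + 1) * \<beta> 1 m - \<beta> 0 m * \<beta> 1 (m + 0) = g 0 1 * \<beta> 1 m" if "m + 1 \<le> n" for m
      using bracket[of 0 1 m] n01 that by simp
    have g01: "g 0 1 = - 2"
      using b1[of 0] n_ge \<beta>_0[of 1] by (simp add: \<beta>_1 \<beta>_1[of 0, unfolded One_nat_def])
    obtain \<alpha> where \<alpha>: "\<And>m. m + 0 + 1 \<le> n \<Longrightarrow>
        \<beta> 0 (m + 1) * C 1 m - \<beta> 0 m * C 1 (m + 0) + (C 0 (m + 1) * \<beta> 1 m - C 0 m * \<beta> 1 (m + 0))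
        - g 0 1 * C 1 m = \<alpha> * \<beta> 1 m"
      using coc[OF n01] n01(2) by auto
    have "C 0 (m + 1) - C 0 m = \<alpha>" if "m + 1 \<le> n" for m
    proof -
      have b: "\<beta> 0 m = \<beta> 0 (m + 1) + 2" using \<beta>_0_add[of m 1] by simp
      show ?thesis
        using \<alpha>[of m] that by (simp add: b \<beta>_1 g01 algebra_simps del: One_nat_def)
    qed
    then show ?thesis by blast
  qed
  then obtain \<alpha> where \<alpha>: "\<And>m. m + 1 \<le> n \<Longrightarrow> C 0 (m + 1) = C 0 m + \<alpha>" by (metis add.commute diff_add_cancel)
  have C0: "C 0 m = C 0 0 + of_nat m * \<alpha>" if "m \<le> n" for m
    using that
  proof (induction m)
    case (Suc m)
    then show ?case using \<alpha>[of m] by (simp add: algebra_simps)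
  qed simp
  \<comment> \<open>The coefficient of R in Z_0; the X_0-part, with coefficient -\<alpha>/2, is in
    the kernel of \<Omega>.\<close>
  define a where "a = C 0 0 + \<alpha> / 2 * \<beta> 0 0"
  have X0: "pairing n (X 0) (\<lambda>i. ?\<theta> i l) = Const a * \<omega> l" if l: "l \<le> n" for l
  proof -
    have "contract (shift_field n 0 (C 0)) l = contract (\<lambda>i. Const a * radial n i + Const (- \<alpha> / 2) * X 0 i) l"
    proof (rule pairing_cong[OF _ refl])
      fix i assume i: "i \<le> n"
      have "C 0 i = a + (- \<alpha> / 2) * \<beta> 0 i"
        by (subst \<beta>_0[of i]) (simp add: C0[OF i] a_def field_simps)
      then show "shift_field n 0 (C 0) i = Const a * radial n i + Const (- \<alpha> / 2) * X 0 i"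
        using i by (simp only: shift_field_def radial_def add_0_right if_True Const_add Const_mult distrib_right mult.assoc)
    qed
    also have "\<dots> = Const a * \<omega> l"
      using contract_X[OF n01(1) l] by (simp add: pairing_add pairing_mult \<omega>_def)
    finally show ?thesis using C[OF n01(1) l] by simp
  qed
  \<comment> \<open>In weight 0 Cartan's formula reads 0 = a \<omega> + dF, so a \<omega> is closed,
    whereas \<omega> is not.\<close>
  have "Const a * d1 \<omega> 0 1 = 0"
  proof -
    define F where "F = pairing n (X 0) \<eta>"
    have "Const a * \<omega> l = - pdiff l F" if l: "l \<le> n" for l
    proof -
      have "Lie1 n (X 0) \<eta> l = 0"
      proof (rule poly_mapping_eqI)
        fix m
        show "lookup (Lie1 n (X 0) \<eta> l) m = lookup 0 m"
          using lookup_Lie1_X0[of \<eta> l m] hom[OF l] l w[OF l, of m]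
          by (cases "m \<in> keys (\<eta> l)") (auto simp: hom_polys_iff in_keys_iff)
      qed
      then show ?thesis
        using X0[OF l] by (simp add: cartan1 F_def eq_neg_iff_add_eq_0)
    qed
    then have "d1 (\<lambda>l. Const a * \<omega> l) 0 1 = d1 (\<lambda>l. - pdiff l F) 0 1"
      using n_ge by (simp add: d1_def)
    also have "\<dots> = 0"
      using pdiff_commute[of 0 1 F] by (simp add: d1_def pdiff_uminus)
    finally show ?thesis by (simp add: d1_def pdiff_mult right_diff_distrib)
  qed
  then have "a = 0" using d1_\<omega>_01 by simp
  then have X0': "pairing n (X 0) (\<lambda>i. ?\<theta> i l) = 0" if "l \<le> n" for l
    using X0[OF that] by simp
  have "\<exists>d. \<forall>k. 1 \<le> k \<and> k < n - 1 \<longrightarrow>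
      (\<exists>\<epsilon>. \<forall>m. m + k \<le> n \<longrightarrow> C k m = \<epsilon> * \<beta> k m - (d (m + k) - d m) * \<beta> k m)"
    by (rule rigidity) (use coc in auto)
  then obtain d where d: "\<And>k. 1 \<le> k \<Longrightarrow> k < n - 1 \<Longrightarrow>
      \<exists>\<epsilon>. \<forall>m. m + k \<le> n \<longrightarrow> C k m = \<epsilon> * \<beta> k m - (d (m + k) - d m) * \<beta> k m" by blast
  define v where "v = shift_field n 0 d"
  have vhom: "v i \<in> hom_polys n 1" if "i \<le> n" for i
    unfolding v_def by (rule shift_field_hom[OF that])
  define \<theta>' where "\<theta>' a b = ?\<theta> a b - Lie2 n v \<Omega> a b" for a b
  have ker: "pairing n (X k) (\<lambda>i. \<theta>' i l) = 0" if k: "k < n - 1" and l: "l \<le> n" for k l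
  proof -
    have L: "Lie1 n v (contract (X k)) l = Lie1 n v (\<lambda>_. 0) l"
      using contract_X[OF k] l by (intro Lie1_cong) auto
    have e: "pairing n (X k) (\<lambda>i. \<theta>' i l) = pairing n (X k) (\<lambda>i. ?\<theta> i l) + contract (lie_bracket n v (X k)) l"
      unfolding \<theta>'_def pairing_diff_right cartan_commutator L by (simp add: Lie1_def)
    have b: "lie_bracket n v (X k) i = shift_field n k (\<lambda>m. (d (m + k) - d m) * \<beta> k m) i" if "i \<le> n" for i
      unfolding v_def lie_bracket_shift[OF that] by (simp add: algebra_simps)
    show ?thesis
    proof (cases "k = 0")
      case True
      have "contract (lie_bracket n v (X k)) l = contract (\<lambda>_. 0) l"
        using b True by (intro pairing_cong) (auto simp: shift_field_def)
      then show ?thesis using e X0'[OF l] True by simp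
    next
      case False
      then obtain \<epsilon> where \<epsilon>: "\<And>m. m + k \<le> n \<Longrightarrow> C k m = \<epsilon> * \<beta> k m - (d (m + k) - d m) * \<beta> k m"
        using d[of k] k by auto
      have "pairing n (X k) (\<lambda>i. \<theta>' i l) = contract (\<lambda>i. shift_field n k (C k) i + lie_bracket n v (X k) i) l"
        using e C[OF k l] by (simp add: pairing_add)
      also have "\<dots> = contract (\<lambda>i. Const \<epsilon> * X k i) l"
      proof (rule pairing_cong[OF _ refl])
        fix i assume "i \<le> n"
        then show "shift_field n k (C k) i + lie_bracket n v (X k) i = Const \<epsilon> * X k i"
          unfolding b[OF \<open>i \<le> n\<close>] shift_field_add shift_field_Const
          by (intro shift_field_cong) (simp add: \<epsilon>)
      qed
      finally show ?thesis using contract_X[OF k l] by (simp add: pairing_mult)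
    qed
  qed
  have "\<exists>e. \<forall>a\<le>n. \<forall>b\<le>n. \<theta>' a b = Const e * \<Omega> a b"
  proof (rule proportional)
    show "\<theta>' a b = - \<theta>' b a" for a b
      unfolding \<theta>'_def by (subst d1_anti[of \<eta> a b], subst Lie2_anti[of v a b]) simp
    show "\<theta>' 0 1 \<in> hom_polys n (n - 1)"
      unfolding \<theta>'_def using n_ge by (intro hom_polys_diff d1_hom Lie2_hom vhom hom) auto
  qed (rule ker)
  then obtain e where e: "\<And>a b. a \<le> n \<Longrightarrow> b \<le> n \<Longrightarrow> ?\<theta> a b = Lie2 n v \<Omega> a b + Const e * \<Omega> a b"
    unfolding \<theta>'_def by (metis add.commute diff_add_cancel)
  define N where "N = (of_nat (n + 1) :: complex)"
  have N: "N \<noteq> 0" unfolding N_def using of_nat_neq_0[of n] by (simp del: of_nat_Suc)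
  have CN: "Const N = (of_nat (n + 1) :: nat cpoly)" unfolding N_def by (rule Const_of_nat)
  \<comment> \<open>Contracting d\<eta> with R gives (n+1) \<eta> by Euler's formula, and R commutes
    with the linear field \<open>v\<close>. The term with \<open>e\<close> is absorbed by a multiple
    of R, as N \<omega> is the Lie derivative of \<omega> along R.\<close>
  have \<eta>: "Const N * \<eta> l = Lie1 n v \<omega> l + Const e * \<omega> l" if l: "l \<le> n" for l
  proof -
    have "Lie1 n (radial n) \<eta> l = of_nat (n + 1) * \<eta> l"
      by (rule Lie1_radial[OF hom l])
    moreover have "Lie1 n (radial n) \<eta> l = pairing n (radial n) (\<lambda>i. ?\<theta> i l)"
      using T by (simp add: cartan1 tangent_def)
    ultimately have "Const N * \<eta> l = pairing n (radial n) (\<lambda>i. ?\<theta> i l)" by (simp only: CN)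
    also have "\<dots> = pairing n (radial n) (\<lambda>i. Lie2 n v \<Omega> i l + Const e * \<Omega> i l)"
      using e l by (intro pairing_cong) auto
    also have "\<dots> = Lie1 n v \<omega> l - contract (lie_bracket n v (radial n)) l + Const e * \<omega> l"
      by (simp add: pairing_add_right pairing_mult_right cartan_commutator \<omega>_def)
    also have "contract (lie_bracket n v (radial n)) l = contract (\<lambda>_. 0) l"
      using lie_bracket_radial(1)[OF vhom] by (intro pairing_cong) auto
    finally show ?thesis by simp
  qed
  have R\<omega>: "Lie1 n (radial n) \<omega> l = Const N * \<omega> l" if "l \<le> n" for l
    unfolding CN by (rule Lie1_radial[OF \<omega>_hom that])
  have "trivial (\<lambda>l. Const N * \<eta> l)"
    unfolding trivial_def
  proof (intro exI conjI allI impI)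
    fix i assume "i \<le> n"
    then show "v i + Const (e / N) * radial n i \<in> hom_polys n 1"
      by (intro hom_polys_add vhom hom_polys_Const_mult radial_hom)
  next
    fix l assume l: "l \<le> n"
    have "Const (e / N) * (Const N * \<omega> l) = Const e * \<omega> l"
      using N by (simp flip: mult.assoc Const_mult)
    then show "Const N * \<eta> l = Lie1 n (\<lambda>i. v i + Const (e / N) * radial n i) \<omega> l"
      by (simp only: Lie1_add Lie1_Const R\<omega>[OF l] \<eta>[OF l])
  qed
  then have "trivial (\<lambda>l. Const (1 / N) * (Const N * \<eta> l))"
    by (rule trivial_Const)
  moreover have "Const (1 / N) * (Const N * \<eta> l) = \<eta> l" for l
    using N by (simp add: Const_1 flip: mult.assoc Const_mult)
  ultimately show ?thesis by simp
qed

theorem tangent_imp_trivial: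
  assumes T: "tangent \<eta>"
  shows "trivial \<eta>"
proof -
  define \<Lambda> where "\<Lambda> = (\<Union>l\<le>n. (\<lambda>m. wt m + \<beta> 0 l) ` keys (\<eta> l))"
  have fin: "finite \<Lambda>" unfolding \<Lambda>_def by auto
  have "trivial (part \<mu> \<eta>)" for \<mu>
  proof -
    have w: "wt m + \<beta> 0 l = \<mu>" if "m \<in> keys (part \<mu> \<eta> l)" for l m
      using that by (simp add: part_def keys_pfilter)
    show ?thesis
    proof (cases "\<mu> = 0")
      case True
      then show ?thesis using w by (intro trivial_zero_weight[OF tangent_part[OF T]]) auto
    next
      case False
      then show ?thesis using w by (intro trivial_nonzero_weight[OF tangent_part[OF T] False]) auto
    qed
  qed
  then have tr: "trivial (\<lambda>l. \<Sum>\<mu>\<in>\<Lambda>. part \<mu> \<eta> l)"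
    by (intro trivial_sum[OF fin])
  have "\<eta> l = (\<Sum>\<mu>\<in>\<Lambda>. part \<mu> \<eta> l)" if l: "l \<le> n" for l
  proof (rule poly_mapping_eqI)
    fix m
    have "lookup (\<Sum>\<mu>\<in>\<Lambda>. part \<mu> \<eta> l) m = (\<Sum>\<mu>\<in>\<Lambda>. if wt m + \<beta> 0 l = \<mu> then lookup (\<eta> l) m else 0)"
      by (simp add: lookup_sum part_def lookup_pfilter)
    also have "\<dots> = (if wt m + \<beta> 0 l \<in> \<Lambda> then lookup (\<eta> l) m else 0)"
      using fin by simp
    also have "\<dots> = lookup (\<eta> l) m"
      using l by (cases "m \<in> keys (\<eta> l)") (force simp: \<Lambda>_def in_keys_iff)+
    finally show "lookup (\<eta> l) m = lookup (\<Sum>\<mu>\<in>\<Lambda>. part \<mu> \<eta> l) m" by simp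
  qed
  then show ?thesis
    using tr unfolding trivial_def by metis
qed

end

section \<open>Iterated contractions as alternating multilinear maps; independence of the
  basis\<close>

section \<open>Interior products\<close>

lemma interior_prod_zero_form [simp]: "interior_prod n v (\<lambda>_. 0) = (\<lambda>_. 0)"
  by (simp add: interior_prod_def)

lemma interior_prod_add: "interior_prod n v (\<lambda>I. \<alpha> I + \<beta> I) = (\<lambda>I. interior_prod n v \<alpha> I + interior_prod n v \<beta> I)"
  by (simp add: interior_prod_def distrib_left sum.distrib)

lemma interior_prod_scale: "interior_prod n v (scale_form c \<alpha>) = scale_form c (interior_prod n v \<alpha>)"
  by (simp add: interior_prod_def scale_form_def sum_distrib_left mult_ac)

lemma interior_prod_field_add:
  "interior_prod n (v + w) \<alpha> = (\<lambda>I. interior_prod n v \<alpha> I + interior_prod n w \<alpha> I)"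
  by (simp add: interior_prod_def distrib_left distrib_right sum.distrib)

lemma interior_prod_field_scale: "interior_prod n (scale_vf c v) \<alpha> = scale_form c (interior_prod n v \<alpha>)"
  by (simp add: interior_prod_def scale_form_def scale_vf_def sum_distrib_left mult_ac)

lemma interior_prod_field_0: "interior_prod n 0 \<alpha> = (\<lambda>_. 0)"
  by (simp add: interior_prod_def)

lemma interior_prod_twice:
  "interior_prod n v (interior_prod n w \<alpha>) I =
    (\<Sum>k\<in>{..n} - I. \<Sum>l\<in>{..n} - I. (if k = l then 0 else if k < l then - 1 else 1) *
      ((- 1) ^ card {j\<in>I. j < k} * (- 1) ^ card {j\<in>I. j < l} * (v k * w l * \<alpha> (insert k (insert l I)))))"
proof -
  let ?e = "\<lambda>I k. (- 1) ^ card {j\<in>I. j < k} :: nat cpoly"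
  have e: "?e (insert k I) l = (if k < l then - 1 else 1) * ?e I l" if "k \<notin> I" for k l
  proof (cases "k < l")
    case True
    then have "{j \<in> insert k I. j < l} = insert k {j \<in> I. j < l}" by auto
    moreover have "finite {j \<in> I. j < l}" by (rule finite_subset[of _ "{..<l}"]) auto
    ultimately show ?thesis using that True by simp
  next
    case False
    then have "{j \<in> insert k I. j < l} = {j \<in> I. j < l}" by auto
    then show ?thesis using False by simp
  qed
  have "?e I k * (v k * (\<Sum>l\<in>{..n} - insert k I. ?e (insert k I) l * (w l * \<alpha> (insert l (insert k I))))) =
    (\<Sum>l\<in>{..n} - I. (if k = l then 0 else if k < l then - 1 else 1) *
      (?e I k * ?e I l * (v k * w l * \<alpha> (insert k (insert l I)))))" if k: "k \<in> {..n} - I" for k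
  proof -
    have "(\<Sum>l\<in>{..n} - insert k I. ?e (insert k I) l * (w l * \<alpha> (insert l (insert k I)))) =
        (\<Sum>l\<in>{..n} - I. (if k = l then 0 else if k < l then - 1 else 1) * (?e I l * (w l * \<alpha> (insert l (insert k I)))))"
    proof (rule sum.mono_neutral_cong_left)
      fix l assume l: "l \<in> {..n} - insert k I"
      show "?e (insert k I) l * (w l * \<alpha> (insert l (insert k I))) =
          (if k = l then 0 else if k < l then - 1 else 1) * (?e I l * (w l * \<alpha> (insert l (insert k I))))"
      proof -
        have ek: "?e (insert k I) l = (if k < l then - 1 else 1) * ?e I l" using k by (intro e) auto
        show ?thesis unfolding ek using l by auto
      qed
    qed (use k in auto)
    then show ?thesis
      by (simp add: sum_distrib_left insert_commute mult_ac)
  qed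
  then show ?thesis
    unfolding interior_prod_def by (intro sum.cong refl)
qed

lemma interior_prod_anticommute:
  "interior_prod n v (interior_prod n w \<alpha>) = scale_form (- 1) (interior_prod n w (interior_prod n v \<alpha>))"
proof
  fix I
  let ?t = "\<lambda>v w k l. (if k = l then 0 else if k < l then - 1 else 1) *
      ((- 1) ^ card {j\<in>I. j < k} * (- 1) ^ card {j\<in>I. j < l} * (v k * w l * \<alpha> (insert k (insert l I))))"
  have "(\<Sum>k\<in>{..n} - I. \<Sum>l\<in>{..n} - I. ?t v w k l) = (\<Sum>l\<in>{..n} - I. \<Sum>k\<in>{..n} - I. - ?t w v l k)"
    by (subst sum.swap) (auto intro!: sum.cong simp: insert_commute mult_ac)
  then show "interior_prod n v (interior_prod n w \<alpha>) I = scale_form (- 1) (interior_prod n w (interior_prod n v \<alpha>)) I"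
    unfolding interior_prod_twice scale_form_def by (simp add: sum_negf Const_uminus Const_1)
qed

lemma interior_prod_self: "interior_prod n v (interior_prod n v \<alpha>) = (\<lambda>_. 0)"
proof
  fix I
  have "interior_prod n v (interior_prod n v \<alpha>) I = - interior_prod n v (interior_prod n v \<alpha>) I"
    by (subst (1) interior_prod_anticommute) (simp add: scale_form_def Const_uminus Const_1)
  then show "interior_prod n v (interior_prod n v \<alpha>) I = 0"
    by (simp only: cpoly_eq_uminus_iff)
qed

lemma scale_form_scale_form [simp]: "scale_form a (scale_form b \<alpha>) = scale_form (a * b) \<alpha>"
  by (simp add: scale_form_def Const_mult mult.assoc)

lemma scale_form_1 [simp]: "scale_form 1 \<alpha> = \<alpha>"
  by (simp add: scale_form_def Const_1)

lemma scale_form_zero [simp]: "scale_form a (\<lambda>_. 0) = (\<lambda>_. 0)" "scale_form 0 \<alpha> = (\<lambda>_. 0)"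
  by (simp_all add: scale_form_def)

abbreviation "ips n vs \<zeta> \<equiv> foldr (interior_prod n) vs \<zeta>"

lemma ips_add: "ips n vs (\<lambda>I. \<alpha> I + \<beta> I) = (\<lambda>I. ips n vs \<alpha> I + ips n vs \<beta> I)"
  by (induction vs) (simp_all add: interior_prod_add)

lemma ips_scale: "ips n vs (scale_form c \<alpha>) = scale_form c (ips n vs \<alpha>)"
  by (induction vs) (simp_all add: interior_prod_scale)

lemma ips_zero [simp]: "ips n vs (\<lambda>_. 0) = (\<lambda>_. 0)"
  by (induction vs) simp_all

lemma ips_commute: "ips n vs (interior_prod n w \<alpha>) = scale_form ((- 1) ^ length vs) (interior_prod n w (ips n vs \<alpha>))"
proof (induction vs)
  case (Cons v vs)
  show ?case
    by (simp add: Cons interior_prod_scale) (subst interior_prod_anticommute, simp add: mult.commute)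
qed simp

lemma ips_member: "v \<in> set vs \<Longrightarrow> interior_prod n v (ips n vs \<zeta>) = (\<lambda>_. 0)"
proof (induction vs)
  case (Cons w vs)
  show ?case
  proof (cases "v = w")
    case True
    then show ?thesis by (simp add: interior_prod_self)
  next
    case False
    then show ?thesis
      using Cons by (subst foldr.simps, subst o_apply, subst interior_prod_anticommute) simp
  qed
qed simp

lemma ips_not_distinct: "\<not> distinct vs \<Longrightarrow> ips n vs \<zeta> = (\<lambda>_. 0)"
proof (induction vs)
  case (Cons v vs)
  then show ?case by (cases "v \<in> set vs") (auto simp: ips_member)
qed simp

lemma ips_perm: "mset vs = mset ws \<Longrightarrow> \<exists>c. ips n vs \<zeta> = scale_form c (ips n ws \<zeta>)"
proof (induction ws arbitrary: vs)
  case Nil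
  then show ?case by (intro exI[of _ 1]) simp
next
  case (Cons w ws)
  then have "w \<in> set vs" by (metis list.set_intros(1) set_mset_mset)
  then obtain pre post where vs: "vs = pre @ w # post" by (meson split_list)
  then have "mset (pre @ post) = mset ws" using Cons.prems by simp
  then obtain c where c: "ips n (pre @ post) \<zeta> = scale_form c (ips n ws \<zeta>)" using Cons.IH by blast
  have "ips n vs \<zeta> = scale_form ((- 1) ^ length pre) (interior_prod n w (ips n (pre @ post) \<zeta>))"
    unfolding vs by (simp add: ips_commute)
  then show ?case
    unfolding c by (auto simp: interior_prod_scale)
qed

text \<open>The fields of \<open>Xs\<close> are expanded in the basis one after the other. In the
  end all entries are basis elements: with a repetition the form is 0, otherwise the list is a
  permutation of \<open>Bs\<close>.\<close>

lemma ips_span: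
  assumes Bs: "distinct Bs" and Xs: "set Xs \<subseteq> vf.span (set Bs)" and len: "length Xs = length Bs"
  shows "\<exists>c. ips n Xs \<zeta> = scale_form c (ips n Bs \<zeta>)"
proof -
  let ?P = "\<lambda>xs. \<exists>c. ips n xs \<zeta> = scale_form c (ips n Bs \<zeta>)"
  have "?P (pre @ ys)" if "set pre \<subseteq> set Bs" "set ys \<subseteq> vf.span (set Bs)" "length pre + length ys = length Bs" for pre ys
    using that
  proof (induction ys arbitrary: pre)
    case Nil
    show ?case
    proof (cases "distinct pre")
      case True
      then have "card (set pre) = card (set Bs)"
        using Nil.prems(3) Bs by (simp add: distinct_card)
      then have "set pre = set Bs"
        using Nil.prems(1) by (simp add: card_subset_eq)
      then have "mset pre = mset Bs"
        using True Bs by (simp add: set_eq_iff_mset_eq_distinct)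
      then show ?thesis using ips_perm[of pre Bs n \<zeta>] by simp
    next
      case False
      then show ?thesis by (intro exI[of _ 0]) (simp add: ips_not_distinct)
    qed
  next
    case (Cons v ys)
    have "v \<in> vf.span (set Bs)" using Cons.prems(2) by simp
    then show ?case
    proof (induction rule: vf.span_induct_alt)
      case base
      show ?case by (intro exI[of _ 0]) (simp add: interior_prod_field_0[unfolded zero_fun_def])
    next
      case (step a x y)
      have "?P ((pre @ [x]) @ ys)"
        using Cons.prems step(1) by (intro Cons.IH) auto
      then obtain c1 where c1: "ips n (pre @ x # ys) \<zeta> = scale_form c1 (ips n Bs \<zeta>)" by auto
      obtain c2 where c2: "ips n (pre @ y # ys) \<zeta> = scale_form c2 (ips n Bs \<zeta>)" using step(2) by auto
      have "ips n (pre @ (scale_vf a x + y) # ys) \<zeta> =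
          (\<lambda>I. scale_form a (ips n (pre @ x # ys) \<zeta>) I + ips n (pre @ y # ys) \<zeta> I)"
        by (simp add: interior_prod_field_add interior_prod_field_scale ips_add ips_scale)
      also have "\<dots> = scale_form (a * c1 + c2) (ips n Bs \<zeta>)"
        unfolding c1 c2 by (simp add: scale_form_def Const_add Const_mult distrib_right mult.assoc)
      finally show ?case by blast
    qed
  qed
  from this[of "[]" Xs] show ?thesis using Xs len by simp
qed

lemma form_class_scale:
  assumes "c \<noteq> 0"
  shows "form_class (scale_form c \<alpha>) = form_class \<alpha>"
proof -
  have "scale_form d \<alpha> = scale_form (d / c) (scale_form c \<alpha>)" "scale_form d (scale_form c \<alpha>) = scale_form (d * c) \<alpha>" for d
    using assms by simp_all
  then show ?thesis
    unfolding form_class_def using assms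
    by (metis (no_types, lifting) divide_eq_0_iff mult_eq_0_iff)
qed

text \<open>The definition selects an arbitrary basis. The forms of two bases are multiples of each
  other, so if one is nonzero the factor is nonzero and the classes agree.\<close>

lemma lie_foliation_eq:
  assumes B: "ordered_basis Bs \<g>" and nz: "lie_form n Bs \<noteq> (\<lambda>_. 0)"
  shows "lie_foliation n \<g> = form_class (lie_form n Bs)"
proof -
  define Xs where "Xs = (SOME Xs. ordered_basis Xs \<g>)"
  have X: "ordered_basis Xs \<g>"
    unfolding Xs_def using B by (rule someI)
  have "card (set Xs) = vf.dim \<g>" "card (set Bs) = vf.dim \<g>"
    using X B vf.dim_span_eq_card_independent unfolding ordered_basis_def by metis+
  then have len: "length Xs = length Bs"
    using X B by (simp add: ordered_basis_def distinct_card)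
  have "set Xs \<subseteq> vf.span (set Bs)" "set Bs \<subseteq> vf.span (set Xs)"
    using X B vf.span_superset unfolding ordered_basis_def by metis+
  then obtain c d where c: "lie_form n Xs = scale_form c (lie_form n Bs)"
    and d: "lie_form n Bs = scale_form d (lie_form n Xs)"
    using ips_span[of Bs Xs] ips_span[of Xs Bs] X B len
    unfolding lie_form_def ordered_basis_def by metis
  have "c \<noteq> 0"
    using c d nz by auto
  then show ?thesis
    unfolding lie_foliation_def Xs_def[symmetric] c by (rule form_class_scale)
qed

lemma interior_prod_forms:
  assumes "\<alpha> \<in> forms n (Suc k) e" "\<And>i. i \<le> n \<Longrightarrow> v i \<in> hom_polys n 1"
  shows "interior_prod n v \<alpha> \<in> forms n k (Suc e)"
proof -
  have "if I \<subseteq> {..n} \<and> card I = k then interior_prod n v \<alpha> I \<in> hom_polys n (Suc e) else interior_prod n v \<alpha> I = 0" for I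
  proof (cases "I \<subseteq> {..n} \<and> card I = k")
    case True
    have "(- 1) ^ card {j\<in>I. j < l} * (v l * \<alpha> (insert l I)) \<in> hom_polys n (1 + e)" if "l \<in> {..n} - I" for l
    proof -
      have "insert l I \<subseteq> {..n} \<and> card (insert l I) = Suc k"
        using True that finite_subset[of I "{..n}"] by auto
      then have "\<alpha> (insert l I) \<in> hom_polys n e"
        using assms(1) unfolding forms_def by (auto split: if_splits)
      then show ?thesis
        using assms(2)[of l] that by (intro hom_polys_sgn_mult hom_polys_mult) auto
    qed
    then show ?thesis
      using True unfolding interior_prod_def by (auto intro!: hom_polys_sum)
  next
    case False
    have "\<alpha> (insert l I) = 0" if "l \<in> {..n} - I" for l
    proof -
      have "\<not> (insert l I \<subseteq> {..n} \<and> card (insert l I) = Suc k)"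
        using False that finite_subset[of I "{..n}"] by auto
      then show ?thesis
        using assms(1) unfolding forms_def by (auto split: if_splits)
    qed
    then show ?thesis
      using False unfolding interior_prod_def by (auto intro!: sum.neutral)
  qed
  then show ?thesis unfolding forms_def by blast
qed

lemma volume_form_forms: "volume_form n \<in> forms n (Suc n) 0"
proof -
  have "I = {..n}" if "I \<subseteq> {..n}" "card I = Suc n" for I
    using that by (intro card_subset_eq) auto
  moreover have "(1 :: nat cpoly) \<in> hom_polys n 0"
    using hom_polys_Const[of 1 n] by (simp add: Const_1)
  ultimately show ?thesis unfolding forms_def volume_form_def by auto
qed

section \<open>Integrability of one-forms as identities between components\<close>

section \<open>One-forms in coordinates\<close>

lemma one_form_outside: "\<alpha> \<in> forms n 1 e \<Longrightarrow> \<not> (\<exists>l\<le>n. I = {l}) \<Longrightarrow> \<alpha> I = 0"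
  unfolding forms_def by (auto simp: card_1_singleton_iff split: if_splits)

lemma one_form_coeff: "\<alpha> \<in> forms n 1 e \<Longrightarrow> l \<le> n \<Longrightarrow> \<alpha> {l} \<in> hom_polys n e"
  unfolding forms_def by (auto dest!: spec[of _ "{l}"])

lemma one_form_vars: "\<alpha> \<in> forms n 1 e \<Longrightarrow> \<alpha> I \<in> vars_in {..n}"
  using one_form_outside[of \<alpha> n e I] one_form_coeff[of \<alpha> n e] by (cases "\<exists>l\<le>n. I = {l}") (auto simp: hom_polys_iff)

definition one_form :: "nat \<Rightarrow> (nat \<Rightarrow> nat cpoly) \<Rightarrow> pform" where
  "one_form n \<eta> = (\<lambda>I. if \<exists>l\<le>n. I = {l} then \<eta> (the_elem I) else 0)"

lemma one_form_singleton [simp]: "l \<le> n \<Longrightarrow> one_form n \<eta> {l} = \<eta> l"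
  by (simp add: one_form_def)

lemma one_form_forms: "(\<And>l. l \<le> n \<Longrightarrow> \<eta> l \<in> hom_polys n e) \<Longrightarrow> one_form n \<eta> \<in> forms n 1 e"
  unfolding forms_def one_form_def by (auto simp: card_1_singleton_iff)

lemma forms_1_eqI:
  assumes "\<alpha> \<in> forms n 1 e" "\<beta> \<in> forms n 1 e'" "\<And>l. l \<le> n \<Longrightarrow> \<alpha> {l} = \<beta> {l}"
  shows "\<alpha> = \<beta>"
proof
  fix I
  show "\<alpha> I = \<beta> I"
    using one_form_outside[OF assms(1), of I] one_form_outside[OF assms(2), of I] assms(3)
    by (cases "\<exists>l\<le>n. I = {l}") auto
qed

lemma interior_prod_one_form:
  assumes "\<alpha> \<in> forms n 1 e"
  shows "interior_prod n v \<alpha> = (\<lambda>I. if I = {} then pairing n v (\<lambda>l. \<alpha> {l}) else 0)"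
proof
  fix I
  show "interior_prod n v \<alpha> I = (if I = {} then pairing n v (\<lambda>l. \<alpha> {l}) else 0)"
  proof (cases "I = {}")
    case False
    have "\<alpha> (insert k I) = 0" if "k \<in> {..n} - I" for k
    proof (rule one_form_outside[OF assms])
      obtain i where "i \<in> I" using False by blast
      with that have "i \<noteq> k" by auto
      show "\<not> (\<exists>l\<le>n. insert k I = {l})"
      proof
        assume "\<exists>l\<le>n. insert k I = {l}"
        then obtain l where "insert k I = {l}" by blast
        with \<open>i \<in> I\<close> have "k \<in> {l}" "i \<in> {l}" by auto
        with \<open>i \<noteq> k\<close> show False by simp
      qed
    qed
    then show ?thesis using False by (auto simp: interior_prod_def intro!: sum.neutral)
  qed (simp add: interior_prod_def pairing_def)
qed

text \<open>The coefficient of dz_a dz_b dz_c in the wedge product of \<eta> with its derivative,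
  for indices in any order, which is convenient for contractions and pull-backs.\<close>

definition cubic :: "(nat \<Rightarrow> nat cpoly) \<Rightarrow> nat \<Rightarrow> nat \<Rightarrow> nat \<Rightarrow> nat cpoly" where
  "cubic \<eta> a b c = \<eta> a * d1 \<eta> b c + \<eta> b * d1 \<eta> c a + \<eta> c * d1 \<eta> a b"

lemma ext_d_one_form:
  assumes \<alpha>: "\<alpha> \<in> forms n 1 e"
  shows "b < c \<Longrightarrow> ext_d \<alpha> {b, c} = d1 (\<lambda>l. \<alpha> {l}) b c" and "card J \<noteq> 2 \<Longrightarrow> ext_d \<alpha> J = 0"
proof -
  assume "b < c"
  then have s: "{j \<in> {b, c}. j < b} = {}" "{j \<in> {b, c}. j < c} = {b}" "{b, c} - {b} = {c}" "{b, c} - {c} = {b}"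
    by auto
  have "ext_d \<alpha> {b, c} = (- 1) ^ card {j \<in> {b, c}. j < b} * pdiff b (\<alpha> ({b, c} - {b})) +
      (- 1) ^ card {j \<in> {b, c}. j < c} * pdiff c (\<alpha> ({b, c} - {c}))"
    unfolding ext_d_def using \<open>b < c\<close> by (subst sum.insert) auto
  then show "ext_d \<alpha> {b, c} = d1 (\<lambda>l. \<alpha> {l}) b c"
    unfolding s d1_def by simp
next
  assume J: "card J \<noteq> 2"
  show "ext_d \<alpha> J = 0"
  proof (cases "finite J")
    case True
    have "\<alpha> (J - {k}) = 0" if "k \<in> J" for k
    proof (rule one_form_outside[OF \<alpha>])
      show "\<not> (\<exists>l\<le>n. J - {k} = {l})"
      proof
        assume "\<exists>l\<le>n. J - {k} = {l}"
        then obtain l where "J - {k} = {l}" by blast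
        then have "card (J - {k}) = 1" by simp
        then show False using J True that by (simp add: card_Diff_singleton)
      qed
    qed
    then show ?thesis unfolding ext_d_def by (auto intro!: sum.neutral)
  qed (simp add: ext_d_def)
qed

lemma wedge_d_one_form:
  assumes \<alpha>: "\<alpha> \<in> forms n 1 e"
  shows "a < b \<Longrightarrow> b < c \<Longrightarrow> wedge \<alpha> (ext_d \<alpha>) {a, b, c} = cubic (\<lambda>l. \<alpha> {l}) a b c"
    and "card K \<noteq> 3 \<Longrightarrow> wedge \<alpha> (ext_d \<alpha>) K = 0"
proof -
  \<comment> \<open>Only singletons contribute a component of \<alpha>; for \<open>I = {a}\<close>
    the sign counts the elements of \<open>K\<close> below \<open>a\<close>.\<close>
  have red: "wedge \<alpha> \<beta> K = (\<Sum>a\<in>K. (- 1) ^ card {j\<in>K. j < a} * (\<alpha> {a} * \<beta> (K - {a})))" if K: "finite K" for K \<beta>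
  proof -
    have "wedge \<alpha> \<beta> K = (\<Sum>I\<in>(\<lambda>a. {a}) ` K. (- 1) ^ card {(i, j). i \<in> I \<and> j \<in> K - I \<and> j < i} * (\<alpha> I * \<beta> (K - I)))"
      unfolding wedge_def
    proof (rule sum.mono_neutral_right)
      show "\<forall>I\<in>Pow K - (\<lambda>a. {a}) ` K. (- 1) ^ card {(i, j). i \<in> I \<and> j \<in> K - I \<and> j < i} * (\<alpha> I * \<beta> (K - I)) = 0"
      proof
        fix I assume "I \<in> Pow K - (\<lambda>a. {a}) ` K"
        then have "\<not> (\<exists>l\<le>n. I = {l})" by auto
        then show "(- 1) ^ card {(i, j). i \<in> I \<and> j \<in> K - I \<and> j < i} * (\<alpha> I * \<beta> (K - I)) = 0"
          using one_form_outside[OF \<alpha>] by simp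
      qed
    qed (use K in auto)
    also have "\<dots> = (\<Sum>a\<in>K. (- 1) ^ card {(i, j). i \<in> {a} \<and> j \<in> K - {a} \<and> j < i} * (\<alpha> {a} * \<beta> (K - {a})))"
      by (subst sum.reindex) (auto simp: inj_on_def)
    also have "\<dots> = (\<Sum>a\<in>K. (- 1) ^ card {j\<in>K. j < a} * (\<alpha> {a} * \<beta> (K - {a})))"
    proof (rule sum.cong[OF refl])
      fix a assume "a \<in> K"
      have "{(i, j). i \<in> {a} \<and> j \<in> K - {a} \<and> j < i} = Pair a ` {j\<in>K. j < a}" by auto
      then have "card {(i, j). i \<in> {a} \<and> j \<in> K - {a} \<and> j < i} = card {j\<in>K. j < a}"
        by (simp add: card_image inj_on_def)
      then show "(- 1) ^ card {(i, j). i \<in> {a} \<and> j \<in> K - {a} \<and> j < i} * (\<alpha> {a} * \<beta> (K - {a})) =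
          (- 1) ^ card {j\<in>K. j < a} * (\<alpha> {a} * \<beta> (K - {a}))" by simp
    qed
    finally show ?thesis .
  qed
  show "wedge \<alpha> (ext_d \<alpha>) K = 0" if K: "card K \<noteq> 3"
  proof (cases "finite K")
    case True
    have "ext_d \<alpha> (K - {a}) = 0" if "a \<in> K" for a
      using K True that by (intro ext_d_one_form(2)[OF \<alpha>]) (auto simp: card_Diff_singleton)
    then show ?thesis by (auto simp: red[OF True] intro!: sum.neutral)
  next
    case False
    then show ?thesis by (simp add: wedge_def finite_Pow_iff)
  qed
  show "wedge \<alpha> (ext_d \<alpha>) {a, b, c} = cubic (\<lambda>l. \<alpha> {l}) a b c" if "a < b" "b < c"
  proof -
    have s: "{j \<in> {a, b, c}. j < a} = {}" "{j \<in> {a, b, c}. j < b} = {a}" "{j \<in> {a, b, c}. j < c} = {a, b}"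
      "{a, b, c} - {a} = {b, c}" "{a, b, c} - {b} = {a, c}" "{a, b, c} - {c} = {a, b}"
      using that by auto
    have "wedge \<alpha> (ext_d \<alpha>) {a, b, c} = (\<Sum>x\<in>{a, b, c}. (- 1) ^ card {j\<in>{a, b, c}. j < x} * (\<alpha> {x} * ext_d \<alpha> ({a, b, c} - {x})))"
      by (rule red) simp
    also have "\<dots> = (- 1) ^ card {j\<in>{a, b, c}. j < a} * (\<alpha> {a} * ext_d \<alpha> ({a, b, c} - {a})) +
       ((- 1) ^ card {j\<in>{a, b, c}. j < b} * (\<alpha> {b} * ext_d \<alpha> ({a, b, c} - {b})) +
        (- 1) ^ card {j\<in>{a, b, c}. j < c} * (\<alpha> {c} * ext_d \<alpha> ({a, b, c} - {c})))"
      using that by (subst sum.insert; simp)+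
    also have "\<dots> = cubic (\<lambda>l. \<alpha> {l}) a b c"
      unfolding s cubic_def using that ext_d_one_form(1)[OF \<alpha>, of b c] ext_d_one_form(1)[OF \<alpha>, of a c]
        ext_d_one_form(1)[OF \<alpha>, of a b] d1_anti[of "\<lambda>l. \<alpha> {l}" c a]
      by simp
    finally show ?thesis .
  qed
qed

lemma cubic_swap: "cubic \<eta> a b c = - cubic \<eta> b a c" "cubic \<eta> a b c = - cubic \<eta> a c b"
  unfolding cubic_def using d1_anti[of \<eta> a b] d1_anti[of \<eta> a c] d1_anti[of \<eta> b c]
  by (simp_all add: algebra_simps)

lemma cubic_diag: "cubic \<eta> a a c = 0" "cubic \<eta> a c c = 0"
  using iffD1[OF cpoly_eq_uminus_iff, OF cubic_swap(1)[of \<eta> a a c]]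
    iffD1[OF cpoly_eq_uminus_iff, OF cubic_swap(2)[of \<eta> a c c]] by auto

lemma wedge_d_eq_0_iff:
  assumes \<alpha>: "\<alpha> \<in> forms n 1 e"
  shows "wedge \<alpha> (ext_d \<alpha>) = 0 \<longleftrightarrow> (\<forall>a\<le>n. \<forall>b\<le>n. \<forall>c\<le>n. cubic (\<lambda>l. \<alpha> {l}) a b c = 0)" (is "?L \<longleftrightarrow> ?R")
proof
  let ?c = "cubic (\<lambda>l. \<alpha> {l})"
  assume ?L
  then have 1: "?c a b c = 0" if "a < b" "b < c" for a b c
    using wedge_d_one_form(1)[OF \<alpha> that] by simp
  have 2: "?c a b c = 0" if ab: "a < b" for a b c
  proof (cases "b \<le> c")
    case True
    then show ?thesis using 1[OF ab, of c] cubic_diag(2) by (cases "b = c") auto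
  next
    case bc: False
    show ?thesis
    proof (cases "a < c")
      case True
      then show ?thesis using 1[of a c b] bc cubic_swap(2)[of _ a b c] by simp
    next
      case False
      then consider "a = c" | "c < a" by linarith
      then show ?thesis
      proof cases
        case 1
        then show ?thesis using cubic_swap(1)[of _ a b c] cubic_diag(2)[of _ b a] by simp
      next
        case 2
        then show ?thesis
          using 1[OF 2 ab] cubic_swap(2)[of _ a b c] cubic_swap(1)[of _ a c b] by simp
      qed
    qed
  qed
  show ?R
  proof (intro allI impI)
    fix a b c
    show "?c a b c = 0"
    proof (cases a b rule: linorder_cases)
      case less
      then show ?thesis by (rule 2)
    next
      case equal
      then show ?thesis using cubic_diag(1) by simp
    next
      case greater
      then show ?thesis using 2[of b a c] cubic_swap(1)[of _ a b c] by simp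
    qed
  qed
next
  assume R: ?R
  show ?L
  proof
    fix K
    show "wedge \<alpha> (ext_d \<alpha>) K = 0 K"
    proof (cases "card K = 3")
      case False
      then show ?thesis using wedge_d_one_form(2)[OF \<alpha>] by simp
    next
      case True
      then obtain x y z where K: "K = {x, y, z}" "x \<noteq> y" "y \<noteq> z" "x \<noteq> z" by (auto simp: card_3_iff)
      have "\<exists>a b c. a < b \<and> b < c \<and> K = {a, b, c}"
      proof (cases "x < y")
        case xy: True
        show ?thesis
        proof (cases "y < z")
          case True
          then show ?thesis using xy K(1) by (intro exI[of _ x] exI[of _ y] exI[of _ z]) auto
        next
          case False
          have "x < z \<and> z < y \<or> z < x \<and> x < y"
            using False xy K by linarith
          moreover have "K = {x, z, y}" "K = {z, x, y}" using K(1) by auto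
          ultimately show ?thesis by metis
        qed
      next
        case yx: False
        show ?thesis
        proof (cases "z < y")
          case True
          then show ?thesis using yx K by (intro exI[of _ z] exI[of _ y] exI[of _ x]) auto
        next
          case False
          have "y < x \<and> x < z \<or> y < z \<and> z < x"
            using False yx K by linarith
          moreover have "K = {y, x, z}" "K = {y, z, x}" using K(1) by auto
          ultimately show ?thesis by metis
        qed
      qed
      then obtain a b c where abc: "a < b" "b < c" "K = {a, b, c}" by blast
      have "cubic (\<lambda>l. \<alpha> {l}) a b c = 0"
      proof (cases "c \<le> n")
        case True
        then show ?thesis using R abc by simp
      next
        \<comment> \<open>An index beyond \<open>n\<close> kills everything: the component is 0 and
          no component depends on that variable.\<close>
        case False
        then have "\<alpha> {c} = 0" by (intro one_form_outside[OF \<alpha>]) auto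
        moreover have "pdiff c (\<alpha> I) = 0" for I
          using False by (intro pdiff_eq_0[OF one_form_vars[OF \<alpha>]]) auto
        ultimately show ?thesis by (simp add: cubic_def d1_def)
      qed
      then show ?thesis using wedge_d_one_form(1)[OF \<alpha> abc(1,2)] abc(3) by simp
    qed
  qed
qed

section \<open>Closed and irreducible sets in both Zariski topologies; a criterion for codimension
  two\<close>

section \<open>Zariski topologies\<close>

text \<open>Covers the affine and the projective case at once. The nowhere vanishing
  \<open>e\<close> makes the whole set open, so that \<open>S\<close> is the topological
  space.\<close>

lemma closedin_nonvanishing_iff:
  fixes nz :: "'a \<Rightarrow> 'p \<Rightarrow> bool" and mul :: "'p \<Rightarrow> 'p \<Rightarrow> 'p"
  assumes X: "X = topology (\<lambda>U. \<exists>P. P \<subseteq> H \<and> U = {x \<in> S. \<exists>p\<in>P. nz x p})"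
    and H: "\<And>p q. p \<in> H \<Longrightarrow> q \<in> H \<Longrightarrow> mul p q \<in> H"
    and mul: "\<And>x p q. nz x (mul p q) \<longleftrightarrow> nz x p \<and> nz x q"
    and e: "e \<in> H" "\<And>x. x \<in> S \<Longrightarrow> nz x e"
  shows "topspace X = S" and "closedin X C \<longleftrightarrow> (\<exists>P. P \<subseteq> H \<and> C = {x \<in> S. \<forall>p\<in>P. \<not> nz x p})"
proof -
  have ist: "istopology (\<lambda>U. \<exists>P. P \<subseteq> H \<and> U = {x \<in> S. \<exists>p\<in>P. nz x p})"
    by (rule istopology_nonvanishing[where mul = mul]) (use H mul in auto)
  have op: "openin X U \<longleftrightarrow> (\<exists>P. P \<subseteq> H \<and> U = {x \<in> S. \<exists>p\<in>P. nz x p})" for U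
    unfolding X topology_inverse'[OF ist] ..
  have "openin X S"
    unfolding op using e by (intro exI[of _ "{e}"]) auto
  moreover have "U \<subseteq> S" if "openin X U" for U
    using that unfolding op by auto
  ultimately show top: "topspace X = S"
    by (meson openin_subset openin_topspace subset_antisym)
  show "closedin X C \<longleftrightarrow> (\<exists>P. P \<subseteq> H \<and> C = {x \<in> S. \<forall>p\<in>P. \<not> nz x p})"
  proof
    assume C: "closedin X C"
    then obtain P where P: "P \<subseteq> H" "S - C = {x \<in> S. \<exists>p\<in>P. nz x p}"
      unfolding closedin_def top op by blast
    have "C \<subseteq> S" using C unfolding closedin_def top by blast
    then have "C = {x \<in> S. \<forall>p\<in>P. \<not> nz x p}" using P(2) by auto
    with P(1) show "\<exists>P. P \<subseteq> H \<and> C = {x \<in> S. \<forall>p\<in>P. \<not> nz x p}" by blast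
  next
    assume "\<exists>P. P \<subseteq> H \<and> C = {x \<in> S. \<forall>p\<in>P. \<not> nz x p}"
    then obtain P where P: "P \<subseteq> H" "C = {x \<in> S. \<forall>p\<in>P. \<not> nz x p}" by blast
    then have "S - C = {x \<in> S. \<exists>p\<in>P. nz x p}" by auto
    then show "closedin X C" unfolding closedin_def top op using P by blast
  qed
qed

lemma irreducible_inD:
  "irreducible_in X T \<Longrightarrow> closedin X A \<Longrightarrow> closedin X B \<Longrightarrow> T \<subseteq> A \<union> B \<Longrightarrow> T \<subseteq> A \<or> T \<subseteq> B"
  by (simp add: irreducible_in_def)

text \<open>A point of \<open>T\<close> outside \<open>A\<close> and one outside \<open>B\<close>
  yield one equation each, so irreducibility need only be tested on hypersurfaces.\<close>

lemma irreducible_nonvanishing_iff: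
  fixes nz :: "'a \<Rightarrow> 'p \<Rightarrow> bool" and mul :: "'p \<Rightarrow> 'p \<Rightarrow> 'p"
  assumes top: "topspace X = S" and cl: "\<And>C. closedin X C \<longleftrightarrow> (\<exists>P. P \<subseteq> H \<and> C = {x \<in> S. \<forall>p\<in>P. \<not> nz x p})"
  shows "irreducible_in X T \<longleftrightarrow> T \<subseteq> S \<and> T \<noteq> {} \<and>
    (\<forall>p\<in>H. \<forall>q\<in>H. (\<forall>x\<in>T. \<not> nz x p \<or> \<not> nz x q) \<longrightarrow> (\<forall>x\<in>T. \<not> nz x p) \<or> (\<forall>x\<in>T. \<not> nz x q))"
    (is "_ \<longleftrightarrow> _ \<and> _ \<and> ?R")
proof
  assume I: "irreducible_in X T"
  have ?R
  proof (intro ballI impI)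
    fix p q assume pq: "p \<in> H" "q \<in> H" "\<forall>x\<in>T. \<not> nz x p \<or> \<not> nz x q"
    have "closedin X {x \<in> S. \<forall>p\<in>{p}. \<not> nz x p}" "closedin X {x \<in> S. \<forall>p\<in>{q}. \<not> nz x p}"
      unfolding cl using pq by blast+
    moreover have "T \<subseteq> {x \<in> S. \<forall>p\<in>{p}. \<not> nz x p} \<union> {x \<in> S. \<forall>p\<in>{q}. \<not> nz x p}"
      using pq(3) I top unfolding irreducible_in_def by auto
    ultimately have "T \<subseteq> {x \<in> S. \<forall>p\<in>{p}. \<not> nz x p} \<or> T \<subseteq> {x \<in> S. \<forall>p\<in>{q}. \<not> nz x p}"
      by (rule irreducible_inD[OF I])
    then show "(\<forall>x\<in>T. \<not> nz x p) \<or> (\<forall>x\<in>T. \<not> nz x q)" by auto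
  qed
  moreover have "T \<subseteq> S" "T \<noteq> {}" using I top unfolding irreducible_in_def by simp_all
  ultimately show "T \<subseteq> S \<and> T \<noteq> {} \<and> ?R" by simp
next
  assume R: "T \<subseteq> S \<and> T \<noteq> {} \<and> ?R"
  have "T \<subseteq> A \<or> T \<subseteq> B" if AB: "closedin X A" "closedin X B" "T \<subseteq> A \<union> B" for A B
  proof (rule ccontr)
    assume n: "\<not> (T \<subseteq> A \<or> T \<subseteq> B)"
    obtain P Q where P: "P \<subseteq> H" "A = {x \<in> S. \<forall>p\<in>P. \<not> nz x p}" and Q: "Q \<subseteq> H" "B = {x \<in> S. \<forall>p\<in>Q. \<not> nz x p}"
      using AB unfolding cl by blast
    have TS: "T \<subseteq> S" using R by simp
    obtain x where x: "x \<in> T" "x \<notin> A" using n by blast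
    then obtain p where p: "p \<in> P" "nz x p" using TS P(2) by auto
    obtain y where y: "y \<in> T" "y \<notin> B" using n by blast
    then obtain q where q: "q \<in> Q" "nz y q" using TS Q(2) by auto
    have "\<not> nz z p \<or> \<not> nz z q" if "z \<in> T" for z
    proof -
      have "z \<in> A \<or> z \<in> B" using that AB(3) by auto
      then show ?thesis using p(1) q(1) P(2) Q(2) by auto
    qed
    then have 1: "\<forall>z\<in>T. \<not> nz z p \<or> \<not> nz z q" by simp
    have "p \<in> H" "q \<in> H" using p(1) q(1) P(1) Q(1) by auto
    with R 1 have "(\<forall>x\<in>T. \<not> nz x p) \<or> (\<forall>x\<in>T. \<not> nz x q)" by simp
    then show False using p(2) q(2) x(1) y(1) by auto
  qed
  then show "irreducible_in X T" using R top unfolding irreducible_in_def by simp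
qed

lemma affine_zariski_eq:
  "affine_zariski n = topology (\<lambda>U. \<exists>P. P \<subseteq> UNIV \<and> U = {z \<in> affine_space n. \<exists>p\<in>P. eval_at z p \<noteq> 0})"
  by (simp add: affine_zariski_def affine_open_def[abs_def])

lemma topspace_affine: "topspace (affine_zariski n) = affine_space n"
  by (rule closedin_nonvanishing_iff(1)[OF affine_zariski_eq, where mul = "(*)" and e = 1]) (auto simp: eval_at_mult)

lemma closedin_affine:
  "closedin (affine_zariski n) C \<longleftrightarrow> (\<exists>P. C = {z \<in> affine_space n. \<forall>p\<in>P. eval_at z p = 0})"
  by (subst closedin_nonvanishing_iff(2)[OF affine_zariski_eq, where mul = "(*)" and e = 1]) (auto simp: eval_at_mult)

lemma irreducible_affine:
  "irreducible_in (affine_zariski n) T \<longleftrightarrow> T \<subseteq> affine_space n \<and> T \<noteq> {} \<and>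
    (\<forall>p q. (\<forall>z\<in>T. eval_at z p = 0 \<or> eval_at z q = 0) \<longrightarrow> (\<forall>z\<in>T. eval_at z p = 0) \<or> (\<forall>z\<in>T. eval_at z q = 0))"
  by (subst irreducible_nonvanishing_iff[where H = UNIV and nz = "\<lambda>z p. eval_at z p \<noteq> 0", OF topspace_affine])
    (auto simp: closedin_affine)

definition polyfun :: "(complex \<Rightarrow> complex) \<Rightarrow> bool" where
  "polyfun f \<longleftrightarrow> (\<exists>q. \<forall>s. f s = poly q s)"

lemma polyfun_const [intro]: "polyfun (\<lambda>_. c)"
  unfolding polyfun_def by (intro exI[of _ "[:c:]"]) simp

lemma polyfun_id [intro]: "polyfun (\<lambda>s. s)"
  unfolding polyfun_def by (intro exI[of _ "[:0, 1:]"]) simp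

lemma polyfun_add [intro]: "polyfun f \<Longrightarrow> polyfun g \<Longrightarrow> polyfun (\<lambda>s. f s + g s)"
  unfolding polyfun_def by (metis poly_add)

lemma polyfun_mult [intro]: "polyfun f \<Longrightarrow> polyfun g \<Longrightarrow> polyfun (\<lambda>s. f s * g s)"
  unfolding polyfun_def by (metis poly_mult)

lemma polyfun_sum: "(\<And>a. a \<in> A \<Longrightarrow> polyfun (f a)) \<Longrightarrow> polyfun (\<lambda>s. \<Sum>a\<in>A. f a s)"
  by (induction A rule: infinite_finite_induct) auto

lemma polyfun_prod: "(\<And>a. a \<in> A \<Longrightarrow> polyfun (f a)) \<Longrightarrow> polyfun (\<lambda>s. \<Prod>a\<in>A. f a s)"
  by (induction A rule: infinite_finite_induct) auto

lemma polyfun_eval_at: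
  assumes "\<And>v. polyfun (\<lambda>s. x s v)"
  shows "polyfun (\<lambda>s. eval_at (x s) p)"
proof -
  have "p \<in> vars_in UNIV" by simp
  then show ?thesis
    by (induction rule: cpoly_induct) (use assms in \<open>auto simp: eval_at_simps\<close>)
qed

lemma polyfun_roots: "polyfun f \<Longrightarrow> f a \<noteq> 0 \<Longrightarrow> finite {s. f s = 0}"
  unfolding polyfun_def by (metis (no_types, lifting) Collect_cong poly_0 poly_roots_finite)

text \<open>On a line through a point where \<open>p\<close> does not vanish and a point where
  \<open>q\<close> does not, each has finitely many zeros; the line is infinite.\<close>

lemma irreducible_lines:
  assumes "T \<subseteq> affine_space n" "T \<noteq> {}" "\<And>a b s. a \<in> T \<Longrightarrow> b \<in> T \<Longrightarrow> (\<lambda>v. a v + s * (b v - a v)) \<in> T"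
  shows "irreducible_in (affine_zariski n) T"
  unfolding irreducible_affine
proof (intro conjI allI impI)
  fix p q assume pq: "\<forall>z\<in>T. eval_at z p = 0 \<or> eval_at z q = 0"
  show "(\<forall>z\<in>T. eval_at z p = 0) \<or> (\<forall>z\<in>T. eval_at z q = 0)"
  proof (rule ccontr)
    assume "\<not> ?thesis"
    then obtain a b where a: "a \<in> T" "eval_at a p \<noteq> 0" and b: "b \<in> T" "eval_at b q \<noteq> 0" by blast
    define x where "x s v = a v + s * (b v - a v)" for s :: complex and v
    have x: "x s \<in> T" for s unfolding x_def using assms(3)[OF a(1) b(1)] .
    have "polyfun (\<lambda>s. x s v)" for v
      unfolding x_def by (intro polyfun_add polyfun_mult polyfun_const polyfun_id)
    moreover have "x 0 = a" "x 1 = b" by (simp_all add: x_def fun_eq_iff)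
    ultimately have "finite {s. eval_at (x s) p = 0}" "finite {s. eval_at (x s) q = 0}"
      using polyfun_roots[OF polyfun_eval_at[of x p], of 0] polyfun_roots[OF polyfun_eval_at[of x q], of 1] a b
      by simp_all
    then have "finite ({s. eval_at (x s) p = 0} \<union> {s. eval_at (x s) q = 0})" by blast
    moreover have "{s. eval_at (x s) p = 0} \<union> {s. eval_at (x s) q = 0} = UNIV" using pq x by auto
    ultimately show False using infinite_UNIV_char_0[where 'a = complex] by simp
  qed
qed (use assms in auto)

lemma irreducible_affine_space: "irreducible_in (affine_zariski n) (affine_space n)"
  by (rule irreducible_lines) (auto simp: affine_space_def)

definition closure_zeros :: "nat \<Rightarrow> (nat \<Rightarrow> complex) set \<Rightarrow> (nat \<Rightarrow> complex) set" where
  "closure_zeros n T = {z \<in> affine_space n. \<forall>p\<in>{p. \<forall>y\<in>T. eval_at y p = 0}. eval_at z p = 0}"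

lemma irreducible_closure_zeros:
  assumes "irreducible_in (affine_zariski n) T"
  shows "irreducible_in (affine_zariski n) (closure_zeros n T)" "T \<subseteq> closure_zeros n T"
    "closedin (affine_zariski n) (closure_zeros n T)"
proof -
  show s: "T \<subseteq> closure_zeros n T"
    using assms unfolding irreducible_affine closure_zeros_def by blast
  show "closedin (affine_zariski n) (closure_zeros n T)"
    unfolding closedin_affine closure_zeros_def by blast
  have "(\<forall>z\<in>closure_zeros n T. eval_at z p = 0) \<or> (\<forall>z\<in>closure_zeros n T. eval_at z q = 0)"
    if pq: "\<forall>z\<in>closure_zeros n T. eval_at z p = 0 \<or> eval_at z q = 0" for p q
  proof -
    have "\<forall>z\<in>T. eval_at z p = 0 \<or> eval_at z q = 0" using pq s by blast
    then have "(\<forall>z\<in>T. eval_at z p = 0) \<or> (\<forall>z\<in>T. eval_at z q = 0)"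
      using assms unfolding irreducible_affine by blast
    then show ?thesis unfolding closure_zeros_def by blast
  qed
  moreover have "closure_zeros n T \<subseteq> affine_space n" "closure_zeros n T \<noteq> {}"
    using s assms unfolding irreducible_affine closure_zeros_def by auto
  ultimately show "irreducible_in (affine_zariski n) (closure_zeros n T)"
    unfolding irreducible_affine by blast
qed

text \<open>For each translation \<open>s\<close> one of \<open>p\<close>, \<open>q\<close> vanishes
  on the translate of \<open>T\<close>. One of them does so for infinitely many \<open>s\<close>,
  hence for all, being polynomial in \<open>s\<close>.\<close>

lemma irreducible_cylinder:
  assumes T: "irreducible_in (affine_zariski n) T" and v: "v \<le> n"
  shows "irreducible_in (affine_zariski n) {z(v := z v + s) |z s. z \<in> T}"
  unfolding irreducible_affine
proof (intro conjI allI impI)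
  show "{z(v := z v + s) |z s. z \<in> T} \<subseteq> affine_space n"
    using T v unfolding irreducible_affine affine_space_def by auto
  show "{z(v := z v + s) |z s. z \<in> T} \<noteq> {}"
  proof -
    obtain z where "z \<in> T" using T unfolding irreducible_affine by blast
    then have "z(v := z v + 0) \<in> {z(v := z v + s) |z s. z \<in> T}" by blast
    then show ?thesis by blast
  qed
next
  fix p q assume pq: "\<forall>z\<in>{z(v := z v + s) |z s. z \<in> T}. eval_at z p = 0 \<or> eval_at z q = 0"
  define sh where "sh s r = substitute (\<lambda>w. if w = v then Var v + Const s else Var w) r" for s and r :: "nat cpoly"
  have sh: "eval_at z (sh s r) = eval_at (z(v := z v + s)) r" for z s r
    unfolding sh_def eval_at_substitute by (rule arg_cong[where f = "\<lambda>x. eval_at x r"]) (auto simp: eval_at_simps)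
  have alt: "(\<forall>z\<in>T. eval_at z (sh s p) = 0) \<or> (\<forall>z\<in>T. eval_at z (sh s q) = 0)" for s
  proof -
    have "\<forall>z\<in>T. eval_at z (sh s p) = 0 \<or> eval_at z (sh s q) = 0" using pq unfolding sh by blast
    then show ?thesis using T unfolding irreducible_affine by blast
  qed
  have all: "\<forall>z\<in>{z(v := z v + s) |z s. z \<in> T}. eval_at z r = 0"
    if inf: "infinite {s. \<forall>z\<in>T. eval_at z (sh s r) = 0}" for r
  proof (rule ccontr)
    assume "\<not> ?thesis"
    then obtain z t where z: "z \<in> T" "eval_at (z(v := z v + t)) r \<noteq> 0" by blast
    have "polyfun (\<lambda>s. (z(v := z v + s)) w)" for w
      using polyfun_add[OF polyfun_const polyfun_id] by (cases "w = v") auto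
    then have "polyfun (\<lambda>s. eval_at (z(v := z v + s)) r)" by (rule polyfun_eval_at)
    then have "finite {s. eval_at (z(v := z v + s)) r = 0}" using z(2) by (rule polyfun_roots)
    moreover have "{s. \<forall>z\<in>T. eval_at z (sh s r) = 0} \<subseteq> {s. eval_at (z(v := z v + s)) r = 0}"
      using z(1) by (auto simp: sh)
    ultimately show False using inf finite_subset by blast
  qed
  have "infinite {s. \<forall>z\<in>T. eval_at z (sh s p) = 0} \<or> infinite {s. \<forall>z\<in>T. eval_at z (sh s q) = 0}"
  proof (rule ccontr)
    assume "\<not> ?thesis"
    then have "finite ({s. \<forall>z\<in>T. eval_at z (sh s p) = 0} \<union> {s. \<forall>z\<in>T. eval_at z (sh s q) = 0})" by blast
    moreover have "{s. \<forall>z\<in>T. eval_at z (sh s p) = 0} \<union> {s. \<forall>z\<in>T. eval_at z (sh s q) = 0} = UNIV" using alt by auto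
    ultimately show False using infinite_UNIV_char_0[where 'a = complex] by simp
  qed
  then show "(\<forall>z\<in>{z(v := z v + s) |z s. z \<in> T}. eval_at z p = 0) \<or> (\<forall>z\<in>{z(v := z v + s) |z s. z \<in> T}. eval_at z q = 0)"
    using all by blast
qed

text \<open>Yields codimension at least two through the chain T, T', whole space, and transports
  easily along linear isomorphisms.\<close>

definition not_maximal :: "nat \<Rightarrow> (nat \<Rightarrow> complex) set \<Rightarrow> bool" where
  "not_maximal n Z \<longleftrightarrow> (\<forall>T. closedin (affine_zariski n) T \<and> irreducible_in (affine_zariski n) T \<and> T \<subseteq> Z \<longrightarrow>
     (\<exists>T'. closedin (affine_zariski n) T' \<and> irreducible_in (affine_zariski n) T' \<and> T \<subset> T' \<and> T' \<subset> affine_space n))"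

lemma not_maximalD:
  assumes "not_maximal n Z" "closedin (affine_zariski n) T" "irreducible_in (affine_zariski n) T" "T \<subseteq> Z"
  shows "\<exists>T'. closedin (affine_zariski n) T' \<and> irreducible_in (affine_zariski n) T' \<and> T \<subset> T' \<and> T' \<subset> affine_space n"
  using assms unfolding not_maximal_def by simp

lemma codimension_ge_2I:
  assumes "not_maximal n Z"
  shows "2 \<le> codimension (affine_zariski n) Z"
  unfolding codimension_def
proof (rule INF_greatest)
  fix T assume "T \<in> {T. closedin (affine_zariski n) T \<and> irreducible_in (affine_zariski n) T \<and> T \<subseteq> Z}"
  then have T: "closedin (affine_zariski n) T" "irreducible_in (affine_zariski n) T" "T \<subseteq> Z" by auto
  then obtain T' where T': "closedin (affine_zariski n) T'" "irreducible_in (affine_zariski n) T'" "T \<subset> T'" "T' \<subset> affine_space n"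
    using not_maximalD[OF assms T] by auto
  define C where "C i = (if i = 0 then T else if i = 1 then T' else affine_space n)" for i :: nat
  have A: "closedin (affine_zariski n) (affine_space n)"
    using closedin_topspace[of "affine_zariski n"] by (simp add: topspace_affine)
  have "C 0 = T \<and> (\<forall>i\<le>2. closedin (affine_zariski n) (C i) \<and> irreducible_in (affine_zariski n) (C i)) \<and>
      (\<forall>i<2. C i \<subset> C (Suc i))"
    using T T' A irreducible_affine_space by (auto simp: C_def less_2_cases_iff)
  then have "(2::nat) \<in> {c. \<exists>C. C 0 = T \<and> (\<forall>i\<le>c. closedin (affine_zariski n) (C i) \<and> irreducible_in (affine_zariski n) (C i)) \<and>
      (\<forall>i<c. C i \<subset> C (Suc i))}" by (intro CollectI exI[of _ C])
  then have "enat 2 \<le> (SUP c \<in> {c. \<exists>C. C 0 = T \<and> (\<forall>i\<le>c. closedin (affine_zariski n) (C i) \<and> irreducible_in (affine_zariski n) (C i)) \<and>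
      (\<forall>i<c. C i \<subset> C (Suc i))}. enat c)" by (rule SUP_upper)
  then show "2 \<le> (SUP c \<in> {c. \<exists>C. C 0 = T \<and> (\<forall>i\<le>c. closedin (affine_zariski n) (C i) \<and> irreducible_in (affine_zariski n) (C i)) \<and>
      (\<forall>i<c. C i \<subset> C (Suc i))}. enat c)" by (simp add: numeral_eq_enat)
qed

lemma not_maximal_transfer:
  assumes Z: "not_maximal n Z"
    and L: "\<And>z. z \<in> affine_space n \<Longrightarrow> L z \<in> affine_space n" "\<And>z. z \<in> affine_space n \<Longrightarrow> N (L z) = z"
      "\<And>p. \<exists>q. \<forall>z\<in>affine_space n. eval_at z q = eval_at (L z) p"
    and N: "\<And>z. z \<in> affine_space n \<Longrightarrow> N z \<in> affine_space n" "\<And>z. z \<in> affine_space n \<Longrightarrow> L (N z) = z"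
      "\<And>p. \<exists>q. \<forall>z\<in>affine_space n. eval_at z q = eval_at (N z) p"
    and Z': "Z' \<subseteq> {z \<in> affine_space n. L z \<in> Z}"
  shows "not_maximal n Z'"
proof -
  have image: "closedin (affine_zariski n) (L ` T) \<and> irreducible_in (affine_zariski n) (L ` T)"
    if L: "\<And>z. z \<in> affine_space n \<Longrightarrow> L z \<in> affine_space n" "\<And>z. z \<in> affine_space n \<Longrightarrow> N (L z) = z"
      "\<And>p. \<exists>q. \<forall>z\<in>affine_space n. eval_at z q = eval_at (L z) p"
    and N: "\<And>z. z \<in> affine_space n \<Longrightarrow> N z \<in> affine_space n" "\<And>z. z \<in> affine_space n \<Longrightarrow> L (N z) = z"
      "\<And>p. \<exists>q. \<forall>z\<in>affine_space n. eval_at z q = eval_at (N z) p"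
    and T: "closedin (affine_zariski n) T" "irreducible_in (affine_zariski n) T"
    for L N :: "(nat \<Rightarrow> complex) \<Rightarrow> nat \<Rightarrow> complex" and T
  proof
    obtain P where P: "T = {z \<in> affine_space n. \<forall>p\<in>P. eval_at z p = 0}"
      using T(1) unfolding closedin_affine by blast
    obtain h where h: "\<And>p z. z \<in> affine_space n \<Longrightarrow> eval_at z (h p) = eval_at (N z) p"
      using N(3) by metis
    have "L ` T = {z \<in> affine_space n. \<forall>p\<in>h ` P. eval_at z p = 0}"
    proof (intro equalityI subsetI)
      fix y assume "y \<in> L ` T"
      then show "y \<in> {z \<in> affine_space n. \<forall>p\<in>h ` P. eval_at z p = 0}" using L h unfolding P by auto
    next
      fix y assume y: "y \<in> {z \<in> affine_space n. \<forall>p\<in>h ` P. eval_at z p = 0}"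
      then have "N y \<in> T" "y = L (N y)" using N h unfolding P by auto
      then show "y \<in> L ` T" by blast
    qed
    then show "closedin (affine_zariski n) (L ` T)" unfolding closedin_affine by blast
    obtain k where k: "\<And>p z. z \<in> affine_space n \<Longrightarrow> eval_at z (k p) = eval_at (L z) p"
      using L(3) by metis
    have TA: "T \<subseteq> affine_space n" unfolding P by blast
    show "irreducible_in (affine_zariski n) (L ` T)"
      unfolding irreducible_affine
    proof (intro conjI allI impI)
      show "L ` T \<subseteq> affine_space n" using TA L(1) by blast
      show "L ` T \<noteq> {}" using T(2) unfolding irreducible_affine by blast
      fix p q assume pq: "\<forall>z\<in>L ` T. eval_at z p = 0 \<or> eval_at z q = 0"
      have k': "eval_at z (k r) = eval_at (L z) r" if "z \<in> T" for z r using that TA k by blast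
      have "\<forall>z\<in>T. eval_at z (k p) = 0 \<or> eval_at z (k q) = 0" using pq by (simp add: k')
      then have "(\<forall>z\<in>T. eval_at z (k p) = 0) \<or> (\<forall>z\<in>T. eval_at z (k q) = 0)"
        using T(2) unfolding irreducible_affine by blast
      then show "(\<forall>z\<in>L ` T. eval_at z p = 0) \<or> (\<forall>z\<in>L ` T. eval_at z q = 0)" by (simp add: k')
    qed
  qed
  show ?thesis
    unfolding not_maximal_def
  proof (intro allI impI)
    fix T assume T: "closedin (affine_zariski n) T \<and> irreducible_in (affine_zariski n) T \<and> T \<subseteq> Z'"
    have LT: "closedin (affine_zariski n) (L ` T) \<and> irreducible_in (affine_zariski n) (L ` T)"
      by (rule image[of L N, OF L N]) (use T in simp_all)
    have LZ: "L ` T \<subseteq> Z" using T Z' by auto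
    obtain U where U: "closedin (affine_zariski n) U" "irreducible_in (affine_zariski n) U" "L ` T \<subset> U" "U \<subset> affine_space n"
      using not_maximalD[OF Z LT[THEN conjunct1] LT[THEN conjunct2] LZ] by auto
    have "closedin (affine_zariski n) (N ` U) \<and> irreducible_in (affine_zariski n) (N ` U)"
      by (rule image[of N L, OF N L U(1,2)])
    moreover have TA: "T \<subseteq> affine_space n" using T Z' by blast
    have "T \<subset> N ` U"
    proof
      show "T \<subseteq> N ` U"
      proof
        fix z assume "z \<in> T"
        then have "z = N (L z)" "L z \<in> U" using TA L(2) U(3) by auto
        then show "z \<in> N ` U" by blast
      qed
      show "T \<noteq> N ` U"
      proof
        assume e: "T = N ` U"
        have "U \<subseteq> L ` T"
        proof
          fix u assume "u \<in> U"
          then have "u = L (N u)" "N u \<in> T" using e N(2) U(4) by auto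
          then show "u \<in> L ` T" by blast
        qed
        then show False using U(3) by blast
      qed
    qed
    moreover have "N ` U \<subset> affine_space n"
    proof
      show "N ` U \<subseteq> affine_space n" using U(4) N(1) by blast
      obtain y where y: "y \<in> affine_space n" "y \<notin> U" using U(4) by blast
      have "N y \<notin> N ` U"
      proof
        assume "N y \<in> N ` U"
        then obtain u where u: "u \<in> U" "N y = N u" by blast
        then have "L (N y) = L (N u)" by simp
        then have "y = u" using N(2)[of y] N(2)[of u] y(1) u(1) U(4) by auto
        then show False using y u by simp
      qed
      then show "N ` U \<noteq> affine_space n" using N(1) y(1) by blast
    qed
    ultimately show "\<exists>T'. closedin (affine_zariski n) T' \<and> irreducible_in (affine_zariski n) T' \<and> T \<subset> T' \<and> T' \<subset> affine_space n"
      by (intro exI[of _ "N ` U"] conjI) simp_all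
  qed
qed

section \<open>Dependence of \<omega> on z_0 and the codimension of its zero set\<close>

section \<open>The singular set\<close>

lemma eval_at_kill: "eval_at z (kill S p) = eval_at (\<lambda>v. if v \<in> S then 0 else z v) p"
proof -
  have "p \<in> vars_in UNIV" by simp
  then show ?thesis
    by (induction rule: cpoly_induct) (auto simp: kill_add kill_mult kill_Var eval_at_simps)
qed

lemma kill_vars_in: "p \<in> vars_in V \<Longrightarrow> kill S p \<in> vars_in V"
  by (auto simp: vars_in_def kill_def keys_pfilter)

lemma kill_pdiff: "v \<notin> S \<Longrightarrow> kill S (pdiff v p) = pdiff v (kill S p)"
  unfolding kill_def by (rule pfilter_pdiff) (auto simp: keys_add_nat)

lemma eval_at_independent:
  assumes "pdiff v p = 0" "\<And>w. w \<noteq> v \<Longrightarrow> x w = y w"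
  shows "eval_at x p = eval_at y p"
proof -
  have False if m: "m \<in> keys p" "v \<in> keys m" for m
  proof -
    from m have "m - single v 1 + single v 1 = m"
      by (intro poly_mapping_eqI) (auto simp: lookup_add lookup_minus lookup_single when_def in_keys_iff)
    then have "of_nat (Suc (lookup (m - single v 1) v)) * lookup p m = 0"
      using lookup_pdiff[of v p "m - single v 1"] assms(1) by simp
    then show False using m(1) of_nat_neq_0 by (auto simp: in_keys_iff simp del: of_nat_Suc)
  qed
  then have "p \<in> vars_in (UNIV - {v})" unfolding vars_in_def by blast
  then show ?thesis by (rule eval_at_cong) (use assms(2) in auto)
qed

context deformation_setup
begin

lemma pdiff0_X: "1 \<le> k \<Longrightarrow> pdiff 0 (X k i) = 0"
  by (simp add: shift_field_def pdiff_mult pdiff_Var)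

text \<open>The entries (0, 1) and (1, 0) are free of z_0, and so are the fields with positive
  shift, which determine the further rows \<open>k < n\<close> of these columns.\<close>

lemma pdiff0_\<Omega>:
  assumes e: "e = 0 \<or> e = 1" and k: "k < n"
  shows "pdiff 0 (\<Omega> k e) = 0"
  using k
proof (induction k rule: less_induct)
  case (less k)
  have p: "pdiff 0 (Var n ^ (n - 1)) = (0 :: nat cpoly)"
    using n_ge by (intro pdiff_eq_0[of _ "{n}"]) (auto simp: Var_power intro!: vars_in_single)
  have 01: "pdiff 0 (\<Omega> 0 1) = 0"
    unfolding \<Omega>_01 by (simp add: pdiff_prod_Const p del: One_nat_def)
  have 10: "pdiff 0 (\<Omega> 1 0) = 0"
    using \<Omega>_anti[of 1 0] 01 by (simp add: pdiff_uminus)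
  show ?case
  proof (cases "k < 2")
    case True
    then have "k = 0 \<or> k = 1" by linarith
    then show ?thesis using e 01 10 by auto
  next
    case False
    let ?j = "n - k"
    have j: "?j < n - 1" "1 \<le> ?j" "k + ?j = n" using False less.prems by auto
    have "pdiff 0 (contract (X ?j) e) = 0" using contract_X[of ?j e] j e n_ge by auto
    moreover have "pdiff 0 (contract (X ?j) e) = (\<Sum>i\<le>n. X ?j i * pdiff 0 (\<Omega> i e))"
      unfolding pairing_def pdiff_sum pdiff_mult pdiff0_X[OF j(2)] by simp
    moreover have "(\<Sum>i\<le>n. X ?j i * pdiff 0 (\<Omega> i e)) = X ?j k * pdiff 0 (\<Omega> k e)"
    proof (rule sum_eq_single)
      fix i assume i: "i \<in> {..n}" "i \<noteq> k"
      show "X ?j i * pdiff 0 (\<Omega> i e) = 0"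
        using i less j(3) by (cases "i < k") (auto simp: shift_field_def)
    qed (use less.prems in auto)
    ultimately have "Const (\<beta> ?j k) * Var n * pdiff 0 (\<Omega> k e) = 0"
      using j(3) by (simp add: shift_field_def)
    then show ?thesis using \<beta>_nz[of ?j k] j by simp
  qed
qed

text \<open>Subtracting from R a multiple of X_0, which \<Omega> does not see, removes row
  \<open>j\<close> from the contraction.\<close>

lemma \<omega>_expand:
  assumes "l \<le> n" "\<beta> 0 j \<noteq> 0"
  shows "\<omega> l = (\<Sum>i\<le>n. Const (1 - \<beta> 0 i / \<beta> 0 j) * (Var i * \<Omega> i l))"
proof -
  have "\<omega> l = contract (radial n) l - Const (1 / \<beta> 0 j) * contract (X 0) l"
    using contract_X[of 0 l] n_ge assms(1) by (simp add: \<omega>_def)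
  also have "\<dots> = (\<Sum>i\<le>n. radial n i * \<Omega> i l - Const (1 / \<beta> 0 j) * (X 0 i * \<Omega> i l))"
    by (simp add: pairing_def sum_subtractf sum_distrib_left)
  also have "\<dots> = (\<Sum>i\<le>n. Const (1 - \<beta> 0 i / \<beta> 0 j) * (Var i * \<Omega> i l))"
  proof (rule sum.cong[OF refl])
    fix i assume "i \<in> {..n}"
    have "Const (1 / \<beta> 0 j) * Const (\<beta> 0 i) = (Const (\<beta> 0 i / \<beta> 0 j) :: nat cpoly)"
      by (simp flip: Const_mult)
    then have "Const (1 / \<beta> 0 j) * (Const (\<beta> 0 i) * Var i * \<Omega> i l) = Const (\<beta> 0 i / \<beta> 0 j) * (Var i * \<Omega> i l)"
      by (simp only: mult.assoc[symmetric])
    then show "radial n i * \<Omega> i l - Const (1 / \<beta> 0 j) * (X 0 i * \<Omega> i l) = Const (1 - \<beta> 0 i / \<beta> 0 j) * (Var i * \<Omega> i l)"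
      using \<open>i \<in> {..n}\<close> by (simp add: radial_def shift_field_def Const_diff Const_1 left_diff_distrib)
  qed
  finally show ?thesis .
qed

lemma \<beta>_0n: "\<beta> 0 n \<noteq> 0" and \<beta>_0n1: "\<beta> 0 (n - 1) \<noteq> 0"
  using \<beta>_nz[of 0 n] \<beta>_nz[of 0 "n - 1"] n_ge by auto

text \<open>Expanding with \<open>j = n\<close> drops the one row of \<Omega> that may involve z_0;
  after that z_0 occurs only as the explicit factor of row 0.\<close>

lemma pdiff0_\<omega>:
  assumes e: "e = 0 \<or> e = 1"
  shows "pdiff 0 (\<omega> e) = Const (1 - \<beta> 0 0 / \<beta> 0 n) * \<Omega> 0 e"
proof -
  have en: "e \<le> n" using e n_ge by auto
  have "pdiff 0 (\<omega> e) = (\<Sum>i\<le>n. Const (1 - \<beta> 0 i / \<beta> 0 n) * (pdiff 0 (Var i) * \<Omega> i e + Var i * pdiff 0 (\<Omega> i e)))"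
    unfolding \<omega>_expand[OF en \<beta>_0n] by (simp add: pdiff_sum pdiff_prod_Const pdiff_mult)
  also have "\<dots> = Const (1 - \<beta> 0 0 / \<beta> 0 n) * (pdiff 0 (Var 0) * \<Omega> 0 e + Var 0 * pdiff 0 (\<Omega> 0 e))"
  proof (rule sum_eq_single)
    fix i assume i: "i \<in> {..n}" "i \<noteq> 0"
    show "Const (1 - \<beta> 0 i / \<beta> 0 n) * (pdiff 0 (Var i) * \<Omega> i e + Var i * pdiff 0 (\<Omega> i e)) = 0"
      using i pdiff0_\<Omega>[OF e, of i] \<beta>_0n by (cases "i = n") (auto simp: pdiff_Var)
  qed auto
  also have "\<dots> = Const (1 - \<beta> 0 0 / \<beta> 0 n) * \<Omega> 0 e"
    using pdiff0_\<Omega>[OF e, of 0] n_ge by (simp add: pdiff_Var)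
  finally show ?thesis .
qed

text \<open>The number is -2n / \<beta>_0(n). Equality with n + 1 would, together with
  \<open>trace\<close>, force n = 1.\<close>

lemma \<kappa>: "1 - \<beta> 0 0 / \<beta> 0 n \<noteq> 0" "1 - \<beta> 0 0 / \<beta> 0 n \<noteq> of_nat (n + 1)"
proof -
  have n0: "(of_nat n :: complex) \<noteq> 0" "(of_nat n :: complex) \<noteq> 1"
    using n_ge by (auto simp: of_nat_eq_1_iff)
  have bn: "\<beta> 0 n = \<beta> 0 0 - 2 * of_nat n" and b1: "\<beta> 0 1 = \<beta> 0 0 - 2"
    using \<beta>_0[of n] \<beta>_0[of 1] by auto
  show "1 - \<beta> 0 0 / \<beta> 0 n \<noteq> 0"
    using \<beta>_0n n0 by (simp add: bn)
  show "1 - \<beta> 0 0 / \<beta> 0 n \<noteq> of_nat (n + 1)"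
  proof
    assume "1 - \<beta> 0 0 / \<beta> 0 n = of_nat (n + 1)"
    then have 1: "- 2 * of_nat n = of_nat (n + 1) * \<beta> 0 n"
    proof -
      have "\<beta> 0 n - \<beta> 0 0 = of_nat (n + 1) * \<beta> 0 n"
        using \<open>1 - \<beta> 0 0 / \<beta> 0 n = of_nat (n + 1)\<close> \<beta>_0n by (simp add: diff_divide_eq_iff divide_eq_eq)
      then show ?thesis by (simp add: bn)
    qed
    have m: "of_nat (n - 1) = (of_nat n - 1 :: complex)" using n_ge by (simp add: of_nat_diff)
    then have "(of_nat n - 1) * \<beta> 0 n + (\<beta> 0 n + 2 * of_nat n) + (\<beta> 0 n + 2 * of_nat n - 2) = 0"
      using trace unfolding m b1 by (simp add: bn)
    then have "of_nat (n + 1) * \<beta> 0 n + 4 * of_nat n - 2 = 0" by (simp add: algebra_simps)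
    then have "of_nat n = (1 :: complex)" unfolding 1[symmetric] by simp
    then show False using n0 by simp
  qed
qed

text \<open>Otherwise (n+1) \<open>\<Omega> 0 1\<close> would be the z_0-derivative of
  \<open>\<omega> 1\<close>, that is \<kappa> \<open>\<Omega> 0 1\<close>, with \<kappa> = n +
  1.\<close>

lemma \<omega>_0_nonzero: "\<omega> 0 \<noteq> 0"
proof
  assume z: "\<omega> 0 = 0"
  have "of_nat (n + 1) * \<Omega> 0 1 = pdiff 0 (\<omega> 1) - pdiff 1 (\<omega> 0)"
    using d1_\<omega>[of 0 1] n_ge by (simp add: d1_def)
  then have "(Const (of_nat (n + 1)) - Const (1 - \<beta> 0 0 / \<beta> 0 n)) * \<Omega> 0 1 = 0"
    using pdiff0_\<omega>[of 1] z by (simp only: Const_of_nat left_diff_distrib) simp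
  moreover have "\<Omega> 0 1 \<noteq> 0" using c_nz by (simp add: \<Omega>_01 del: One_nat_def)
  ultimately have "Const (of_nat (n + 1)) - Const (1 - \<beta> 0 0 / \<beta> 0 n) = (0 :: nat cpoly)"
    by (metis mult_eq_0_iff)
  then have "Const (of_nat (n + 1) - (1 - \<beta> 0 0 / \<beta> 0 n)) = (0 :: nat cpoly)"
    unfolding Const_diff .
  then have "of_nat (n + 1) - (1 - \<beta> 0 0 / \<beta> 0 n) = 0" by (simp only: Const_eq_0_iff)
  then show False using \<kappa>(2) by (simp only: right_minus_eq)
qed

text \<open>The same induction on the hyperplane z_n = 0, where the pivots are multiples of z_(n-1)
  in row n - 1 - j.\<close>

lemma pdiff0_kill_\<Omega>:
  assumes "k < n - 1"
  shows "pdiff 0 (kill {n} (\<Omega> k n)) = 0"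
  using assms
proof (induction k rule: less_induct)
  case (less k)
  show ?case
  proof (cases "k = 0")
    case True
    have "pdiff 0 (Var (n - 1) ^ (n - 1)) = (0 :: nat cpoly)"
      using n_ge by (intro pdiff_eq_0[of _ "{n - 1}"]) (auto simp: Var_power intro!: vars_in_single)
    then show ?thesis unfolding True \<Omega>_0n by (simp add: pdiff_prod_Const del: One_nat_def)
  next
    case False
    let ?j = "n - 1 - k"
    have j: "?j < n - 1" "1 \<le> ?j" "k + ?j = n - 1" "k \<le> n" using False less.prems by auto
    have "pdiff 0 (kill {n} (contract (X ?j) n)) = 0" using contract_X[of ?j n] j by simp
    moreover have "pdiff 0 (kill {n} (X ?j i)) = 0" for i
      using n_ge pdiff0_X[OF j(2)] by (simp flip: kill_pdiff)
    then have "pdiff 0 (kill {n} (contract (X ?j) n)) = (\<Sum>i\<le>n. kill {n} (X ?j i) * pdiff 0 (kill {n} (\<Omega> i n)))"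
      unfolding pairing_def kill_sum kill_mult pdiff_sum pdiff_mult by simp
    moreover have "(\<Sum>i\<le>n. kill {n} (X ?j i) * pdiff 0 (kill {n} (\<Omega> i n))) = kill {n} (X ?j k) * pdiff 0 (kill {n} (\<Omega> k n))"
    proof (rule sum_eq_single)
      fix i assume i: "i \<in> {..n}" "i \<noteq> k"
      show "kill {n} (X ?j i) * pdiff 0 (kill {n} (\<Omega> i n)) = 0"
      proof (cases "i < k")
        case True
        then show ?thesis using less by simp
      next
        case False
        then have "i + ?j = n \<or> n < i + ?j" using i j(3) by linarith
        then have "kill {n} (X ?j i) = 0" by (auto simp: shift_field_def kill_mult kill_Var)
        then show ?thesis by simp
      qed
    qed (use j in auto)
    ultimately have "kill {n} (X ?j k) * pdiff 0 (kill {n} (\<Omega> k n)) = 0" by simp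
    moreover have "kill {n} (X ?j k) = Const (\<beta> ?j k) * Var (n - 1)"
      using j(3) n_ge by (simp add: shift_field_def kill_mult kill_Var)
    ultimately show ?thesis using \<beta>_nz[of ?j k] j by simp
  qed
qed

text \<open>Shows that \<omega> does not vanish identically on z_n = 0. The expansion uses
  \<open>j = n - 1\<close>, the row that the preceding lemma leaves open, so the z_0-derivative is a
  nonzero multiple of \<open>\<Omega> 0 n\<close>.\<close>

lemma kill_\<omega>_n: "kill {n} (\<omega> n) \<noteq> 0"
proof
  assume z: "kill {n} (\<omega> n) = 0"
  let ?\<gamma> = "\<lambda>i. kill {n} (\<Omega> i n)"
  have "pdiff 0 (kill {n} (\<omega> n)) =
      (\<Sum>i\<le>n. Const (1 - \<beta> 0 i / \<beta> 0 (n - 1)) * (pdiff 0 (kill {n} (Var i)) * ?\<gamma> i + kill {n} (Var i) * pdiff 0 (?\<gamma> i)))"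
    unfolding \<omega>_expand[OF order_refl \<beta>_0n1]
    by (simp add: kill_sum kill_mult pdiff_sum pdiff_prod_Const pdiff_mult)
  also have "\<dots> = Const (1 - \<beta> 0 0 / \<beta> 0 (n - 1)) * (pdiff 0 (kill {n} (Var 0)) * ?\<gamma> 0 + kill {n} (Var 0) * pdiff 0 (?\<gamma> 0))"
  proof (rule sum_eq_single)
    fix i assume i: "i \<in> {..n}" "i \<noteq> 0"
    consider "i = n" | "i = n - 1" | "i < n - 1" using i(1) by fastforce
    then show "Const (1 - \<beta> 0 i / \<beta> 0 (n - 1)) * (pdiff 0 (kill {n} (Var i)) * ?\<gamma> i + kill {n} (Var i) * pdiff 0 (?\<gamma> i)) = 0"
    proof cases
      case 2
      then have "1 - \<beta> 0 i / \<beta> 0 (n - 1) = 0" using \<beta>_0n1 by simp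
      then show ?thesis by simp
    qed (use i pdiff0_kill_\<Omega>[of i] in \<open>auto simp: kill_Var pdiff_Var\<close>)
  qed auto
  also have "\<dots> = Const (1 - \<beta> 0 0 / \<beta> 0 (n - 1)) * (Const c' * Var (n - 1) ^ (n - 1))"
    using pdiff0_kill_\<Omega>[of 0] n_ge by (simp add: kill_Var pdiff_Var \<Omega>_0n del: One_nat_def)
  finally have "Const (1 - \<beta> 0 0 / \<beta> 0 (n - 1)) * (Const c' * Var (n - 1) ^ (n - 1)) = (0 :: nat cpoly)"
    using z by simp
  then have "1 - \<beta> 0 0 / \<beta> 0 (n - 1) = 0" using c'_nz by simp
  then have "\<beta> 0 0 = \<beta> 0 (n - 1)" using \<beta>_0n1 by simp
  then have "of_nat (n - 1) = (0 :: complex)" using \<beta>_0[of "n - 1"] by (simp del: of_nat_diff)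
  then show False using n_ge by (simp del: of_nat_diff)
qed

text \<open>Inside z_n = 0 the hyperplane itself lies strictly between \<open>T\<close> and the
  whole space. Otherwise the closure of the cylinder over \<open>T\<close> in direction z_0 does:
  \<open>\<omega> 1\<close> is affine in z_0 with slope a nonzero multiple of z_n^(n-1), so the
  cylinder leaves \<open>T\<close>, and \<open>\<omega> 0\<close> is a nonzero polynomial free of
  z_0, so it still vanishes on the cylinder.\<close>

lemma not_maximal_\<omega>: "not_maximal n (zero_set n (one_form n \<omega>))"
  unfolding not_maximal_def
proof (intro allI impI)
  let ?Az = "affine_zariski n"
  fix T assume T: "closedin ?Az T \<and> irreducible_in ?Az T \<and> T \<subseteq> zero_set n (one_form n \<omega>)"
  have TA: "T \<subseteq> affine_space n" using T unfolding irreducible_affine by blast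
  have \<omega>0: "eval_at z (\<omega> l) = 0" if "z \<in> T" "l \<le> n" for z l
  proof -
    have "eval_at z (one_form n \<omega> {l}) = 0" using T that(1) unfolding zero_set_def by blast
    then show ?thesis using that(2) by simp
  qed
  show "\<exists>T'. closedin ?Az T' \<and> irreducible_in ?Az T' \<and> T \<subset> T' \<and> T' \<subset> affine_space n"
  proof (cases "\<forall>z\<in>T. z n = 0")
    case True
    define H where "H = {z \<in> affine_space n. z n = 0}"
    have "H = {z \<in> affine_space n. \<forall>p\<in>{Var n}. eval_at z p = 0}" unfolding H_def by simp
    then have "closedin ?Az H" unfolding closedin_affine by blast
    moreover have "irreducible_in ?Az H"
      by (rule irreducible_lines) (auto simp: H_def affine_space_def)
    moreover have "T \<subset> H"
    proof
      show "T \<subseteq> H" using True TA unfolding H_def by blast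
      show "T \<noteq> H"
      proof
        assume TH: "T = H"
        have "kill {n} (\<omega> n) = 0"
        proof (rule vars_in_eq_0I)
          show "kill {n} (\<omega> n) \<in> vars_in {..n}" using \<omega>_hom by (intro kill_vars_in) (auto simp: hom_polys_iff)
          fix x assume x: "\<forall>v. v \<notin> {..n} \<longrightarrow> x v = (0::complex)"
          have "(\<lambda>v. if v \<in> {n} then 0 else x v) \<in> T"
            unfolding TH H_def affine_space_def using x by auto
          then show "eval_at x (kill {n} (\<omega> n)) = 0" unfolding eval_at_kill by (rule \<omega>0) simp
        qed
        then show False using kill_\<omega>_n by simp
      qed
    qed
    moreover have "H \<subset> affine_space n"
    proof -
      have "(\<lambda>v. if v = n then 1 else 0) \<in> affine_space n" "(\<lambda>v. if v = n then 1 else 0) \<notin> H"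
        by (auto simp: H_def affine_space_def)
      then have "H \<noteq> affine_space n" by metis
      moreover have "H \<subseteq> affine_space n" by (auto simp: H_def)
      ultimately show ?thesis by simp
    qed
    ultimately show ?thesis by (intro exI[of _ H] conjI)
  next
    case False
    then obtain y where y: "y \<in> T" "y n \<noteq> 0" by blast
    define U where "U = {z(0 := z 0 + s) |z s. z \<in> T}"
    have U: "irreducible_in ?Az U" unfolding U_def by (rule irreducible_cylinder) (use T in auto)
    note cl = irreducible_closure_zeros[OF U]
    have TU: "T \<subseteq> U"
    proof
      fix z assume "z \<in> T"
      then show "z \<in> U" unfolding U_def by (intro CollectI exI[of _ z] exI[of _ 0]) simp
    qed
    have "closure_zeros n U \<noteq> T"
    proof
      assume eq: "closure_zeros n U = T"
      have "y(0 := y 0 + 1) \<in> U" unfolding U_def using y(1) by blast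
      then have "y(0 := y 0 + 1) \<in> T" using cl(2) eq by auto
      then have 1: "eval_at (y(0 := y 0 + 1)) (\<omega> 1) = 0" using n_ge by (intro \<omega>0) auto
      have 0: "eval_at y (\<omega> 1) = 0" using y(1) n_ge by (intro \<omega>0) auto
      define k where "k = (1 - \<beta> 0 0 / \<beta> 0 n) * c"
      define r where "r = \<omega> 1 - Const k * Var n ^ (n - 1) * Var 0"
      have p: "pdiff 0 (Var n ^ (n - 1)) = (0 :: nat cpoly)"
        using n_ge by (intro pdiff_eq_0[of _ "{n}"]) (auto simp: Var_power intro!: vars_in_single)
      have "pdiff 0 (\<omega> 1) = Const k * Var n ^ (n - 1)"
        using pdiff0_\<omega>[of 1] by (simp add: \<Omega>_01 k_def Const_mult mult.assoc del: One_nat_def)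
      then have "pdiff 0 r = 0"
        by (simp add: r_def pdiff_diff pdiff_mult pdiff_Var p del: One_nat_def)
      then have "eval_at (y(0 := y 0 + 1)) r = eval_at y r"
        by (rule eval_at_independent) simp
      then have "k * y n ^ (n - 1) * (y 0 + 1) = k * y n ^ (n - 1) * y 0"
        using 0 1 n_ge by (simp add: r_def eval_at_simps del: One_nat_def)
      then have "k * y n ^ (n - 1) = 0" by (simp only: distrib_left) simp
      then show False using y(2) \<kappa>(1) c_nz by (simp add: k_def)
    qed
    moreover have "closure_zeros n U \<noteq> affine_space n"
    proof
      assume eq: "closure_zeros n U = affine_space n"
      have p0: "pdiff 0 (\<omega> 0) = 0" using pdiff0_\<omega>[of 0] by simp
      have "\<forall>z\<in>U. eval_at z (\<omega> 0) = 0"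
      proof
        fix z assume "z \<in> U"
        then obtain x s where x: "x \<in> T" "z = x(0 := x 0 + s)" unfolding U_def by blast
        have "eval_at z (\<omega> 0) = eval_at x (\<omega> 0)"
          by (rule eval_at_independent[OF p0]) (simp add: x(2))
        then show "eval_at z (\<omega> 0) = 0" using \<omega>0[OF x(1)] by simp
      qed
      then have "\<forall>z\<in>closure_zeros n U. eval_at z (\<omega> 0) = 0"
        unfolding closure_zeros_def by auto
      then have z: "\<forall>z\<in>affine_space n. eval_at z (\<omega> 0) = 0" by (simp only: eq)
      have "\<omega> 0 = 0"
      proof (rule vars_in_eq_0I)
        show "\<omega> 0 \<in> vars_in {..n}" using \<omega>_hom[of 0] by (simp add: hom_polys_iff)
        fix x assume "\<forall>v. v \<notin> {..n} \<longrightarrow> x v = (0::complex)"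
        then show "eval_at x (\<omega> 0) = 0" using z by (auto simp: affine_space_def)
      qed
      then show False using \<omega>_0_nonzero by simp
    qed
    moreover have "closure_zeros n U \<subseteq> affine_space n" unfolding closure_zeros_def by blast
    moreover have "T \<subseteq> closure_zeros n U" using TU cl(2) by simp
    ultimately show ?thesis using cl(1,3) by (intro exI[of _ "closure_zeros n U"]) auto
  qed
qed

end

section \<open>Invariance of integrability and singular sets under GL, and expansion along lines of
  matrices\<close>

section \<open>Linear changes of coordinates\<close>

definition act :: "nat \<Rightarrow> complex mat \<Rightarrow> (nat \<Rightarrow> complex) \<Rightarrow> nat \<Rightarrow> complex" where
  "act n M z = (\<lambda>i. if i \<le> n then \<Sum>j\<le>n. M $$ (i, j) * z j else 0)"

definition GLn :: "nat \<Rightarrow> complex mat set" where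
  "GLn n = {M \<in> carrier_mat (n + 1) (n + 1). invertible_mat M}"

lemma GLn_inverse:
  assumes "M \<in> GLn n"
  shows "\<exists>N\<in>GLn n. (\<forall>i\<le>n. \<forall>k\<le>n. (\<Sum>j\<le>n. M $$ (i, j) * N $$ (j, k)) = (if i = k then 1 else 0)) \<and>
    (\<forall>i\<le>n. \<forall>k\<le>n. (\<Sum>j\<le>n. N $$ (i, j) * M $$ (j, k)) = (if i = k then 1 else 0))"
proof -
  have M: "M \<in> carrier_mat (n + 1) (n + 1)" using assms by (simp add: GLn_def)
  obtain N where N: "M * N = 1\<^sub>m (dim_row M)" "N * M = 1\<^sub>m (dim_row N)"
    using assms unfolding GLn_def invertible_mat_def inverts_mat_def by blast
  have "dim_col N = n + 1"
    using arg_cong[OF N(1), of dim_col] M by simp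
  moreover have "dim_row N = n + 1"
    using arg_cong[OF N(2), of dim_col] M by simp
  ultimately have Nc: "N \<in> carrier_mat (n + 1) (n + 1)" by auto
  have set: "{0..<n + 1} = {..n}" by auto
  have entry: "(\<Sum>j\<le>n. A $$ (i, j) * B $$ (j, k)) = (if i = k then 1 else 0)"
    if "A \<in> carrier_mat (n + 1) (n + 1)" "B \<in> carrier_mat (n + 1) (n + 1)" "A * B = 1\<^sub>m (n + 1)" "i \<le> n" "k \<le> n"
    for A B :: "complex mat" and i k
  proof -
    have "(A * B) $$ (i, k) = (\<Sum>j\<in>{0..<n + 1}. A $$ (i, j) * B $$ (j, k))"
      using that(1,2,4,5) by (simp add: scalar_prod_def del: sum.op_ivl_Suc)
    then have "(\<Sum>j\<le>n. A $$ (i, j) * B $$ (j, k)) = 1\<^sub>m (n + 1) $$ (i, k)"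
      unfolding set that(3) by simp
    then show ?thesis using that(4,5) by simp
  qed
  have "N \<in> GLn n"
    unfolding GLn_def invertible_mat_def inverts_mat_def using N M Nc by auto
  then show ?thesis
    using entry[OF M Nc] entry[OF Nc M] N M Nc by (intro bexI[of _ N]) auto
qed

lemma GLn_det: "M \<in> carrier_mat (n + 1) (n + 1) \<Longrightarrow> M \<in> GLn n \<longleftrightarrow> Determinant.det M \<noteq> 0"
proof
  assume M: "M \<in> carrier_mat (n + 1) (n + 1)" "Determinant.det M \<noteq> 0"
  from det_non_zero_imp_unit[OF this, unfolded Units_def, of "()"]
  obtain B where "B \<in> carrier_mat (n + 1) (n + 1)" "B * M = 1\<^sub>m (n + 1)" "M * B = 1\<^sub>m (n + 1)"
    by (auto simp: ring_mat_def)
  then show "M \<in> GLn n"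
    using M unfolding GLn_def invertible_mat_def inverts_mat_def by auto
next
  assume M: "M \<in> carrier_mat (n + 1) (n + 1)" "M \<in> GLn n"
  obtain N where N: "M * N = 1\<^sub>m (dim_row M)" "N * M = 1\<^sub>m (dim_row N)"
    using M(2) unfolding GLn_def invertible_mat_def inverts_mat_def by blast
  have "dim_col N = n + 1" using arg_cong[OF N(1), of dim_col] M by simp
  moreover have "dim_row N = n + 1" using arg_cong[OF N(2), of dim_col] M by simp
  ultimately have "N \<in> carrier_mat (n + 1) (n + 1)" by auto
  from det_mult[OF M(1) this] show "Determinant.det M \<noteq> 0" using N M(1) by auto
qed

lemma eval_linear_coord: "eval_at z (linear_coord n M i) = (\<Sum>j\<le>n. M $$ (i, j) * z j)"
  by (simp add: linear_coord_def eval_at_simps)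

lemma linear_coord_hom: "linear_coord n M i \<in> hom_polys n 1"
  unfolding linear_coord_def using hom_polys_Const_mult[OF hom_polys_Var] by (intro hom_polys_sum) auto

lemma eval_substitute_linear:
  assumes "p \<in> vars_in {..n}"
  shows "eval_at z (substitute (linear_coord n M) p) = eval_at (act n M z) p"
  unfolding eval_at_substitute by (rule eval_at_cong[OF assms]) (simp add: eval_linear_coord act_def)

lemma act_polynomial: "\<exists>q. \<forall>z\<in>affine_space n. eval_at z q = eval_at (act n M z) p"
proof (intro exI ballI)
  fix z
  show "eval_at z (substitute (\<lambda>i. if i \<le> n then linear_coord n M i else 0) p) = eval_at (act n M z) p"
    unfolding eval_at_substitute
    by (rule arg_cong[where f = "\<lambda>x. eval_at x p"]) (auto simp: act_def eval_linear_coord)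
qed

lemma act_affine: "act n M z \<in> affine_space n"
  by (simp add: act_def affine_space_def)

lemma act_act:
  assumes "\<And>i k. i \<le> n \<Longrightarrow> k \<le> n \<Longrightarrow> (\<Sum>j\<le>n. N $$ (i, j) * M $$ (j, k)) = (if i = k then 1 else 0)"
    and z: "z \<in> affine_space n"
  shows "act n N (act n M z) = z"
proof
  fix i
  show "act n N (act n M z) i = z i"
  proof (cases "i \<le> n")
    case True
    have "act n N (act n M z) i = (\<Sum>j\<le>n. \<Sum>k\<le>n. N $$ (i, j) * M $$ (j, k) * z k)"
      using True by (simp add: act_def sum_distrib_left mult.assoc)
    also have "\<dots> = (\<Sum>k\<le>n. (\<Sum>j\<le>n. N $$ (i, j) * M $$ (j, k)) * z k)"
      by (subst sum.swap) (simp add: sum_distrib_right)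
    also have "\<dots> = (\<Sum>k\<le>n. (if i = k then 1 else 0) * z k)"
      using assms(1) True by (intro sum.cong) auto
    also have "\<dots> = z i"
      using True by (subst sum_eq_single[where i = i]) auto
    finally show ?thesis .
  next
    case False
    then show ?thesis using z by (simp add: act_def affine_space_def)
  qed
qed

definition pull :: "nat \<Rightarrow> complex mat \<Rightarrow> (nat \<Rightarrow> nat cpoly) \<Rightarrow> nat \<Rightarrow> nat cpoly" where
  "pull n M \<eta> j = pairing n (\<lambda>i. Const (M $$ (i, j))) (\<lambda>i. substitute (linear_coord n M) (\<eta> i))"

lemma pdiff_linear_coord: "pdiff j (linear_coord n M i) = (if j \<le> n then Const (M $$ (i, j)) else 0)"
proof -
  have "pdiff j (linear_coord n M i) = (\<Sum>k\<le>n. Const (M $$ (i, k)) * (if j = k then 1 else 0))"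
    by (simp add: linear_coord_def pdiff_sum pdiff_mult pdiff_Var)
  also have "\<dots> = (if j \<le> n then Const (M $$ (i, j)) else 0)"
    by (cases "j \<le> n") (auto simp: sum_eq_single[where i = j] intro!: sum.neutral)
  finally show ?thesis .
qed

lemma pullback_eq: "pullback n M \<alpha> = one_form n (pull n M (\<lambda>l. \<alpha> {l}))"
proof
  fix I :: "nat set"
  have ext: "ext_d (function_form q) I = (if \<exists>j. I = {j} then pdiff (the_elem I) q else 0)" for q
  proof (cases "\<exists>j. I = {j}")
    case True
    then obtain j where j: "I = {j}" by blast
    have e: "{i. i = j \<and> i < j} = {}" by auto
    have "ext_d (function_form q) {j} = pdiff j q" unfolding ext_d_def by (simp add: function_form_def e)
    then show ?thesis unfolding j by simp
  next
    case False
    have "function_form q (I - {k}) = 0" if "k \<in> I" for k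
      using False that by (auto simp: function_form_def)
    then show ?thesis using False by (auto simp: ext_d_def intro!: sum.neutral)
  qed
  show "pullback n M \<alpha> I = one_form n (pull n M (\<lambda>l. \<alpha> {l})) I"
  proof (cases "\<exists>j. I = {j}")
    case True
    then obtain j where j: "I = {j}" by blast
    show ?thesis
      unfolding pullback_def ext unfolding j
      by (cases "j \<le> n") (simp_all add: pdiff_linear_coord one_form_def pull_def pairing_def mult.commute)
  next
    case False
    then show ?thesis unfolding pullback_def ext by (auto simp: one_form_def)
  qed
qed

lemma hom_polys_power: "p \<in> hom_polys n e \<Longrightarrow> p ^ k \<in> hom_polys n (k * e)"
proof (induction k)
  case 0
  then show ?case using hom_polys_Const[of 1 n] by (simp add: Const_1)
next
  case (Suc k)
  then show ?case using hom_polys_mult[of p n e "p ^ k" "k * e"] by simp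
qed

lemma hom_polys_prod: "(\<And>a. a \<in> A \<Longrightarrow> f a \<in> hom_polys n (e a)) \<Longrightarrow> prod f A \<in> hom_polys n (sum e A)"
proof (induction A rule: infinite_finite_induct)
  case (insert a A)
  then show ?case using hom_polys_mult[of "f a" n "e a" "prod f A" "sum e A"] by simp
qed (use hom_polys_Const[of 1 n] in \<open>simp_all add: Const_1\<close>)

lemma substitute_hom:
  assumes "p \<in> hom_polys n e" "\<And>i. \<sigma> i \<in> hom_polys n 1"
  shows "substitute \<sigma> p \<in> hom_polys n e"
  unfolding substitute_def poly_eval_def
proof (rule hom_polys_sum)
  fix m assume "m \<in> keys p"
  then have "(\<Sum>v\<in>keys m. lookup m v * 1) = e"
    using assms(1) by (simp add: hom_polys_def homogeneous_def mon_degree_def)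
  moreover have "(\<Prod>v\<in>keys m. \<sigma> v ^ lookup m v) \<in> hom_polys n (\<Sum>v\<in>keys m. lookup m v * 1)"
    by (intro hom_polys_prod hom_polys_power assms(2))
  ultimately show "Const (lookup p m) * (\<Prod>v\<in>keys m. \<sigma> v ^ lookup m v) \<in> hom_polys n e"
    by (intro hom_polys_Const_mult) simp
qed

lemma pull_hom:
  assumes "\<And>l. l \<le> n \<Longrightarrow> \<eta> l \<in> hom_polys n e"
  shows "pull n M \<eta> j \<in> hom_polys n e"
  unfolding pull_def pairing_def
  by (intro hom_polys_sum hom_polys_Const_mult substitute_hom assms linear_coord_hom) auto

lemma eval_pull:
  assumes "\<And>l. l \<le> n \<Longrightarrow> \<eta> l \<in> vars_in {..n}"
  shows "eval_at z (pull n M \<eta> j) = (\<Sum>i\<le>n. M $$ (i, j) * eval_at (act n M z) (\<eta> i))"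
  using eval_substitute_linear[of _ n z M] assms by (simp add: pull_def pairing_def eval_at_simps)

lemma pairing_fubini:
  "pairing n v (\<lambda>y. pairing n w (\<lambda>x. F x y)) = pairing n w (\<lambda>x. pairing n v (\<lambda>y. F x y))"
  unfolding pairing_def sum_distrib_left by (subst sum.swap) (simp add: mult.left_commute)

lemma substitute_diff: "substitute \<sigma> (p - q) = substitute \<sigma> p - substitute \<sigma> q"
proof -
  have "substitute \<sigma> (p - q) + substitute \<sigma> q = substitute \<sigma> (p - q + q)"
    by (simp only: substitute_add)
  then show ?thesis by (simp add: eq_diff_eq)
qed

lemma pdiff_substitute_linear:
  assumes "p \<in> vars_in {..n}" "j \<le> n"
  shows "pdiff j (substitute (linear_coord n M) p) =
    pairing n (\<lambda>i. Const (M $$ (i, j))) (\<lambda>i. substitute (linear_coord n M) (pdiff i p))"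
  using assms(1)
proof (induction rule: cpoly_induct)
  case (Const c)
  then show ?case by simp
next
  case (Var i)
  have "pairing n (\<lambda>i. Const (M $$ (i, j))) (\<lambda>l. substitute (linear_coord n M) (pdiff l (Var i))) =
      Const (M $$ (i, j)) * substitute (linear_coord n M) (pdiff i (Var i))"
    unfolding pairing_def using Var by (intro sum_eq_single) (auto simp: pdiff_Var)
  then show ?case using assms(2) by (simp add: pdiff_Var pdiff_linear_coord)
next
  case (add p q)
  then show ?case by (simp add: substitute_add pdiff_add pairing_add_right)
next
  case (mult p q)
  then show ?case
    by (simp add: substitute_add substitute_mult pdiff_mult pairing_add_right pairing_mult_right pairing_mult_right2)
qed

lemma d1_pull:
  assumes "\<And>l. l \<le> n \<Longrightarrow> \<eta> l \<in> vars_in {..n}" "a \<le> n" "b \<le> n"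
  shows "d1 (pull n M \<eta>) a b = pairing n (\<lambda>i. Const (M $$ (i, a))) (\<lambda>x. pairing n (\<lambda>i. Const (M $$ (i, b)))
    (\<lambda>y. substitute (linear_coord n M) (d1 \<eta> x y)))"
proof -
  let ?m = "\<lambda>a i. Const (M $$ (i, a)) :: nat cpoly"
  let ?S = "substitute (linear_coord n M)"
  have p: "pdiff a (pull n M \<eta> b) = pairing n (?m b) (\<lambda>y. pairing n (?m a) (\<lambda>x. ?S (pdiff x (\<eta> y))))"
    if "a \<le> n" for a b
  proof -
    have "pdiff a (pull n M \<eta> b) = pairing n (?m b) (\<lambda>y. pdiff a (?S (\<eta> y)))"
      by (simp add: pull_def pairing_def pdiff_sum pdiff_mult)
    also have "\<dots> = pairing n (?m b) (\<lambda>y. pairing n (?m a) (\<lambda>x. ?S (pdiff x (\<eta> y))))"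
      using assms(1) that by (intro pairing_cong refl pdiff_substitute_linear) auto
    finally show ?thesis .
  qed
  have "pdiff a (pull n M \<eta> b) = pairing n (?m a) (\<lambda>x. pairing n (?m b) (\<lambda>y. ?S (pdiff x (\<eta> y))))"
    unfolding p[OF assms(2)] by (rule pairing_fubini)
  then show ?thesis
    unfolding d1_def p[OF assms(3), of a] by (simp add: substitute_diff pairing_diff_right)
qed

lemma cubic_pull:
  assumes "\<And>l. l \<le> n \<Longrightarrow> \<eta> l \<in> vars_in {..n}" "a \<le> n" "b \<le> n" "c \<le> n"
  shows "cubic (pull n M \<eta>) a b c = pairing n (\<lambda>i. Const (M $$ (i, a))) (\<lambda>x. pairing n (\<lambda>i. Const (M $$ (i, b)))
    (\<lambda>y. pairing n (\<lambda>i. Const (M $$ (i, c))) (\<lambda>w. substitute (linear_coord n M) (cubic \<eta> x y w))))"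
proof -
  let ?m = "\<lambda>a i. Const (M $$ (i, a)) :: nat cpoly"
  let ?S = "substitute (linear_coord n M)"
  have d: "d1 (pull n M \<eta>) a b = pairing n (?m a) (\<lambda>x. pairing n (?m b) (\<lambda>y. ?S (d1 \<eta> x y)))"
    if "a \<le> n" "b \<le> n" for a b
    by (rule d1_pull) (use assms(1) that in auto)
  have 2: "d1 (pull n M \<eta>) c a = pairing n (?m a) (\<lambda>x. pairing n (?m c) (\<lambda>w. ?S (d1 \<eta> w x)))"
    unfolding d[OF assms(4,2)] by (rule pairing_fubini)
  show ?thesis
    unfolding cubic_def d[OF assms(2,3)] d[OF assms(3,4)] 2
    by (simp add: pull_def substitute_add substitute_mult pairing_add_right pairing_mult_right pairing_mult_right2)
qed

text \<open>Only the polynomial conditions are kept. The result is a cone containing 0 and stable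
  under scaling and pull-back, to which the local argument applies directly.\<close>

definition foliation_forms :: "nat \<Rightarrow> nat \<Rightarrow> pform set" where
  "foliation_forms n e = {\<alpha> \<in> forms n 1 e. interior_prod n (radial n) \<alpha> = 0 \<and> wedge \<alpha> (ext_d \<alpha>) = 0}"

lemma foliation_forms_iff:
  assumes "\<alpha> \<in> forms n 1 e"
  shows "\<alpha> \<in> foliation_forms n e \<longleftrightarrow> pairing n (radial n) (\<lambda>l. \<alpha> {l}) = 0 \<and>
    (\<forall>a\<le>n. \<forall>b\<le>n. \<forall>c\<le>n. cubic (\<lambda>l. \<alpha> {l}) a b c = 0)"
proof -
  have "interior_prod n (radial n) \<alpha> = 0 \<longleftrightarrow> pairing n (radial n) (\<lambda>l. \<alpha> {l}) = 0"
    unfolding interior_prod_one_form[OF assms] by (auto simp: fun_eq_iff)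
  moreover note wedge_d_eq_0_iff[OF assms]
  ultimately show ?thesis
    using assms unfolding foliation_forms_def by blast
qed

lemma cubic_cong:
  assumes "\<And>l. l \<le> n \<Longrightarrow> \<eta> l = \<theta> l" "a \<le> n" "b \<le> n" "c \<le> n"
  shows "cubic \<eta> a b c = cubic \<theta> a b c"
  using assms by (simp add: cubic_def d1_def)

lemma pullback_foliation_forms:
  assumes \<alpha>: "\<alpha> \<in> foliation_forms n e"
  shows "pullback n M \<alpha> \<in> foliation_forms n e"
proof -
  have f: "\<alpha> \<in> forms n 1 e" using \<alpha> by (simp add: foliation_forms_def)
  let ?\<eta> = "\<lambda>l. \<alpha> {l}"
  have hom: "?\<eta> l \<in> hom_polys n e" if "l \<le> n" for l using one_form_coeff[OF f that] .
  have vars: "?\<eta> l \<in> vars_in {..n}" for l using one_form_vars[OF f] .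
  have pf: "pullback n M \<alpha> \<in> forms n 1 e"
    unfolding pullback_eq by (rule one_form_forms) (rule pull_hom[OF hom])
  have 1: "pairing n (radial n) (\<lambda>l. pullback n M \<alpha> {l}) = 0"
  proof (rule cpoly_eq_0I)
    fix z :: "nat \<Rightarrow> complex"
    have R: "eval_at y (pairing n (radial n) \<gamma>) = (\<Sum>i\<le>n. y i * eval_at y (\<gamma> i))" for y \<gamma>
      by (simp add: pairing_def eval_at_simps radial_def)
    have "eval_at z (pairing n (radial n) (\<lambda>l. pullback n M \<alpha> {l})) =
        (\<Sum>j\<le>n. z j * (\<Sum>i\<le>n. M $$ (i, j) * eval_at (act n M z) (?\<eta> i)))"
      unfolding R by (intro sum.cong refl) (simp add: pullback_eq eval_pull[OF vars])
    also have "\<dots> = (\<Sum>i\<le>n. (\<Sum>j\<le>n. M $$ (i, j) * z j) * eval_at (act n M z) (?\<eta> i))"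
      unfolding sum_distrib_left sum_distrib_right by (subst sum.swap) (simp add: mult_ac)
    also have "\<dots> = eval_at (act n M z) (pairing n (radial n) ?\<eta>)"
      unfolding R by (intro sum.cong refl) (simp add: act_def)
    also have "\<dots> = 0" using \<alpha> foliation_forms_iff[OF f] by simp
    finally show "eval_at z (pairing n (radial n) (\<lambda>l. pullback n M \<alpha> {l})) = 0" .
  qed
  have 2: "cubic (\<lambda>l. pullback n M \<alpha> {l}) a b c = 0" if abc: "a \<le> n" "b \<le> n" "c \<le> n" for a b c
  proof -
    have c0: "cubic ?\<eta> x y w = 0" if "x \<le> n" "y \<le> n" "w \<le> n" for x y w
      using \<alpha> foliation_forms_iff[OF f] that by blast
    have "cubic (\<lambda>l. pullback n M \<alpha> {l}) a b c = cubic (pull n M ?\<eta>) a b c"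
      by (rule cubic_cong[OF _ abc]) (simp add: pullback_eq)
    also have "\<dots> = pairing n (\<lambda>i. Const (M $$ (i, a))) (\<lambda>x. pairing n (\<lambda>i. Const (M $$ (i, b)))
        (\<lambda>y. pairing n (\<lambda>i. Const (M $$ (i, c))) (\<lambda>w. substitute (linear_coord n M) (cubic ?\<eta> x y w))))"
      by (rule cubic_pull[OF vars abc])
    also have "\<dots> = 0"
      unfolding pairing_def using c0 by (intro sum.neutral ballI) simp
    finally show ?thesis .
  qed
  show ?thesis
    unfolding foliation_forms_iff[OF pf] using 1 2 by blast
qed

lemma zero_set_pullback:
  assumes f: "\<alpha> \<in> forms n 1 e" and M: "M \<in> GLn n"
  shows "zero_set n (pullback n M \<alpha>) \<subseteq> {z \<in> affine_space n. act n M z \<in> zero_set n \<alpha>}"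
proof
  fix z assume z: "z \<in> zero_set n (pullback n M \<alpha>)"
  from GLn_inverse[OF M] obtain N where
    N: "\<forall>i\<le>n. \<forall>k\<le>n. (\<Sum>j\<le>n. M $$ (i, j) * N $$ (j, k)) = (if i = k then 1 else 0)"
    by (elim bexE conjE)
  have vars: "\<alpha> {l} \<in> vars_in {..n}" for l using one_form_vars[OF f] .
  let ?e = "\<lambda>i. eval_at (act n M z) (\<alpha> {i})"
  have 0: "(\<Sum>i\<le>n. M $$ (i, j) * ?e i) = 0" if "j \<le> n" for j
  proof -
    have "eval_at z (pullback n M \<alpha> {j}) = 0" using z unfolding zero_set_def by blast
    then show ?thesis using that by (simp add: pullback_eq eval_pull[OF vars])
  qed
  have "?e k = 0" if k: "k \<le> n" for k
  proof -
    have "?e k = (\<Sum>i\<le>n. (if i = k then 1 else 0) * ?e i)"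
      using k by (subst sum_eq_single[where i = k]) auto
    also have "\<dots> = (\<Sum>i\<le>n. (\<Sum>j\<le>n. M $$ (i, j) * N $$ (j, k)) * ?e i)"
      using N k by (intro sum.cong) auto
    also have "\<dots> = (\<Sum>j\<le>n. N $$ (j, k) * (\<Sum>i\<le>n. M $$ (i, j) * ?e i))"
      unfolding sum_distrib_left sum_distrib_right by (subst sum.swap) (simp add: mult_ac)
    also have "\<dots> = 0" using 0 by simp
    finally show ?thesis .
  qed
  note e0 = this
  have "eval_at (act n M z) (\<alpha> I) = 0" for I
  proof (cases "\<exists>l\<le>n. I = {l}")
    case True
    then obtain l where "l \<le> n" "I = {l}" by auto
    then show ?thesis using e0 by simp
  next
    case False
    then show ?thesis using one_form_outside[OF f] by simp
  qed
  then have "act n M z \<in> zero_set n \<alpha>" using act_affine unfolding zero_set_def by simp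
  moreover have "z \<in> affine_space n" using z unfolding zero_set_def by simp
  ultimately show "z \<in> {z \<in> affine_space n. act n M z \<in> zero_set n \<alpha>}" by simp
qed

lemma not_maximal_pullback:
  assumes f: "\<alpha> \<in> forms n 1 e" and M: "M \<in> GLn n" and nm: "not_maximal n (zero_set n \<alpha>)"
  shows "not_maximal n (zero_set n (pullback n M \<alpha>))"
proof -
  from GLn_inverse[OF M] obtain N where
    N: "\<forall>i\<le>n. \<forall>k\<le>n. (\<Sum>j\<le>n. M $$ (i, j) * N $$ (j, k)) = (if i = k then 1 else 0)"
    "\<forall>i\<le>n. \<forall>k\<le>n. (\<Sum>j\<le>n. N $$ (i, j) * M $$ (j, k)) = (if i = k then 1 else 0)"
    by (elim bexE conjE)
  have "act n N (act n M z) = z" "act n M (act n N z) = z" if "z \<in> affine_space n" for z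
    by (rule act_act[OF _ that]; use N in simp)+
  then show ?thesis
    by (intro not_maximal_transfer[OF nm, where L = "act n M" and N = "act n N"]
        act_affine act_polynomial zero_set_pullback[OF f M])
qed

subsection \<open>Pull-backs along a line of matrices\<close>

definition mat_line :: "nat \<Rightarrow> complex mat \<Rightarrow> complex mat \<Rightarrow> complex \<Rightarrow> complex mat" where
  "mat_line n A B s = mat (n + 1) (n + 1) (\<lambda>ij. A $$ ij + s * B $$ ij)"

lemma mat_line_carrier [simp]: "mat_line n A B s \<in> carrier_mat (n + 1) (n + 1)"
  by (simp add: mat_line_def)

lemma mat_line_index: "i \<le> n \<Longrightarrow> j \<le> n \<Longrightarrow> mat_line n A B s $$ (i, j) = A $$ (i, j) + s * B $$ (i, j)"
  by (simp add: mat_line_def)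

lemma linear_coord_line:
  "i \<le> n \<Longrightarrow> linear_coord n (mat_line n A B s) i = linear_coord n A i + Const s * linear_coord n B i"
  by (simp add: linear_coord_def mat_line_index Const_add Const_mult distrib_right sum.distrib sum_distrib_left mult.assoc)

lemma coeff_mult_0_1: "coeff (p * q) 0 = coeff p 0 * coeff q 0"
  "coeff (p * q) (Suc 0) = coeff p 0 * coeff q (Suc 0) + coeff p (Suc 0) * coeff q 0"
  by (simp_all add: coeff_mult)

text \<open>The dependence on \<open>s\<close> is recorded as a polynomial over the polynomial ring,
  so that value and derivative at \<open>s = 0\<close> are its two lowest coefficients.\<close>

lemma substitute_line:
  assumes "p \<in> vars_in {..n}"
  shows "\<exists>q. (\<forall>s. substitute (linear_coord n (mat_line n A B s)) p = poly q (Const s)) \<and>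
    coeff q 0 = substitute (linear_coord n A) p \<and>
    coeff q (Suc 0) = (\<Sum>i\<le>n. substitute (linear_coord n A) (pdiff i p) * linear_coord n B i)"
  using assms
proof (induction rule: cpoly_induct)
  case (Const c)
  then show ?case by (intro exI[of _ "[:Const c:]"]) simp
next
  case (Var i)
  have "(\<Sum>l\<le>n. substitute (linear_coord n A) (pdiff l (Var i)) * linear_coord n B l) =
      substitute (linear_coord n A) (pdiff i (Var i)) * linear_coord n B i"
    using Var by (intro sum_eq_single) (auto simp: pdiff_Var)
  then show ?case
    using Var by (intro exI[of _ "[:linear_coord n A i, linear_coord n B i:]"]) (simp add: linear_coord_line pdiff_Var)
next
  case (add p1 p2)
  then obtain q1 q2 where "\<forall>s. substitute (linear_coord n (mat_line n A B s)) p1 = poly q1 (Const s)"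
    "coeff q1 0 = substitute (linear_coord n A) p1"
    "coeff q1 (Suc 0) = (\<Sum>i\<le>n. substitute (linear_coord n A) (pdiff i p1) * linear_coord n B i)"
    "\<forall>s. substitute (linear_coord n (mat_line n A B s)) p2 = poly q2 (Const s)"
    "coeff q2 0 = substitute (linear_coord n A) p2"
    "coeff q2 (Suc 0) = (\<Sum>i\<le>n. substitute (linear_coord n A) (pdiff i p2) * linear_coord n B i)" by blast
  then show ?case
    by (intro exI[of _ "q1 + q2"]) (simp add: substitute_add pdiff_add distrib_right sum.distrib)
next
  case (mult p1 p2)
  then obtain q1 q2 where "\<forall>s. substitute (linear_coord n (mat_line n A B s)) p1 = poly q1 (Const s)"
    "coeff q1 0 = substitute (linear_coord n A) p1"
    "coeff q1 (Suc 0) = (\<Sum>i\<le>n. substitute (linear_coord n A) (pdiff i p1) * linear_coord n B i)"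
    "\<forall>s. substitute (linear_coord n (mat_line n A B s)) p2 = poly q2 (Const s)"
    "coeff q2 0 = substitute (linear_coord n A) p2"
    "coeff q2 (Suc 0) = (\<Sum>i\<le>n. substitute (linear_coord n A) (pdiff i p2) * linear_coord n B i)" by blast
  then show ?case
    by (intro exI[of _ "q1 * q2"])
      (simp add: substitute_mult substitute_add pdiff_mult coeff_mult_0_1 distrib_right sum.distrib
        sum_distrib_left sum_distrib_right distrib_left add_ac mult_ac)
qed

lemma pull_line:
  assumes vars: "\<And>l. l \<le> n \<Longrightarrow> \<eta> l \<in> vars_in {..n}" and j: "j \<le> n"
  shows "\<exists>q. (\<forall>s. pull n (mat_line n A B s) \<eta> j = poly q (Const s)) \<and> coeff q 0 = pull n A \<eta> j \<and>
    coeff q (Suc 0) = (\<Sum>i\<le>n. Const (A $$ (i, j)) *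
      (\<Sum>l\<le>n. substitute (linear_coord n A) (pdiff l (\<eta> i)) * linear_coord n B l) +
      Const (B $$ (i, j)) * substitute (linear_coord n A) (\<eta> i))"
proof -
  define Q where "Q i q \<longleftrightarrow> (\<forall>s. substitute (linear_coord n (mat_line n A B s)) (\<eta> i) = poly q (Const s)) \<and>
    coeff q 0 = substitute (linear_coord n A) (\<eta> i) \<and>
    coeff q (Suc 0) = (\<Sum>l\<le>n. substitute (linear_coord n A) (pdiff l (\<eta> i)) * linear_coord n B l)" for i q
  have "\<exists>q. i \<le> n \<longrightarrow> Q i q" for i
    using substitute_line[OF vars, of i A B] unfolding Q_def by (cases "i \<le> n") simp_all
  then have "\<forall>i. \<exists>q. i \<le> n \<longrightarrow> Q i q" by (rule allI)
  from choice[OF this] obtain q where Q: "\<forall>i. i \<le> n \<longrightarrow> Q i (q i)" ..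
  have q: "\<And>i s. i \<le> n \<Longrightarrow> substitute (linear_coord n (mat_line n A B s)) (\<eta> i) = poly (q i) (Const s)"
    "\<And>i. i \<le> n \<Longrightarrow> coeff (q i) 0 = substitute (linear_coord n A) (\<eta> i)"
    "\<And>i. i \<le> n \<Longrightarrow> coeff (q i) (Suc 0) = (\<Sum>l\<le>n. substitute (linear_coord n A) (pdiff l (\<eta> i)) * linear_coord n B l)"
    using Q unfolding Q_def by simp_all
  let ?q = "\<Sum>i\<le>n. [:Const (A $$ (i, j)), Const (B $$ (i, j)):] * q i"
  show ?thesis
  proof (intro exI[of _ ?q] conjI allI)
    fix s
    show "pull n (mat_line n A B s) \<eta> j = poly ?q (Const s)"
      unfolding pull_def pairing_def poly_sum
      using q(1) j by (intro sum.cong refl) (simp add: mat_line_index Const_add Const_mult distrib_right)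
    show "coeff ?q 0 = pull n A \<eta> j"
      unfolding pull_def pairing_def coeff_sum coeff_mult_0_1 using q(2) by (intro sum.cong refl) simp
    show "coeff ?q (Suc 0) = (\<Sum>i\<le>n. Const (A $$ (i, j)) *
      (\<Sum>l\<le>n. substitute (linear_coord n A) (pdiff l (\<eta> i)) * linear_coord n B l) +
      Const (B $$ (i, j)) * substitute (linear_coord n A) (\<eta> i))"
      unfolding coeff_sum coeff_mult_0_1 using q(2,3) by (intro sum.cong refl) simp
  qed
qed

lemma linear_coord_one: "i \<le> n \<Longrightarrow> linear_coord n (1\<^sub>m (Suc n)) i = Var i"
  unfolding linear_coord_def by (subst sum_eq_single[where i = i]) (auto simp: Const_1)

lemma substitute_one: "p \<in> vars_in {..n} \<Longrightarrow> substitute (linear_coord n (1\<^sub>m (Suc n))) p = p"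
  by (induction rule: cpoly_induct) (auto simp: linear_coord_one substitute_add substitute_mult)

lemma pull_one:
  assumes "\<And>l. l \<le> n \<Longrightarrow> \<eta> l \<in> vars_in {..n}" and j: "j \<le> n"
  shows "pull n (1\<^sub>m (Suc n)) \<eta> j = \<eta> j"
  unfolding pull_def pairing_def using assms
  by (subst sum_eq_single[where i = j]) (auto simp: Const_1 substitute_one)

text \<open>The derivative of the action at the identity is the Lie derivative along the linear
  field with matrix \<open>B\<close>.\<close>

lemma pull_line_one:
  assumes vars: "\<And>l. l \<le> n \<Longrightarrow> \<eta> l \<in> vars_in {..n}" and j: "j \<le> n"
  shows "\<exists>q. (\<forall>s. pull n (mat_line n (1\<^sub>m (Suc n)) B s) \<eta> j = poly q (Const s)) \<and> coeff q 0 = \<eta> j \<and>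
    coeff q (Suc 0) = Lie1 n (linear_coord n B) \<eta> j"
proof -
  let ?I = "1\<^sub>m (Suc n) :: complex mat"
  have d: "(\<Sum>i\<le>n. Const (?I $$ (i, j)) * F i) = F j" for F :: "nat \<Rightarrow> nat cpoly"
    using j by (subst sum_eq_single[where i = j]) (auto simp: Const_1)
  note pull_one[of n \<eta>, OF vars j]
  moreover have "(\<Sum>i\<le>n. Const (?I $$ (i, j)) *
      (\<Sum>l\<le>n. substitute (linear_coord n ?I) (pdiff l (\<eta> i)) * linear_coord n B l) +
      Const (B $$ (i, j)) * substitute (linear_coord n ?I) (\<eta> i)) = Lie1 n (linear_coord n B) \<eta> j"
    unfolding sum.distrib d Lie1_def pdiff_linear_coord
    using vars j by (simp add: substitute_one pdiff_vars_in mult.commute)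
  ultimately show ?thesis
    using pull_line[where \<eta> = \<eta> and j = j and n = n and A = ?I and B = B] vars j by simp
qed

lemma lookup_poly_Const:
  "lookup (poly q (Const s)) m = poly (\<Sum>k\<le>degree q. monom (lookup (coeff q k) m) k) s"
  by (simp add: poly_altdef[of q] lookup_sum poly_sum poly_monom mult.commute flip: Const_power)
    (simp add: mult.commute[of _ "Const _"])

lemma polyfun_det_line: "polyfun (\<lambda>s. Determinant.det (mat_line n A B s))"
proof -
  have *: "Determinant.det (mat_line n A B s) =
      (\<Sum>p\<in>{p. p permutes {0..<n + 1}}. signof p * (\<Prod>i = 0..<n + 1. mat_line n A B s $$ (i, p i)))" for s
    by (simp add: Determinant.det_def mat_line_def)
  show ?thesis
    unfolding * 
  proof (intro polyfun_sum polyfun_mult polyfun_const polyfun_prod)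
    fix p i assume "p \<in> {p. p permutes {0..<n + 1}}" "i \<in> {0..<n + 1}"
    then have "i \<in> {0..<n + 1}" "p i \<in> {0..<n + 1}"
      using permutes_in_image[of p "{0..<n + 1}" i] by (simp_all only: mem_Collect_eq)
    then have "i \<le> n" "p i \<le> n" by simp_all
    then show "polyfun (\<lambda>s. mat_line n A B s $$ (i, p i))"
      using polyfun_add[OF polyfun_const polyfun_mult[OF polyfun_id polyfun_const]] by (simp add: mat_line_index)
  qed
qed

section \<open>Construction of \<Omega> from the volume form and its two decisive
  coefficients\<close>

section \<open>The form defined by a shift family\<close>

context shift_family
begin

definition contracted_volume :: "nat \<Rightarrow> pform" where
  "contracted_volume m = ips n (map X (rev [0..<m])) (volume_form n)"

lemma contracted_volume_0: "contracted_volume 0 = volume_form n"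
  by (simp add: contracted_volume_def)

lemma contracted_volume_Suc: "contracted_volume (Suc m) = interior_prod n (X m) (contracted_volume m)"
  by (simp add: contracted_volume_def)

lemma contracted_volume_forms: "m \<le> n \<Longrightarrow> contracted_volume m \<in> forms n (n + 1 - m) m"
proof (induction m)
  case 0
  then show ?case using volume_form_forms by (simp add: contracted_volume_0)
next
  case (Suc m)
  have "n + 1 - m = Suc (n + 1 - Suc m)" using Suc.prems by simp
  then have "contracted_volume m \<in> forms n (Suc (n + 1 - Suc m)) m" using Suc by simp
  then show ?case
    unfolding contracted_volume_Suc by (rule interior_prod_forms) (rule shift_field_hom)
qed

text \<open>The field \<open>X m\<close> has no component beyond index \<open>n - m\<close>, so the
  only index that can be added to {0, ..., n-m-1} is n - m, with coefficient \<beta> z_n.\<close>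

lemma contracted_volume_initial:
  "m \<le> n - 1 \<Longrightarrow> \<exists>c. c \<noteq> 0 \<and> contracted_volume m {..n - m} = Const c * Var n ^ m"
proof (induction m)
  case 0
  then show ?case by (intro exI[of _ 1]) (simp add: contracted_volume_0 volume_form_def Const_1)
next
  case (Suc m)
  then obtain c where c: "c \<noteq> 0" "contracted_volume m {..n - m} = Const c * Var n ^ m" by auto
  let ?I = "{..n - Suc m}"
  define N where "N = card {j \<in> ?I. j < n - m}"
  have ins: "insert (n - m) ?I = {..n - m}" using Suc.prems n_ge by auto
  have "contracted_volume (Suc m) ?I =
      (\<Sum>k\<in>{..n} - ?I. (- 1) ^ card {j\<in>?I. j < k} * (X m k * contracted_volume m (insert k ?I)))"
    by (simp add: contracted_volume_Suc interior_prod_def)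
  also have "\<dots> = (- 1) ^ card {j\<in>?I. j < n - m} * (X m (n - m) * contracted_volume m (insert (n - m) ?I))"
  proof (rule sum_eq_single)
    show "n - m \<in> {..n} - ?I" using Suc.prems n_ge by auto
    fix k assume k: "k \<in> {..n} - ?I" "k \<noteq> n - m"
    then have "\<not> k + m \<le> n" by auto
    then have "X m k = 0" by (simp add: shift_field_def)
    then show "(- 1) ^ card {j\<in>?I. j < k} * (X m k * contracted_volume m (insert k ?I)) = 0" by simp
  qed simp
  also have "\<dots> = (- 1) ^ N * (Const (\<beta> m (n - m)) * Var n * (Const c * Var n ^ m))"
    using Suc.prems by (simp add: ins c(2) shift_field_def N_def)
  also have "\<dots> = Const ((- 1) ^ N * \<beta> m (n - m) * c) * Var n ^ Suc m"
    by (simp add: Const_mult Const_power Const_uminus Const_1 mult_ac)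
  finally have "contracted_volume (Suc m) ?I = Const ((- 1) ^ N * \<beta> m (n - m) * c) * Var n ^ Suc m" .
  moreover have "\<beta> m (n - m) \<noteq> 0" using Suc.prems by (intro \<beta>_nz) auto
  ultimately show ?case using c(1) by (intro exI[of _ "(- 1) ^ N * \<beta> m (n - m) * c"]) simp
qed

text \<open>Modulo z_n the last nonzero component of \<open>X m\<close> is at n - 1 - m, with
  coefficient \<beta> z_(n-1); again a single term survives. For \<open>m = n - 1\<close> the index
  set is {0, n}.\<close>

lemma contracted_volume_last:
  "m \<le> n - 1 \<Longrightarrow> \<exists>c. c \<noteq> 0 \<and> kill {n} (contracted_volume m ({..<n - m} \<union> {n})) = Const c * Var (n - 1) ^ m"
proof (induction m)
  case 0
  have "{..<n} \<union> {n} = {..n}" by auto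
  then show ?case
    using kill_Const[of "{n}" 1]
    by (intro exI[of _ 1]) (simp add: contracted_volume_0 volume_form_def Const_1)
next
  case (Suc m)
  then obtain c where c: "c \<noteq> 0" "kill {n} (contracted_volume m ({..<n - m} \<union> {n})) = Const c * Var (n - 1) ^ m"
    by auto
  let ?I = "{..<n - Suc m} \<union> {n}" and ?k = "n - 1 - m"
  define N where "N = card {j \<in> ?I. j < ?k}"
  have ins: "insert ?k ?I = {..<n - m} \<union> {n}" using Suc.prems n_ge by auto
  have "kill {n} (contracted_volume (Suc m) ?I) =
      (\<Sum>k\<in>{..n} - ?I. kill {n} ((- 1) ^ card {j\<in>?I. j < k} * (X m k * contracted_volume m (insert k ?I))))"
    by (simp add: contracted_volume_Suc interior_prod_def kill_sum)
  also have "\<dots> = kill {n} ((- 1) ^ card {j\<in>?I. j < ?k} * (X m ?k * contracted_volume m (insert ?k ?I)))"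
  proof (rule sum_eq_single)
    show "?k \<in> {..n} - ?I" using Suc.prems n_ge by auto
    fix k assume k: "k \<in> {..n} - ?I" "k \<noteq> ?k"
    then have "k + m = n \<or> \<not> k + m \<le> n" by auto
    then have "kill {n} (X m k) = 0" by (auto simp: shift_field_def kill_mult kill_Var)
    then show "kill {n} ((- 1) ^ card {j\<in>?I. j < k} * (X m k * contracted_volume m (insert k ?I))) = 0"
      by (simp add: kill_mult)
  qed simp
  also have "\<dots> = kill {n} ((- 1) ^ N) * (Const (\<beta> m ?k) * Var (n - 1) * (Const c * Var (n - 1) ^ m))"
  proof -
    have "?k + m = n - 1" using Suc.prems by simp
    then have "kill {n} (X m ?k) = Const (\<beta> m ?k) * Var (n - 1)"
      using n_ge by (simp add: shift_field_def kill_mult kill_Var)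
    then show ?thesis unfolding kill_mult ins c(2) N_def by simp
  qed
  also have "kill {n} ((- 1) ^ N) = Const ((- 1) ^ N)"
    using kill_Const[of "{n}" "(- 1) ^ N"] by (simp add: Const_power Const_uminus Const_1)
  also have "Const ((- 1) ^ N) * (Const (\<beta> m ?k) * Var (n - 1) * (Const c * Var (n - 1) ^ m)) =
      Const ((- 1) ^ N * \<beta> m ?k * c) * Var (n - 1) ^ Suc m"
    by (simp add: Const_mult mult_ac)
  finally have "kill {n} (contracted_volume (Suc m) ?I) = Const ((- 1) ^ N * \<beta> m ?k * c) * Var (n - 1) ^ Suc m" .
  moreover have "\<beta> m ?k \<noteq> 0" using Suc.prems by (intro \<beta>_nz) auto
  ultimately show ?case using c(1) by (intro exI[of _ "(- 1) ^ N * \<beta> m ?k * c"]) simp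
qed

definition kernel_two_form :: "nat \<Rightarrow> nat \<Rightarrow> nat cpoly" where
  "kernel_two_form i j = (if i < j then contracted_volume (n - 1) {i, j}
     else if j < i then - contracted_volume (n - 1) {i, j} else 0)"

lemma two_form: "contracted_volume (n - 1) \<in> forms n (Suc 1) (n - 1)"
proof -
  have "n + 1 - (n - 1) = Suc 1" using n_ge by simp
  then show ?thesis using contracted_volume_forms[of "n - 1"] by simp
qed

lemma interior_prod_two_form:
  assumes "l \<le> n"
  shows "interior_prod n v (contracted_volume (n - 1)) {l} = pairing n v (\<lambda>i. kernel_two_form i l)"
proof -
  have "(- 1) ^ card {j\<in>{l}. j < k} * (v k * contracted_volume (n - 1) (insert k {l})) = v k * kernel_two_form k l"
    if "k \<in> {..n} - {l}" for k
  proof (cases "k < l")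
    case True
    then have "{j\<in>{l}. j < k} = {}" by auto
    then have "card {j\<in>{l}. j < k} = 0" by (simp only: card.empty)
    then show ?thesis using True by (simp only: kernel_two_form_def) simp
  next
    case False
    then have "{j\<in>{l}. j < k} = {l}" "l < k" using that by auto
    then have "card {j\<in>{l}. j < k} = 1" "l < k" by (simp_all only: card_1_singleton_iff One_nat_def) blast+
    then show ?thesis using False by (simp only: kernel_two_form_def) simp
  qed
  then have "interior_prod n v (contracted_volume (n - 1)) {l} = (\<Sum>k\<in>{..n} - {l}. v k * kernel_two_form k l)"
    unfolding interior_prod_def by (rule sum.cong[OF refl])
  also have "\<dots> = (\<Sum>k\<le>n. v k * kernel_two_form k l)"
    by (rule sum.mono_neutral_left) (auto simp: kernel_two_form_def)
  finally show ?thesis by (simp add: pairing_def)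
qed

lemma kernel_form: "\<exists>c c'. kernel_form n \<beta> kernel_two_form c c'"
proof -
  obtain c where c: "c \<noteq> 0" "contracted_volume (n - 1) {..n - (n - 1)} = Const c * Var n ^ (n - 1)"
    using contracted_volume_initial[of "n - 1"] by auto
  obtain c' where c': "c' \<noteq> 0"
    "kill {n} (contracted_volume (n - 1) ({..<n - (n - 1)} \<union> {n})) = Const c' * Var (n - 1) ^ (n - 1)"
    using contracted_volume_last[of "n - 1"] by auto
  have s: "{..n - (n - 1)} = {0, 1}" "{..<n - (n - 1)} \<union> {n} = {0, n}" using n_ge by auto
  have "kernel_form n \<beta> kernel_two_form c c'"
  proof (intro kernel_form.intro kernel_form_axioms.intro shift_family_axioms)
    fix i j
    show "kernel_two_form i j = - kernel_two_form j i"
      by (cases i j rule: linorder_cases) (simp_all add: kernel_two_form_def insert_commute)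
    assume "i \<le> n" "j \<le> n"
    then show "kernel_two_form i j \<in> hom_polys n (n - 1)"
    proof (cases "i = j")
      case False
      then have "{i, j} \<subseteq> {..n} \<and> card {i, j} = Suc 1" using \<open>i \<le> n\<close> \<open>j \<le> n\<close> by simp
      then have "contracted_volume (n - 1) {i, j} \<in> hom_polys n (n - 1)"
        using two_form unfolding forms_def by (auto split: if_splits)
      then show ?thesis using False by (auto simp: kernel_two_form_def intro: hom_polys_uminus)
    qed (simp add: kernel_two_form_def)
  next
    fix k l assume kl: "k < n - 1" "l \<le> n"
    have "X k \<in> set (map X (rev [0..<n - 1]))" using kl(1) by simp
    from ips_member[OF this] have "interior_prod n (X k) (contracted_volume (n - 1)) = (\<lambda>_. 0)"
      unfolding contracted_volume_def .
    then show "pairing n (X k) (\<lambda>i. kernel_two_form i l) = 0"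
      using interior_prod_two_form[OF kl(2), of "X k"] by simp
  next
    show "kernel_two_form 0 1 = Const c * Var n ^ (n - 1)"
      using c(2) s(1) by (simp add: kernel_two_form_def)
    show "kill {n} (kernel_two_form 0 n) = Const c' * Var (n - 1) ^ (n - 1)"
      using c'(2) s(2) n_ge by (simp add: kernel_two_form_def)
  qed (use c(1) c'(1) in auto)
  then show ?thesis by blast
qed

lemma interior_prod_radial_two_form:
  "interior_prod n (radial n) (contracted_volume (n - 1)) =
     one_form n (pairing n (radial n) \<circ> (\<lambda>l i. kernel_two_form i l))"
proof (rule forms_1_eqI)
  show 1: "interior_prod n (radial n) (contracted_volume (n - 1)) \<in> forms n 1 (Suc (n - 1))"
    by (rule interior_prod_forms[OF two_form]) (rule radial_hom)
  show "one_form n (pairing n (radial n) \<circ> (\<lambda>l i. kernel_two_form i l)) \<in> forms n 1 (Suc (n - 1))"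
    by (rule one_form_forms) (use one_form_coeff[OF 1] interior_prod_two_form in simp)
qed (simp add: interior_prod_two_form del: One_nat_def)

text \<open>The volume form has already been contracted with R, so adding a multiple of R to the
  diagonal field changes nothing; moving R to the outside costs a sign.\<close>

lemma lie_form_shift:
  assumes Z: "Z = (\<lambda>i. X 0 i + Const a * radial n i)"
  shows "\<exists>s. s \<noteq> 0 \<and> lie_form n (map X (rev [1..<n - 1]) @ [Z]) =
    scale_form s (one_form n (pairing n (radial n) \<circ> (\<lambda>l i. kernel_two_form i l)))"
proof -
  let ?vs = "map X (rev [1..<n - 1])" and ?R = "interior_prod n (radial n) (volume_form n)"
  have "Z = X 0 + scale_vf a (radial n)" unfolding Z by (simp add: fun_eq_iff scale_vf_def)
  then have "interior_prod n Z ?R = interior_prod n (X 0) ?R"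
    by (simp add: interior_prod_field_add interior_prod_field_scale interior_prod_self)
  also have "\<dots> = scale_form (- 1) (interior_prod n (radial n) (interior_prod n (X 0) (volume_form n)))"
    by (rule interior_prod_anticommute)
  finally have 1: "interior_prod n Z ?R = \<dots>" .
  have "[0..<n - 1] = 0 # [1..<n - 1]" using n_ge by (simp add: upt_conv_Cons)
  then have 2: "ips n ?vs (interior_prod n (X 0) (volume_form n)) = contracted_volume (n - 1)"
    unfolding contracted_volume_def by simp
  have "lie_form n (?vs @ [Z]) = ips n ?vs (interior_prod n Z ?R)"
    by (simp add: lie_form_def)
  also have "\<dots> = scale_form ((- 1) * (- 1) ^ length ?vs) (interior_prod n (radial n) (contracted_volume (n - 1)))"
    unfolding 1 ips_scale ips_commute[of n ?vs "radial n"] 2 by simp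
  finally show ?thesis
    unfolding interior_prod_radial_two_form by (intro exI[of _ "(- 1) * (- 1) ^ length ?vs"]) simp
qed

text \<open>An antisymmetric tensor has no entry with three distinct indices in \<open>{0, 1}\<close>.\<close>

lemma tensor3_eq_0:
  assumes swap: "\<And>a b e. T a b e = - T b a e" "\<And>a b e. T a b e = - T a e b"
    and ker: "\<And>k b e. k < n - 1 \<Longrightarrow> b \<le> n \<Longrightarrow> e \<le> n \<Longrightarrow> pairing n (X k) (\<lambda>a. T a b e) = 0"
    and abe: "a \<le> n" "b \<le> n" "e \<le> n"
  shows "T a b e = 0"
proof -
  have d1: "T a a e = 0" for a e
    using swap(1)[of a a e] cpoly_eq_uminus_iff by blast
  have d2: "T a e e = 0" for a e
    using swap(2)[of a e e] cpoly_eq_uminus_iff by blast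
  have d3: "T a b a = 0" for a b
    using swap(2)[of a b a] d1[of a b] by simp
  have 1: "T e 0 1 = 0" if "e \<le> n" for e
    by (rule covector_eq_0[of "\<lambda>e. T e 0 1"]) (use ker[of _ 0 1] d1 d3 that n_ge in auto)
  have 2: "T b 0 e = 0" if "b \<le> n" "e \<le> n" for b e
  proof (rule covector_eq_0[of "\<lambda>b. T b 0 e"])
    show "T 1 0 e = 0" using swap(1)[of 1 0 e] swap(2)[of 0 1 e] swap(1)[of 0 e 1] 1[OF that(2)] by simp
  qed (use ker[of _ 0 e] d1 that in auto)
  have 3: "T b 1 e = 0" if "b \<le> n" "e \<le> n" for b e
  proof (rule covector_eq_0[of "\<lambda>b. T b 1 e"])
    show "T 0 1 e = 0" using swap(2)[of 0 1 e] swap(1)[of 0 e 1] 1[OF that(2)] by simp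
  qed (use ker[of _ 1 e] d1 that n_ge in auto)
  show ?thesis
  proof (rule covector_eq_0[of "\<lambda>a. T a b e"])
    show "T 0 b e = 0" using swap(1)[of 0 b e] 2[OF abe(2,3)] by simp
    show "T 1 b e = 0" using swap(1)[of 1 b e] 3[OF abe(2,3)] by simp
  qed (use ker[of _ b e] abe in auto)
qed

end

context deformation_setup
begin

lemma cubic_\<omega>:
  assumes "a \<le> n" "b \<le> n" "e \<le> n"
  shows "cubic \<omega> a b e = 0"
proof (rule tensor3_eq_0[OF cubic_swap _ assms])
  fix k b e assume k: "k < n - 1" "b \<le> n" "e \<le> n"
  have K: "pairing n (X k) (\<lambda>a. d1 \<omega> a l) = 0" if "l \<le> n" for l
  proof -
    have "pairing n (X k) (\<lambda>a. d1 \<omega> a l) = pairing n (X k) (\<lambda>a. of_nat (n + 1) * \<Omega> a l)"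
      using that d1_\<omega> by (intro pairing_cong) auto
    then show ?thesis using contract_X[OF k(1) that] by (simp add: pairing_mult_right)
  qed
  have "pairing n (X k) (\<lambda>a. d1 \<omega> e a) = pairing n (X k) (\<lambda>a. - d1 \<omega> a e)"
    by (intro pairing_cong refl d1_anti)
  then have K': "pairing n (X k) (\<lambda>a. d1 \<omega> e a) = 0" using K[OF k(3)] by (simp add: pairing_uminus_right)
  show "pairing n (X k) (\<lambda>a. cubic \<omega> a b e) = 0"
    unfolding cubic_def
    using pairing_X_\<omega>[OF k(1)] K[OF k(2)] K'
    by (simp add: pairing_add_right pairing_mult_right pairing_mult_right2)
qed

end

section \<open>The integrability equations as polynomials in the coefficients of a form\<close>

section \<open>Coordinates on the space of one-forms\<close>

definition coord_set :: "nat \<Rightarrow> nat \<Rightarrow> (nat set \<times> (nat \<Rightarrow>\<^sub>0 nat)) set" where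
  "coord_set n e = {({i}, m) |i m. i \<le> n \<and> keys m \<subseteq> {..n} \<and> mon_degree m = e}"

lemma finite_monomials: "finite {m :: nat \<Rightarrow>\<^sub>0 nat. keys m \<subseteq> {..n} \<and> mon_degree m = e}" (is "finite ?M")
proof -
  have "?M \<subseteq> (\<lambda>f. \<Sum>i\<le>n. single i (f i)) ` (PiE {..n} (\<lambda>_. {..e}))"
  proof
    fix m :: "nat \<Rightarrow>\<^sub>0 nat" assume m: "m \<in> ?M"
    have le: "lookup m i \<le> e" if "i \<le> n" for i
    proof -
      have "mon_degree m = (\<Sum>i\<le>n. lookup m i)" using m by (intro mon_degree_superset) auto
      moreover have "lookup m i \<le> (\<Sum>i\<le>n. lookup m i)" using that by (intro member_le_sum) auto
      ultimately show ?thesis using m by simp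
    qed
    have "m = (\<Sum>i\<le>n. single i (restrict (lookup m) {..n} i))"
    proof (rule poly_mapping_eqI)
      fix k
      have "lookup (\<Sum>i\<le>n. single i (restrict (lookup m) {..n} i)) k = (\<Sum>i\<le>n. if i = k then lookup m i else 0)"
        unfolding lookup_sum by (intro sum.cong refl) (auto simp: lookup_single when_def)
      also have "\<dots> = (if k \<le> n then lookup m k else 0)" by simp
      also have "\<dots> = lookup m k"
      proof (cases "k \<le> n")
        case False
        then have "k \<notin> keys m" using m by auto
        then show ?thesis using False by (simp add: in_keys_iff)
      qed simp
      finally show "lookup m k = lookup (\<Sum>i\<le>n. single i (restrict (lookup m) {..n} i)) k" ..
    qed
    moreover have "restrict (lookup m) {..n} \<in> PiE {..n} (\<lambda>_. {..e})" using le by auto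
    ultimately show "m \<in> (\<lambda>f. \<Sum>i\<le>n. single i (f i)) ` (PiE {..n} (\<lambda>_. {..e}))" by (rule image_eqI)
  qed
  then show ?thesis by (rule finite_subset) (intro finite_imageI finite_PiE; simp)
qed

lemma finite_coord_set: "finite (coord_set n e)"
proof (rule finite_subset)
  show "coord_set n e \<subseteq> (\<lambda>i. {i}) ` {..n} \<times> {m. keys m \<subseteq> {..n} \<and> mon_degree m = e}"
    by (auto simp: coord_set_def)
qed (intro finite_cartesian_product finite_imageI finite_monomials finite_atMost)

lemma form_coords_support:
  assumes "\<alpha> \<in> forms n 1 e" "v \<notin> coord_set n e"
  shows "form_coords \<alpha> v = 0"
proof -
  obtain I m where v: "v = (I, m)" by (cases v)
  have "lookup (\<alpha> I) m = 0"
  proof (cases "\<exists>l\<le>n. I = {l}")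
    case True
    then obtain l where l: "l \<le> n" "I = {l}" by auto
    have "m \<notin> keys (\<alpha> {l})"
    proof
      assume "m \<in> keys (\<alpha> {l})"
      then have "keys m \<subseteq> {..n} \<and> mon_degree m = e"
        using one_form_coeff[OF assms(1) l(1)] by (simp add: hom_polys_def homogeneous_def)
      then show False using assms(2) l unfolding v coord_set_def by auto
    qed
    then show ?thesis by (simp add: l in_keys_iff)
  next
    case False
    then show ?thesis using one_form_outside[OF assms(1)] by simp
  qed
  then show ?thesis by (simp add: v form_coords_def)
qed

lemma form_coords_surj:
  assumes "\<forall>v. v \<notin> coord_set n e \<longrightarrow> w v = 0"
  shows "\<exists>\<eta>. (\<forall>l\<le>n. \<eta> l \<in> hom_polys n e) \<and> form_coords (one_form n \<eta>) = w"
proof (intro exI conjI)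
  let ?M = "{m :: nat \<Rightarrow>\<^sub>0 nat. keys m \<subseteq> {..n} \<and> mon_degree m = e}"
  let ?\<eta> = "\<lambda>l. \<Sum>m\<in>?M. single m (w ({l}, m)) :: nat cpoly"
  show hom: "\<forall>l\<le>n. ?\<eta> l \<in> hom_polys n e"
  proof (intro allI impI hom_polys_sum)
    fix l m assume "m \<in> ?M"
    then show "single m (w ({l}, m)) \<in> hom_polys n e"
      by (auto simp: hom_polys_def homogeneous_def)
  qed
  then have f: "one_form n ?\<eta> \<in> forms n 1 e" by (intro one_form_forms) simp
  show "form_coords (one_form n ?\<eta>) = w"
  proof
    fix v
    show "form_coords (one_form n ?\<eta>) v = w v"
    proof (cases "v \<in> coord_set n e")
      case True
      then obtain l m where v: "v = ({l}, m)" "l \<le> n" "m \<in> ?M" by (auto simp: coord_set_def)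
      have "form_coords (one_form n ?\<eta>) v = lookup (?\<eta> l) m"
        using v(2) by (simp add: v(1) form_coords_def)
      also have "\<dots> = (\<Sum>m'\<in>?M. if m' = m then w ({l}, m') else 0)"
        unfolding lookup_sum by (intro sum.cong refl) (auto simp: lookup_single when_def)
      also have "\<dots> = w v" using finite_monomials[of n e] v by simp
      finally show ?thesis .
    next
      case False
      then have "w v = 0" using assms by blast
      then show ?thesis using form_coords_support[OF f False] by simp
    qed
  qed
qed

text \<open>Any linear functional \<open>L\<close> on polynomials becomes a linear form in the
  coefficients. With evaluation at a point, or evaluation of a derivative, the equations can be
  written pointwise instead of coefficient by coefficient.\<close>

definition coord_form :: "nat \<Rightarrow> nat \<Rightarrow> (nat cpoly \<Rightarrow> complex) \<Rightarrow> nat \<Rightarrow> (nat set \<times> (nat \<Rightarrow>\<^sub>0 nat)) cpoly" where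
  "coord_form n e L i = lin_form (coord_set n e) (\<lambda>v. if fst v = {i} then L (single (snd v) 1) else 0)"

lemma eval_coord_form:
  assumes L: "\<And>p q. L (p + q) = L p + L q" "\<And>c p. L (Const c * p) = c * L p"
    and \<alpha>: "\<alpha> \<in> forms n 1 e" and i: "i \<le> n"
  shows "eval_at (form_coords \<alpha>) (coord_form n e L i) = L (\<alpha> {i})"
proof -
  have L0: "L 0 = 0" using L(2)[of 0 0] by simp
  have Ls: "L (sum f A) = (\<Sum>a\<in>A. L (f a))" for f and A :: "(nat \<Rightarrow>\<^sub>0 nat) set"
    by (induction A rule: infinite_finite_induct) (simp_all add: L0 L(1))
  let ?K = "keys (\<alpha> {i})"
  let ?A = "\<lambda>v. if fst v = {i} then L (single (snd v) 1) else 0"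
  have "eval_at (form_coords \<alpha>) (coord_form n e L i) = (\<Sum>v\<in>coord_set n e. ?A v * form_coords \<alpha> v)"
    by (simp add: coord_form_def)
  also have "\<dots> = (\<Sum>v\<in>Pair {i} ` ?K. ?A v * form_coords \<alpha> v)"
  proof (rule sum.mono_neutral_right[OF finite_coord_set])
    show "Pair {i} ` ?K \<subseteq> coord_set n e"
      using one_form_coeff[OF \<alpha> i] i by (auto simp: coord_set_def hom_polys_def homogeneous_def)
    show "\<forall>v\<in>coord_set n e - Pair {i} ` ?K. ?A v * form_coords \<alpha> v = 0"
    proof
      fix v assume v: "v \<in> coord_set n e - Pair {i} ` ?K"
      obtain I m where [simp]: "v = (I, m)" by (cases v)
      show "?A v * form_coords \<alpha> v = 0"
      proof (cases "I = {i}")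
        case True
        then have "m \<notin> ?K" using v by auto
        then show ?thesis using True by (simp add: form_coords_def in_keys_iff)
      qed simp
    qed
  qed
  also have "\<dots> = (\<Sum>m\<in>?K. L (single m 1) * lookup (\<alpha> {i}) m)"
    by (subst sum.reindex) (auto simp: inj_on_def form_coords_def)
  also have "\<dots> = L (\<Sum>m\<in>?K. single m (lookup (\<alpha> {i}) m))"
    unfolding Ls
  proof (intro sum.cong refl)
    fix m
    have "L (single m (lookup (\<alpha> {i}) m * 1)) = lookup (\<alpha> {i}) m * L (single m 1)"
      using L(2)[of "lookup (\<alpha> {i}) m" "single m 1"] by (simp only: Const_mult_single)
    then show "L (single m 1) * lookup (\<alpha> {i}) m = L (single m (lookup (\<alpha> {i}) m))"
      by (simp add: mult.commute)
  qed
  also have "\<dots> = L (\<alpha> {i})" by (simp only: cpoly_as_sum[symmetric])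
  finally show ?thesis .
qed

definition dir_deriv :: "'v set \<Rightarrow> ('v \<Rightarrow> complex) \<Rightarrow> ('v \<Rightarrow> complex) \<Rightarrow> 'v cpoly \<Rightarrow> complex" where
  "dir_deriv V p w f = (\<Sum>v\<in>V. eval_at p (pdiff v f) * w v)"

lemma dir_deriv_add: "dir_deriv V p w (f + g) = dir_deriv V p w f + dir_deriv V p w g"
  and dir_deriv_diff: "dir_deriv V p w (f - g) = dir_deriv V p w f - dir_deriv V p w g"
  and dir_deriv_mult: "dir_deriv V p w (f * g) = dir_deriv V p w f * eval_at p g + eval_at p f * dir_deriv V p w g"
  and dir_deriv_Const: "dir_deriv V p w (Const c) = 0"
  by (simp_all add: dir_deriv_def pdiff_add pdiff_diff pdiff_mult eval_at_simps algebra_simps sum.distrib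
      sum_subtractf sum_distrib_left)

lemma dir_deriv_sum: "dir_deriv V p w (sum f A) = (\<Sum>a\<in>A. dir_deriv V p w (f a))"
  by (induction A rule: infinite_finite_induct) (simp_all add: dir_deriv_add, simp_all add: dir_deriv_def)

lemma dir_deriv_coord_form: "dir_deriv (coord_set n e) p w (coord_form n e L i) = eval_at w (coord_form n e L i)"
  unfolding dir_deriv_def coord_form_def using pdiff_lin_form[OF finite_coord_set] by simp

definition coeff_at :: "nat \<Rightarrow> nat \<Rightarrow> (nat \<Rightarrow> complex) \<Rightarrow> nat \<Rightarrow> (nat set \<times> (nat \<Rightarrow>\<^sub>0 nat)) cpoly" where
  "coeff_at n e z = coord_form n e (eval_at z)"

definition deriv_at :: "nat \<Rightarrow> nat \<Rightarrow> (nat \<Rightarrow> complex) \<Rightarrow> nat \<Rightarrow> nat \<Rightarrow> (nat set \<times> (nat \<Rightarrow>\<^sub>0 nat)) cpoly" where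
  "deriv_at n e z b = coord_form n e (\<lambda>p. eval_at z (pdiff b p))"

lemma eval_coeff_at: "\<alpha> \<in> forms n 1 e \<Longrightarrow> i \<le> n \<Longrightarrow> eval_at (form_coords \<alpha>) (coeff_at n e z i) = eval_at z (\<alpha> {i})"
  unfolding coeff_at_def by (rule eval_coord_form) (simp_all add: eval_at_simps)

lemma eval_deriv_at:
  "\<alpha> \<in> forms n 1 e \<Longrightarrow> i \<le> n \<Longrightarrow> eval_at (form_coords \<alpha>) (deriv_at n e z b i) = eval_at z (pdiff b (\<alpha> {i}))"
  unfolding deriv_at_def by (rule eval_coord_form) (simp_all add: eval_at_simps pdiff_add pdiff_mult)

definition radial_eq :: "nat \<Rightarrow> nat \<Rightarrow> (nat \<Rightarrow> complex) \<Rightarrow> (nat set \<times> (nat \<Rightarrow>\<^sub>0 nat)) cpoly" where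
  "radial_eq n e z = (\<Sum>i\<le>n. Const (z i) * coeff_at n e z i)"

definition d1_at :: "nat \<Rightarrow> nat \<Rightarrow> (nat \<Rightarrow> complex) \<Rightarrow> nat \<Rightarrow> nat \<Rightarrow> (nat set \<times> (nat \<Rightarrow>\<^sub>0 nat)) cpoly" where
  "d1_at n e z a b = deriv_at n e z a b - deriv_at n e z b a"

definition cubic_eq :: "nat \<Rightarrow> nat \<Rightarrow> (nat \<Rightarrow> complex) \<Rightarrow> nat \<Rightarrow> nat \<Rightarrow> nat \<Rightarrow> (nat set \<times> (nat \<Rightarrow>\<^sub>0 nat)) cpoly" where
  "cubic_eq n e z a b c = coeff_at n e z a * d1_at n e z b c + coeff_at n e z b * d1_at n e z c a +
     coeff_at n e z c * d1_at n e z a b"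

lemma eval_d1_at:
  "\<alpha> \<in> forms n 1 e \<Longrightarrow> a \<le> n \<Longrightarrow> b \<le> n \<Longrightarrow> eval_at (form_coords \<alpha>) (d1_at n e z a b) = eval_at z (d1 (\<lambda>l. \<alpha> {l}) a b)"
  by (simp add: d1_at_def d1_def eval_at_diff eval_deriv_at)

lemma eval_radial_eq:
  "\<alpha> \<in> forms n 1 e \<Longrightarrow> eval_at (form_coords \<alpha>) (radial_eq n e z) = eval_at z (pairing n (radial n) (\<lambda>l. \<alpha> {l}))"
  by (simp add: radial_eq_def pairing_def eval_at_simps eval_coeff_at radial_def)

lemma eval_cubic_eq:
  "\<alpha> \<in> forms n 1 e \<Longrightarrow> a \<le> n \<Longrightarrow> b \<le> n \<Longrightarrow> c \<le> n \<Longrightarrow>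
    eval_at (form_coords \<alpha>) (cubic_eq n e z a b c) = eval_at z (cubic (\<lambda>l. \<alpha> {l}) a b c)"
  by (simp add: cubic_eq_def cubic_def eval_at_add eval_at_mult eval_coeff_at eval_d1_at)

lemma dir_coeff_at: "dir_deriv (coord_set n e) p w (coeff_at n e z i) = eval_at w (coeff_at n e z i)"
  unfolding coeff_at_def by (rule dir_deriv_coord_form)

lemma dir_d1_at: "dir_deriv (coord_set n e) p w (d1_at n e z a b) = eval_at w (d1_at n e z a b)"
  unfolding d1_at_def deriv_at_def dir_deriv_diff eval_at_diff dir_deriv_coord_form ..

lemma dir_radial_eq: "dir_deriv (coord_set n e) p w (radial_eq n e z) = eval_at w (radial_eq n e z)"
  by (simp add: radial_eq_def dir_deriv_sum dir_deriv_mult dir_deriv_Const dir_coeff_at eval_at_simps)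

text \<open>The equation is quadratic in the coefficients, so its differential is the polarisation:
  exactly the linear condition that \<open>tangentI\<close> asks for.\<close>

lemma dir_cubic_eq:
  assumes \<alpha>: "\<alpha> \<in> forms n 1 e" and \<eta>: "\<eta> \<in> forms n 1 e" and abc: "a \<le> n" "b \<le> n" "c \<le> n"
  shows "dir_deriv (coord_set n e) (form_coords \<alpha>) (form_coords \<eta>) (cubic_eq n e z a b c) =
    eval_at z (\<alpha> {a} * d1 (\<lambda>l. \<eta> {l}) b c + \<alpha> {b} * d1 (\<lambda>l. \<eta> {l}) c a + \<alpha> {c} * d1 (\<lambda>l. \<eta> {l}) a b +
      \<eta> {a} * d1 (\<lambda>l. \<alpha> {l}) b c + \<eta> {b} * d1 (\<lambda>l. \<alpha> {l}) c a + \<eta> {c} * d1 (\<lambda>l. \<alpha> {l}) a b)"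
  using abc
  by (simp add: cubic_eq_def dir_deriv_add dir_deriv_mult dir_coeff_at dir_d1_at eval_at_add eval_at_mult
      eval_coeff_at[OF \<alpha>] eval_coeff_at[OF \<eta>] eval_d1_at[OF \<alpha>] eval_d1_at[OF \<eta>])

section \<open>The orbit of a one-form\<close>

lemma lookup_poly_Const':
  "\<exists>Q. (\<forall>s. lookup (poly q (Const s)) m = poly Q s) \<and> (\<forall>k. coeff Q k = lookup (coeff q k) m)"
proof (intro exI conjI allI)
  fix s k
  show "lookup (poly q (Const s)) m = poly (\<Sum>k\<le>degree q. monom (lookup (coeff q k) m) k) s"
    by (rule lookup_poly_Const)
  have "coeff (\<Sum>k\<le>degree q. monom (lookup (coeff q k) m) k) k = (if k \<le> degree q then lookup (coeff q k) m else 0)"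
    by (simp add: coeff_sum)
  also have "\<dots> = lookup (coeff q k) m" by (simp add: coeff_eq_0)
  finally show "coeff (\<Sum>k\<le>degree q. monom (lookup (coeff q k) m) k) k = lookup (coeff q k) m" .
qed

lemma pullback_forms:
  assumes "\<alpha> \<in> forms n 1 e"
  shows "pullback n M \<alpha> \<in> forms n 1 e"
  unfolding pullback_eq by (rule one_form_forms) (rule pull_hom[OF one_form_coeff[OF assms]])

lemma polyfun_pullback:
  assumes \<alpha>: "\<alpha> \<in> forms n 1 e"
  shows "polyfun (\<lambda>s. form_coords (pullback n (mat_line n A B s) \<alpha>) v)"
proof -
  obtain I m where v: "v = (I, m)" by (cases v)
  show ?thesis
  proof (cases "\<exists>l\<le>n. I = {l}")
    case True
    then obtain l where l: "l \<le> n" "I = {l}" by auto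
    obtain q where q: "\<forall>s. pull n (mat_line n A B s) (\<lambda>l. \<alpha> {l}) l = poly q (Const s)"
      using pull_line[where \<eta> = "\<lambda>l. \<alpha> {l}" and j = l and n = n and A = A and B = B] l one_form_vars[OF \<alpha>] by auto
    obtain Q where "\<forall>s. lookup (poly q (Const s)) m = poly Q s"
      using lookup_poly_Const'[of q m] by auto
    then have "\<forall>s. form_coords (pullback n (mat_line n A B s) \<alpha>) v = poly Q s"
      using q l by (simp add: v form_coords_def pullback_eq)
    then show ?thesis unfolding polyfun_def by blast
  next
    case False
    then have "pullback n M \<alpha> I = 0" for M by (auto simp: pullback_eq one_form_def)
    then have "(\<lambda>s. form_coords (pullback n (mat_line n A B s) \<alpha>) v) = (\<lambda>s. 0)" by (simp add: v form_coords_def)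
    then show ?thesis using polyfun_const by simp
  qed
qed

lemma pullback_tangent:
  assumes \<alpha>: "\<alpha> \<in> forms n 1 e"
  shows "\<exists>R. (\<forall>s. form_coords (pullback n (mat_line n (1\<^sub>m (Suc n)) B s) \<alpha>) v = form_coords \<alpha> v + s * poly R s) \<and>
    poly R 0 = form_coords (one_form n (Lie1 n (linear_coord n B) (\<lambda>l. \<alpha> {l}))) v"
proof -
  obtain I m where v: "v = (I, m)" by (cases v)
  show ?thesis
  proof (cases "\<exists>l\<le>n. I = {l}")
    case True
    then obtain l where l: "l \<le> n" "I = {l}" by auto
    obtain q where q: "\<forall>s. pull n (mat_line n (1\<^sub>m (Suc n)) B s) (\<lambda>l. \<alpha> {l}) l = poly q (Const s)"
      "coeff q 0 = \<alpha> {l}" "coeff q (Suc 0) = Lie1 n (linear_coord n B) (\<lambda>l. \<alpha> {l}) l"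
      using pull_line_one[where \<eta> = "\<lambda>l. \<alpha> {l}" and j = l and n = n and B = B] l one_form_vars[OF \<alpha>] by auto
    obtain Q where Q: "\<forall>s. lookup (poly q (Const s)) m = poly Q s" "\<forall>k. coeff Q k = lookup (coeff q k) m"
      using lookup_poly_Const'[of q m] by auto
    \<comment> \<open>Dropping the constant coefficient of \<open>Q\<close> gives the difference
      quotient; its value at 0 is the velocity.\<close>
    obtain a R where aR: "Q = pCons a R" by (cases Q)
    have "a = lookup (\<alpha> {l}) m" using Q(2)[rule_format, of 0] q(2) by (simp add: aR)
    moreover have "poly R 0 = lookup (Lie1 n (linear_coord n B) (\<lambda>l. \<alpha> {l}) l) m"
      using Q(2)[rule_format, of "Suc 0"] q(3) by (simp add: aR poly_0_coeff_0)
    moreover have "\<forall>s. form_coords (pullback n (mat_line n (1\<^sub>m (Suc n)) B s) \<alpha>) v = a + s * poly R s"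
      using q(1) Q(1) l by (simp add: v form_coords_def pullback_eq aR)
    ultimately show ?thesis using l by (intro exI[of _ R]) (simp add: v form_coords_def)
  next
    case False
    then have "pullback n M \<alpha> I = 0" for M by (auto simp: pullback_eq one_form_def)
    then show ?thesis using False one_form_outside[OF \<alpha> False]
      by (intro exI[of _ 0]) (auto simp: v form_coords_def one_form_def)
  qed
qed

lemma mat_line_0: "A \<in> carrier_mat (n + 1) (n + 1) \<Longrightarrow> mat_line n A B 0 = A"
  by (rule eq_matI) (auto simp: mat_line_def)

lemma pullback_one:
  assumes "\<alpha> \<in> forms n 1 e"
  shows "pullback n (1\<^sub>m (Suc n)) \<alpha> = \<alpha>"
proof (rule forms_1_eqI[OF pullback_forms[OF assms] assms])
  fix l assume "l \<le> n"
  then show "pullback n (1\<^sub>m (Suc n)) \<alpha> {l} = \<alpha> {l}"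
    using pull_one[where \<eta> = "\<lambda>l. \<alpha> {l}" and n = n and j = l] one_form_vars[OF assms] by (simp add: pullback_eq)
qed

lemma one_GLn: "1\<^sub>m (Suc n) \<in> GLn n"
  using GLn_det[of "1\<^sub>m (Suc n)" n] by simp

lemma eventually_polyfun_nonzero:
  assumes "polyfun f" "f 0 \<noteq> 0"
  shows "eventually (\<lambda>s. f s \<noteq> 0) (at 0)"
proof -
  obtain q where q: "\<And>s. f s = poly q s" using assms(1) unfolding polyfun_def by auto
  have "isCont (poly q) 0" by simp
  then have "(poly q \<longlongrightarrow> poly q 0) (at 0)" by (simp add: isCont_def)
  then have "eventually (\<lambda>s. poly q s \<noteq> 0) (at 0)"
    by (rule tendsto_imp_eventually_ne) (use assms(2) q in simp)
  then show ?thesis by (simp add: q)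
qed

lemma hom_polys_1_eq:
  assumes "p \<in> hom_polys n 1"
  shows "p = (\<Sum>j\<le>n. Const (lookup p (single j 1)) * Var j)"
proof (rule poly_mapping_eqI)
  fix m
  have *: "lookup (\<Sum>j\<le>n. Const (lookup p (single j 1)) * Var j) m =
      (\<Sum>j\<le>n. if m = single j 1 then lookup p (single j 1) else 0)"
    unfolding lookup_sum by (intro sum.cong refl) (simp add: Var_def lookup_single when_def)
  show "lookup p m = lookup (\<Sum>j\<le>n. Const (lookup p (single j 1)) * Var j) m"
  proof (cases "m \<in> keys p")
    case True
    then have m: "keys m \<subseteq> {..n}" "mon_degree m = 1"
      using assms by (auto simp: hom_polys_def homogeneous_def)
    from m(2) obtain k where k: "m = single k 1" unfolding mon_degree_1_iff by (rule exE)
    have kn: "k \<le> n" using m(1) by (simp add: k)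
    have inj: "single k (1::nat) = single j 1 \<longleftrightarrow> j = k" for j
      by (metis lookup_single_eq lookup_single_not_eq one_neq_zero)
    show ?thesis
      unfolding * unfolding k inj using kn by simp
  next
    case False
    then have "lookup p m = 0" by (simp add: in_keys_iff)
    moreover have "(\<Sum>j\<le>n. if m = single j 1 then lookup p (single j 1) else 0) = 0"
      using calculation by (intro sum.neutral) auto
    ultimately show ?thesis unfolding * by simp
  qed
qed

context deformation_setup
begin

lemma \<omega>_form: "one_form n \<omega> \<in> forms n 1 n"
  by (rule one_form_forms) (rule \<omega>_hom)

text \<open>The instance of \<open>local_vanishing\<close> for the cone of integrable forms, with
  the radial and cubic equations at all points \<open>z\<close> as \<open>E\<close>. The curves are
  pull-backs along lines of matrices through the identity.\<close>

lemma deformations_locally_in_orbit: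
  assumes \<omega>_foliation: "one_form n \<omega> \<in> foliation_forms n n"
    and f: "\<And>M. M \<in> GLn n \<Longrightarrow> eval_at (form_coords (pullback n M (one_form n \<omega>))) f = 0"
  shows "\<exists>g. eval_at (form_coords (one_form n \<omega>)) g \<noteq> 0 \<and>
    (\<forall>\<alpha>\<in>foliation_forms n n. eval_at (form_coords \<alpha>) (g * f) = 0)"
proof -
  let ?W = "one_form n \<omega>" and ?V = "coord_set n n"
  let ?S = "form_coords ` foliation_forms n n"
  let ?Ob = "(\<lambda>M. form_coords (pullback n M ?W)) ` GLn n"
  let ?E = "range (radial_eq n n) \<union> {cubic_eq n n z a b c |z a b c. a \<le> n \<and> b \<le> n \<and> c \<le> n}"
  have F: "\<alpha> \<in> forms n 1 n" if "\<alpha> \<in> foliation_forms n n" for \<alpha>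
    using that unfolding foliation_forms_def by simp
  have "\<exists>g. eval_at (form_coords ?W) g \<noteq> 0 \<and> (\<forall>x\<in>?S. eval_at x (g * f) = 0)"
  proof (rule local_vanishing[where V = ?V and Ob = ?Ob and E = ?E])
    show "finite ?V" by (rule finite_coord_set)
    show "x v = 0" if "x \<in> ?S" "v \<notin> ?V" for x v
    proof -
      from that(1) obtain \<alpha> where "x = form_coords \<alpha>" "\<alpha> \<in> foliation_forms n n" by (rule imageE)
      then show ?thesis using form_coords_support[OF F that(2)] by simp
    qed
    show "form_coords ?W \<in> ?S" using \<omega>_foliation by (rule imageI)
    show "?Ob \<subseteq> ?S" using pullback_foliation_forms[OF \<omega>_foliation] by auto
    show "eval_at x q = 0" if "q \<in> ?E" "x \<in> ?S" for q x
    proof -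
      obtain \<alpha> where x: "x = form_coords \<alpha>" and \<alpha>: "\<alpha> \<in> foliation_forms n n" using \<open>x \<in> ?S\<close> by auto
      note A = F[OF \<alpha>] and B = foliation_forms_iff[OF F[OF \<alpha>], THEN iffD1, OF \<alpha>]
      from \<open>q \<in> ?E\<close> show ?thesis
      proof
        assume "q \<in> range (radial_eq n n)"
        then obtain z where "q = radial_eq n n z" by auto
        then show ?thesis using B eval_radial_eq[OF A] by (simp add: x)
      next
        assume "q \<in> {cubic_eq n n z a b c |z a b c. a \<le> n \<and> b \<le> n \<and> c \<le> n}"
        then obtain z a b c where "q = cubic_eq n n z a b c" "a \<le> n" "b \<le> n" "c \<le> n" by auto
        then show ?thesis using B eval_cubic_eq[OF A] by (simp add: x)
      qed
    qed
    show "eval_at x f = 0" if "x \<in> ?Ob" for x using that f by auto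
    fix w assume w: "\<forall>v. v \<notin> ?V \<longrightarrow> w v = 0"
      and tan: "\<forall>q\<in>?E. (\<Sum>v\<in>?V. eval_at (form_coords ?W) (pdiff v q) * w v) = 0"
    obtain \<eta> where \<eta>: "\<forall>l\<le>n. \<eta> l \<in> hom_polys n n" "form_coords (one_form n \<eta>) = w"
      using form_coords_surj[OF w] by auto
    have \<eta>f: "one_form n \<eta> \<in> forms n 1 n" by (rule one_form_forms) (use \<eta>(1) in simp)
    have tan': "dir_deriv ?V (form_coords ?W) (form_coords (one_form n \<eta>)) q = 0" if "q \<in> ?E" for q
      using tan that unfolding \<eta>(2) dir_deriv_def by blast
    have "tangent \<eta>"
    proof (rule tangentI)
      show "\<eta> l \<in> hom_polys n n" if "l \<le> n" for l using \<eta>(1) that by simp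
      show "pairing n (radial n) \<eta> = 0"
      proof (rule cpoly_eq_0I)
        fix z
        have "eval_at z (pairing n (radial n) (\<lambda>l. one_form n \<eta> {l})) = 0"
          using tan'[of "radial_eq n n z"] eval_radial_eq[OF \<eta>f] by (simp add: dir_radial_eq)
        moreover have "pairing n (radial n) (\<lambda>l. one_form n \<eta> {l}) = pairing n (radial n) \<eta>"
          by (intro pairing_cong) simp_all
        ultimately show "eval_at z (pairing n (radial n) \<eta>) = 0" by simp
      qed
      fix a b e assume abe: "a \<le> n" "b \<le> n" "e \<le> n"
      have d: "d1 (\<lambda>l. one_form n \<gamma> {l}) x y = d1 \<gamma> x y" if "x \<le> n" "y \<le> n" for \<gamma> x y
        using that by (simp add: d1_def)
      show "\<omega> a * d1 \<eta> b e + \<omega> b * d1 \<eta> e a + \<omega> e * d1 \<eta> a b +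
          \<eta> a * d1 \<omega> b e + \<eta> b * d1 \<omega> e a + \<eta> e * d1 \<omega> a b = 0" (is "?p = 0")
      proof (rule cpoly_eq_0I)
        fix z
        have "cubic_eq n n z a b e \<in> ?E" using abe by blast
        from tan'[OF this] show "eval_at z ?p = 0"
          unfolding dir_cubic_eq[OF \<omega>_form \<eta>f abe] using abe by (simp add: d)
      qed
    qed
    then have "trivial \<eta>" by (rule tangent_imp_trivial)
    then obtain v where v: "\<forall>i\<le>n. v i \<in> hom_polys n 1" "\<forall>l\<le>n. \<eta> l = Lie1 n v \<omega> l"
      unfolding trivial_def by auto
    define B where "B = mat (n + 1) (n + 1) (\<lambda>(i, j). lookup (v i) (single j 1))"
    have B: "linear_coord n B i = v i" if "i \<le> n" for i
    proof -
      have "linear_coord n B i = (\<Sum>j\<le>n. Const (lookup (v i) (single j 1)) * Var j)"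
        unfolding linear_coord_def using that by (intro sum.cong refl) (simp add: B_def)
      then show ?thesis using hom_polys_1_eq[of "v i" n] v(1) that by simp
    qed
    have "Lie1 n (linear_coord n B) (\<lambda>l. ?W {l}) l = \<eta> l" if "l \<le> n" for l
    proof -
      have "Lie1 n (linear_coord n B) (\<lambda>l. ?W {l}) l = Lie1 n v \<omega> l"
        unfolding Lie1_def using that B by (intro sum.cong refl) simp
      then show ?thesis using v(2) that by simp
    qed
    then have "one_form n (Lie1 n (linear_coord n B) (\<lambda>l. ?W {l})) = one_form n \<eta>"
      by (auto simp: one_form_def fun_eq_iff)
    then have Lw: "form_coords (one_form n (Lie1 n (linear_coord n B) (\<lambda>l. ?W {l}))) = w" using \<eta>(2) by simp
    let ?m = "mat_line n (1\<^sub>m (Suc n)) B"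
    have "\<forall>v. \<exists>R. (\<forall>s. form_coords (pullback n (?m s) ?W) v = form_coords ?W v + s * poly R s) \<and> poly R 0 = w v"
      using pullback_tangent[OF \<omega>_form, of B] unfolding Lw by blast
    from choice[OF this] obtain R where
      R: "\<forall>v. (\<forall>s. form_coords (pullback n (?m s) ?W) v = form_coords ?W v + s * poly (R v) s) \<and> poly (R v) 0 = w v" ..
    show "\<exists>u. (\<forall>v. ((\<lambda>s. u s v) \<longlongrightarrow> w v) (at 0)) \<and>
        eventually (\<lambda>s. (\<lambda>v. form_coords ?W v + s * u s v) \<in> ?Ob) (at 0)"
    proof (intro exI[of _ "\<lambda>s v. poly (R v) s"] conjI allI)
      fix v
      have "isCont (poly (R v)) 0" by simp
      then show "((\<lambda>s. poly (R v) s) \<longlongrightarrow> w v) (at 0)" using R by (simp add: isCont_def)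
    next
      \<comment> \<open>The determinant is a polynomial in \<open>s\<close> with value 1 at 0, so
        the line stays in GL for small \<open>s\<close>.\<close>
      have "eventually (\<lambda>s. Determinant.det (?m s) \<noteq> 0) (at 0)"
      proof (rule eventually_polyfun_nonzero[OF polyfun_det_line])
        have "?m 0 = 1\<^sub>m (Suc n)" using mat_line_0[of "1\<^sub>m (Suc n)" n] by simp
        then show "Determinant.det (?m 0) \<noteq> 0" by simp
      qed
      then show "eventually (\<lambda>s. (\<lambda>v. form_coords ?W v + s * poly (R v) s) \<in> ?Ob) (at 0)"
      proof (rule eventually_mono)
        fix s assume "Determinant.det (?m s) \<noteq> 0"
        then have "?m s \<in> GLn n" using GLn_det[OF mat_line_carrier] by simp
        moreover have "(\<lambda>v. form_coords ?W v + s * poly (R v) s) = form_coords (pullback n (?m s) ?W)"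
          using R by (simp add: fun_eq_iff)
        ultimately show "(\<lambda>v. form_coords ?W v + s * poly (R v) s) \<in> ?Ob" by auto
      qed
    qed
  qed
  then show ?thesis by auto
qed

end

section \<open>Irreducible components through multipliers\<close>

section \<open>The space of foliations\<close>

lemma eval_at_scale:
  assumes "homogeneous r p"
  shows "eval_at (\<lambda>v. c * x v) p = c ^ r * eval_at x p"
proof -
  have "eval_at (\<lambda>v. c * x v) p = (\<Sum>m\<in>keys p. lookup p m * (c ^ r * mon_eval x m))"
    unfolding eval_at_eq_sum using assms
    by (intro sum.cong refl) (simp add: mon_eval_scale homogeneous_def)
  then show ?thesis by (simp add: eval_at_eq_sum sum_distrib_left mult.left_commute)
qed

lemma form_coords_scale: "form_coords (scale_form c \<alpha>) = (\<lambda>v. c * form_coords \<alpha> v)"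
  by (auto simp: form_coords_def scale_form_def fun_eq_iff)

text \<open>Quantifies over all representatives, as the projective topology does; for homogeneous
  polynomials one representative decides.\<close>

definition nonvanishing :: "pform set \<Rightarrow> (nat set \<times> (nat \<Rightarrow>\<^sub>0 nat)) cpoly \<Rightarrow> bool" where
  "nonvanishing F p \<longleftrightarrow> (\<forall>\<omega>\<in>F. eval_at (form_coords \<omega>) p \<noteq> 0)"

lemma nonvanishing_form_class:
  assumes "homogeneous r p"
  shows "nonvanishing (form_class \<alpha>) p \<longleftrightarrow> eval_at (form_coords \<alpha>) p \<noteq> 0"
proof -
  have *: "eval_at (form_coords (scale_form c \<alpha>)) p = c ^ r * eval_at (form_coords \<alpha>) p" for c
    unfolding form_coords_scale by (rule eval_at_scale[OF assms])
  have "(\<exists>c. c \<noteq> (0::complex))" by (intro exI[of _ 1]) simp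
  then show ?thesis
    unfolding nonvanishing_def form_class_def by (auto simp: *)
qed

lemma nonvanishing_mult: "nonvanishing F (p * q) \<longleftrightarrow> nonvanishing F p \<and> nonvanishing F q"
  by (simp add: nonvanishing_def eval_at_mult ball_conj_distrib)

abbreviation homogeneous_polys :: "'v cpoly set" where
  "homogeneous_polys \<equiv> {p. \<exists>r. homogeneous r p}"

lemma proj_zariski_eq:
  "proj_zariski n e = topology (\<lambda>U. \<exists>P. P \<subseteq> homogeneous_polys \<and> U = {F \<in> proj_forms n e. \<exists>p\<in>P. nonvanishing F p})"
  by (simp add: proj_zariski_def proj_open_def[abs_def] nonvanishing_def)

lemma topspace_proj: "topspace (proj_zariski n e) = proj_forms n e"
  and closedin_proj: "closedin (proj_zariski n e) C \<longleftrightarrow>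
    (\<exists>P. P \<subseteq> homogeneous_polys \<and> C = {F \<in> proj_forms n e. \<forall>p\<in>P. \<not> nonvanishing F p})"
proof -
  have H: "p * q \<in> homogeneous_polys" if "p \<in> homogeneous_polys" "q \<in> homogeneous_polys"
    for p q :: "(nat set \<times> (nat \<Rightarrow>\<^sub>0 nat)) cpoly"
    using that homogeneous_mult by blast
  have 1: "1 \<in> homogeneous_polys" using homogeneous_1 by blast
  have nz: "nonvanishing F 1" for F by (simp add: nonvanishing_def)
  show "topspace (proj_zariski n e) = proj_forms n e"
    by (rule closedin_nonvanishing_iff(1)[OF proj_zariski_eq, where mul = "(*)" and e = 1, OF H nonvanishing_mult 1 nz])
  show "closedin (proj_zariski n e) C \<longleftrightarrow>
    (\<exists>P. P \<subseteq> homogeneous_polys \<and> C = {F \<in> proj_forms n e. \<forall>p\<in>P. \<not> nonvanishing F p})"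
    by (rule closedin_nonvanishing_iff(2)[OF proj_zariski_eq, where mul = "(*)" and e = 1, OF H nonvanishing_mult 1 nz])
qed

text \<open>Excludes the zero form, whose zero set is everything, from the foliations.\<close>

lemma codimension_affine_space: "codimension (affine_zariski n) (affine_space n) = 0"
proof -
  have cl: "closedin (affine_zariski n) (affine_space n)"
    using closedin_topspace[of "affine_zariski n"] by (simp add: topspace_affine)
  have "codimension (affine_zariski n) (affine_space n) \<le>
    (SUP c \<in> {c. \<exists>C. C 0 = affine_space n \<and> (\<forall>i\<le>c. closedin (affine_zariski n) (C i) \<and> irreducible_in (affine_zariski n) (C i)) \<and>
                        (\<forall>i<c. C i \<subset> C (Suc i))}. enat c)"
    unfolding codimension_def
    by (rule INF_lower) (use cl irreducible_affine_space in simp)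
  also have "\<dots> \<le> 0"
  proof (rule SUP_least)
    fix c assume "c \<in> {c. \<exists>C. C 0 = affine_space n \<and> (\<forall>i\<le>c. closedin (affine_zariski n) (C i) \<and> irreducible_in (affine_zariski n) (C i)) \<and>
                        (\<forall>i<c. C i \<subset> C (Suc i))}"
    then obtain C where C: "C 0 = affine_space n" "\<forall>i\<le>c. closedin (affine_zariski n) (C i)" "\<forall>i<c. C i \<subset> C (Suc i)"
      by auto
    have "c = 0"
    proof (rule ccontr)
      assume "c \<noteq> 0"
      then have "affine_space n \<subset> C 1" "closedin (affine_zariski n) (C 1)" using C by auto
      then show False using closedin_subset[of "affine_zariski n" "C 1"] by (auto simp: topspace_affine)
    qed
    then show "enat c \<le> 0" by (simp add: zero_enat_def)
  qed
  finally show ?thesis by simp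
qed

lemma foliations_iff:
  "F \<in> foliations n d \<longleftrightarrow> (\<exists>\<alpha>. F = form_class \<alpha> \<and> \<alpha> \<in> foliation_forms n (d + 1) \<and>
     2 \<le> codimension (affine_zariski n) (zero_set n \<alpha>))"
  unfolding foliations_def foliation_forms_def by auto

lemma foliations_proj: "foliations n d \<subseteq> proj_forms n (d + 1)"
proof
  fix F assume "F \<in> foliations n d"
  then obtain \<alpha> where \<alpha>: "F = form_class \<alpha>" "\<alpha> \<in> forms n 1 (d + 1)" "2 \<le> codimension (affine_zariski n) (zero_set n \<alpha>)"
    unfolding foliations_def by auto
  have "\<alpha> \<noteq> 0"
  proof
    assume "\<alpha> = 0"
    then have "zero_set n \<alpha> = affine_space n" by (auto simp: zero_set_def)
    then show False using \<alpha>(3) by (simp add: codimension_affine_space)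
  qed
  then show "F \<in> proj_forms n (d + 1)" using \<alpha> unfolding proj_forms_def by auto
qed

lemma topspace_foliation_space: "topspace (foliation_space n d) = foliations n d"
  using foliations_proj[of n d] by (simp add: foliation_space_def topspace_proj Int_absorb1)

lemma closedin_foliation_space:
  "closedin (foliation_space n d) C \<longleftrightarrow>
     (\<exists>P. P \<subseteq> homogeneous_polys \<and> C = {F \<in> foliations n d. \<forall>p\<in>P. \<not> nonvanishing F p})"
  (is "?L \<longleftrightarrow> ?R")
proof
  assume ?L
  then obtain P where P: "P \<subseteq> homogeneous_polys"
    "C = {F \<in> proj_forms n (d + 1). \<forall>p\<in>P. \<not> nonvanishing F p} \<inter> foliations n d"
    unfolding foliation_space_def closedin_subtopology closedin_proj by auto
  have "C = {F \<in> foliations n d. \<forall>p\<in>P. \<not> nonvanishing F p}"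
    unfolding P(2) using foliations_proj[of n d] by auto
  then show ?R using P(1) by (intro exI[of _ P] conjI)
next
  assume ?R
  then obtain P where P: "P \<subseteq> homogeneous_polys" "C = {F \<in> foliations n d. \<forall>p\<in>P. \<not> nonvanishing F p}" by auto
  let ?T = "{F \<in> proj_forms n (d + 1). \<forall>p\<in>P. \<not> nonvanishing F p}"
  have "closedin (proj_zariski n (d + 1)) ?T" unfolding closedin_proj using P(1) by (intro exI[of _ P] conjI refl)
  moreover have "C = ?T \<inter> foliations n d" unfolding P(2) using foliations_proj[of n d] by auto
  ultimately show ?L unfolding foliation_space_def closedin_subtopology by (intro exI[of _ ?T] conjI)
qed

lemma irreducible_foliation_space:
  "irreducible_in (foliation_space n d) T \<longleftrightarrow> T \<subseteq> foliations n d \<and> T \<noteq> {} \<and>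
    (\<forall>p\<in>homogeneous_polys. \<forall>q\<in>homogeneous_polys. (\<forall>F\<in>T. \<not> nonvanishing F p \<or> \<not> nonvanishing F q) \<longrightarrow>
      (\<forall>F\<in>T. \<not> nonvanishing F p) \<or> (\<forall>F\<in>T. \<not> nonvanishing F q))"
  by (rule irreducible_nonvanishing_iff[OF topspace_foliation_space closedin_foliation_space])

text \<open>On an irreducible \<open>U\<close> containing the closure, the product of
  \<open>g\<close> and \<open>f\<close> vanishes while \<open>g\<close> does not, so every equation
  \<open>f\<close> of the closure holds on \<open>U\<close>.\<close>

lemma irreducible_component_closure:
  assumes T: "irreducible_in (foliation_space n d) T"
    and mult: "\<And>f. f \<in> homogeneous_polys \<Longrightarrow> \<forall>F\<in>T. \<not> nonvanishing F f \<Longrightarrow>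
      \<exists>g\<in>homogeneous_polys. (\<exists>F\<in>T. nonvanishing F g) \<and> (\<forall>F\<in>foliations n d. \<not> nonvanishing F g \<or> \<not> nonvanishing F f)"
  shows "irreducible_component (foliation_space n d) (foliation_space n d closure_of T)"
proof -
  let ?X = "foliation_space n d" and ?C = "foliation_space n d closure_of T"
  have TF: "T \<subseteq> foliations n d" "T \<noteq> {}" using T unfolding irreducible_foliation_space by auto
  have TC: "T \<subseteq> ?C" using TF(1) by (intro closure_of_subset) (simp add: topspace_foliation_space)
  have C: "?C \<subseteq> foliations n d" using closure_of_subset_topspace[of ?X T] by (simp add: topspace_foliation_space)
  have van: "\<forall>F\<in>?C. \<not> nonvanishing F p" if p: "p \<in> homogeneous_polys" "\<forall>F\<in>T. \<not> nonvanishing F p" for p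
  proof -
    let ?Z = "{F \<in> foliations n d. \<forall>q\<in>{p}. \<not> nonvanishing F q}"
    have "closedin ?X ?Z" unfolding closedin_foliation_space using p(1) by (intro exI[of _ "{p}"] conjI refl) simp
    moreover have "T \<subseteq> ?Z" using TF(1) p(2) by auto
    ultimately have "?C \<subseteq> ?Z" by (intro closure_of_minimal)
    then show ?thesis by auto
  qed
  have irr: "irreducible_in ?X ?C"
    unfolding irreducible_foliation_space
  proof (intro conjI ballI impI)
    show "?C \<noteq> {}" using TC TF(2) by auto
    fix p q assume p: "p \<in> homogeneous_polys" and q: "q \<in> homogeneous_polys"
      and pq: "\<forall>F\<in>?C. \<not> nonvanishing F p \<or> \<not> nonvanishing F q"
    have "\<forall>F\<in>T. \<not> nonvanishing F p \<or> \<not> nonvanishing F q" using pq TC by auto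
    then have "(\<forall>F\<in>T. \<not> nonvanishing F p) \<or> (\<forall>F\<in>T. \<not> nonvanishing F q)"
      using T p q unfolding irreducible_foliation_space by simp
    then show "(\<forall>F\<in>?C. \<not> nonvanishing F p) \<or> (\<forall>F\<in>?C. \<not> nonvanishing F q)" using van p q by auto
  qed (rule C)
  have "U = ?C" if U: "irreducible_in ?X U" "?C \<subseteq> U" for U
  proof
    have UF: "U \<subseteq> foliations n d" using U(1) unfolding irreducible_foliation_space by simp
    have "closedin ?X ?C" by (rule closedin_closure_of)
    then obtain P where P: "P \<subseteq> homogeneous_polys" "?C = {F \<in> foliations n d. \<forall>p\<in>P. \<not> nonvanishing F p}"
      unfolding closedin_foliation_space by auto
    have "\<not> nonvanishing F f" if f: "f \<in> P" and F: "F \<in> U" for F f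
    proof -
      have fh: "f \<in> homogeneous_polys" using f P(1) by auto
      have "\<forall>F\<in>?C. \<not> nonvanishing F f" unfolding P(2) using f by auto
      then have "\<forall>F\<in>T. \<not> nonvanishing F f" using TC by auto
      from mult[OF fh this] obtain g where g1: "g \<in> homogeneous_polys"
        and g2: "(\<exists>F\<in>T. nonvanishing F g) \<and> (\<forall>F\<in>foliations n d. \<not> nonvanishing F g \<or> \<not> nonvanishing F f)" by (rule bexE)
      note g = g1 g2[THEN conjunct1] g2[THEN conjunct2]
      have "\<forall>F\<in>U. \<not> nonvanishing F g \<or> \<not> nonvanishing F f" using g(3) UF by auto
      then have "(\<forall>F\<in>U. \<not> nonvanishing F g) \<or> (\<forall>F\<in>U. \<not> nonvanishing F f)"
        using U(1) g(1) fh unfolding irreducible_foliation_space by simp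
      moreover have "\<exists>F\<in>U. nonvanishing F g" using g(2) TC U(2) by auto
      ultimately show ?thesis using F by auto
    qed
    then show "U \<subseteq> ?C" unfolding P(2) using UF by auto
  qed (rule U(2))
  then show ?thesis using irr unfolding irreducible_component_def by auto
qed

section \<open>Orbits\<close>

lemma pullback_scale: "pullback n M (scale_form c \<alpha>) = scale_form c (pullback n M \<alpha>)"
  by (simp add: pullback_def scale_form_def substitute_mult sum_distrib_left mult.assoc)

lemma aut_orbit_form_class: "aut_orbit n (form_class \<alpha>) = {form_class (pullback n M \<alpha>) |M. M \<in> GLn n}"
proof (intro equalityI subsetI)
  fix F assume "F \<in> aut_orbit n (form_class \<alpha>)"
  then obtain M c where "M \<in> GLn n" "c \<noteq> 0" "F = form_class (pullback n M (scale_form c \<alpha>))"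
    unfolding aut_orbit_def GLn_def form_class_def by auto
  then show "F \<in> {form_class (pullback n M \<alpha>) |M. M \<in> GLn n}"
    by (auto simp: pullback_scale form_class_scale)
next
  fix F assume "F \<in> {form_class (pullback n M \<alpha>) |M. M \<in> GLn n}"
  then obtain M where M: "M \<in> GLn n" "F = form_class (pullback n M \<alpha>)" by auto
  have "\<alpha> \<in> form_class \<alpha>" unfolding form_class_def by (intro CollectI exI[of _ 1]) simp
  then show "F \<in> aut_orbit n (form_class \<alpha>)"
    using M unfolding aut_orbit_def GLn_def by auto
qed

lemma aut_orbit_foliations:
  assumes \<alpha>: "\<alpha> \<in> foliation_forms n (d + 1)" and nm: "not_maximal n (zero_set n \<alpha>)"
  shows "aut_orbit n (form_class \<alpha>) \<subseteq> foliations n d"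
proof
  fix F assume "F \<in> aut_orbit n (form_class \<alpha>)"
  then obtain M where M: "M \<in> GLn n" "F = form_class (pullback n M \<alpha>)" unfolding aut_orbit_form_class by auto
  have f: "\<alpha> \<in> forms n 1 (d + 1)" using \<alpha> by (simp add: foliation_forms_def)
  have "2 \<le> codimension (affine_zariski n) (zero_set n (pullback n M \<alpha>))"
    by (intro codimension_ge_2I not_maximal_pullback[OF f M(1) nm])
  then show "F \<in> foliations n d"
    unfolding foliations_iff using M(2) pullback_foliation_forms[OF \<alpha>] by auto
qed

text \<open>The line joining two invertible matrices is invertible outside finitely many parameters,
  and along it \<open>p\<close> and \<open>q\<close> become nonzero polynomials in one variable;
  some parameter avoids all zeros.\<close>

lemma irreducible_aut_orbit:
  assumes \<alpha>: "\<alpha> \<in> foliation_forms n (d + 1)" and nm: "not_maximal n (zero_set n \<alpha>)"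
  shows "irreducible_in (foliation_space n d) (aut_orbit n (form_class \<alpha>))"
  unfolding irreducible_foliation_space
proof (intro conjI ballI impI)
  have f: "\<alpha> \<in> forms n 1 (d + 1)" using \<alpha> by (simp add: foliation_forms_def)
  show "aut_orbit n (form_class \<alpha>) \<subseteq> foliations n d" by (rule aut_orbit_foliations[OF \<alpha> nm])
  show "aut_orbit n (form_class \<alpha>) \<noteq> {}" using one_GLn[of n] unfolding aut_orbit_form_class by auto
  fix p q :: "(nat set \<times> (nat \<Rightarrow>\<^sub>0 nat)) cpoly"
  assume p: "p \<in> homogeneous_polys" and q: "q \<in> homogeneous_polys"
    and pq: "\<forall>F\<in>aut_orbit n (form_class \<alpha>). \<not> nonvanishing F p \<or> \<not> nonvanishing F q"
  obtain r t where rt: "homogeneous r p" "homogeneous t q" using p q by auto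
  show "(\<forall>F\<in>aut_orbit n (form_class \<alpha>). \<not> nonvanishing F p) \<or> (\<forall>F\<in>aut_orbit n (form_class \<alpha>). \<not> nonvanishing F q)"
  proof (rule ccontr)
    assume "\<not> ?thesis"
    then obtain A B where A: "A \<in> GLn n" "eval_at (form_coords (pullback n A \<alpha>)) p \<noteq> 0"
      and B: "B \<in> GLn n" "eval_at (form_coords (pullback n B \<alpha>)) q \<noteq> 0"
      unfolding aut_orbit_form_class using nonvanishing_form_class[OF rt(1)] nonvanishing_form_class[OF rt(2)] by auto
    have Ac: "A \<in> carrier_mat (n + 1) (n + 1)" and Bc: "B \<in> carrier_mat (n + 1) (n + 1)"
      using A(1) B(1) by (simp_all add: GLn_def)
    let ?m = "mat_line n A (B - A)"
    have m0: "?m 0 = A" by (rule mat_line_0[OF Ac])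
    have m1: "?m 1 = B" by (rule eq_matI) (use Ac Bc in \<open>auto simp: mat_line_def\<close>)
    let ?f = "\<lambda>h s. eval_at (form_coords (pullback n (?m s) \<alpha>)) h"
    have fin: "finite {s. ?f h s = 0}" if "?f h a \<noteq> 0" for h a
      by (rule polyfun_roots[OF polyfun_eval_at[OF polyfun_pullback[OF f]] that])
    have "finite {s. Determinant.det (?m s) = 0}"
      by (rule polyfun_roots[OF polyfun_det_line, of _ _ _ 0]) (use A(1) GLn_det[OF Ac] m0 in simp)
    then have fin3: "finite ({s. Determinant.det (?m s) = 0} \<union> ({s. ?f p s = 0} \<union> {s. ?f q s = 0}))"
      using fin[where h = p and a = 0] fin[where h = q and a = 1] A(2) B(2) m0 m1 by simp
    obtain s where s: "s \<notin> {s. Determinant.det (?m s) = 0} \<union> ({s. ?f p s = 0} \<union> {s. ?f q s = 0})"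
      using ex_new_if_finite[OF infinite_UNIV_char_0 fin3] by (rule exE)
    have "?m s \<in> GLn n" using s GLn_det[OF mat_line_carrier] by simp
    then have "form_class (pullback n (?m s) \<alpha>) \<in> aut_orbit n (form_class \<alpha>)" unfolding aut_orbit_form_class by auto
    with pq have "\<not> nonvanishing (form_class (pullback n (?m s) \<alpha>)) p \<or> \<not> nonvanishing (form_class (pullback n (?m s) \<alpha>)) q"
      by (rule bspec)
    then show False using s by (simp add: nonvanishing_form_class[OF rt(1)] nonvanishing_form_class[OF rt(2)])
  qed
qed

lemma foliation_forms_scale:
  assumes \<alpha>: "\<alpha> \<in> foliation_forms n e"
  shows "scale_form c \<alpha> \<in> foliation_forms n e"
proof -
  have f: "\<alpha> \<in> forms n 1 e" using \<alpha> by (simp add: foliation_forms_def)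
  have cf: "scale_form c \<alpha> \<in> forms n 1 e"
    using f hom_polys_Const_mult unfolding forms_def scale_form_def by (auto split: if_splits)
  have "pairing n (radial n) (\<lambda>l. scale_form c \<alpha> {l}) = Const c * pairing n (radial n) (\<lambda>l. \<alpha> {l})"
    by (simp add: scale_form_def pairing_mult_right)
  moreover have "cubic (\<lambda>l. scale_form c \<alpha> {l}) x y z = Const c * (Const c * cubic (\<lambda>l. \<alpha> {l}) x y z)" for x y z
    by (simp add: cubic_def d1_def scale_form_def pdiff_prod_Const algebra_simps)
  ultimately show ?thesis
    using \<alpha> unfolding foliation_forms_iff[OF f] foliation_forms_iff[OF cf] by simp
qed

text \<open>The homogeneous components of a multiplier are multipliers, because the space of forms is a cone.\<close>

lemma homogeneous_multiplier:
  assumes f: "homogeneous r f" and g: "eval_at (form_coords W) g \<noteq> 0"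
    and van: "\<And>\<alpha>. \<alpha> \<in> foliation_forms n e \<Longrightarrow> eval_at (form_coords \<alpha>) (g * f) = 0"
  shows "\<exists>h\<in>homogeneous_polys. eval_at (form_coords W) h \<noteq> 0 \<and>
    (\<forall>\<alpha>\<in>foliation_forms n e. eval_at (form_coords \<alpha>) (h * f) = 0)"
proof -
  let ?h = "\<lambda>k. pfilter (\<lambda>m. mon_degree m = k) g"
  let ?K = "mon_degree ` keys g"
  have ev: "eval_at x (?h k) = (\<Sum>m\<in>{m\<in>keys g. mon_degree m = k}. lookup g m * mon_eval x m)" for x k
    unfolding eval_at_eq_sum keys_pfilter by (intro sum.cong refl) (simp add: lookup_pfilter)
  have tot: "eval_at x g = (\<Sum>k\<in>?K. eval_at x (?h k))" for x
    unfolding ev eval_at_eq_sum[of x g] by (rule sum.image_gen) simp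
  obtain k where k: "eval_at (form_coords W) (?h k) \<noteq> 0"
    using g unfolding tot[of "form_coords W"] by (metis (no_types, lifting) sum.neutral)
  have "eval_at (form_coords \<alpha>) (?h k * f) = 0" if \<alpha>: "\<alpha> \<in> foliation_forms n e" for \<alpha>
  proof (cases "eval_at (form_coords \<alpha>) f = 0")
    case False
    let ?x = "form_coords \<alpha>"
    \<comment> \<open>The values of \<open>g\<close> on the line through the form, as a polynomial
      in the scaling factor. It vanishes at all nonzero factors, so each coefficient, a homogeneous
      component of \<open>g\<close>, vanishes at the form.\<close>
    let ?q = "\<Sum>m\<in>keys g. monom (lookup g m * mon_eval ?x m) (mon_degree m)"
    have q: "poly ?q c = 0" if "c \<noteq> 0" for c
    proof -
      have "eval_at (form_coords (scale_form c \<alpha>)) (g * f) = 0" by (rule van[OF foliation_forms_scale[OF \<alpha>]])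
      then have "eval_at (\<lambda>v. c * ?x v) g = 0"
        using False that unfolding form_coords_scale eval_at_mult eval_at_scale[OF f] by simp
      moreover have "eval_at (\<lambda>v. c * ?x v) g = poly ?q c"
        unfolding eval_at_eq_sum mon_eval_scale by (simp add: poly_sum poly_monom mult_ac)
      ultimately show ?thesis by simp
    qed
    have "?q = 0"
    proof (rule ccontr)
      assume "?q \<noteq> 0"
      then have "finite ({c. poly ?q c = 0} \<union> {0})" using poly_roots_finite by simp
      moreover have "{c. poly ?q c = 0} \<union> {0} = UNIV" using q by auto
      ultimately have "finite (UNIV :: complex set)" by (simp only:)
      then show False using infinite_UNIV_char_0[where 'a = complex] by blast
    qed
    then have "coeff ?q k = 0" by (simp only: coeff_0)
    moreover have "coeff ?q k = (\<Sum>m\<in>keys g. if mon_degree m = k then lookup g m * mon_eval ?x m else 0)"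
      unfolding coeff_sum by (intro sum.cong refl) simp
    moreover have "\<dots> = eval_at ?x (?h k)"
      unfolding ev by (rule sum.inter_filter[symmetric]) simp
    ultimately show ?thesis by (simp add: eval_at_mult)
  qed (simp add: eval_at_mult)
  moreover have "homogeneous k (?h k)" by (auto simp: homogeneous_def keys_pfilter)
  ultimately show ?thesis using k by (intro bexI[of _ "?h k"]) auto
qed

context deformation_setup
begin

lemma \<omega>_foliation: "one_form n \<omega> \<in> foliation_forms n n"
proof -
  have "pairing n (radial n) (\<lambda>l. one_form n \<omega> {l}) = pairing n (radial n) \<omega>"
    by (intro pairing_cong) simp_all
  then have 1: "pairing n (radial n) (\<lambda>l. one_form n \<omega> {l}) = 0" by (simp only: pairing_radial_\<omega>)
  have 2: "cubic (\<lambda>l. one_form n \<omega> {l}) a b c = 0" if "a \<le> n" "b \<le> n" "c \<le> n" for a b c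
    using cubic_cong[OF _ that, of "\<lambda>l. one_form n \<omega> {l}" \<omega>] cubic_\<omega>[OF that] by simp
  show ?thesis unfolding foliation_forms_iff[OF \<omega>_form] using 1 2 by simp
qed

theorem rigid_\<omega>: "rigid n (form_class (one_form n \<omega>))"
proof -
  let ?W = "one_form n \<omega>"
  have d: "n - 1 + 1 = n" using n_ge by simp
  have W: "?W \<in> foliation_forms n (n - 1 + 1)" unfolding d by (rule \<omega>_foliation)
  have Worb: "form_class ?W \<in> aut_orbit n (form_class ?W)"
    unfolding aut_orbit_form_class
    by (intro CollectI exI[of _ "1\<^sub>m (Suc n)"] conjI one_GLn) (simp add: pullback_one[OF \<omega>_form])
  have "irreducible_component (foliation_space n (n - 1)) (foliation_space n (n - 1) closure_of aut_orbit n (form_class ?W))"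
  proof (rule irreducible_component_closure)
    show "irreducible_in (foliation_space n (n - 1)) (aut_orbit n (form_class ?W))"
      by (rule irreducible_aut_orbit[OF W not_maximal_\<omega>])
    fix f :: "(nat set \<times> (nat \<Rightarrow>\<^sub>0 nat)) cpoly"
    assume "f \<in> homogeneous_polys" and van: "\<forall>F\<in>aut_orbit n (form_class ?W). \<not> nonvanishing F f"
    then obtain r where f: "homogeneous r f" by auto
    have "eval_at (form_coords (pullback n M ?W)) f = 0" if "M \<in> GLn n" for M
    proof -
      have "form_class (pullback n M ?W) \<in> aut_orbit n (form_class ?W)" unfolding aut_orbit_form_class using that by auto
      then show ?thesis using van nonvanishing_form_class[OF f] by auto
    qed
    from deformations_locally_in_orbit[OF \<omega>_foliation this] obtain g where
      g: "eval_at (form_coords ?W) g \<noteq> 0" "\<forall>\<alpha>\<in>foliation_forms n n. eval_at (form_coords \<alpha>) (g * f) = 0" by auto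
    have "\<exists>h\<in>homogeneous_polys. eval_at (form_coords ?W) h \<noteq> 0 \<and> (\<forall>\<alpha>\<in>foliation_forms n n. eval_at (form_coords \<alpha>) (h * f) = 0)"
      by (rule homogeneous_multiplier[OF f g(1)]) (use g(2) in blast)
    then obtain h where
      h: "h \<in> homogeneous_polys" "eval_at (form_coords ?W) h \<noteq> 0"
        "\<forall>\<alpha>\<in>foliation_forms n n. eval_at (form_coords \<alpha>) (h * f) = 0" by (elim bexE conjE)
    obtain t where t: "homogeneous t h" using h(1) by auto
    show "\<exists>g\<in>homogeneous_polys. (\<exists>F\<in>aut_orbit n (form_class ?W). nonvanishing F g) \<and>
        (\<forall>F\<in>foliations n (n - 1). \<not> nonvanishing F g \<or> \<not> nonvanishing F f)"
    proof (intro bexI[of _ h] conjI ballI h(1))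
      show "\<exists>F\<in>aut_orbit n (form_class ?W). nonvanishing F h"
        using Worb h(2) nonvanishing_form_class[OF t] by auto
      fix F assume "F \<in> foliations n (n - 1)"
      then obtain \<alpha> where "F = form_class \<alpha>" "\<alpha> \<in> foliation_forms n n" unfolding foliations_iff d by auto
      then show "\<not> nonvanishing F h \<or> \<not> nonvanishing F f"
        using h(3) nonvanishing_form_class[OF t] nonvanishing_form_class[OF f] by (auto simp: eval_at_mult)
    qed
  qed
  moreover have "form_class ?W \<in> foliations n (n - 1)"
    using aut_orbit_foliations[OF W not_maximal_\<omega>] Worb by auto
  ultimately show ?thesis unfolding rigid_def by simp
qed

end

section \<open>Tables of coefficients and bracket relations for n = 6 and n = 7\<close>

section \<open>The Lie algebras of the theorem\<close>

text \<open>The parameter \<open>c\<close> adds a multiple of the radial field to the diagonal field; neither the brackets nor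
  the form change, and for one value of \<open>c\<close> the fields preserve the contracted volume form.\<close>

definition lie_shift :: "nat \<Rightarrow> complex \<Rightarrow> nat \<Rightarrow> nat \<Rightarrow> complex" where
  "lie_shift n c k i = (if k = 0 then of_nat n - 2 * of_nat i + c
     else if k = 1 \<or> k = n - 2 then 1 else b_coeff n k i)"

definition lie_const :: "nat \<Rightarrow> nat \<Rightarrow> nat \<Rightarrow> complex" where
  "lie_const n i j = (if i = 0 then - 2 * of_nat j else if j = 0 then 2 * of_nat i
     else if i = 1 \<and> 2 \<le> j \<and> j \<le> n - 3 then - 1 else if j = 1 \<and> 2 \<le> i \<and> i \<le> n - 3 then 1
     else if n = 7 \<and> i = 2 \<and> j = 3 then 5 / 2 else if n = 7 \<and> i = 3 \<and> j = 2 then - 5 / 2 else 0)"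

lemma lie_shift_0: "lie_shift n c 0 i = of_nat n - 2 * of_nat i + c"
  and lie_shift_1: "lie_shift n c 1 i = 1" "lie_shift n c (Suc 0) i = 1"
  by (simp_all add: lie_shift_def)

text \<open>A difference table: the differences of the values for shift \<open>k\<close> are the
  values for shift \<open>k + 1\<close>, which is the relation with the shift 1.\<close>

lemma lie_shift_6:
  "lie_shift 6 c 4 i = 1"
  "lie_shift 6 c 2 0 = 9 / 8" "lie_shift 6 c 2 (Suc 0) = - 3 / 8" "lie_shift 6 c 2 2 = - 7 / 8"
  "lie_shift 6 c 2 3 = - 3 / 8" "lie_shift 6 c 2 4 = 9 / 8"
  "lie_shift 6 c 3 0 = - 3 / 2" "lie_shift 6 c 3 (Suc 0) = - 1 / 2" "lie_shift 6 c 3 2 = 1 / 2" "lie_shift 6 c 3 3 = 3 / 2"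
  by (simp_all add: lie_shift_def b_coeff_def b_init_def numeral_eq_Suc) (simp_all add: numeral_eq_Suc[symmetric])?

abbreviation r3 :: complex where "r3 \<equiv> complex_of_real (sqrt 3)"

lemma r3_square: "r3 * r3 = 3" "r3 * (r3 * x) = 3 * x"
proof -
  have "complex_of_real (sqrt 3 * sqrt 3) = 3" by simp
  then show "r3 * r3 = 3" by (simp only: of_real_mult)
  then show "r3 * (r3 * x) = 3 * x" by (simp flip: mult.assoc)
qed

lemma lie_shift_7:
  "lie_shift 7 c 5 i = 1"
  "lie_shift 7 c 2 0 = r3 / 2" "lie_shift 7 c 2 (Suc 0) = 1 - r3 / 2" "lie_shift 7 c 2 2 = 1 / 2 - r3"
  "lie_shift 7 c 2 3 = - 1 / 2 - r3" "lie_shift 7 c 2 4 = - 1 - r3 / 2" "lie_shift 7 c 2 5 = r3 / 2"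
  "lie_shift 7 c 3 0 = 1 - r3" "lie_shift 7 c 3 (Suc 0) = (- 1 - r3) / 2" "lie_shift 7 c 3 2 = - 1"
  "lie_shift 7 c 3 3 = (r3 - 1) / 2" "lie_shift 7 c 3 4 = 1 + r3"
  "lie_shift 7 c 4 0 = (r3 - 3) / 2" "lie_shift 7 c 4 (Suc 0) = (r3 - 1) / 2" "lie_shift 7 c 4 2 = (r3 + 1) / 2"
  "lie_shift 7 c 4 3 = (r3 + 3) / 2"
  by (simp_all add: lie_shift_def b_coeff_def b_init_def numeral_eq_Suc field_simps)

lemma Re_nonzero: "Re x < 0 \<or> 0 < Re x \<Longrightarrow> x \<noteq> 0"
  by auto

lemma lie_shift_nonzero_6:
  assumes "k < 5" "4 \<le> i + k" "i + k \<le> 6"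
  shows "lie_shift 6 (20 / 7) k i \<noteq> 0"
proof -
  have "k = 0 \<or> k = 1 \<or> k = 2 \<or> k = 3 \<or> k = 4" using assms by linarith
  then show ?thesis
  proof (elim disjE)
    assume k: "k = 0"
    then have "i = 4 \<or> i = 5 \<or> i = 6" using assms by linarith
    then show ?thesis unfolding k lie_shift_0 by (elim disjE) simp_all
  next
    assume k: "k = 2"
    then have "i = 2 \<or> i = 3 \<or> i = 4" using assms by linarith
    then show ?thesis unfolding k by (elim disjE) (simp_all add: lie_shift_6)
  next
    assume k: "k = 3"
    then have "i = 1 \<or> i = 2 \<or> i = 3" using assms by linarith
    then show ?thesis unfolding k by (elim disjE) (simp_all add: lie_shift_6)
  qed (simp_all add: lie_shift_1 lie_shift_6)
qed

lemma lie_shift_nonzero_7: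
  assumes "k < 6" "5 \<le> i + k" "i + k \<le> 7"
  shows "lie_shift 7 (15 / 4) k i \<noteq> 0"
proof -
  have s: "- (1 / 2) < sqrt (3 :: real)" "- 1 < sqrt (3 :: real)" "- 2 < sqrt (3 :: real)" "0 < 1 + sqrt (3 :: real)"
    "0 < sqrt (3 :: real) + 1" "0 < sqrt (3 :: real) + 3"
    using real_sqrt_ge_zero[of 3] by linarith+
  have "k = 0 \<or> k = 1 \<or> k = 2 \<or> k = 3 \<or> k = 4 \<or> k = 5" using assms by linarith
  then show ?thesis
  proof (elim disjE)
    assume k: "k = 0"
    then have "i = 5 \<or> i = 6 \<or> i = 7" using assms by linarith
    then show ?thesis unfolding k lie_shift_0 by (elim disjE) simp_all
  next
    assume k: "k = 2"
    then have "i = 3 \<or> i = 4 \<or> i = 5" using assms by linarith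
    then show ?thesis unfolding k by (elim disjE; intro Re_nonzero) (simp_all add: lie_shift_7 s)
  next
    assume k: "k = 3"
    then have "i = 2 \<or> i = 3 \<or> i = 4" using assms by linarith
    then show ?thesis unfolding k by (elim disjE; intro Re_nonzero) (simp_all add: lie_shift_7 s)
  next
    assume k: "k = 4"
    then have "i = 1 \<or> i = 2 \<or> i = 3" using assms by linarith
    then show ?thesis unfolding k by (elim disjE; intro Re_nonzero) (simp_all add: lie_shift_7 s)
  qed (simp_all add: lie_shift_1 lie_shift_7)
qed

text \<open>For \<open>k = 0\<close> the point is that the shift by \<open>c\<close> moves none of
  the last three diagonal entries to 0.\<close>

lemma lie_shift_nonzero:
  assumes n: "n = 6 \<or> n = 7" and c: "c = of_nat ((n - 1) * (n - 2)) / of_nat (n + 1)"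
    and k: "k < n - 1" "n - 2 \<le> i + k" "i + k \<le> n"
  shows "lie_shift n c k i \<noteq> 0"
  using n
proof
  assume n: "n = 6"
  then have "c = 20 / 7" using c by simp
  with n show ?thesis using lie_shift_nonzero_6[of k i] k by (simp only:) simp
next
  assume n: "n = 7"
  then have "c = 15 / 4" using c by simp
  with n show ?thesis using lie_shift_nonzero_7[of k i] k by (simp only:) simp
qed

text \<open>For \<open>i = 1\<close> this is the difference table. The pair (2, 4) requires b^(2)_4
  = b^(2)_0, which fixes b_0^(3) = -3/2; the pair (2, 3) then fixes b_0^(2) = 9/8.\<close>

lemma lie_shift_bracket_6_less:
  assumes "1 \<le> i" "i < j" "j < 5" "m + i + j \<le> 6"
  shows "lie_shift 6 c i (m + j) * lie_shift 6 c j m - lie_shift 6 c i m * lie_shift 6 c j (m + i) =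
    (if i + j < 5 then lie_const 6 i j * lie_shift 6 c (i + j) m else 0)"
proof -
  have "i = 1 \<and> j = 2 \<or> i = 1 \<and> j = 3 \<or> i = 1 \<and> j = 4 \<or> i = 2 \<and> j = 3 \<or> i = 2 \<and> j = 4"
    using assms by presburger
  then show ?thesis
  proof (elim disjE conjE)
    assume ij: "i = 1" "j = 2"
    then have "m = 0 \<or> m = 1 \<or> m = 2 \<or> m = 3" using assms(4) by linarith
    then show ?thesis unfolding ij
      by (elim disjE; hypsubst) (simp_all add: lie_shift_1 lie_shift_6 lie_const_def numeral_2_eq_2[symmetric] numeral_3_eq_3[symmetric])
  next
    assume ij: "i = 1" "j = 3"
    then have "m = 0 \<or> m = 1 \<or> m = 2" using assms(4) by linarith
    then show ?thesis unfolding ij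
      by (elim disjE; hypsubst) (simp_all add: lie_shift_1 lie_shift_6 lie_const_def numeral_2_eq_2[symmetric] numeral_3_eq_3[symmetric])
  next
    assume ij: "i = 1" "j = 4"
    then have "m = 0 \<or> m = 1" using assms(4) by linarith
    then show ?thesis unfolding ij
      by (elim disjE; hypsubst) (simp_all add: lie_shift_1 lie_shift_6 lie_const_def numeral_2_eq_2[symmetric] numeral_3_eq_3[symmetric])
  next
    assume ij: "i = 2" "j = 3"
    then have "m = 0 \<or> m = 1" using assms(4) by linarith
    then show ?thesis unfolding ij
      by (elim disjE; hypsubst) (simp_all add: lie_shift_1 lie_shift_6 lie_const_def numeral_2_eq_2[symmetric] numeral_3_eq_3[symmetric])
  next
    assume ij: "i = 2" "j = 4"
    then have "m = 0" using assms(4) by linarith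
    then show ?thesis unfolding ij
      by (simp_all add: lie_shift_1 lie_shift_6 lie_const_def numeral_2_eq_2[symmetric] numeral_3_eq_3[symmetric])
  qed
qed

lemma lie_shift_bracket_6:
  assumes k: "i < 5" "j < 5" "m + i + j \<le> 6"
  shows "lie_shift 6 c i (m + j) * lie_shift 6 c j m - lie_shift 6 c i m * lie_shift 6 c j (m + i) =
    (if i + j < 5 then lie_const 6 i j * lie_shift 6 c (i + j) m else 0)"
proof -
  have anti: "lie_const 6 i j = - lie_const 6 j i" if "i \<noteq> j" "0 < i" "0 < j"
    using that by (auto simp: lie_const_def)
  have same: "lie_const 6 i i = 0" if "0 < i" using that by (auto simp: lie_const_def)
  consider "i = 0" | "j = 0" "i \<noteq> 0" | "i = j" "0 < i" | "0 < i" "i < j" | "0 < j" "j < i" by linarith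
  then show ?thesis
  proof cases
    case 3
    then show ?thesis using same by simp
  next
    case 4
    then show ?thesis using lie_shift_bracket_6_less[of i j m c] k by simp
  next
    case 5
    then have "lie_shift 6 c j (m + i) * lie_shift 6 c i m - lie_shift 6 c j m * lie_shift 6 c i (m + j) =
        (if j + i < 5 then lie_const 6 j i * lie_shift 6 c (j + i) m else 0)"
      using k by (intro lie_shift_bracket_6_less) auto
    then show ?thesis using anti 5 by (simp add: algebra_simps split: if_splits)
  qed (simp_all add: lie_shift_0 lie_const_def algebra_simps, (use k in \<open>auto simp: algebra_simps\<close>)?)
qed

text \<open>Put x = b_0^(4). The pair (2, 5) gives b_0^(3) = -2x - 2, and the pair (2, 4) at m = 0
  and m = 1 gives b_0^(2) = -x^2 - 2x and b_0^(2) = x^2 + 4x + 3. Hence 2x^2 + 6x + 3 = 0, with (-3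
  + sqrt 3)/2 as the chosen root.\<close>

lemma lie_shift_bracket_7_less:
  assumes "1 \<le> i" "i < j" "j < 6" "m + i + j \<le> 7"
  shows "lie_shift 7 c i (m + j) * lie_shift 7 c j m - lie_shift 7 c i m * lie_shift 7 c j (m + i) =
    (if i + j < 6 then lie_const 7 i j * lie_shift 7 c (i + j) m else 0)"
proof -
  have "i = 1 \<and> j = 2 \<or> i = 1 \<and> j = 3 \<or> i = 1 \<and> j = 4 \<or> i = 1 \<and> j = 5 \<or> i = 2 \<and> j = 3 \<or> i = 2 \<and> j = 4 \<or> i = 2 \<and> j = 5 \<or> i = 3 \<and> j = 4"
    using assms by presburger
  then show ?thesis
  proof (elim disjE conjE)
    assume ij: "i = 1" "j = 2"
    then have "m = 0 \<or> m = 1 \<or> m = 2 \<or> m = 3 \<or> m = 4" using assms(4) by linarith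
    then show ?thesis unfolding ij
      by (elim disjE; hypsubst) (simp_all add: lie_shift_1 lie_shift_7 lie_const_def numeral_2_eq_2[symmetric] numeral_3_eq_3[symmetric]
        field_simps r3_square)
  next
    assume ij: "i = 1" "j = 3"
    then have "m = 0 \<or> m = 1 \<or> m = 2 \<or> m = 3" using assms(4) by linarith
    then show ?thesis unfolding ij
      by (elim disjE; hypsubst) (simp_all add: lie_shift_1 lie_shift_7 lie_const_def numeral_2_eq_2[symmetric] numeral_3_eq_3[symmetric]
        field_simps r3_square)
  next
    assume ij: "i = 1" "j = 4"
    then have "m = 0 \<or> m = 1 \<or> m = 2" using assms(4) by linarith
    then show ?thesis unfolding ij
      by (elim disjE; hypsubst) (simp_all add: lie_shift_1 lie_shift_7 lie_const_def numeral_2_eq_2[symmetric] numeral_3_eq_3[symmetric]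
        field_simps r3_square)
  next
    assume ij: "i = 1" "j = 5"
    then have "m = 0 \<or> m = 1" using assms(4) by linarith
    then show ?thesis unfolding ij
      by (elim disjE; hypsubst) (simp_all add: lie_shift_1 lie_shift_7 lie_const_def numeral_2_eq_2[symmetric] numeral_3_eq_3[symmetric]
        field_simps r3_square)
  next
    assume ij: "i = 2" "j = 3"
    then have "m = 0 \<or> m = 1 \<or> m = 2" using assms(4) by linarith
    then show ?thesis unfolding ij
      by (elim disjE; hypsubst) (simp_all add: lie_shift_1 lie_shift_7 lie_const_def numeral_2_eq_2[symmetric] numeral_3_eq_3[symmetric]
        field_simps r3_square)
  next
    assume ij: "i = 2" "j = 4"
    then have "m = 0 \<or> m = 1" using assms(4) by linarith
    then show ?thesis unfolding ij
      by (elim disjE; hypsubst) (simp_all add: lie_shift_1 lie_shift_7 lie_const_def numeral_2_eq_2[symmetric] numeral_3_eq_3[symmetric]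
        field_simps r3_square)
  next
    assume ij: "i = 2" "j = 5"
    then have "m = 0" using assms(4) by linarith
    then show ?thesis unfolding ij
      by (simp_all add: lie_shift_1 lie_shift_7 lie_const_def numeral_2_eq_2[symmetric] numeral_3_eq_3[symmetric]
        field_simps r3_square)
  next
    assume ij: "i = 3" "j = 4"
    then have "m = 0" using assms(4) by linarith
    then show ?thesis unfolding ij
      by (simp_all add: lie_shift_1 lie_shift_7 lie_const_def numeral_2_eq_2[symmetric] numeral_3_eq_3[symmetric]
        field_simps r3_square)
  qed
qed

lemma lie_shift_bracket_7:
  assumes k: "i < 6" "j < 6" "m + i + j \<le> 7"
  shows "lie_shift 7 c i (m + j) * lie_shift 7 c j m - lie_shift 7 c i m * lie_shift 7 c j (m + i) =
    (if i + j < 6 then lie_const 7 i j * lie_shift 7 c (i + j) m else 0)"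
proof -
  have anti: "lie_const 7 i j = - lie_const 7 j i" if "i \<noteq> j" "0 < i" "0 < j"
    using that by (auto simp: lie_const_def)
  have same: "lie_const 7 i i = 0" if "0 < i" using that by (auto simp: lie_const_def)
  consider "i = 0" | "j = 0" "i \<noteq> 0" | "i = j" "0 < i" | "0 < i" "i < j" | "0 < j" "j < i" by linarith
  then show ?thesis
  proof cases
    case 3
    then show ?thesis using same by simp
  next
    case 4
    then show ?thesis using lie_shift_bracket_7_less[of i j m c] k by simp
  next
    case 5
    then have "lie_shift 7 c j (m + i) * lie_shift 7 c i m - lie_shift 7 c j m * lie_shift 7 c i (m + j) =
        (if j + i < 6 then lie_const 7 j i * lie_shift 7 c (j + i) m else 0)"
      using k by (intro lie_shift_bracket_7_less) auto
    then show ?thesis using anti 5 by (simp add: algebra_simps split: if_splits)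
  qed (simp_all add: lie_shift_0 lie_const_def algebra_simps, (use k in \<open>auto simp: algebra_simps\<close>)?)
qed

lemma lie_shift_bracket:
  assumes n: "n = 6 \<or> n = 7" and k: "i < n - 1" "j < n - 1" "m + i + j \<le> n"
  shows "lie_shift n c i (m + j) * lie_shift n c j m - lie_shift n c i m * lie_shift n c j (m + i) =
    (if i + j < n - 1 then lie_const n i j * lie_shift n c (i + j) m else 0)"
  using n
proof
  assume n: "n = 6"
  then show ?thesis using lie_shift_bracket_6[of i j m c] k unfolding n by simp
next
  assume n: "n = 7"
  then show ?thesis using lie_shift_bracket_7[of i j m c] k unfolding n by simp
qed

section \<open>Weight-zero deformations modulo diagonal conjugation and scaling\<close>

section \<open>Infinitesimal rigidity of the Lie algebras\<close>

text \<open>The linearised relation [X_i, Z_j] + [Z_i, X_j] - g_ij Z_(i+j) = \<alpha> X_(i+j), where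
  \<alpha> is the unknown variation of the structure constant.\<close>

definition deformation_eq :: "nat \<Rightarrow> (nat \<Rightarrow> nat \<Rightarrow> complex) \<Rightarrow> (nat \<Rightarrow> nat \<Rightarrow> complex) \<Rightarrow> (nat \<Rightarrow> nat \<Rightarrow> complex) \<Rightarrow> nat \<Rightarrow> nat \<Rightarrow> bool" where
  "deformation_eq n \<beta> g C i j \<longleftrightarrow> (\<exists>\<alpha>. \<forall>m. m + i + j \<le> n \<longrightarrow>
      \<beta> i (m + j) * C j m - \<beta> i m * C j (m + i) + (C i (m + j) * \<beta> j m - C i m * \<beta> j (m + i))
        - (if i + j < n - 1 then g i j * C (i + j) m else 0)
      = (if i + j < n - 1 then \<alpha> * \<beta> (i + j) m else 0))"

text \<open>Conjugation by diagonal matrices makes the deformation of the first shift field vanish.\<close>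

lemma normalise_first:
  fixes \<beta> C :: "nat \<Rightarrow> nat \<Rightarrow> complex"
  assumes bracket: "\<And>i j m. i < n - 1 \<Longrightarrow> j < n - 1 \<Longrightarrow> m + i + j \<le> n \<Longrightarrow>
      \<beta> i (m + j) * \<beta> j m - \<beta> i m * \<beta> j (m + i) = (if i + j < n - 1 then g i j * \<beta> (i + j) m else 0)"
    and \<beta>1: "\<And>m. \<beta> 1 m = 1"
    and eq: "\<And>i j. 1 \<le> i \<Longrightarrow> i < n - 1 \<Longrightarrow> 1 \<le> j \<Longrightarrow> j < n - 1 \<Longrightarrow> deformation_eq n \<beta> g C i j"
  shows "\<exists>d D. (\<forall>k m. C k m = D k m - (d (m + k) - d m) * \<beta> k m) \<and> (\<forall>m. D 1 m = 0) \<and>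
    (\<forall>i j. 1 \<le> i \<and> i < n - 1 \<and> 1 \<le> j \<and> j < n - 1 \<longrightarrow> deformation_eq n \<beta> g D i j)"
proof -
  define d where "d m = - (\<Sum>l<m. C 1 l)" for m
  define D where "D k m = C k m + (d (m + k) - d m) * \<beta> k m" for k m
  have "deformation_eq n \<beta> g D i j" if ij: "1 \<le> i" "i < n - 1" "1 \<le> j" "j < n - 1" for i j
  proof -
    obtain \<alpha> where \<alpha>: "\<forall>m. m + i + j \<le> n \<longrightarrow>
      \<beta> i (m + j) * C j m - \<beta> i m * C j (m + i) + (C i (m + j) * \<beta> j m - C i m * \<beta> j (m + i))
        - (if i + j < n - 1 then g i j * C (i + j) m else 0)
      = (if i + j < n - 1 then \<alpha> * \<beta> (i + j) m else 0)"
      using eq[OF ij] unfolding deformation_eq_def by blast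
    have "\<beta> i (m + j) * D j m - \<beta> i m * D j (m + i) + (D i (m + j) * \<beta> j m - D i m * \<beta> j (m + i))
        - (if i + j < n - 1 then g i j * D (i + j) m else 0)
      = (if i + j < n - 1 then \<alpha> * \<beta> (i + j) m else 0)" if m: "m + i + j \<le> n" for m
    proof -
      let ?e = "d (m + i + j) - d m"
      have "\<beta> i (m + j) * D j m - \<beta> i m * D j (m + i) + (D i (m + j) * \<beta> j m - D i m * \<beta> j (m + i)) =
          \<beta> i (m + j) * C j m - \<beta> i m * C j (m + i) + (C i (m + j) * \<beta> j m - C i m * \<beta> j (m + i)) +
          ?e * (\<beta> i (m + j) * \<beta> j m - \<beta> i m * \<beta> j (m + i))"
        by (simp add: D_def algebra_simps)
      also have "\<beta> i (m + j) * \<beta> j m - \<beta> i m * \<beta> j (m + i) = (if i + j < n - 1 then g i j * \<beta> (i + j) m else 0)"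
        using bracket ij m by blast
      finally show ?thesis
        using \<alpha>[rule_format, OF m] by (simp add: D_def algebra_simps split: if_splits)
    qed
    then show ?thesis unfolding deformation_eq_def by blast
  qed
  moreover have "D 1 m = 0" for m
    using \<beta>1[of m] by (simp add: D_def d_def)
  ultimately show ?thesis
    by (intro exI[of _ d] exI[of _ D]) (auto simp: D_def)
qed

text \<open>The relation of the indices \<open>1\<close> and \<open>k\<close> is a difference equation for \<open>D k\<close>.\<close>

lemma integrate_shift:
  fixes \<beta> D :: "nat \<Rightarrow> nat \<Rightarrow> complex"
  assumes eq: "deformation_eq n \<beta> g D 1 k" and D1: "\<And>m. D 1 m = 0" and \<beta>1: "\<And>m. \<beta> 1 m = 1"
    and g: "g 1 k = - 1" and k: "k + 1 < n - 1"
    and \<beta>: "\<And>m. m + k + 1 \<le> n \<Longrightarrow> \<beta> k (m + 1) = \<beta> k m + \<beta> (k + 1) m"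
    and D: "\<And>m. m + k + 1 \<le> n \<Longrightarrow> D (k + 1) m = p m + s * \<beta> (k + 1) m"
    and P: "P 0 = 0" "\<And>m. P (Suc m) = P m + p m"
  shows "\<exists>c s'. \<forall>m. m + k \<le> n \<longrightarrow> D k m = c + P m + s' * \<beta> k m"
proof -
  obtain \<alpha> where \<alpha>: "\<forall>m. m + 1 + k \<le> n \<longrightarrow>
      \<beta> 1 (m + k) * D k m - \<beta> 1 m * D k (m + 1) + (D 1 (m + k) * \<beta> k m - D 1 m * \<beta> k (m + 1))
        - (if 1 + k < n - 1 then g 1 k * D (1 + k) m else 0)
      = (if 1 + k < n - 1 then \<alpha> * \<beta> (1 + k) m else 0)"
    using eq unfolding deformation_eq_def by blast
  define s' where "s' = s - \<alpha>"
  have "D k m = (D k 0 - s' * \<beta> k 0) + P m + s' * \<beta> k m" if "m + k \<le> n" for m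
    using that
  proof (induction m)
    case 0
    then show ?case by (simp add: P)
  next
    case (Suc m)
    have m: "m + 1 + k \<le> n" "m + k + 1 \<le> n" using Suc.prems by auto
    have "D k m - D k (m + 1) + D (k + 1) m = \<alpha> * \<beta> (k + 1) m"
      using \<alpha>[unfolded add.commute[of 1 k], rule_format, OF m(1)] k by (simp add: D1 \<beta>1 g del: One_nat_def add_Suc_right)
    then have "D k (m + 1) = D k m + D (k + 1) m - \<alpha> * \<beta> (k + 1) m" by (simp add: algebra_simps)
    also have "\<dots> = (D k 0 - s' * \<beta> k 0) + (P m + p m) + s' * (\<beta> k m + \<beta> (k + 1) m)"
      using Suc m unfolding D[OF m(2)] s'_def by (simp add: algebra_simps)
    also have "\<dots> = (D k 0 - s' * \<beta> k 0) + P (Suc m) + s' * \<beta> k (Suc m)"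
      using \<beta>[OF m(2)] P(2)[of m] by simp
    finally show ?case by simp
  qed
  then show ?thesis by blast
qed

lemma deformation_eqD:
  assumes eq: "deformation_eq n \<beta> g D i j" and m: "m + i + j \<le> n" and ij: "n - 1 \<le> i + j"
  shows "\<beta> i (m + j) * D j m - \<beta> i m * D j (m + i) + (D i (m + j) * \<beta> j m - D i m * \<beta> j (m + i)) = 0"
proof -
  have "\<not> i + j < n - 1" using ij by simp
  then show ?thesis using eq m unfolding deformation_eq_def by auto
qed

text \<open>For the top shift the bracket with shift 1 leaves the range, so the difference equation
  has right-hand side 0.\<close>

lemma deformation_eq_last:
  fixes \<beta> D :: "nat \<Rightarrow> nat \<Rightarrow> complex"
  assumes eq: "deformation_eq n \<beta> g D 1 (n - 2)" and D1: "\<And>m. D 1 m = 0" and \<beta>1: "\<And>m. \<beta> 1 m = 1"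
    and n: "3 \<le> n" and m: "m \<le> 2"
  shows "D (n - 2) m = D (n - 2) 0"
proof -
  have *: "D (n - 2) m = D (n - 2) (m + 1)" if "m \<le> 1" for m
  proof -
    have "m + 1 + (n - 2) \<le> n" "n - 1 \<le> 1 + (n - 2)" using n that by auto
    from deformation_eqD[OF eq this] show ?thesis by (simp add: D1 \<beta>1 del: One_nat_def)
  qed
  have "m = 0 \<or> m = 1 \<or> m = 2" using m by linarith
  then show ?thesis using *[of 0] *[of 1] by (auto simp: numeral_2_eq_2)
qed

text \<open>Integrating downwards from shift 4 leaves, up to multiples of the \<beta>, the
  variations \<open>a\<close> and \<open>e\<close> of b_0^(3) and b_0^(2). The pairs (2, 4) and (2,
  3), which determined these initial values, force them to be 0.\<close>

lemma rigidity_6: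
  fixes D :: "nat \<Rightarrow> nat \<Rightarrow> complex" and c :: complex
  defines "\<beta> \<equiv> lie_shift 6 c" and "g \<equiv> lie_const 6"
  assumes eq: "\<And>i j. 1 \<le> i \<Longrightarrow> i < 5 \<Longrightarrow> 1 \<le> j \<Longrightarrow> j < 5 \<Longrightarrow> deformation_eq 6 \<beta> g D i j"
    and D1: "\<And>m. D 1 m = 0" and k: "1 \<le> k" "k < 5"
  shows "\<exists>\<epsilon>. \<forall>m. m + k \<le> 6 \<longrightarrow> D k m = \<epsilon> * \<beta> k m"
proof -
  have \<beta>1: "\<And>m. \<beta> 1 m = 1" by (simp add: \<beta>_def lie_shift_def)
  have \<beta>4: "\<And>m. \<beta> 4 m = 1" by (simp add: \<beta>_def lie_shift_6)
  have D4: "D 4 m = 0 + D 4 0 * \<beta> (3 + 1) m" if "m + 3 + 1 \<le> 6" for m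
    using deformation_eq_last[of 6 \<beta> g D m, OF _ D1 \<beta>1] eq[of 1 4] that by (simp add: \<beta>4)
  have step3: "\<beta> 3 (m + 1) = \<beta> 3 m + \<beta> (3 + 1) m" if "m + 3 + 1 \<le> 6" for m
  proof -
    have "m \<in> {0, 1, 2}" using that by auto
    then show ?thesis by (elim insertE emptyE) (simp_all add: \<beta>_def lie_shift_6 numeral_2_eq_2[symmetric] numeral_3_eq_3[symmetric])
  qed
  have "\<exists>a s. \<forall>m. m + 3 \<le> 6 \<longrightarrow> D 3 m = a + 0 + s * \<beta> 3 m"
  proof (rule integrate_shift[where P = "\<lambda>_. 0" and p = "\<lambda>_. 0" and g = g and s = "D 4 0"])
    show "deformation_eq 6 \<beta> g D 1 3" using eq[of 1 3] by simp
    show "g 1 3 = - 1" by (simp add: g_def lie_const_def)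
    show "\<beta> 3 (m + 1) = \<beta> 3 m + \<beta> (3 + 1) m" if "m + 3 + 1 \<le> 6" for m using that by (rule step3)
    show "D (3 + 1) m = 0 + D 4 0 * \<beta> (3 + 1) m" if "m + 3 + 1 \<le> 6" for m using D4[OF that] by simp
  qed (simp_all del: One_nat_def add: D1 \<beta>1)
  then obtain a s where D3: "\<And>m. m + 3 \<le> 6 \<Longrightarrow> D 3 m = a + s * \<beta> 3 m" by auto
  have step2: "\<beta> 2 (m + 1) = \<beta> 2 m + \<beta> (2 + 1) m" if "m + 2 + 1 \<le> 6" for m
  proof -
    have "m \<in> {0, 1, 2, 3}" using that by auto
    then show ?thesis by (elim insertE emptyE) (simp_all add: \<beta>_def lie_shift_6 numeral_2_eq_2[symmetric] numeral_3_eq_3[symmetric])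
  qed
  have "\<exists>e s. \<forall>m. m + 2 \<le> 6 \<longrightarrow> D 2 m = e + a * of_nat m + s * \<beta> 2 m"
  proof (rule integrate_shift[where P = "\<lambda>m. a * of_nat m" and p = "\<lambda>_. a" and g = g and s = "s"])
    show "deformation_eq 6 \<beta> g D 1 2" using eq[of 1 2] by simp
    show "g 1 2 = - 1" by (simp add: g_def lie_const_def)
    show "\<beta> 2 (m + 1) = \<beta> 2 m + \<beta> (2 + 1) m" if "m + 2 + 1 \<le> 6" for m using that by (rule step2)
    show "D (2 + 1) m = a + s * \<beta> (2 + 1) m" if "m + 2 + 1 \<le> 6" for m using that D3[of m] by simp
  qed (simp_all del: One_nat_def add: D1 \<beta>1 algebra_simps)
  then obtain e t where D2: "\<And>m. m + 2 \<le> 6 \<Longrightarrow> D 2 m = e + a * of_nat m + t * \<beta> 2 m" by auto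
  have "\<beta> 2 4 * D 4 0 - \<beta> 2 0 * D 4 2 + (D 2 4 * \<beta> 4 0 - D 2 0 * \<beta> 4 2) = 0"
    using deformation_eqD[OF eq[of 2 4], of 0] by (simp add: numeral_2_eq_2[symmetric] numeral_3_eq_3[symmetric])
  then have "4 * a = 0" using D4[of 2] D2[of 0] D2[of 4] by (simp add: \<beta>_def lie_shift_6)
  then have a: "a = 0" by simp
  have "\<beta> 2 3 * D 3 0 - \<beta> 2 0 * D 3 2 + (D 2 3 * \<beta> 3 0 - D 2 0 * \<beta> 3 2) = 0"
    using deformation_eqD[OF eq[of 2 3], of 0] by (simp add: numeral_2_eq_2[symmetric] numeral_3_eq_3[symmetric])
  then have "e = 0" using D3[of 0] D3[of 2] D2[of 0] D2[of 3] a by (simp add: \<beta>_def lie_shift_6 field_simps)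
  have "k \<in> {1, 2, 3, 4}" using k by auto
  then show ?thesis
  proof (elim insertE emptyE)
    assume "k = 1" then show ?thesis using D1 by (intro exI[of _ 0]) simp
  next
    assume "k = 2" then show ?thesis using D2 a \<open>e = 0\<close> by (intro exI[of _ t]) simp
  next
    assume "k = 3" then show ?thesis using D3 a by (intro exI[of _ s]) simp
  next
    assume k: "k = 4"
    have "D 4 m = D 4 0 * \<beta> 4 m" if "m + 4 \<le> 6" for m using D4[of m] that by simp
    then show ?thesis unfolding k by blast
  qed
qed

text \<open>Here \<open>a\<close>, \<open>b\<close>, \<open>e\<close> are the variations of b_0^(4),
  b_0^(3), b_0^(2). Linearising the system for the initial values gives b = -2a, e = -(2x + 2)a and
  e = (2x + 4)a at x = b_0^(4); the last two differ because x is a simple root, 4x + 6 being 2 sqrt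
  3.\<close>

lemma rigidity_7:
  fixes D :: "nat \<Rightarrow> nat \<Rightarrow> complex" and c :: complex
  defines "\<beta> \<equiv> lie_shift 7 c" and "g \<equiv> lie_const 7"
  assumes eq: "\<And>i j. 1 \<le> i \<Longrightarrow> i < 6 \<Longrightarrow> 1 \<le> j \<Longrightarrow> j < 6 \<Longrightarrow> deformation_eq 7 \<beta> g D i j"
    and D1: "\<And>m. D 1 m = 0" and k: "1 \<le> k" "k < 6"
  shows "\<exists>\<epsilon>. \<forall>m. m + k \<le> 7 \<longrightarrow> D k m = \<epsilon> * \<beta> k m"
proof -
  have \<beta>1: "\<And>m. \<beta> 1 m = 1" by (simp add: \<beta>_def lie_shift_def)
  have \<beta>5: "\<And>m. \<beta> 5 m = 1" by (simp add: \<beta>_def lie_shift_7)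
  have D5: "D 5 m = 0 + D 5 0 * \<beta> (4 + 1) m" if "m + 4 + 1 \<le> 7" for m
    using deformation_eq_last[of 7 \<beta> g D m, OF _ D1 \<beta>1] eq[of 1 5] that by (simp add: \<beta>5)
  have step4: "\<beta> 4 (m + 1) = \<beta> 4 m + \<beta> (4 + 1) m" if "m + 4 + 1 \<le> 7" for m
  proof -
    have "m \<in> {0, 1, 2}" using that by auto
    then show ?thesis by (elim insertE emptyE)
      (simp_all add: \<beta>_def lie_shift_7 numeral_2_eq_2[symmetric] numeral_3_eq_3[symmetric] field_simps)
  qed
  have "\<exists>a s. \<forall>m. m + 4 \<le> 7 \<longrightarrow> D 4 m = a + 0 + s * \<beta> 4 m"
  proof (rule integrate_shift[where P = "\<lambda>_. 0" and p = "\<lambda>_. 0" and g = g and s = "D 5 0"])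
    show "deformation_eq 7 \<beta> g D 1 4" using eq[of 1 4] by simp
    show "g 1 4 = - 1" by (simp add: g_def lie_const_def)
    show "\<beta> 4 (m + 1) = \<beta> 4 m + \<beta> (4 + 1) m" if "m + 4 + 1 \<le> 7" for m using that by (rule step4)
    show "D (4 + 1) m = 0 + D 5 0 * \<beta> (4 + 1) m" if "m + 4 + 1 \<le> 7" for m using D5[OF that] by simp
  qed (simp_all del: One_nat_def add: D1 \<beta>1)
  then obtain a s where D4: "\<And>m. m + 4 \<le> 7 \<Longrightarrow> D 4 m = a + s * \<beta> 4 m" by auto
  have step3: "\<beta> 3 (m + 1) = \<beta> 3 m + \<beta> (3 + 1) m" if "m + 3 + 1 \<le> 7" for m
  proof -
    have "m \<in> {0, 1, 2, 3}" using that by auto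
    then show ?thesis by (elim insertE emptyE)
      (simp_all add: \<beta>_def lie_shift_7 numeral_2_eq_2[symmetric] numeral_3_eq_3[symmetric] field_simps)
  qed
  have "\<exists>b s. \<forall>m. m + 3 \<le> 7 \<longrightarrow> D 3 m = b + a * of_nat m + s * \<beta> 3 m"
  proof (rule integrate_shift[where P = "\<lambda>m. a * of_nat m" and p = "\<lambda>_. a" and g = g and s = "s"])
    show "deformation_eq 7 \<beta> g D 1 3" using eq[of 1 3] by simp
    show "g 1 3 = - 1" by (simp add: g_def lie_const_def)
    show "\<beta> 3 (m + 1) = \<beta> 3 m + \<beta> (3 + 1) m" if "m + 3 + 1 \<le> 7" for m using that by (rule step3)
    show "D (3 + 1) m = a + s * \<beta> (3 + 1) m" if "m + 3 + 1 \<le> 7" for m using that D4[of m] by simp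
  qed (simp_all del: One_nat_def add: D1 \<beta>1 algebra_simps)
  then obtain b t where D3: "\<And>m. m + 3 \<le> 7 \<Longrightarrow> D 3 m = b + a * of_nat m + t * \<beta> 3 m" by auto
  have step2: "\<beta> 2 (m + 1) = \<beta> 2 m + \<beta> (2 + 1) m" if "m + 2 + 1 \<le> 7" for m
  proof -
    have "m \<in> {0, 1, 2, 3, 4}" using that by auto
    then show ?thesis by (elim insertE emptyE)
      (simp_all add: \<beta>_def lie_shift_7 numeral_2_eq_2[symmetric] numeral_3_eq_3[symmetric] field_simps)
  qed
  define P where "P m = (\<Sum>l<m. b + a * of_nat l)" for m
  have "\<exists>e s. \<forall>m. m + 2 \<le> 7 \<longrightarrow> D 2 m = e + P m + s * \<beta> 2 m"
  proof (rule integrate_shift[where P = "P" and p = "\<lambda>m. b + a * of_nat m" and g = g and s = "t"])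
    show "deformation_eq 7 \<beta> g D 1 2" using eq[of 1 2] by simp
    show "g 1 2 = - 1" by (simp add: g_def lie_const_def)
    show "\<beta> 2 (m + 1) = \<beta> 2 m + \<beta> (2 + 1) m" if "m + 2 + 1 \<le> 7" for m using that by (rule step2)
    show "D (2 + 1) m = b + a * of_nat m + t * \<beta> (2 + 1) m" if "m + 2 + 1 \<le> 7" for m using that D3[of m] by simp
  qed (simp_all del: One_nat_def add: D1 \<beta>1 P_def)
  then obtain e u where D2: "\<And>m. m + 2 \<le> 7 \<Longrightarrow> D 2 m = e + P m + u * \<beta> 2 m" by auto
  have P: "P 0 = 0" "P (Suc 0) = b" "P 4 = 4 * b + 6 * a" "P 5 = 5 * b + 10 * a"
    by (simp_all add: P_def eval_nat_numeral algebra_simps)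
  have "\<beta> 2 5 * D 5 0 - \<beta> 2 0 * D 5 2 + (D 2 5 * \<beta> 5 0 - D 2 0 * \<beta> 5 2) = 0"
    using deformation_eqD[OF eq[of 2 5], of 0] by (simp add: numeral_2_eq_2[symmetric] numeral_3_eq_3[symmetric])
  then have "5 * b + 10 * a = 0" using D5[of 2] D2[of 0] D2[of 5] by (simp add: \<beta>_def lie_shift_7 P algebra_simps)
  moreover have "b = (5 * b + 10 * a) / 5 - 2 * a" by (simp add: field_simps)
  ultimately have b: "b = - 2 * a" by simp
  have "\<beta> 2 4 * D 4 0 - \<beta> 2 0 * D 4 2 + (D 2 4 * \<beta> 4 0 - D 2 0 * \<beta> 4 2) = 0"
    using deformation_eqD[OF eq[of 2 4], of 0] by (simp add: numeral_2_eq_2[symmetric] numeral_3_eq_3[symmetric])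
  then have "(- 1 - r3 / 2) * (a + s * ((r3 - 3) / 2)) - r3 / 2 * (a + s * ((r3 + 1) / 2)) +
      ((e - 2 * a + u * (- 1 - r3 / 2)) * ((r3 - 3) / 2) - (e + u * (r3 / 2)) * ((r3 + 1) / 2)) = 0" (is "?E0 = 0")
    using D4[of 0] D4[of 2] D2[of 0] D2[of 4] by (simp add: \<beta>_def lie_shift_7 P b algebra_simps)
  \<comment> \<open>The multiples \<open>s\<close> and \<open>u\<close> of the \<beta> cancel, since
    the undeformed bracket of the shifts 2 and 4 vanishes.\<close>
  moreover have "a * (1 - r3) - e = ?E0 / 2" by (simp add: field_simps r3_square)
  ultimately have e0: "e = a * (1 - r3)" by simp
  have v: "D 4 (Suc 0) = a + s * ((r3 - 1) / 2)" "D 4 3 = a + s * ((r3 + 3) / 2)"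
    "D 2 (Suc 0) = e - 2 * a + u * (1 - r3 / 2)" "D 2 5 = e + u * (r3 / 2)"
    using D4[of 1] D4[of 3] D2[of 1] D2[of 5] by (simp_all add: \<beta>_def lie_shift_7 P b)
  have "\<beta> 2 5 * D 4 1 - \<beta> 2 1 * D 4 3 + (D 2 5 * \<beta> 4 1 - D 2 1 * \<beta> 4 3) = 0"
    using deformation_eqD[OF eq[of 2 4], of 1] by (simp add: numeral_2_eq_2[symmetric] numeral_3_eq_3[symmetric])
  then have "r3 / 2 * (a + s * ((r3 - 1) / 2)) - (1 - r3 / 2) * (a + s * ((r3 + 3) / 2)) +
      ((e + u * (r3 / 2)) * ((r3 - 1) / 2) - (e - 2 * a + u * (1 - r3 / 2)) * ((r3 + 3) / 2)) = 0" (is "?E1 = 0")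
    by (simp add: \<beta>_def lie_shift_7 v)
  moreover have "a * (1 + r3) - e = ?E1 / 2" by (simp add: field_simps r3_square)
  ultimately have e1: "e = a * (1 + r3)" by simp
  have "2 * (a * r3) = a * (1 + r3) - a * (1 - r3)" by (simp add: algebra_simps)
  also have "\<dots> = 0" unfolding e0[symmetric] e1[symmetric] by simp
  finally have "a * r3 = 0" by simp
  then have a: "a = 0" by simp
  then have e: "e = 0" and b0: "b = 0" using e0 b by simp_all
  have P0: "P m = 0" for m by (simp add: P_def a b0)
  have "k \<in> {1, 2, 3, 4, 5}" using k by auto
  then show ?thesis
  proof (elim insertE emptyE)
    assume "k = 1" then show ?thesis using D1 by (intro exI[of _ 0]) simp
  next
    assume "k = 2" then show ?thesis using D2 P0 e by (intro exI[of _ u]) simp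
  next
    assume "k = 3" then show ?thesis using D3 a b0 by (intro exI[of _ t]) simp
  next
    assume "k = 4" then show ?thesis using D4 a by (intro exI[of _ s]) simp
  next
    assume k: "k = 5"
    have "D 5 m = D 5 0 * \<beta> 5 m" if "m + 5 \<le> 7" for m using D5[of m] that by simp
    then show ?thesis unfolding k by blast
  qed
qed

lemma lie_shift_rigidity:
  fixes C :: "nat \<Rightarrow> nat \<Rightarrow> complex"
  assumes n: "n = 6 \<or> n = 7"
    and eq: "\<And>i j. 1 \<le> i \<Longrightarrow> i < n - 1 \<Longrightarrow> 1 \<le> j \<Longrightarrow> j < n - 1 \<Longrightarrow> deformation_eq n (lie_shift n c) (lie_const n) C i j"
  shows "\<exists>d. \<forall>k. 1 \<le> k \<and> k < n - 1 \<longrightarrow>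
    (\<exists>\<epsilon>. \<forall>m. m + k \<le> n \<longrightarrow> C k m = \<epsilon> * lie_shift n c k m - (d (m + k) - d m) * lie_shift n c k m)"
proof -
  have \<beta>1: "lie_shift n c 1 m = 1" for m by (simp add: lie_shift_def)
  have "\<exists>d D. (\<forall>k m. C k m = D k m - (d (m + k) - d m) * lie_shift n c k m) \<and> (\<forall>m. D 1 m = 0) \<and>
    (\<forall>i j. 1 \<le> i \<and> i < n - 1 \<and> 1 \<le> j \<and> j < n - 1 \<longrightarrow> deformation_eq n (lie_shift n c) (lie_const n) D i j)"
  proof (rule normalise_first)
    fix i j m assume "i < n - 1" "j < n - 1" "m + i + j \<le> n"
    then show "lie_shift n c i (m + j) * lie_shift n c j m - lie_shift n c i m * lie_shift n c j (m + i) =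
      (if i + j < n - 1 then lie_const n i j * lie_shift n c (i + j) m else 0)"
      by (rule lie_shift_bracket[OF n])
  qed (use \<beta>1 eq in auto)
  then obtain d D where dD: "\<forall>k m. C k m = D k m - (d (m + k) - d m) * lie_shift n c k m" "\<forall>m. D 1 m = 0"
    "\<forall>i j. 1 \<le> i \<and> i < n - 1 \<and> 1 \<le> j \<and> j < n - 1 \<longrightarrow> deformation_eq n (lie_shift n c) (lie_const n) D i j"
    by (elim exE conjE)
  have "\<exists>\<epsilon>. \<forall>m. m + k \<le> n \<longrightarrow> D k m = \<epsilon> * lie_shift n c k m" if "1 \<le> k" "k < n - 1" for k
    using n
  proof
    assume n: "n = 6"
    show ?thesis using rigidity_6[of c D k] dD that unfolding n by simp
  next
    assume n: "n = 7"
    show ?thesis using rigidity_7[of c D k] dD that unfolding n by simp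
  qed
  note ex = this
  show ?thesis
  proof (intro exI[of _ d] allI impI)
    fix k assume k: "1 \<le> k \<and> k < n - 1"
    then obtain \<epsilon> where "\<forall>m. m + k \<le> n \<longrightarrow> D k m = \<epsilon> * lie_shift n c k m" using ex by auto
    then show "\<exists>\<epsilon>. \<forall>m. m + k \<le> n \<longrightarrow> C k m = \<epsilon> * lie_shift n c k m - (d (m + k) - d m) * lie_shift n c k m"
      using dD(1) by (intro exI[of _ \<epsilon>]) simp
  qed
qed

section \<open>Span, brackets and basis of the algebra as stated\<close>

section \<open>The Lie subalgebra\<close>

text \<open>The fields of the statement, with shift constant 0; only the diagonal field depends on
  that constant.\<close>

definition lie_field :: "nat \<Rightarrow> nat \<Rightarrow> vfield" where
  "lie_field n k = shift_field n k (lie_shift n 0 k)"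

lemma X_field_eq: "X_field n = lie_field n 0"
  by (simp add: X_field_def lie_field_def shift_field_def lie_shift_0 fun_eq_iff)

lemma Y_field_eq: "1 \<le> k \<Longrightarrow> Y_field n k = lie_field n k"
  by (auto simp: Y_field_def lie_field_def shift_field_def lie_shift_def fun_eq_iff)

lemma lie_g_eq:
  assumes "3 \<le> n"
  shows "lie_g n = vf.span (lie_field n ` {..<n - 1})"
proof -
  have s: "{..<n - 1} = insert 0 {1..n - 2}" using assms by auto
  have "Y_field n ` {1..n - 2} = lie_field n ` {1..n - 2}" by (intro image_cong refl Y_field_eq) simp
  then show ?thesis unfolding lie_g_def X_field_eq s image_insert by simp
qed

lemma lie_bracket_shift_fields:
  "lie_bracket n (shift_field n k c) (shift_field n l d) =
     shift_field n (k + l) (\<lambda>j. c (j + l) * d j - c j * d (j + k))"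
proof
  fix j
  show "lie_bracket n (shift_field n k c) (shift_field n l d) j =
     shift_field n (k + l) (\<lambda>j. c (j + l) * d j - c j * d (j + k)) j"
    by (cases "j \<le> n") (simp_all add: lie_bracket_shift, simp add: lie_bracket_def shift_field_def)
qed

lemma lie_bracket_lie_field:
  assumes n: "n = 6 \<or> n = 7" and ij: "i < n - 1" "j < n - 1"
  shows "lie_bracket n (lie_field n i) (lie_field n j) =
    (if i + j < n - 1 then scale_vf (lie_const n i j) (lie_field n (i + j)) else 0)"
proof
  fix m
  show "lie_bracket n (lie_field n i) (lie_field n j) m =
    (if i + j < n - 1 then scale_vf (lie_const n i j) (lie_field n (i + j)) else 0) m"
    unfolding lie_field_def lie_bracket_shift_fields
    using lie_shift_bracket[OF n ij, of m 0]
    by (auto simp: shift_field_def scale_vf_def Const_mult mult.assoc add.assoc)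
qed

lemma lie_bracket_add_left: "lie_bracket n (v + w) u = lie_bracket n v u + lie_bracket n w u"
  and lie_bracket_add_right: "lie_bracket n u (v + w) = lie_bracket n u v + lie_bracket n u w"
  and lie_bracket_scale_left: "lie_bracket n (scale_vf c v) u = scale_vf c (lie_bracket n v u)"
  and lie_bracket_scale_right: "lie_bracket n u (scale_vf c v) = scale_vf c (lie_bracket n u v)"
  by (simp_all add: lie_bracket_def scale_vf_def fun_eq_iff pdiff_add pdiff_prod_Const sum.distrib[symmetric]
      sum_distrib_left algebra_simps)

lemma lie_bracket_0: "lie_bracket n 0 u = 0" "lie_bracket n u 0 = 0"
  by (simp_all add: lie_bracket_def fun_eq_iff)

lemma subspace_sl_fields: "vf.subspace (sl_fields n)"
  unfolding vf.subspace_def sl_fields_def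
  by (auto simp: scale_vf_def pdiff_add pdiff_prod_Const sum.distrib sum_distrib_left[symmetric]
      intro: hom_polys_add hom_polys_Const_mult)

lemma lie_field_sl:
  assumes n: "n = 6 \<or> n = 7"
  shows "lie_field n k \<in> sl_fields n"
proof -
  have "(\<Sum>i\<le>n. pdiff i (lie_field n k i)) = 0"
  proof (cases "k = 0")
    case True
    have "(\<Sum>i\<le>n. pdiff i (lie_field n k i)) = (\<Sum>i\<le>n. Const (of_nat n - 2 * of_nat i))"
      unfolding True by (intro sum.cong refl) (simp add: lie_field_def shift_field_def lie_shift_0 pdiff_prod_Const pdiff_Var)
    also have "\<dots> = Const (\<Sum>i\<le>n. of_nat n - 2 * of_nat i)" by (simp add: Const_sum)
    also have "(\<Sum>i\<le>n. of_nat n - 2 * of_nat i :: complex) = 0"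
      using n by (auto simp: eval_nat_numeral)
    finally show ?thesis by simp
  qed (simp add: lie_field_def shift_field_def pdiff_prod_Const pdiff_Var if_distrib[of "pdiff _"] cong: if_cong)
  then show ?thesis
    unfolding sl_fields_def using shift_field_hom by (auto simp: lie_field_def) (simp add: shift_field_def)
qed

lemma lie_subalgebra_lie_g:
  assumes n: "n = 6 \<or> n = 7"
  shows "lie_subalgebra n (lie_g n)"
proof -
  let ?S = "lie_field n ` {..<n - 1}"
  have n3: "3 \<le> n" using n by auto
  have gen: "lie_bracket n v w \<in> vf.span ?S" if vw: "v \<in> ?S" "w \<in> ?S" for v w
  proof -
    obtain i j where ij: "i < n - 1" "j < n - 1" "v = lie_field n i" "w = lie_field n j" using vw by auto
    note b = lie_bracket_lie_field[OF n ij(1,2)]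
    show ?thesis
    proof (cases "i + j < n - 1")
      case True
      then have "lie_field n (i + j) \<in> vf.span ?S" by (intro vf.span_base) auto
      then have "scale_vf (lie_const n i j) (lie_field n (i + j)) \<in> vf.span ?S" by (rule vf.span_scale)
      then show ?thesis using True b by (simp add: ij(3,4))
    next
      case False
      then have "lie_bracket n v w = 0" using b by (simp add: ij(3,4))
      then show ?thesis by (simp only: vf.span_zero)
    qed
  qed
  have right: "lie_bracket n v w \<in> vf.span ?S" if "v \<in> ?S" "w \<in> vf.span ?S" for v w
    using that(2)
  proof (induction rule: vf.span_induct_alt)
    case base
    show ?case unfolding lie_bracket_0 by (rule vf.span_zero)
  next
    case (step c x y)
    show ?case
      unfolding lie_bracket_add_right lie_bracket_scale_right
      by (intro vf.span_add vf.span_scale gen[OF that(1) step(1)] step(2))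
  qed
  have "lie_bracket n v w \<in> vf.span ?S" if "v \<in> vf.span ?S" "w \<in> vf.span ?S" for v w
    using that(1)
  proof (induction rule: vf.span_induct_alt)
    case base
    show ?case unfolding lie_bracket_0 by (rule vf.span_zero)
  next
    case (step c x y)
    show ?case
      unfolding lie_bracket_add_left lie_bracket_scale_left
      by (intro vf.span_add vf.span_scale right[OF step(1) that(2)] step(2))
  qed
  moreover have "vf.span ?S \<subseteq> sl_fields n"
    using lie_field_sl[OF n] by (intro vf.span_minimal subspace_sl_fields) auto
  ultimately show ?thesis
    unfolding lie_subalgebra_def lie_g_eq[OF n3] by (simp add: vf.subspace_span)
qed

text \<open>Makes the fields independent: their components at index 0 are nonzero multiples of the
  distinct variables z_k.\<close>

lemma lie_shift_0_nonzero:
  assumes n: "n = 6 \<or> n = 7" and k: "k < n - 1"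
  shows "lie_shift n 0 k 0 \<noteq> 0"
  using n
proof
  assume n: "n = 6"
  have "k \<in> {0, 1, 2, 3, 4}" using k n by auto
  then show ?thesis unfolding n by (elim insertE emptyE) (simp_all add: lie_shift_0 lie_shift_1 lie_shift_6)
next
  assume n: "n = 7"
  have s: "1 < sqrt (3 :: real)" "sqrt 3 < (3 :: real)" by (simp_all add: real_less_lsqrt)
  have "k \<in> {0, 1, 2, 3, 4, 5}" using k n by auto
  then show ?thesis
    using s unfolding n by (elim insertE emptyE) (simp_all add: lie_shift_0 lie_shift_1 lie_shift_7 complex_eq_iff)
qed

lemma lookup_lie_field: "lookup (lie_field n k 0) (single j 1) = (if j = k \<and> k \<le> n then lie_shift n 0 k 0 else 0)"
proof -
  have "single k (1::nat) = single j 1 \<longleftrightarrow> j = k"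
    by (metis lookup_single_eq lookup_single_not_eq one_neq_zero)
  then show ?thesis by (simp add: lie_field_def shift_field_def Var_def lookup_single when_def)
qed

lemma sum_vfield_apply: "(\<Sum>a\<in>A. f a) x = (\<Sum>a\<in>A. f a x)" for f :: "'a \<Rightarrow> vfield"
  by (induction A rule: infinite_finite_induct) auto

lemma lie_field_basis:
  assumes n: "n = 6 \<or> n = 7"
  shows "inj_on (lie_field n) {..<n - 1}" "vf.independent (lie_field n ` {..<n - 1})"
proof -
  show inj: "inj_on (lie_field n) {..<n - 1}"
  proof (rule inj_onI)
    fix k j assume kj: "k \<in> {..<n - 1}" "j \<in> {..<n - 1}" "lie_field n k = lie_field n j"
    then have "lookup (lie_field n k 0) (single k 1) = lookup (lie_field n j 0) (single k 1)" by simp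
    then show "k = j"
      using kj(1) lie_shift_0_nonzero[OF n, of k] unfolding lookup_lie_field by (auto split: if_splits)
  qed
  show "vf.independent (lie_field n ` {..<n - 1})"
  proof
    assume "vf.dependent (lie_field n ` {..<n - 1})"
    then obtain u where u: "\<exists>v\<in>lie_field n ` {..<n - 1}. u v \<noteq> 0" "(\<Sum>v\<in>lie_field n ` {..<n - 1}. scale_vf (u v) v) = 0"
      by (subst (asm) vf.dependent_finite) auto
    have "u (lie_field n j) = 0" if j: "j < n - 1" for j
    proof -
      have "0 = lookup ((\<Sum>v\<in>lie_field n ` {..<n - 1}. scale_vf (u v) v) 0) (single j 1)"
        unfolding u(2) by simp
      also have "\<dots> = (\<Sum>k<n - 1. u (lie_field n k) * lookup (lie_field n k 0) (single j 1))"
        by (subst sum.reindex[OF inj]) (simp add: sum_vfield_apply scale_vf_def lookup_sum)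
      also have "\<dots> = u (lie_field n j) * lookup (lie_field n j 0) (single j 1)"
        using j by (intro sum_eq_single) (auto simp: lookup_lie_field simp del: One_nat_def)
      finally show ?thesis
        using lie_shift_0_nonzero[OF n j] j unfolding lookup_lie_field by (auto split: if_splits)
    qed
    then show False using u(1) by auto
  qed
qed

lemma dim_lie_g:
  assumes n: "n = 6 \<or> n = 7"
  shows "vf.dim (lie_g n) = n - 1"
proof -
  have "3 \<le> n" using n by auto
  from lie_g_eq[OF this] show ?thesis
    using vf.dim_span_eq_card_independent[OF lie_field_basis(2)[OF n]] card_image[OF lie_field_basis(1)[OF n]] by simp
qed

text \<open>The order, with decreasing shifts and the diagonal field last, is the one in which
  \<Omega> is built, so no permutation sign has to be tracked.\<close>

lemma ordered_basis_lie_g: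
  assumes n: "n = 6 \<or> n = 7"
  shows "ordered_basis (map (lie_field n) (rev [1..<n - 1]) @ [lie_field n 0]) (lie_g n)"
proof -
  have n3: "3 \<le> n" using n by auto
  let ?ks = "rev [1..<n - 1] @ [0]"
  have s: "set ?ks = {..<n - 1}" using n3 by auto
  have "distinct ?ks" by simp
  then have "distinct (map (lie_field n) ?ks)"
    using lie_field_basis(1)[OF n] unfolding distinct_map s by simp
  moreover have "set (map (lie_field n) ?ks) = lie_field n ` {..<n - 1}" unfolding set_map s ..
  ultimately show ?thesis
    using lie_field_basis(2)[OF n] lie_g_eq[OF n3] unfolding ordered_basis_def by simp
qed

theorem proposition6p9:
  fixes n :: nat
  assumes "n = 6 \<or> n = 7"
  shows "lie_subalgebra n (lie_g n) \<and> vf.dim (lie_g n) = n - 1 \<and>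
         lie_foliation n (lie_g n) \<in> foliations n (n - 1) \<and>
         rigid n (lie_foliation n (lie_g n))"
proof -
  \<comment> \<open>The solution of \<open>trace\<close>: (n-1)(c - n) + (n + c) + (n - 2 + c) =
    (n+1) c - (n-1)(n-2).\<close>
  define c :: complex where "c = of_nat ((n - 1) * (n - 2)) / of_nat (n + 1)"
  have n3: "3 \<le> n" using assms by auto
  interpret shift_family n "lie_shift n c"
  proof
    show "lie_shift n c k i \<noteq> 0" if "k < n - 1" "n - 2 \<le> i + k" "i + k \<le> n" for k i
      by (rule lie_shift_nonzero[OF assms c_def that])
  qed (rule n3)
  obtain a b where "kernel_form n (lie_shift n c) kernel_two_form a b"
    using kernel_form by blast
  then interpret kernel_form n "lie_shift n c" kernel_two_form a b .
  interpret deformation_setup n "lie_shift n c" kernel_two_form a b "lie_const n"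
  proof
    show "lie_shift n c i (m + j) * lie_shift n c j m - lie_shift n c i m * lie_shift n c j (m + i) =
        (if i + j < n - 1 then lie_const n i j * lie_shift n c (i + j) m else 0)"
      if "i < n - 1" "j < n - 1" "m + i + j \<le> n" for i j m
      by (rule lie_shift_bracket[OF assms that])
    show "lie_shift n c 0 i = lie_shift n c 0 0 - 2 * of_nat i" for i by (simp add: lie_shift_0)
    show "lie_shift n c 1 i = 1" for i by (rule lie_shift_1)
    show "of_nat (n - 1) * lie_shift n c 0 n + lie_shift n c 0 0 + lie_shift n c 0 1 = 0"
      using assms by (auto simp: lie_shift_0 c_def)
    fix C
    assume eq: "\<And>i j. 1 \<le> i \<Longrightarrow> i < n - 1 \<Longrightarrow> 1 \<le> j \<Longrightarrow> j < n - 1 \<Longrightarrow>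
        \<exists>\<alpha>. \<forall>m. m + i + j \<le> n \<longrightarrow>
          lie_shift n c i (m + j) * C j m - lie_shift n c i m * C j (m + i) +
            (C i (m + j) * lie_shift n c j m - C i m * lie_shift n c j (m + i))
            - (if i + j < n - 1 then lie_const n i j * C (i + j) m else 0)
          = (if i + j < n - 1 then \<alpha> * lie_shift n c (i + j) m else 0)"
    show "\<exists>d. \<forall>k. 1 \<le> k \<and> k < n - 1 \<longrightarrow>
        (\<exists>\<epsilon>. \<forall>m. m + k \<le> n \<longrightarrow> C k m = \<epsilon> * lie_shift n c k m - (d (m + k) - d m) * lie_shift n c k m)"
      by (rule lie_shift_rigidity[OF assms]) (unfold deformation_eq_def, rule eq)
  qed
  let ?Bs = "map (lie_field n) (rev [1..<n - 1]) @ [lie_field n 0]"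
  have X: "lie_field n k = X k" if "k \<in> set (rev [1..<n - 1])" for k
    using that by (auto simp: lie_field_def shift_field_def lie_shift_def fun_eq_iff)
  have "map (lie_field n) (rev [1..<n - 1]) = map X (rev [1..<n - 1])"
    by (rule map_cong[OF refl]) (rule X)
  then have Bs: "?Bs = map X (rev [1..<n - 1]) @ [lie_field n 0]"
    by (simp only:)
  \<comment> \<open>The diagonal field of the statement differs from the shifted one by -c R, as
    \<open>lie_form_shift\<close> allows.\<close>
  have "lie_field n 0 i = X 0 i + Const (- c) * radial n i" for i
  proof (cases "i \<le> n")
    case True
    have "Const (of_nat n - 2 * of_nat i + c) + Const (- c) = (Const (of_nat n - 2 * of_nat i) :: nat cpoly)"
      by (simp flip: Const_add)
    then have "Const (of_nat n - 2 * of_nat i) * Var i =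
        Const (of_nat n - 2 * of_nat i + c) * Var i + Const (- c) * (Var i :: nat cpoly)"
      by (metis distrib_right)
    then show ?thesis using True by (simp add: lie_field_def shift_field_def lie_shift_0 radial_def)
  qed (simp add: lie_field_def shift_field_def radial_def)
  then have "lie_field n 0 = (\<lambda>i. X 0 i + Const (- c) * radial n i)" by (rule ext)
  from lie_form_shift[OF this] obtain s where s: "s \<noteq> 0" "lie_form n ?Bs = scale_form s (one_form n \<omega>)"
    unfolding Bs \<omega>_def comp_def by auto
  \<comment> \<open>Nonvanishing of the form for this basis is what makes the class independent of
    the selected basis.\<close>
  have "lie_form n ?Bs {0} \<noteq> 0"
    unfolding s(2) using s(1) \<omega>_0_nonzero by (simp add: scale_form_def)
  then have "lie_form n ?Bs \<noteq> (\<lambda>_. 0)" by auto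
  from lie_foliation_eq[OF ordered_basis_lie_g[OF assms] this]
  have "lie_foliation n (lie_g n) = form_class (one_form n \<omega>)"
    using s by (simp add: form_class_scale)
  then show ?thesis
    using lie_subalgebra_lie_g[OF assms] dim_lie_g[OF assms] rigid_\<omega> unfolding rigid_def by simp
qed

end
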